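(* Assume that there are $\beta\in(0,1)$, $C_\beta>0$ with $0\le\gamma(t)\le C_\beta|t|^{-\beta}$ for all $t$, and $\alpha\in(0,1-\beta)$ with $\int_{\mathbb R^d}\frac{\mu(d\xi)}{1+|\xi|^{2(1-\beta-\alpha)}}<\infty$. Let $u_{t,x}=E_B[\exp(V_{t,x})]$ (Feynman–Kac functional with initial condition $u_0\equiv1$). Then $u$ admits a version which is, on every compact set $[0,T]\times[-M,M]^d$, Hölder continuous of order $\gamma_1$ in time and $\gamma_2$ in space, for any $\gamma_1<\alpha/2$ and $\gamma_2<\alpha$.
   Context: Let $\gamma:\mathbb R\to\mathbb R_+$ and $\Lambda:\mathbb R^d\to\mathbb R_+$ be nonnegative, nonnegative definite functions with $\mu=\mathcal F\Lambda$ a tempered measure ($\mathcal Fu(\xi)=\int e^{-i\langle\xi,x\rangle}u(x)dx$). $W$ is the centered Gaussian family indexed by $\mathcal D([0,\infty)\times\mathbb R^d)$ with $E[W(\varphi)W(\psi)]=\int\varphi(s,x)\psi(t,y)\gamma(s-t)\Lambda(x-y)dxdydsdt$, extended to the completion $\mathcal H$. $p_t(x)=(2\pi t)^{-d/2}e^{-|x|^2/(2t)}$. $B$ is a standard $d$-dimensional Brownian motion independent of $W$, $B^x=x+B$; $E_B$ is expectation w.r.t. $B$ only. $V_{t,x}=\int_0^t\int\delta_0(B^x_{t-r}-y)W(dr,dy)$ denotes the $L^2$-limit as $\varepsilon\to0$ of the Wiener integrals (for fixed path of $B$) $\int_0^t\int p_\varepsilon(B^x_{t-r}-y)W(dr,dy)$.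 *)

theory Defs
  imports "HOL-Probability.Probability"
begin

coinductive smooth_fun :: "('a::euclidean_space \<Rightarrow> real) \<Rightarrow> bool" where
  "(\<forall>x. f differentiable (at x)) \<Longrightarrow>
   (\<forall>i\<in>Basis. smooth_fun (\<lambda>x. frechet_derivative f (at x) i)) \<Longrightarrow> smooth_fun f"

definition test_fun :: "('a::euclidean_space \<Rightarrow> real) \<Rightarrow> bool" where
  "test_fun f \<longleftrightarrow> smooth_fun f \<and> compact (closure {x. f x \<noteq> 0})"

definition fourier :: "('a::euclidean_space \<Rightarrow> real) \<Rightarrow> 'a \<Rightarrow> complex" where
  "fourier u \<xi> = (CLINT x|lborel. iexp (- (\<xi> \<bullet> x)) * complex_of_real (u x))"

definition tempered_measure :: "'a::euclidean_space measure \<Rightarrow> bool" where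
  "tempered_measure \<mu> \<longleftrightarrow> sets \<mu> = sets borel \<and>
     (\<exists>k::nat. (\<integral>\<^sup>+\<xi>. ennreal (1 / (1 + (norm \<xi>)\<^sup>2) ^ k) \<partial>\<mu>) < \<infinity>)"

definition is_fourier_transform :: "'a::euclidean_space measure \<Rightarrow> ('a \<Rightarrow> real) \<Rightarrow> bool" where
  "is_fourier_transform \<mu> \<Lambda> \<longleftrightarrow>
     (\<forall>\<psi>. test_fun \<psi> \<longrightarrow>
        integrable \<mu> \<psi> \<and>
        integrable lborel (\<lambda>x. complex_of_real (\<Lambda> x) * fourier \<psi> x) \<and>
        (CLINT x|lborel. complex_of_real (\<Lambda> x) * fourier \<psi> x) = complex_of_real (\<integral>\<xi>. \<psi> \<xi> \<partial>\<mu>))"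

definition nonneg_definite :: "('a::euclidean_space \<Rightarrow> real) \<Rightarrow> bool" where
  "nonneg_definite g \<longleftrightarrow>
     (\<forall>\<phi>. test_fun \<phi> \<longrightarrow>
        integrable (lborel \<Otimes>\<^sub>M lborel) (\<lambda>z. \<phi> (fst z) * \<phi> (snd z) * g (fst z - snd z)) \<and>
        (\<integral>z. \<phi> (fst z) * \<phi> (snd z) * g (fst z - snd z) \<partial>(lborel \<Otimes>\<^sub>M lborel)) \<ge> 0)"

definition H_kernel :: "(real \<Rightarrow> real) \<Rightarrow> ('d::euclidean_space \<Rightarrow> real)
    \<Rightarrow> (real \<times> 'd) \<times> (real \<times> 'd) \<Rightarrow> real" where
  "H_kernel \<gamma> \<Lambda> z = \<gamma> (fst (fst z) - fst (snd z)) * \<Lambda> (snd (fst z) - snd (snd z))"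

definition H_inner :: "(real \<Rightarrow> real) \<Rightarrow> ('d::euclidean_space \<Rightarrow> real)
    \<Rightarrow> (real \<times> 'd \<Rightarrow> real) \<Rightarrow> (real \<times> 'd \<Rightarrow> real) \<Rightarrow> real" where
  "H_inner \<gamma> \<Lambda> \<phi> \<psi> =
     (\<integral>z. \<phi> (fst z) * \<psi> (snd z) * H_kernel \<gamma> \<Lambda> z \<partial>(lborel \<Otimes>\<^sub>M lborel))"

text \<open>Functions on [0,infinity) x R^d that belong to H (finite absolute H-norm).\<close>
definition H_admissible :: "(real \<Rightarrow> real) \<Rightarrow> ('d::euclidean_space \<Rightarrow> real)
    \<Rightarrow> (real \<times> 'd \<Rightarrow> real) \<Rightarrow> bool" where
  "H_admissible \<gamma> \<Lambda> \<phi> \<longleftrightarrow> \<phi> \<in> borel_measurable borel \<and> (\<forall>s x. s < 0 \<longrightarrow> \<phi> (s, x) = 0) \<and>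
     integrable (lborel \<Otimes>\<^sub>M lborel) (\<lambda>z. \<bar>\<phi> (fst z)\<bar> * \<bar>\<phi> (snd z)\<bar> * H_kernel \<gamma> \<Lambda> z)"

text \<open>W is a centred Gaussian family indexed by H with covariance H_inner:
  it is (a.s.) linear and each W(phi) is centred normal with variance H_inner phi phi.\<close>
definition gaussian_noise :: "'w measure \<Rightarrow> (real \<Rightarrow> real) \<Rightarrow> ('d::euclidean_space \<Rightarrow> real)
    \<Rightarrow> ((real \<times> 'd \<Rightarrow> real) \<Rightarrow> 'w \<Rightarrow> real) \<Rightarrow> bool" where
  "gaussian_noise P \<gamma> \<Lambda> W \<longleftrightarrow> prob_space P \<and>
     (\<forall>\<phi>. H_admissible \<gamma> \<Lambda> \<phi> \<longrightarrow>
        W \<phi> \<in> borel_measurable P \<and>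
        (\<forall>\<theta>. char (distr P borel (W \<phi>)) \<theta> = exp (- complex_of_real (H_inner \<gamma> \<Lambda> \<phi> \<phi> * \<theta>\<^sup>2 / 2)))) \<and>
     (\<forall>\<phi> \<psi> a b. H_admissible \<gamma> \<Lambda> \<phi> \<longrightarrow> H_admissible \<gamma> \<Lambda> \<psi> \<longrightarrow>
        H_admissible \<gamma> \<Lambda> (\<lambda>z. a * \<phi> z + b * \<psi> z) \<longrightarrow>
        (AE \<omega> in P. W (\<lambda>z. a * \<phi> z + b * \<psi> z) \<omega> = a * W \<phi> \<omega> + b * W \<psi> \<omega>))"

definition heat_kernel :: "real \<Rightarrow> 'd::euclidean_space \<Rightarrow> real" where
  "heat_kernel t x = (2 * pi * t) powr (- real DIM('d) / 2) * exp (- (norm x)\<^sup>2 / (2 * t))"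

definition std_brownian_motion :: "'b measure \<Rightarrow> (real \<Rightarrow> 'b \<Rightarrow> 'd::euclidean_space) \<Rightarrow> bool" where
  "std_brownian_motion P B \<longleftrightarrow> prob_space P \<and>
     (\<forall>t. B t \<in> borel_measurable P) \<and>
     (\<forall>\<omega>. B 0 \<omega> = 0) \<and>
     (\<forall>\<omega>. continuous_on {0..} (\<lambda>t. B t \<omega>)) \<and>
     (\<forall>s t. 0 \<le> s \<longrightarrow> s < t \<longrightarrow>
        distributed P lborel (\<lambda>\<omega>. B t \<omega> - B s \<omega>) (\<lambda>y. ennreal (heat_kernel (t - s) y))) \<and>
     (\<forall>(ts::nat \<Rightarrow> real) n. 0 \<le> ts 0 \<longrightarrow> (\<forall>i<n. ts i < ts (Suc i)) \<longrightarrow>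
        prob_space.indep_vars P (\<lambda>_. borel) (\<lambda>i \<omega>. B (ts (Suc i)) \<omega> - B (ts i) \<omega>) {..<n})"

definition mollified_integrand :: "(real \<Rightarrow> 'b \<Rightarrow> 'd::euclidean_space) \<Rightarrow> real \<Rightarrow> 'd \<Rightarrow> 'b \<Rightarrow> real
    \<Rightarrow> real \<times> 'd \<Rightarrow> real" where
  "mollified_integrand B t x \<omega>B \<epsilon> =
     (\<lambda>(r, y). if 0 \<le> r \<and> r \<le> t then heat_kernel \<epsilon> (x + B (t - r) \<omega>B - y) else 0)"

end

theory Submission
  imports Defs
begin

text \<open>
  Conditionally on the Brownian path, \<open>V\<close> is a limit of centred Gaussian variables, so its moments and those
  of its increments are controlled by conditional variances, which are double time integrals of \<open>\<gamma>(r - r')\<close>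
  against the heat-smoothed \<open>\<Lambda>\<close> along the path. By positive definiteness the smoothed \<open>\<Lambda>\<close> is at most twice its value at the
  origin and has a spectral representation; the integrability of \<open>\<mu>\<close> makes the singularities in time integrable.
  Khasminskii's lemma then gives exponential moments of the variance of \<open>V t x\<close>, and the elementary bounds
  \<open>1 - cos z \<le> 2 |z|\<^bsup>2 \<alpha>\<^esup>\<close> and \<open>1 - exp (- z) \<le> z\<^bsup>\<alpha>\<^esup>\<close> show that the mean variance of \<open>V t x - V s y\<close> is
  at most \<open>\<delta>\<^sup>2\<close> with \<open>\<delta> = C (|t - s|\<^bsup>\<alpha>/2\<^esup> + |x - y|\<^bsup>\<alpha>\<^esup>)\<close>. Only this mean is at hand, not higher moments of
  the variance; Jensen's inequality with the weight \<open>\<surd>variance + \<delta>\<close> on Brownian paths still turns it into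
  \<open>E |u t x - u s y|^p \<le> C \<delta>^p\<close> for every \<open>p\<close>, and Kolmogorov's criterion applies.
\<close>

section \<open>Kolmogorov's continuity criterion along dyadic grids\<close>

text \<open>The hypothesis on \<mu> is calibrated by one integral. Against a time kernel of order
  |u|^(-\<beta>) the frequency \<xi> contributes the integral of u^(-\<beta>) exp (-u |\<xi>|^2 /
  2), which is of order |\<xi>|^(-2 (1-\<beta>)) at high frequency. A further factor |\<xi>|^(2
  \<alpha>) is thus affordable, and this factor is the cost of an increment of order |x - y|^(2
  \<alpha>) in space or |t - s|^\<alpha> in time. The weight on paths overcomes the main obstacle.
  The conditional moment of order 2p of an increment is of order variance^p, so a plain Hoelder
  bound would ask for p-th moments of the variance. Dividing by the right power of the weight leaves
  one power of it, whose mean is at most 3 \<delta>; its summand \<delta> keeps it away from zero.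
  The mollification parameter, the regularised singularity of \<gamma> and the L2 limit defining V
  are all removed by Fatou's lemma. For this the estimates are upper bounds that are uniform in the
  approximation, and factors of 2 may be lost in them.\<close>

definition tfloor :: "nat \<Rightarrow> real \<Rightarrow> real" where
  "tfloor n t = of_int \<lfloor>4 ^ n * t\<rfloor> / 4 ^ n"

text \<open>Space is rounded at mesh 2^-n but time at mesh 4^-n. On this parabolic scale |t -
  s|^(\<alpha>/2) and |x - y|^\<alpha> are both of order 2^(-\<alpha> n), so one geometric rate
  governs the chaining.\<close>

definition xfloor :: "nat \<Rightarrow> 'd::euclidean_space \<Rightarrow> 'd" where
  "xfloor n x = (\<Sum>b\<in>Basis. (of_int \<lfloor>2 ^ n * (x \<bullet> b)\<rfloor> / 2 ^ n) *\<^sub>R b)"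

definition tgrid :: "nat \<Rightarrow> nat \<Rightarrow> real set" where
  "tgrid N n = (\<lambda>k::nat. real k / 4 ^ n) ` {..N * 4 ^ n}"

definition xgrid :: "nat \<Rightarrow> nat \<Rightarrow> 'd::euclidean_space set" where
  "xgrid N n = (\<lambda>j::'d \<Rightarrow> int. \<Sum>b\<in>Basis. (of_int (j b) / 2 ^ n) *\<^sub>R b) `
     (Basis \<rightarrow>\<^sub>E {- int (N * 2 ^ n) .. int (N * 2 ^ n)})"

lemma xfloor_inner: "b \<in> Basis \<Longrightarrow> xfloor n x \<bullet> b = of_int \<lfloor>2 ^ n * (x \<bullet> b)\<rfloor> / 2 ^ n"
  by (simp add: xfloor_def inner_sum_left inner_Basis if_distrib cong: if_cong)

lemma finite_tgrid: "finite (tgrid N n)" and finite_xgrid: "finite (xgrid N n :: 'd::euclidean_space set)"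
  by (auto simp: tgrid_def xgrid_def intro!: finite_PiE)

lemma card_tgrid: "real (card (tgrid N n)) \<le> (real N + 1) * 4 ^ n"
proof -
  have "card (tgrid N n) \<le> N * 4 ^ n + 1"
    unfolding tgrid_def using card_image_le[of "{..N * 4 ^ n}"] by fastforce
  then have "real (card (tgrid N n)) \<le> real (N * 4 ^ n + 1)" by linarith
  also have "\<dots> \<le> (real N + 1) * 4 ^ n" by (simp add: algebra_simps)
  finally show ?thesis .
qed

lemma card_xgrid: "real (card (xgrid N n :: 'd::euclidean_space set)) \<le> ((2 * real N + 1) * 2 ^ n) ^ DIM('d)"
proof -
  have "card (xgrid N n :: 'd set) \<le> card ((Basis :: 'd set) \<rightarrow>\<^sub>E {- int (N * 2 ^ n) .. int (N * 2 ^ n)})"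
    unfolding xgrid_def by (intro card_image_le finite_PiE) auto
  also have "\<dots> = nat (2 * int (N * 2 ^ n) + 1) ^ DIM('d)"
    by (subst card_PiE) (auto simp: algebra_simps)
  also have "nat (2 * int (N * 2 ^ n) + 1) = 2 * N * 2 ^ n + 1" by (simp add: nat_add_distrib nat_mult_distrib nat_power_eq)
  finally have "card (xgrid N n :: 'd set) \<le> (2 * N * 2 ^ n + 1) ^ DIM('d)" .
  then have "real (card (xgrid N n :: 'd set)) \<le> real ((2 * N * 2 ^ n + 1) ^ DIM('d))" by linarith
  also have "\<dots> \<le> ((2 * real N + 1) * 2 ^ n) ^ DIM('d)"
    unfolding of_nat_power by (intro power_mono) (auto simp: algebra_simps)
  finally show ?thesis .
qed

lemma tfloor_bounds: "tfloor n t \<le> t" "t < tfloor n t + 1 / 4 ^ n"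
  using of_int_floor_le[of "4 ^ n * t"] floor_correct[of "4 ^ n * t"] by (auto simp: tfloor_def field_simps)

lemma xfloor_bounds:
  assumes "b \<in> Basis"
  shows "xfloor n x \<bullet> b \<le> x \<bullet> b" "x \<bullet> b < xfloor n x \<bullet> b + 1 / 2 ^ n"
proof -
  show "xfloor n x \<bullet> b \<le> x \<bullet> b"
    using of_int_floor_le[of "2 ^ n * (x \<bullet> b)"] by (simp add: xfloor_inner assms field_simps)
  have "2 ^ n * (x \<bullet> b) < of_int \<lfloor>2 ^ n * (x \<bullet> b)\<rfloor> + 1" by linarith
  then show "x \<bullet> b < xfloor n x \<bullet> b + 1 / 2 ^ n" by (simp add: xfloor_inner assms field_simps)
qed

text \<open>A rounded time of level n is a grid point of every finer level m, with numerator
  multiplied by 4^(m-n). This nesting lets a chaining step compare levels n and n+1 inside a single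
  grid.\<close>

lemma tfloor_in_tgrid:
  assumes "0 \<le> t" "t \<le> real N" "n \<le> m"
  shows "tfloor n t \<in> tgrid N m"
proof -
  define k where "k = nat \<lfloor>4 ^ n * t\<rfloor>"
  have k: "real k = of_int \<lfloor>4 ^ n * t\<rfloor>" using assms by (simp add: k_def)
  have "real k \<le> 4 ^ n * t" unfolding k by simp
  also have "\<dots> \<le> 4 ^ n * real N" using assms by simp
  finally have "real k \<le> real (N * 4 ^ n)" by (simp add: mult.commute)
  then have "k \<le> N * 4 ^ n" by (simp only: of_nat_le_iff)
  then have "k * 4 ^ (m - n) \<le> N * 4 ^ n * 4 ^ (m - n)" by (intro mult_right_mono) auto
  also have "\<dots> = N * 4 ^ m"
    using assms(3) power_add[of "4::nat" n "m - n"] by (simp only: mult.assoc le_add_diff_inverse)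
  finally have "k * 4 ^ (m - n) \<in> {..N * 4 ^ m}" by (simp only: atMost_iff)
  moreover have "tfloor n t = real (k * 4 ^ (m - n)) / 4 ^ m"
  proof -
    have "(4::real) ^ m = 4 ^ n * 4 ^ (m - n)"
      using assms(3) power_add[of "4::real" n "m - n"] by (simp only: le_add_diff_inverse)
    then show ?thesis by (simp add: tfloor_def k)
  qed
  ultimately show ?thesis unfolding tgrid_def by (rule image_eqI[rotated])
qed

lemma xfloor_in_xgrid:
  fixes x :: "'d::euclidean_space"
  assumes "\<And>b. b \<in> Basis \<Longrightarrow> \<bar>x \<bullet> b\<bar> \<le> real N" "n \<le> m"
  shows "xfloor n x \<in> xgrid N m"
proof -
  define j where "j b = (if b \<in> Basis then \<lfloor>2 ^ n * (x \<bullet> b)\<rfloor> * 2 ^ (m - n) else undefined)" for b :: 'd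
  have "j \<in> Basis \<rightarrow>\<^sub>E {- int (N * 2 ^ m) .. int (N * 2 ^ m)}"
  proof (intro PiE_I)
    fix b :: 'd assume b: "b \<in> Basis"
    have "2 ^ n * (x \<bullet> b) \<le> 2 ^ n * real N" "- (2 ^ n * real N) \<le> 2 ^ n * (x \<bullet> b)"
      using assms(1)[OF b] mult_left_mono[of "x \<bullet> b" "real N" "2 ^ n"] mult_left_mono[of "- real N" "x \<bullet> b" "2 ^ n"]
      by auto
    then have "of_int \<lfloor>2 ^ n * (x \<bullet> b)\<rfloor> \<le> (of_int (int N * 2 ^ n) :: real)"
      "of_int (- (int N * 2 ^ n)) \<le> 2 ^ n * (x \<bullet> b)"
      using of_int_floor_le[of "2 ^ n * (x \<bullet> b)"] by (simp_all only: of_int_minus of_int_mult of_int_of_nat_eq of_int_power of_int_numeral mult.commute[of "real N"])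
    then have "\<lfloor>2 ^ n * (x \<bullet> b)\<rfloor> \<le> int N * 2 ^ n" "- (int N * 2 ^ n) \<le> \<lfloor>2 ^ n * (x \<bullet> b)\<rfloor>"
      by (simp_all only: of_int_le_iff le_floor_iff)
    then have "\<lfloor>2 ^ n * (x \<bullet> b)\<rfloor> * 2 ^ (m - n) \<le> int N * 2 ^ n * 2 ^ (m - n)"
       "- (int N * 2 ^ n) * 2 ^ (m - n) \<le> \<lfloor>2 ^ n * (x \<bullet> b)\<rfloor> * 2 ^ (m - n)"
      by (simp_all only: mult_right_mono zero_le_power zero_le_numeral)
    moreover have "int N * 2 ^ n * 2 ^ (m - n) = int (N * 2 ^ m)"
      using assms(2) power_add[of "2::int" n "m - n"]
      by (simp only: mult.assoc le_add_diff_inverse of_nat_mult of_nat_power of_nat_numeral)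
    ultimately show "j b \<in> {- int (N * 2 ^ m) .. int (N * 2 ^ m)}" using b by (auto simp: j_def)
  qed (simp add: j_def)
  moreover have "xfloor n x = (\<Sum>b\<in>Basis. (of_int (j b) / 2 ^ m) *\<^sub>R b)"
    unfolding xfloor_def
  proof (intro sum.cong refl)
    fix b :: 'd assume b: "b \<in> Basis"
    have "(2::real) ^ m = 2 ^ n * 2 ^ (m - n)"
      using assms(2) power_add[of "2::real" n "m - n"] by (simp only: le_add_diff_inverse)
    then show "(of_int \<lfloor>2 ^ n * (x \<bullet> b)\<rfloor> / 2 ^ n) *\<^sub>R b = (of_int (j b) / 2 ^ m :: real) *\<^sub>R b"
      using b by (simp add: j_def)
  qed
  ultimately show ?thesis unfolding xgrid_def by blast
qed

definition near :: "nat \<Rightarrow> real \<Rightarrow> 'd::euclidean_space \<Rightarrow> real \<Rightarrow> 'd \<Rightarrow> bool" where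
  "near n s x t y \<longleftrightarrow> \<bar>t - s\<bar> \<le> 1 / 4 ^ n \<and> (\<forall>b\<in>Basis. \<bar>(x - y) \<bullet> b\<bar> \<le> 1 / 2 ^ n)"

lemma tfloor_mono_level: "tfloor n t \<le> tfloor (Suc n) t"
proof -
  have "4 * \<lfloor>4 ^ n * t\<rfloor> \<le> \<lfloor>4 ^ Suc n * t\<rfloor>"
    by (subst le_floor_iff) (use of_int_floor_le[of "4 ^ n * t"] in \<open>auto simp: algebra_simps\<close>)
  then have "4 * of_int \<lfloor>4 ^ n * t\<rfloor> \<le> (of_int \<lfloor>4 ^ Suc n * t\<rfloor> :: real)" by linarith
  then show ?thesis by (simp add: tfloor_def field_simps)
qed

lemma xfloor_mono_level: "b \<in> Basis \<Longrightarrow> xfloor n x \<bullet> b \<le> xfloor (Suc n) x \<bullet> b"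
proof -
  assume b: "b \<in> Basis"
  have "2 * \<lfloor>2 ^ n * (x \<bullet> b)\<rfloor> \<le> \<lfloor>2 ^ Suc n * (x \<bullet> b)\<rfloor>"
    by (subst le_floor_iff) (use of_int_floor_le[of "2 ^ n * (x \<bullet> b)"] in \<open>auto simp: algebra_simps\<close>)
  then have "2 * of_int \<lfloor>2 ^ n * (x \<bullet> b)\<rfloor> \<le> (of_int \<lfloor>2 ^ Suc n * (x \<bullet> b)\<rfloor> :: real)" by linarith
  then show ?thesis by (simp add: xfloor_inner b field_simps)
qed

text \<open>Both roundings lie below the point and the finer one is the larger, so they differ by
  less than one coarse mesh.\<close>

lemma near_floor_Suc: "near n (tfloor n t) (xfloor n x) (tfloor (Suc n) t) (xfloor (Suc n) x)"
  unfolding near_def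
proof (intro conjI ballI)
  show "\<bar>tfloor (Suc n) t - tfloor n t\<bar> \<le> 1 / 4 ^ n"
    using tfloor_bounds[where n=n and t=t] tfloor_bounds[where n="Suc n" and t=t] tfloor_mono_level[of n t] by linarith
  fix b :: 'a assume b: "b \<in> Basis"
  show "\<bar>(xfloor n x - xfloor (Suc n) x) \<bullet> b\<bar> \<le> 1 / 2 ^ n"
    using xfloor_bounds[OF b, where n=n and x=x] xfloor_bounds[OF b, where n="Suc n" and x=x] xfloor_mono_level[OF b, of n x]
    by (simp add: inner_diff_left abs_le_iff)
qed

text \<open>Reals at distance at most one have floors at distance at most one. Rounding therefore
  preserves \<open>near\<close> at the same level, with no loss in the constant.\<close>

lemma floor_diff_le:
  fixes a b K :: real assumes "K > 0" "\<bar>a - b\<bar> \<le> 1 / K"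
  shows "\<bar>of_int \<lfloor>K * a\<rfloor> / K - of_int \<lfloor>K * b\<rfloor> / K\<bar> \<le> 1 / K"
proof -
  have "\<bar>K * a - K * b\<bar> \<le> 1"
  proof -
    have "\<bar>K * a - K * b\<bar> = K * \<bar>a - b\<bar>" using assms(1) by (simp add: abs_mult flip: right_diff_distrib)
    also have "\<dots> \<le> K * (1 / K)" using assms by (intro mult_left_mono) auto
    finally show ?thesis using assms by simp
  qed
  then have "\<bar>\<lfloor>K * a\<rfloor> - \<lfloor>K * b\<rfloor>\<bar> \<le> 1" by linarith
  then have "\<bar>of_int \<lfloor>K * a\<rfloor> - of_int \<lfloor>K * b\<rfloor>\<bar> \<le> (1::real)" by linarith
  then show ?thesis using assms(1) by (simp add: field_simps abs_le_iff)
qed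

lemma near_floor:
  assumes "near n s x t y"
  shows "near n (tfloor n s) (xfloor n x) (tfloor n t) (xfloor n y)"
  unfolding near_def
proof (intro conjI ballI)
  show "\<bar>tfloor n t - tfloor n s\<bar> \<le> 1 / 4 ^ n"
    unfolding tfloor_def using assms by (intro floor_diff_le) (auto simp: near_def)
  fix b :: 'a assume b: "b \<in> Basis"
  have "\<bar>xfloor n x \<bullet> b - xfloor n y \<bullet> b\<bar> \<le> 1 / 2 ^ n"
    unfolding xfloor_inner[OF b] using assms b by (intro floor_diff_le) (auto simp: near_def inner_diff_left)
  then show "\<bar>(xfloor n x - xfloor n y) \<bullet> b\<bar> \<le> 1 / 2 ^ n" by (simp add: inner_diff_left)
qed

text \<open>Deterministic chaining: \<open>f\<close> is only controlled on the nested grids, \<open>g\<close> is its limit along them.\<close>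

lemma chaining_tail:
  fixes f :: "real \<Rightarrow> 'd::euclidean_space \<Rightarrow> real"
  assumes r: "0 < r" "r < 1"
    and inc: "\<And>n s t x y. s \<in> tgrid N (Suc n) \<Longrightarrow> t \<in> tgrid N (Suc n) \<Longrightarrow> x \<in> xgrid N (Suc n) \<Longrightarrow>
       y \<in> xgrid N (Suc n) \<Longrightarrow> near n s x t y \<Longrightarrow> \<bar>f t y - f s x\<bar> \<le> K * r ^ n"
    and t: "0 \<le> t" "t \<le> real N" and x: "\<And>b. b \<in> Basis \<Longrightarrow> \<bar>x \<bullet> b\<bar> \<le> real N"
  shows "convergent (\<lambda>n. f (tfloor n t) (xfloor n x))"
    and "\<bar>lim (\<lambda>n. f (tfloor n t) (xfloor n x)) - f (tfloor n t) (xfloor n x)\<bar> \<le> K * r ^ n / (1 - r)"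
proof -
  define a where "a n = f (tfloor n t) (xfloor n x)" for n
  have st: "\<bar>a (Suc n) - a n\<bar> \<le> K * r ^ n" for n
    unfolding a_def by (intro inc near_floor_Suc tfloor_in_tgrid xfloor_in_xgrid t x) auto
  have sm: "summable (\<lambda>n. K * r ^ n)" using r by (intro summable_mult summable_geometric) auto
  have s: "summable (\<lambda>n. a (Suc n) - a n)"
    by (rule summable_comparison_test'[OF sm]) (use st in auto)
  have "(\<lambda>n. (\<Sum>k<n. a (Suc k) - a k) + a 0) \<longlonglongrightarrow> (\<Sum>k. a (Suc k) - a k) + a 0"
    by (intro tendsto_intros summable_LIMSEQ s)
  then have c: "a \<longlonglongrightarrow> (\<Sum>k. a (Suc k) - a k) + a 0" by (simp add: sum_lessThan_telescope)
  then have "convergent a" by (rule convergentI)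
  then show "convergent (\<lambda>n. f (tfloor n t) (xfloor n x))" by (simp add: a_def[abs_def])
  have geo: "(\<Sum>k. K * r ^ (k + n)) = K * r ^ n / (1 - r)"
  proof -
    have "(\<lambda>k. K * r ^ n * r ^ k) sums (K * r ^ n * (1 / (1 - r)))"
      using r by (intro sums_mult geometric_sums) auto
    then show ?thesis by (intro sums_unique[symmetric]) (simp add: power_add mult_ac)
  qed
  have "lim a - a n = (\<Sum>k. a (Suc (k + n)) - a (k + n))"
  proof -
    have "(\<Sum>k. a (Suc k) - a k) = (\<Sum>k. a (Suc (k + n)) - a (k + n)) + (\<Sum>k<n. a (Suc k) - a k)"
      using suminf_split_initial_segment[OF s, of n] by simp
    then show ?thesis using limI[OF c] by (simp add: sum_lessThan_telescope)
  qed
  also have "\<bar>\<dots>\<bar> \<le> (\<Sum>k. K * r ^ (k + n))"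
  proof -
    have sn: "summable (\<lambda>k. K * r ^ (k + n))" using summable_ignore_initial_segment[OF sm, of n] .
    show ?thesis using st[of "_ + n"]
      by (intro order_trans[OF summable_rabs suminf_le] summable_comparison_test'[OF sn] sn) auto
  qed
  finally show "\<bar>lim (\<lambda>n. f (tfloor n t) (xfloor n x)) - f (tfloor n t) (xfloor n x)\<bar> \<le> K * r ^ n / (1 - r)"
    by (simp add: geo a_def[abs_def])
qed

lemma dyadic_scale:
  fixes \<delta> :: real assumes "0 < \<delta>" "\<delta> \<le> 1"
  obtains n :: nat where "\<delta> \<le> 1 / 2 ^ n" "1 / 2 ^ Suc n < \<delta>"
proof -
  obtain m where m: "(1/2::real) ^ m < \<delta>" using real_arch_pow_inv[of \<delta> "1/2"] assms by auto
  define k where "k = (LEAST m. (1/2::real) ^ m < \<delta>)"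
  have k: "(1/2::real) ^ k < \<delta>" unfolding k_def by (rule LeastI[of _ m]) (rule m)
  then obtain n where n: "k = Suc n" using assms by (cases k) auto
  have "\<not> (1/2::real) ^ n < \<delta>" unfolding k_def by (rule not_less_Least) (use n in \<open>simp add: k_def\<close>)
  then show ?thesis using k n that[of n] by (simp add: power_one_over)
qed

text \<open>Increments are controlled on the grid of level \<open>Suc n\<close> between points that
  are \<open>near\<close> at level n. This covers both kinds of step: the refinement of one point
  from level n to n+1, and the comparison of two nearby points rounded at level n.\<close>

lemma chaining_holder:
  fixes f :: "real \<Rightarrow> 'd::euclidean_space \<Rightarrow> real"
  assumes h: "0 < h" and K: "0 \<le> K"
    and inc: "\<And>n s t x y. s \<in> tgrid N (Suc n) \<Longrightarrow> t \<in> tgrid N (Suc n) \<Longrightarrow> x \<in> xgrid N (Suc n) \<Longrightarrow>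
       y \<in> xgrid N (Suc n) \<Longrightarrow> near n s x t y \<Longrightarrow> \<bar>f t y - f s x\<bar> \<le> K * (2 powr - h) ^ n"
  defines "g \<equiv> \<lambda>t x. lim (\<lambda>n. f (tfloor n t) (xfloor n x))"
  shows "\<exists>C\<ge>0. \<forall>s t x y. 0 \<le> s \<longrightarrow> s \<le> real N \<longrightarrow> 0 \<le> t \<longrightarrow> t \<le> real N \<longrightarrow>
     (\<forall>b\<in>Basis. \<bar>x \<bullet> b\<bar> \<le> real N) \<longrightarrow> (\<forall>b\<in>Basis. \<bar>y \<bullet> b\<bar> \<le> real N) \<longrightarrow>
     \<bar>g t y - g s x\<bar> \<le> C * (\<bar>t - s\<bar> powr (h / 2) + norm (x - y) powr h)"
proof -
  define r where "r = 2 powr - h"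
  have r: "0 < r" "r < 1" using h by (auto simp: r_def powr_less_one)
  \<comment> \<open>For points at distance above one there is no dyadic level to compare on; the
    finitely many values of f on the coarsest grid bound the increment instead.\<close>
  define F where "F = (\<Sum>p\<in>tgrid N 0 \<times> (xgrid N 0 :: 'd set). \<bar>f (fst p) (snd p)\<bar>)"
  have F: "\<bar>f t x\<bar> \<le> F" if "t \<in> tgrid N 0" "x \<in> xgrid N 0" for t x
    using that member_le_sum[of "(t,x)" "tgrid N 0 \<times> (xgrid N 0 :: 'd set)" "\<lambda>p. \<bar>f (fst p) (snd p)\<bar>"]
    by (auto simp: F_def finite_tgrid finite_xgrid)
  have F0: "0 \<le> F" unfolding F_def by (intro sum_nonneg) auto
  \<comment> \<open>Two geometric tails, one for each point, and one comparison between the rounded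
    points.\<close>
  define L where "L = 2 * K / (1 - r) + K"
  have L0: "0 \<le> L" using K r by (auto simp: L_def)
  \<comment> \<open>The factor \<open>2 powr h\<close> pays for the gap between the distance and the
    dyadic number just below it; the second summand covers distances above one.\<close>
  define C where "C = L * 2 powr h + (L + 2 * F)"
  have C0: "0 \<le> C" using L0 F0 by (auto simp: C_def)
  have main: "\<bar>g t y - g s x\<bar> \<le> C * (\<bar>t - s\<bar> powr (h / 2) + norm (x - y) powr h)"
    if s: "0 \<le> s" "s \<le> real N" and t: "0 \<le> t" "t \<le> real N"
      and x: "\<And>b. b \<in> Basis \<Longrightarrow> \<bar>x \<bullet> b\<bar> \<le> real N" and y: "\<And>b. b \<in> Basis \<Longrightarrow> \<bar>y \<bullet> b\<bar> \<le> real N" for s t x y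
  proof -
    \<comment> \<open>The parabolic distance of the two points, matched to the meshes 4^-n and
      2^-n.\<close>
    define \<delta> where "\<delta> = max (\<bar>t - s\<bar> powr (1/2)) (norm (x - y))"
    have \<delta>0: "0 \<le> \<delta>" by (simp add: \<delta>_def max_def)
    have \<delta>h: "\<delta> powr h \<le> \<bar>t - s\<bar> powr (h / 2) + norm (x - y) powr h"
      unfolding \<delta>_def max_def by (auto simp: powr_powr)
    have tails: "\<bar>g t y - f (tfloor n t) (xfloor n y)\<bar> \<le> K * r ^ n / (1 - r)"
        "\<bar>g s x - f (tfloor n s) (xfloor n x)\<bar> \<le> K * r ^ n / (1 - r)" for n
      unfolding g_def
      using chaining_tail(2)[of r N f K t y n, OF r inc[folded r_def] t y]
        chaining_tail(2)[of r N f K s x n, OF r inc[folded r_def] s x] by simp_all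
    have "\<bar>g t y - g s x\<bar> \<le> C * \<delta> powr h"
    proof -
      consider "\<delta> = 0" | "0 < \<delta>" "\<delta> \<le> 1" | "1 < \<delta>" using \<delta>0 by linarith
      then show ?thesis
      proof cases
        case 1
        then have "norm (x - y) = 0" "\<bar>t - s\<bar> powr (1/2) = 0" by (auto simp: \<delta>_def max_def split: if_splits)
        then have "t = s" "x = y" by auto
        then show ?thesis using C0 by simp
      next
        case 2
        then obtain n where n: "\<delta> \<le> 1 / 2 ^ n" "1 / 2 ^ Suc n < \<delta>" using dyadic_scale by blast
        have "near n s x t y" unfolding near_def
        proof (intro conjI ballI)
          have "\<bar>t - s\<bar> = (\<bar>t - s\<bar> powr (1/2))\<^sup>2" by (simp add: powr_half_sqrt)
          also have "\<dots> \<le> (1 / 2 ^ n)\<^sup>2" using n(1) by (intro power_mono) (auto simp: \<delta>_def)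
          also have "\<dots> = 1 / 4 ^ n" by (simp add: power_divide power_mult[symmetric] mult.commute[of n]) (simp add: power_mult)
          finally show "\<bar>t - s\<bar> \<le> 1 / 4 ^ n" .
          show "\<bar>(x - y) \<bullet> b\<bar> \<le> 1 / 2 ^ n" if "b \<in> Basis" for b
            using Basis_le_norm[OF that, of "x - y"] n(1) by (simp add: \<delta>_def)
        qed
        then have "\<bar>f (tfloor n t) (xfloor n y) - f (tfloor n s) (xfloor n x)\<bar> \<le> K * r ^ n"
          unfolding r_def by (intro inc near_floor tfloor_in_tgrid xfloor_in_xgrid s t x y) auto
        then have "\<bar>g t y - g s x\<bar> \<le> K * r ^ n / (1 - r) + K * r ^ n / (1 - r) + K * r ^ n"
          using tails[of n] by linarith
        also have "\<dots> = L * r ^ n" by (simp add: L_def field_simps)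
        also have "\<dots> \<le> L * (2 powr h * \<delta> powr h)"
        proof (rule mult_left_mono[OF _ L0])
          have "r ^ n = 2 powr h * (1 / 2 ^ Suc n) powr h"
          proof -
            have "(1 / 2 ^ Suc n) powr h = (2 powr - real (Suc n)) powr h"
              by (simp add: powr_minus powr_realpow[symmetric] inverse_eq_divide del: of_nat_Suc power_Suc)
            also have "\<dots> = 2 powr (- (real n + 1) * h)" by (simp add: powr_powr algebra_simps)
            finally have "2 powr h * (1 / 2 ^ Suc n) powr h = 2 powr (- h * real n)"
              by (simp flip: powr_add) (simp add: algebra_simps)
            also have "\<dots> = r ^ n" unfolding r_def by (simp add: powr_realpow[symmetric] powr_powr)
            finally show ?thesis ..
          qed
          also have "\<dots> \<le> 2 powr h * \<delta> powr h"
            using n(2) h by (intro mult_left_mono powr_mono2) auto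
          finally show "r ^ n \<le> 2 powr h * \<delta> powr h" .
        qed
        also have "\<dots> \<le> C * \<delta> powr h" using L0 F0 by (simp add: C_def algebra_simps)
        finally show ?thesis .
      next
        case 3
        have "\<bar>f (tfloor 0 t) (xfloor 0 y)\<bar> \<le> F" "\<bar>f (tfloor 0 s) (xfloor 0 x)\<bar> \<le> F"
          by (intro F tfloor_in_tgrid xfloor_in_xgrid s t x y; simp)+
        then have "\<bar>g t y - g s x\<bar> \<le> K / (1 - r) + K / (1 - r) + 2 * F"
          using tails[of 0] by simp
        also have "\<dots> \<le> L + 2 * F" using K by (simp add: L_def)
        also have "\<dots> \<le> C" using L0 by (simp add: C_def)
        also have "\<dots> \<le> C * \<delta> powr h" using mult_left_mono[OF ge_one_powr_ge_zero[of \<delta> h] C0] 3 h by simp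
        finally show ?thesis .
      qed
    qed
    also have "\<dots> \<le> C * (\<bar>t - s\<bar> powr (h / 2) + norm (x - y) powr h)"
      by (intro mult_left_mono \<delta>h C0)
    finally show ?thesis .
  qed
  show ?thesis using C0 main by (intro exI[of _ C]) auto
qed

section \<open>From moment bounds to increments on the grids\<close>

lemma near_norm: "near n s x t y \<Longrightarrow> norm (x - y :: 'd::euclidean_space) \<le> real DIM('d) / 2 ^ n"
  using norm_le_l1[of "x - y"] sum_mono[of Basis "\<lambda>b. \<bar>(x - y) \<bullet> b\<bar>" "\<lambda>_. 1 / 2 ^ n"] by (auto simp: near_def)

text \<open>The meshes are chosen so that both terms decay like 2^(-\<alpha> n). The dimension
  enters because closeness is coordinatewise and is compared with the Euclidean norm through the l1
  norm.\<close>

lemma near_rho: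
  assumes "near n s x t (y :: 'd::euclidean_space)" "0 < \<alpha>"
  shows "\<bar>t - s\<bar> powr (\<alpha> / 2) + norm (x - y) powr \<alpha> \<le> (1 + real DIM('d) powr \<alpha>) * (2 powr - \<alpha>) ^ n"
proof -
  have e: "(2 powr - \<alpha>) ^ n = 2 powr (- \<alpha> * real n)" by (simp add: powr_realpow[symmetric] powr_powr)
  have "\<bar>t - s\<bar> powr (\<alpha> / 2) \<le> (1 / 4 ^ n) powr (\<alpha> / 2)"
    using assms by (intro powr_mono2) (auto simp: near_def)
  also have "1 / 4 ^ n = 2 powr (- 2 * real n)"
  proof -
    have "(4::real) ^ n = 2 powr (2 * real n)"
      by (simp add: powr_realpow[symmetric] power_mult powr_powr[symmetric])
    then show ?thesis by (simp add: powr_minus inverse_eq_divide)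
  qed
  also have "(2 powr (- 2 * real n)) powr (\<alpha> / 2) = (2 powr - \<alpha>) ^ n" unfolding e by (simp add: powr_powr mult.commute)
  finally have 1: "\<bar>t - s\<bar> powr (\<alpha> / 2) \<le> (2 powr - \<alpha>) ^ n" .
  have "norm (x - y) powr \<alpha> \<le> (real DIM('d) / 2 ^ n) powr \<alpha>"
    using near_norm[OF assms(1)] assms(2) by (intro powr_mono2) auto
  also have "\<dots> = (real DIM('d) * 2 powr (- real n)) powr \<alpha>"
    by (simp add: powr_minus powr_realpow inverse_eq_divide)
  also have "\<dots> = real DIM('d) powr \<alpha> * (2 powr - \<alpha>) ^ n"
    unfolding e by (subst powr_mult) (auto simp: powr_powr mult.commute)
  finally show ?thesis using 1 by (simp add: algebra_simps)
qed

text \<open>A union bound in summed form: the p-th powers of all increments between neighbours, each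
  divided by (r^n)^p with r = 2^(-h), are added into one variable \<open>Z\<close>. Its mean is
  finite, so it is finite almost surely, and it dominates every single term.\<close>

lemma kolmogorov_grid_bound:
  fixes u :: "real \<Rightarrow> 'd::euclidean_space \<Rightarrow> 'w \<Rightarrow> real"
  assumes meas: "\<And>t x. 0 \<le> t \<Longrightarrow> u t x \<in> borel_measurable P"
    and \<alpha>: "0 < \<alpha>" and h: "h < \<alpha>"
    and mom: "\<And>p::nat. 0 < p \<Longrightarrow> \<exists>C\<ge>0. \<forall>s t x y. 0 \<le> s \<longrightarrow> s \<le> real N \<longrightarrow> 0 \<le> t \<longrightarrow> t \<le> real N \<longrightarrow>
       (\<integral>\<^sup>+\<omega>. ennreal (\<bar>u t x \<omega> - u s y \<omega>\<bar> ^ p) \<partial>P) \<le> ennreal (C * (\<bar>t - s\<bar> powr (\<alpha> / 2) + norm (x - y) powr \<alpha>) ^ p)"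
  shows "AE \<omega> in P. \<exists>K\<ge>0. \<forall>n s t x y. s \<in> tgrid N (Suc n) \<longrightarrow> t \<in> tgrid N (Suc n) \<longrightarrow> x \<in> xgrid N (Suc n) \<longrightarrow>
       y \<in> xgrid N (Suc n) \<longrightarrow> near n s x t y \<longrightarrow> \<bar>u t y \<omega> - u s x \<omega>\<bar> \<le> K * (2 powr - h) ^ n"
proof -
  define d where "d = DIM('d)"
  \<comment> \<open>Level n has at most A 2^((4+2d) n) pairs, and the mean of a normalised p-th
    power is of order 2^(-p (\<alpha>-h) n). With p (\<alpha>-h) at least 5 + 2d, level n
    contributes at most a multiple of 2^-n.\<close>
  obtain p0 :: nat where p0: "(5 + 2 * real d) / (\<alpha> - h) < real p0" using reals_Archimedean2 by blast
  define p where "p = Suc p0"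
  have p: "0 < p" "5 + 2 * real d \<le> real p * (\<alpha> - h)" using p0 h by (auto simp: p_def field_simps)
  obtain C where C: "0 \<le> C" and mC: "\<And>s t x y. 0 \<le> s \<Longrightarrow> s \<le> real N \<Longrightarrow> 0 \<le> t \<Longrightarrow> t \<le> real N \<Longrightarrow>
       (\<integral>\<^sup>+\<omega>. ennreal (\<bar>u t x \<omega> - u s y \<omega>\<bar> ^ p) \<partial>P) \<le> ennreal (C * (\<bar>t - s\<bar> powr (\<alpha> / 2) + norm (x - y) powr \<alpha>) ^ p)"
    using mom[OF p(1)] by blast
  define r where "r = 2 powr - h"
  have r: "0 < r" by (simp add: r_def)
  define S :: "nat \<Rightarrow> (real \<times> 'd \<times> real \<times> 'd) set" where
    "S n = {(s, x, t, y). s \<in> tgrid N (Suc n) \<and> x \<in> xgrid N (Suc n) \<and> t \<in> tgrid N (Suc n) \<and> y \<in> xgrid N (Suc n) \<and> near n s x t y}" for n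
  have Ssub: "S n \<subseteq> tgrid N (Suc n) \<times> xgrid N (Suc n) \<times> tgrid N (Suc n) \<times> xgrid N (Suc n)" for n by (auto simp: S_def)
  have finS: "finite (S n)" for n
    by (rule finite_subset[OF Ssub]) (auto simp: finite_tgrid finite_xgrid)
  define A where "A = (((real N + 1) * 4) * ((2 * real N + 1) * 2) ^ d)\<^sup>2"
  have cardS: "real (card (S n)) \<le> A * (2 ^ (4 + 2 * d)) ^ n" for n
  proof -
    have "real (card (S n)) \<le> real (card (tgrid N (Suc n) \<times> (xgrid N (Suc n) :: 'd set) \<times> tgrid N (Suc n) \<times> (xgrid N (Suc n) :: 'd set)))"
      using Ssub by (intro of_nat_mono card_mono) (auto simp: finite_tgrid finite_xgrid)
    also have "\<dots> = (real (card (tgrid N (Suc n))) * real (card (xgrid N (Suc n) :: 'd set)))\<^sup>2"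
      by (simp add: card_cartesian_product power2_eq_square)
    also have "\<dots> \<le> (((real N + 1) * 4 ^ Suc n) * (((2 * real N + 1) * 2 ^ Suc n) ^ d))\<^sup>2"
      unfolding d_def by (intro power_mono mult_mono card_tgrid card_xgrid) auto
    also have "\<dots> = A * ((4 ^ n * (2 ^ n) ^ d)\<^sup>2)"
    proof -
      have "((2 * real N + 1) * 2 ^ Suc n) ^ d = ((2 * real N + 1) * 2) ^ d * (2 ^ n) ^ d"
        by (simp only: power_Suc power_mult_distrib mult.assoc)
      then have "(real N + 1) * 4 ^ Suc n * (((2 * real N + 1) * 2 ^ Suc n) ^ d)
          = (((real N + 1) * 4) * ((2 * real N + 1) * 2) ^ d) * (4 ^ n * (2 ^ n) ^ d)"
        by (simp only: power_Suc mult.assoc mult.left_commute)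
      then show ?thesis unfolding A_def by (simp only: power_mult_distrib)
    qed
    also have "(4 ^ n * (2 ^ n) ^ d)\<^sup>2 = ((2::real) ^ (4 + 2 * d)) ^ n"
    proof -
      have "(4::real) ^ n = 2 ^ (2 * n)" by (simp add: power_mult)
      then have "(4 ^ n * (2 ^ n) ^ d)\<^sup>2 = (2::real) ^ ((2 * n + n * d) * 2)" by (simp add: power_mult[symmetric] power_add[symmetric])
      also have "(2 * n + n * d) * 2 = (4 + 2 * d) * n" by (simp add: algebra_simps)
      finally show ?thesis by (simp add: power_mult)
    qed
    finally show ?thesis .
  qed
  define Z where "Z \<omega> = (\<Sum>n. \<Sum>(s, x, t, y)\<in>S n. ennreal (\<bar>u t y \<omega> - u s x \<omega>\<bar> ^ p / (r ^ n) ^ p))" for \<omega>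
  have S0: "0 \<le> s \<and> s \<le> real N \<and> 0 \<le> t \<and> t \<le> real N" if "(s, x, t, y) \<in> S n" for s x t y n
  proof -
    have "real k / 4 ^ Suc n \<le> real N" if "k \<le> N * 4 ^ Suc n" for k
    proof -
      have "real k \<le> real (N * 4 ^ Suc n)" using that by (simp only: of_nat_le_iff)
      then show ?thesis by (simp add: field_simps)
    qed
    then show ?thesis using that by (auto simp: S_def tgrid_def)
  qed
  have m: "(\<lambda>\<omega>. ennreal (\<bar>u t y \<omega> - u s x \<omega>\<bar> ^ p / (r ^ n) ^ p)) \<in> borel_measurable P" if "(s, x, t, y) \<in> S n" for s x t y n
  proof -
    have [measurable]: "u t y \<in> borel_measurable P" "u s x \<in> borel_measurable P" using S0[OF that] meas by auto
    show ?thesis by measurable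
  qed
  have mt: "(\<lambda>\<omega>. \<Sum>(s, x, t, y)\<in>S n. ennreal (\<bar>u t y \<omega> - u s x \<omega>\<bar> ^ p / (r ^ n) ^ p)) \<in> borel_measurable P" for n
    by (intro borel_measurable_sum) (use m in auto)
  have mZ: "Z \<in> borel_measurable P" unfolding Z_def by (intro borel_measurable_suminf_order mt)
  define D where "D = 1 + real d powr \<alpha>"
  have D: "0 \<le> D" by (simp add: D_def)
  have one: "(\<integral>\<^sup>+\<omega>. ennreal (\<bar>u t y \<omega> - u s x \<omega>\<bar> ^ p / (r ^ n) ^ p) \<partial>P) \<le> ennreal (C * D ^ p * (((2 powr - \<alpha>) / r) ^ p) ^ n)"
    if S: "(s, x, t, y) \<in> S n" for s x t y n
  proof -
    have st: "0 \<le> s" "s \<le> real N" "0 \<le> t" "t \<le> real N" using S0[OF S] by auto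
    have [measurable]: "u t y \<in> borel_measurable P" "u s x \<in> borel_measurable P" using st meas by auto
    have "(\<integral>\<^sup>+\<omega>. ennreal (\<bar>u t y \<omega> - u s x \<omega>\<bar> ^ p / (r ^ n) ^ p) \<partial>P)
        = (\<integral>\<^sup>+\<omega>. ennreal (1 / (r ^ n) ^ p) * ennreal (\<bar>u t y \<omega> - u s x \<omega>\<bar> ^ p) \<partial>P)"
      using r by (intro nn_integral_cong) (simp flip: ennreal_mult)
    also have "\<dots> = ennreal (1 / (r ^ n) ^ p) * (\<integral>\<^sup>+\<omega>. ennreal (\<bar>u t y \<omega> - u s x \<omega>\<bar> ^ p) \<partial>P)"
      by (intro nn_integral_cmult) measurable
    also have "\<dots> \<le> ennreal (1 / (r ^ n) ^ p) * ennreal (C * (D * (2 powr - \<alpha>) ^ n) ^ p)"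
    proof (intro mult_left_mono order_trans[OF mC[OF st]] ennreal_leI)
      have "near n s x t y" using S by (simp add: S_def)
      from near_rho[OF this \<alpha>] show "(\<bar>t - s\<bar> powr (\<alpha> / 2) + norm (y - x) powr \<alpha>) ^ p \<le> (D * (2 powr - \<alpha>) ^ n) ^ p"
        unfolding D_def d_def by (intro power_mono) (auto simp: norm_minus_commute)
    qed (use C in auto)
    also have "\<dots> = ennreal (1 / (r ^ n) ^ p * (C * (D * (2 powr - \<alpha>) ^ n) ^ p))"
      using r C D by (intro ennreal_mult[symmetric]) auto
    also have "1 / (r ^ n) ^ p * (C * (D * (2 powr - \<alpha>) ^ n) ^ p) = C * D ^ p * (((2 powr - \<alpha>) / r) ^ p) ^ n"
      by (simp add: power_mult_distrib power_divide power_mult[symmetric] mult.commute[of n p])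
    finally show ?thesis .
  qed
  have ratio: "2 ^ (4 + 2 * d) * ((2 powr - \<alpha>) / r) ^ p \<le> 1 / 2"
  proof -
    have "(2 powr - \<alpha>) / r = 2 powr (- (\<alpha> - h))" by (simp add: r_def powr_diff[symmetric])
    then have "((2 powr - \<alpha>) / r) ^ p = 2 powr (- (real p * (\<alpha> - h)))"
      by (simp add: powr_realpow[symmetric] powr_powr algebra_simps)
    also have "\<dots> \<le> 2 powr (- (5 + 2 * real d))" using p by (intro powr_mono) auto
    finally have "2 ^ (4 + 2 * d) * ((2 powr - \<alpha>) / r) ^ p \<le> 2 powr (real (4 + 2 * d)) * 2 powr (- (5 + 2 * real d))"
      by (intro mult_mono) (auto simp del: of_nat_add of_nat_mult simp: powr_realpow r_def)
    also have "\<dots> = 2 powr (-1)" by (simp flip: powr_add)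
    finally show ?thesis by (simp add: powr_minus)
  qed
  have "(\<integral>\<^sup>+\<omega>. Z \<omega> \<partial>P) = (\<Sum>n. \<integral>\<^sup>+\<omega>. (\<Sum>(s, x, t, y)\<in>S n. ennreal (\<bar>u t y \<omega> - u s x \<omega>\<bar> ^ p / (r ^ n) ^ p)) \<partial>P)"
    unfolding Z_def by (intro nn_integral_suminf mt)
  also have "\<dots> \<le> (\<Sum>n. ennreal (A * C * D ^ p * (1/2) ^ n))"
  proof (intro suminf_le summableI)
    fix n
    have "(\<integral>\<^sup>+\<omega>. (\<Sum>(s, x, t, y)\<in>S n. ennreal (\<bar>u t y \<omega> - u s x \<omega>\<bar> ^ p / (r ^ n) ^ p)) \<partial>P)
      = (\<Sum>(s, x, t, y)\<in>S n. \<integral>\<^sup>+\<omega>. ennreal (\<bar>u t y \<omega> - u s x \<omega>\<bar> ^ p / (r ^ n) ^ p) \<partial>P)"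
      by (subst nn_integral_sum) (use m in \<open>auto intro!: sum.cong\<close>)
    also have "\<dots> \<le> (\<Sum>z\<in>S n. ennreal (C * D ^ p * (((2 powr - \<alpha>) / r) ^ p) ^ n))"
      by (intro sum_mono) (use one in auto)
    also have "\<dots> = ennreal (real (card (S n)) * (C * D ^ p * (((2 powr - \<alpha>) / r) ^ p) ^ n))"
      using C D r by (simp add: ennreal_of_nat_eq_real_of_nat ennreal_mult)
    also have "\<dots> \<le> ennreal (A * C * D ^ p * (1/2) ^ n)"
    proof (rule ennreal_leI)
      have "real (card (S n)) * (C * D ^ p * (((2 powr - \<alpha>) / r) ^ p) ^ n)
         \<le> A * (2 ^ (4 + 2 * d)) ^ n * (C * D ^ p * (((2 powr - \<alpha>) / r) ^ p) ^ n)"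
        using C D r by (intro mult_right_mono cardS) auto
      also have "\<dots> = A * C * D ^ p * (2 ^ (4 + 2 * d) * ((2 powr - \<alpha>) / r) ^ p) ^ n"
        by (simp add: power_mult_distrib mult_ac)
      also have "\<dots> \<le> A * C * D ^ p * (1/2) ^ n"
        using C D r by (intro mult_left_mono power_mono ratio) (auto simp: A_def)
      finally show "real (card (S n)) * (C * D ^ p * (((2 powr - \<alpha>) / r) ^ p) ^ n) \<le> A * C * D ^ p * (1/2) ^ n" .
    qed
    finally show "(\<integral>\<^sup>+\<omega>. (\<Sum>(s, x, t, y)\<in>S n. ennreal (\<bar>u t y \<omega> - u s x \<omega>\<bar> ^ p / (r ^ n) ^ p)) \<partial>P) \<le> ennreal (A * C * D ^ p * (1/2) ^ n)" .
  qed
  also have "\<dots> < \<infinity>"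
  proof -
    have "summable (\<lambda>n. A * C * D ^ p * (1/2::real) ^ n)" by (intro summable_mult summable_geometric) auto
    then show ?thesis using C D by (subst suminf_ennreal2) (auto simp: A_def)
  qed
  finally have "(\<integral>\<^sup>+\<omega>. Z \<omega> \<partial>P) \<noteq> \<infinity>" by simp
  from nn_integral_PInf_AE[OF mZ this] show ?thesis
  proof (rule AE_mp[OF _ AE_I2], intro impI)
    fix \<omega> assume Zfin: "Z \<omega> \<noteq> \<infinity>"
    \<comment> \<open>Being at least one gives K \<le> K^p, so the bound on p-th powers can be
      compared as \<open>?c ^ p\<close> against \<open>K ^ p\<close> and the exponent
      removed.\<close>
    define K where "K = max 1 (enn2real (Z \<omega>))"
    have K1: "1 \<le> K" by (simp add: K_def)
    show "\<exists>K\<ge>0. \<forall>n s t x y. s \<in> tgrid N (Suc n) \<longrightarrow> t \<in> tgrid N (Suc n) \<longrightarrow> x \<in> xgrid N (Suc n) \<longrightarrow>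
       y \<in> xgrid N (Suc n) \<longrightarrow> near n s x t y \<longrightarrow> \<bar>u t y \<omega> - u s x \<omega>\<bar> \<le> K * (2 powr - h) ^ n"
    proof (intro exI[of _ K] conjI allI impI)
      fix n s t and x y :: 'd assume "s \<in> tgrid N (Suc n)" "t \<in> tgrid N (Suc n)" "x \<in> xgrid N (Suc n)" "y \<in> xgrid N (Suc n)" "near n s x t y"
      then have S: "(s, x, t, y) \<in> S n" by (auto simp: S_def)
      let ?c = "\<bar>u t y \<omega> - u s x \<omega>\<bar>"
      have "ennreal (?c ^ p / (r ^ n) ^ p) \<le> (\<Sum>(s, x, t, y)\<in>S n. ennreal (\<bar>u t y \<omega> - u s x \<omega>\<bar> ^ p / (r ^ n) ^ p))"
        using member_le_sum[OF S, of "\<lambda>(s, x, t, y). ennreal (\<bar>u t y \<omega> - u s x \<omega>\<bar> ^ p / (r ^ n) ^ p)"] finS by auto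
      also have "\<dots> \<le> Z \<omega>"
        unfolding Z_def using sum_le_suminf[OF summableI, of "{n}" "\<lambda>n. \<Sum>(s, x, t, y)\<in>S n. ennreal (\<bar>u t y \<omega> - u s x \<omega>\<bar> ^ p / (r ^ n) ^ p)"] by auto
      also have "Z \<omega> = ennreal (enn2real (Z \<omega>))" using Zfin by (simp add: less_top)
      finally have "?c ^ p / (r ^ n) ^ p \<le> enn2real (Z \<omega>)" by (subst (asm) ennreal_le_iff) auto
      also have "\<dots> \<le> K" by (simp add: K_def)
      also have "K \<le> K ^ p" using K1 p by (intro self_le_power) auto
      finally have "(?c / r ^ n) ^ p \<le> K ^ p" by (simp add: power_divide)
      then have "?c / r ^ n \<le> K" using K1 p power_mono_iff[of "?c / r ^ n" K p] r by auto
      then show "?c \<le> K * (2 powr - h) ^ n" using r by (simp add: r_def field_simps)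
    qed (use K1 in auto)
  qed
qed

text \<open>The version is the limit along dyadic roundings, defined path by path without reference
  to exponents. The uncountably many T, M and exponents under the almost-sure quantifier are reduced
  to countably many boxes N and exponents \<open>h k\<close>.\<close>

theorem kolmogorov_continuity:
  fixes u :: "real \<Rightarrow> 'd::euclidean_space \<Rightarrow> 'w \<Rightarrow> real"
  assumes meas: "\<And>t x. 0 \<le> t \<Longrightarrow> u t x \<in> borel_measurable P"
    and \<alpha>: "0 < \<alpha>"
    and mom: "\<And>(N::nat) (p::nat). 0 < p \<Longrightarrow> \<exists>C\<ge>0. \<forall>s t x y. 0 \<le> s \<longrightarrow> s \<le> real N \<longrightarrow> 0 \<le> t \<longrightarrow> t \<le> real N \<longrightarrow>
       (\<integral>\<^sup>+\<omega>. ennreal (\<bar>u t x \<omega> - u s y \<omega>\<bar> ^ p) \<partial>P) \<le> ennreal (C * (\<bar>t - s\<bar> powr (\<alpha> / 2) + norm (x - y) powr \<alpha>) ^ p)"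
  shows "\<exists>U :: real \<Rightarrow> 'd \<Rightarrow> 'w \<Rightarrow> real.
     (\<forall>t x. 0 \<le> t \<longrightarrow> (AE \<omega> in P. U t x \<omega> = u t x \<omega>)) \<and>
     (AE \<omega> in P. \<forall>T M \<gamma>\<^sub>1 \<gamma>\<^sub>2. 0 < \<gamma>\<^sub>1 \<longrightarrow> \<gamma>\<^sub>1 < \<alpha> / 2 \<longrightarrow> 0 < \<gamma>\<^sub>2 \<longrightarrow> \<gamma>\<^sub>2 < \<alpha> \<longrightarrow>
        (\<exists>C. \<forall>s t x y. s \<in> {0..T} \<longrightarrow> t \<in> {0..T} \<longrightarrow>
           (\<forall>i\<in>Basis. \<bar>x \<bullet> i\<bar> \<le> M) \<longrightarrow> (\<forall>i\<in>Basis. \<bar>y \<bullet> i\<bar> \<le> M) \<longrightarrow>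
           \<bar>U t x \<omega> - U s y \<omega>\<bar> \<le> C * (\<bar>t - s\<bar> powr \<gamma>\<^sub>1 + norm (x - y) powr \<gamma>\<^sub>2)))"
proof -
  define U where "U t x \<omega> = lim (\<lambda>n. u (tfloor n t) (xfloor n x) \<omega>)" for t x \<omega>
  \<comment> \<open>These exponents increase to \<alpha>; the shift by 2 keeps \<open>h 0\<close>
    positive.\<close>
  define h where "h k = (1 - 1 / (real k + 2)) * \<alpha>" for k :: nat
  have h: "0 < h k" "h k < \<alpha>" for k using \<alpha> by (auto simp: h_def field_simps intro!: add_pos_nonneg)
  \<comment> \<open>First moments suffice: the L1 distances between u at (t, x) and at its rounding
    of level n are bounded by a convergent geometric series, so the rounded values converge almost
    surely to \<open>u t x \<omega>\<close>.\<close>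
  have version: "AE \<omega> in P. U t x \<omega> = u t x \<omega>" if t: "0 \<le> t" for t x
  proof -
    define N where "N = nat \<lceil>t\<rceil>"
    have tN: "t \<le> real N" by (simp add: N_def real_nat_ceiling_ge)
    obtain C where C: "0 \<le> C" and mC: "\<And>s t x y. 0 \<le> s \<Longrightarrow> s \<le> real N \<Longrightarrow> 0 \<le> t \<Longrightarrow> t \<le> real N \<Longrightarrow>
       (\<integral>\<^sup>+\<omega>. ennreal (\<bar>u t x \<omega> - u s y \<omega>\<bar> ^ 1) \<partial>P) \<le> ennreal (C * (\<bar>t - s\<bar> powr (\<alpha> / 2) + norm (x - y) powr \<alpha>) ^ 1)"
      using mom[of 1 N] by auto
    define D where "D = 1 + real DIM('d) powr \<alpha>"
    have tf: "0 \<le> tfloor n t" "tfloor n t \<le> t" for n using t tfloor_bounds[where n=n and t=t] by (auto simp: tfloor_def)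
    have [measurable]: "u t x \<in> borel_measurable P" "\<And>n. u (tfloor n t) (xfloor n x) \<in> borel_measurable P"
      using t tf meas by auto
    have b: "(\<integral>\<^sup>+\<omega>. ennreal \<bar>u (tfloor n t) (xfloor n x) \<omega> - u t x \<omega>\<bar> \<partial>P) \<le> ennreal (C * (D * (2 powr - \<alpha>) ^ n))" for n
    proof -
      have "near n t x (tfloor n t) (xfloor n x)"
        unfolding near_def
      proof (intro conjI ballI)
        show "\<bar>tfloor n t - t\<bar> \<le> 1 / 4 ^ n" using tfloor_bounds[where n=n and t=t] by linarith
        show "\<bar>(x - xfloor n x) \<bullet> b\<bar> \<le> 1 / 2 ^ n" if "b \<in> Basis" for b
          using xfloor_bounds[OF that, where n=n and x=x] by (auto simp: inner_diff_left abs_le_iff)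
      qed
      from near_rho[OF this \<alpha>]
      have "C * (\<bar>tfloor n t - t\<bar> powr (\<alpha> / 2) + norm (xfloor n x - x) powr \<alpha>) ^ 1 \<le> C * (D * (2 powr - \<alpha>) ^ n)"
        unfolding D_def using C by (intro mult_left_mono) (auto simp: norm_minus_commute)
      then show ?thesis using mC[of t "tfloor n t" "xfloor n x" x] t tN tf[of n]
        by (auto intro: order_trans ennreal_leI)
    qed
    have "(\<integral>\<^sup>+\<omega>. (\<Sum>n. ennreal \<bar>u (tfloor n t) (xfloor n x) \<omega> - u t x \<omega>\<bar>) \<partial>P)
       = (\<Sum>n. \<integral>\<^sup>+\<omega>. ennreal \<bar>u (tfloor n t) (xfloor n x) \<omega> - u t x \<omega>\<bar> \<partial>P)"
      by (intro nn_integral_suminf) measurable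
    also have "\<dots> \<le> (\<Sum>n. ennreal (C * (D * (2 powr - \<alpha>) ^ n)))" by (intro suminf_le b summableI)
    also have "\<dots> < \<infinity>"
    proof -
      have "summable (\<lambda>n. C * (D * (2 powr - \<alpha>) ^ n))" using \<alpha> by (intro summable_mult summable_geometric) (auto simp: powr_less_one)
      then show ?thesis using C by (subst suminf_ennreal2) (auto simp: D_def)
    qed
    finally have fin: "(\<integral>\<^sup>+\<omega>. (\<Sum>n. ennreal \<bar>u (tfloor n t) (xfloor n x) \<omega> - u t x \<omega>\<bar>) \<partial>P) \<noteq> \<infinity>" by simp
    have "AE \<omega> in P. (\<Sum>n. ennreal \<bar>u (tfloor n t) (xfloor n x) \<omega> - u t x \<omega>\<bar>) \<noteq> \<infinity>"
      by (rule nn_integral_PInf_AE[OF _ fin]) measurable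
    then show ?thesis
    proof (rule AE_mp[OF _ AE_I2], intro impI)
      fix \<omega> assume "(\<Sum>n. ennreal \<bar>u (tfloor n t) (xfloor n x) \<omega> - u t x \<omega>\<bar>) \<noteq> \<infinity>"
      then have "summable (\<lambda>n. \<bar>u (tfloor n t) (xfloor n x) \<omega> - u t x \<omega>\<bar>)"
        by (intro summable_suminf_not_top) auto
      then have "(\<lambda>n. \<bar>u (tfloor n t) (xfloor n x) \<omega> - u t x \<omega>\<bar>) \<longlonglongrightarrow> 0" by (rule summable_LIMSEQ_zero)
      then have "(\<lambda>n. u (tfloor n t) (xfloor n x) \<omega>) \<longlonglongrightarrow> u t x \<omega>"
        by (simp add: tendsto_rabs_zero_iff LIM_zero_iff)
      then show "U t x \<omega> = u t x \<omega>" unfolding U_def by (rule limI)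
    qed
  qed
  have "AE \<omega> in P. \<forall>N k. \<exists>K\<ge>0. \<forall>n s t x y. s \<in> tgrid N (Suc n) \<longrightarrow> t \<in> tgrid N (Suc n) \<longrightarrow> x \<in> xgrid N (Suc n) \<longrightarrow>
       y \<in> xgrid N (Suc n) \<longrightarrow> near n s x t y \<longrightarrow> \<bar>u t y \<omega> - u s x \<omega>\<bar> \<le> K * (2 powr - h k) ^ n"
    unfolding AE_all_countable by (intro allI kolmogorov_grid_bound[OF meas \<alpha> h(2) mom])
  then have "AE \<omega> in P. \<forall>T M \<gamma>\<^sub>1 \<gamma>\<^sub>2. 0 < \<gamma>\<^sub>1 \<longrightarrow> \<gamma>\<^sub>1 < \<alpha> / 2 \<longrightarrow> 0 < \<gamma>\<^sub>2 \<longrightarrow> \<gamma>\<^sub>2 < \<alpha> \<longrightarrow>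
        (\<exists>C. \<forall>s t x y. s \<in> {0..T} \<longrightarrow> t \<in> {0..T} \<longrightarrow>
           (\<forall>i\<in>Basis. \<bar>x \<bullet> i\<bar> \<le> M) \<longrightarrow> (\<forall>i\<in>Basis. \<bar>y \<bullet> i\<bar> \<le> M) \<longrightarrow>
           \<bar>U t x \<omega> - U s y \<omega>\<bar> \<le> C * (\<bar>t - s\<bar> powr \<gamma>\<^sub>1 + norm (x - y) powr \<gamma>\<^sub>2))"
  proof (rule AE_mp[OF _ AE_I2], intro impI allI)
    fix \<omega> and T M \<gamma>\<^sub>1 \<gamma>\<^sub>2 :: real
    assume grid: "\<forall>N k. \<exists>K\<ge>0. \<forall>n s t x y. s \<in> tgrid N (Suc n) \<longrightarrow> t \<in> tgrid N (Suc n) \<longrightarrow> x \<in> xgrid N (Suc n) \<longrightarrow>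
       y \<in> xgrid N (Suc n) \<longrightarrow> near n s x t y \<longrightarrow> \<bar>u t y \<omega> - u s x \<omega>\<bar> \<le> K * (2 powr - h k) ^ n"
      and g: "0 < \<gamma>\<^sub>1" "\<gamma>\<^sub>1 < \<alpha> / 2" "0 < \<gamma>\<^sub>2" "\<gamma>\<^sub>2 < \<alpha>"
    \<comment> \<open>One exponent serves both variables: \<open>q \<le> h k\<close> gives
      \<open>\<gamma>\<^sub>1 \<le> h k / 2\<close> in time and
      \<open>\<gamma>\<^sub>2 \<le> h k\<close> in space.\<close>
    define q where "q = max (2 * \<gamma>\<^sub>1) \<gamma>\<^sub>2"
    have q: "0 < q" "q < \<alpha>" using g by (auto simp: q_def)
    obtain k :: nat where k: "\<alpha> / (\<alpha> - q) < real k" using reals_Archimedean2 by blast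
    have qk: "q \<le> h k"
    proof -
      have "\<alpha> < real k * (\<alpha> - q)" using k q by (simp add: field_simps)
      also have "\<dots> \<le> (real k + 2) * (\<alpha> - q)" using q by (intro mult_right_mono) auto
      finally have "\<alpha> / (real k + 2) \<le> \<alpha> - q" by (simp add: field_simps)
      then show ?thesis by (simp add: h_def algebra_simps)
    qed
    have qk1: "\<gamma>\<^sub>1 \<le> h k / 2" "\<gamma>\<^sub>2 \<le> h k" using qk by (auto simp: q_def)
    obtain N :: nat where N: "max 1 (max T M) < real N" using reals_Archimedean2 by blast
    obtain K where K: "0 \<le> K" "\<And>n s t x y. s \<in> tgrid N (Suc n) \<Longrightarrow> t \<in> tgrid N (Suc n) \<Longrightarrow> x \<in> xgrid N (Suc n) \<Longrightarrow>
       y \<in> xgrid N (Suc n) \<Longrightarrow> near n s x t y \<Longrightarrow> \<bar>u t y \<omega> - u s x \<omega>\<bar> \<le> K * (2 powr - h k) ^ n"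
      using grid by meson
    from chaining_holder[of "h k" K N "\<lambda>t x. u t x \<omega>", OF h(1) K] obtain C where C: "0 \<le> C"
      "\<And>s t x y. 0 \<le> s \<Longrightarrow> s \<le> real N \<Longrightarrow> 0 \<le> t \<Longrightarrow> t \<le> real N \<Longrightarrow>
     (\<forall>b\<in>Basis. \<bar>x \<bullet> b\<bar> \<le> real N) \<Longrightarrow> (\<forall>b\<in>Basis. \<bar>y \<bullet> b\<bar> \<le> real N) \<Longrightarrow>
     \<bar>U t y \<omega> - U s x \<omega>\<bar> \<le> C * (\<bar>t - s\<bar> powr (h k / 2) + norm (x - y) powr h k)"
      unfolding U_def by blast
    define R where "R = 2 * real N * real DIM('d)"
    have R: "1 \<le> R" "real N \<le> R"
    proof -
      have "1 \<le> real DIM('d)" by (simp add: Suc_leI)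
      then have "real N * 1 \<le> real N * real DIM('d)" by (intro mult_left_mono) auto
      then show "1 \<le> R" "real N \<le> R" using N unfolding R_def by linarith+
    qed
    \<comment> \<open>On a bounded box an exponent may be lowered at the price of a constant; R
      bounds the distances both in time and in space.\<close>
    have pw: "a powr b \<le> R powr \<alpha> * a powr c" if "0 \<le> a" "a \<le> R" "0 < c" "c \<le> b" "b \<le> \<alpha>" for a b c :: real
    proof -
      have "a powr b = a powr (b - c) * a powr c" by (simp flip: powr_add)
      also have "\<dots> \<le> R powr \<alpha> * a powr c"
      proof (intro mult_right_mono)
        have "a powr (b - c) \<le> R powr (b - c)" using that by (intro powr_mono2) auto
        also have "\<dots> \<le> R powr \<alpha>" using that R by (intro powr_mono) auto
        finally show "a powr (b - c) \<le> R powr \<alpha>" .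
      qed auto
      finally show ?thesis .
    qed
    show "\<exists>C. \<forall>s t x y. s \<in> {0..T} \<longrightarrow> t \<in> {0..T} \<longrightarrow>
           (\<forall>i\<in>Basis. \<bar>x \<bullet> i\<bar> \<le> M) \<longrightarrow> (\<forall>i\<in>Basis. \<bar>y \<bullet> i\<bar> \<le> M) \<longrightarrow>
           \<bar>U t x \<omega> - U s y \<omega>\<bar> \<le> C * (\<bar>t - s\<bar> powr \<gamma>\<^sub>1 + norm (x - y) powr \<gamma>\<^sub>2)"
    proof (intro exI[of _ "C * R powr \<alpha>"] allI impI)
      fix s t and x y :: 'd
      assume st: "s \<in> {0..T}" "t \<in> {0..T}" and xy: "\<forall>i\<in>Basis. \<bar>x \<bullet> i\<bar> \<le> M" "\<forall>i\<in>Basis. \<bar>y \<bullet> i\<bar> \<le> M"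
      have "\<bar>U t x \<omega> - U s y \<omega>\<bar> \<le> C * (\<bar>t - s\<bar> powr (h k / 2) + norm (y - x) powr h k)"
        using st xy N by (intro C(2)) (auto intro: order_trans)
      also have "\<dots> \<le> C * (R powr \<alpha> * \<bar>t - s\<bar> powr \<gamma>\<^sub>1 + R powr \<alpha> * norm (y - x) powr \<gamma>\<^sub>2)"
      proof (intro mult_left_mono add_mono pw C(1) qk1 g)
        show "\<bar>t - s\<bar> \<le> R" using st N R by auto
        have "norm (y - x) \<le> (\<Sum>b\<in>Basis. \<bar>(y - x) \<bullet> b\<bar>)" by (rule norm_le_l1)
        also have "\<dots> \<le> (\<Sum>b\<in>(Basis::'d set). 2 * real N)"
        proof (intro sum_mono)
          fix b :: 'd assume "b \<in> Basis"
          then have "\<bar>x \<bullet> b\<bar> \<le> M" "\<bar>y \<bullet> b\<bar> \<le> M" using xy by auto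
          then show "\<bar>(y - x) \<bullet> b\<bar> \<le> 2 * real N" using N by (simp add: inner_diff_left) linarith
        qed
        also have "\<dots> = R" by (simp add: R_def)
        finally show "norm (y - x) \<le> R" .
        show "h k / 2 \<le> \<alpha>" "h k \<le> \<alpha>" using h[of k] by auto
      qed auto
      finally show "\<bar>U t x \<omega> - U s y \<omega>\<bar> \<le> C * R powr \<alpha> * (\<bar>t - s\<bar> powr \<gamma>\<^sub>1 + norm (x - y) powr \<gamma>\<^sub>2)"
        by (simp add: algebra_simps norm_minus_commute)
    qed
  qed
  with version show ?thesis by (intro exI[of _ U]) auto
qed

section \<open>Smooth cutoffs\<close>

text \<open>Order 0 asks nothing, since \<open>csmooth\<close> quantifies over all orders. Closure
  under products is an induction on the order in this form, whereas a direct coinduction would need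
  an invariant that is also closed under sums of products.\<close>

primrec Ck :: "nat \<Rightarrow> (real \<Rightarrow> complex) \<Rightarrow> bool" where
  "Ck 0 f \<longleftrightarrow> True"
| "Ck (Suc n) f \<longleftrightarrow> (\<exists>f'. (\<forall>x. (f has_vector_derivative f' x) (at x)) \<and> Ck n f')"

definition csmooth :: "(real \<Rightarrow> complex) \<Rightarrow> bool" where
  "csmooth f \<longleftrightarrow> (\<forall>n. Ck n f)"

lemma Ck_SucI: "(\<And>x. (f has_vector_derivative f' x) (at x)) \<Longrightarrow> Ck n f' \<Longrightarrow> Ck (Suc n) f"
  by auto

lemma Ck_SucD: "Ck (Suc n) f \<Longrightarrow> Ck n f"
proof (induction n arbitrary: f)
  case (Suc n)
  then obtain f' where "\<forall>x. (f has_vector_derivative f' x) (at x)" "Ck (Suc n) f'" by (metis Ck.simps(2))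
  then show ?case using Suc.IH by auto
qed simp

lemma Ck_add: "Ck n f \<Longrightarrow> Ck n g \<Longrightarrow> Ck n (\<lambda>x. f x + g x)"
proof (induction n arbitrary: f g)
  case (Suc n)
  obtain f' g' where f: "\<And>x. (f has_vector_derivative f' x) (at x)" "Ck n f'"
    and g: "\<And>x. (g has_vector_derivative g' x) (at x)" "Ck n g'" using Suc.prems by auto
  have "((\<lambda>x. f x + g x) has_vector_derivative (f' x + g' x)) (at x)" for x
    by (intro derivative_intros f g)
  then show ?case by (rule Ck_SucI) (intro Suc.IH f g)
qed simp

lemma Ck_mult: "Ck n f \<Longrightarrow> Ck n g \<Longrightarrow> Ck n (\<lambda>x. f x * g x)"
proof (induction n arbitrary: f g)
  case (Suc n)
  obtain f' g' where f: "\<And>x. (f has_vector_derivative f' x) (at x)" "Ck n f'"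
    and g: "\<And>x. (g has_vector_derivative g' x) (at x)" "Ck n g'" using Suc.prems by auto
  have d: "((\<lambda>x. f x * g x) has_vector_derivative (f x * g' x + f' x * g x)) (at x)" for x
    by (intro has_vector_derivative_mult f g)
  have "Ck n (\<lambda>x. f x * g' x + f' x * g x)"
    by (intro Ck_add Suc.IH f(2) g(2) Ck_SucD[OF Suc.prems(1)] Ck_SucD[OF Suc.prems(2)])
  from Ck_SucI[OF d this] show ?case .
qed simp

lemma Ck_const: "Ck n (\<lambda>_. c)"
proof (induction n arbitrary: c)
  case (Suc n)
  show ?case by (rule Ck_SucI[OF _ Suc[of 0]]) auto
qed simp

lemma Ck_affine: "Ck n f \<Longrightarrow> Ck n (\<lambda>x. f (a * x + b))"
proof (induction n arbitrary: f)
  case (Suc n)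
  obtain f' where f: "\<And>x. (f has_vector_derivative f' x) (at x)" "Ck n f'"
    using Suc.prems by auto
  have d: "((\<lambda>x. f (a * x + b)) has_vector_derivative (of_real a * f' (a * x + b))) (at x)" for x
  proof -
    have "((\<lambda>x. a * x + b) has_vector_derivative a) (at x)"
      by (auto intro!: derivative_eq_intros simp: has_real_derivative_iff_has_vector_derivative[symmetric])
    from vector_diff_chain_at[OF this f(1)] show ?thesis
      by (simp add: o_def scaleR_conv_of_real)
  qed
  have "Ck n (\<lambda>x. of_real a * f' (a * x + b))"
    by (intro Ck_mult Ck_const Suc.IH f)
  from Ck_SucI[OF d this] show ?case .
qed simp

lemma csmooth_mult: "csmooth f \<Longrightarrow> csmooth g \<Longrightarrow> csmooth (\<lambda>x. f x * g x)"
  and csmooth_affine: "csmooth f \<Longrightarrow> csmooth (\<lambda>x. f (a * x + b))"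
  and csmooth_const: "csmooth (\<lambda>_. c)"
  by (auto simp: csmooth_def intro: Ck_mult Ck_affine Ck_const)

text \<open>Each order supplies its own derivative function. Uniqueness of vector derivatives
  identifies them, so a single f' is smooth to all orders.\<close>

lemma csmooth_deriv:
  assumes "csmooth f"
  obtains f' where "\<And>x. (f has_vector_derivative f' x) (at x)" "csmooth f'"
proof -
  have "Ck (Suc 0) f" using assms by (simp add: csmooth_def)
  then obtain f' where f: "\<And>x. (f has_vector_derivative f' x) (at x)" by auto
  have "Ck n f'" for n
  proof -
    have "Ck (Suc n) f" using assms unfolding csmooth_def by blast
    then obtain g where g: "\<And>x. (f has_vector_derivative g x) (at x)" "Ck n g" by auto
    have "g = f'" using f g(1) vector_derivative_unique_at by blast
    with g show ?thesis by simp
  qed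
  then show ?thesis using f that unfolding csmooth_def by blast
qed

lemma csmooth_cis: "csmooth (\<lambda>x. exp (c * of_real x))"
proof -
  have "Ck n (\<lambda>x. exp (c * of_real x))" for n
  proof (induction n)
    case (Suc n)
    have "((\<lambda>x. exp (c * of_real x)) has_vector_derivative (c * exp (c * of_real x))) (at x)" for x
      by (rule has_vector_derivative_real_field) (auto intro!: derivative_eq_intros)
    moreover have "Ck n (\<lambda>x. c * exp (c * of_real x))" by (intro Ck_mult Ck_const Suc)
    ultimately show ?case by (rule Ck_SucI)
  qed simp
  then show ?thesis by (simp add: csmooth_def)
qed

lemma csmooth_gauss: "csmooth (\<lambda>x. of_real (exp (- u * x\<^sup>2 / 2)))"
proof -
  \<comment> \<open>The polynomial factor makes the induction close: the derivative of p times the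
    Gaussian is (p' - u x p) times the Gaussian.\<close>
  have "Ck n (\<lambda>x. of_real (poly p x * exp (- u * x\<^sup>2 / 2)))" for n and p :: "real poly"
  proof (induction n arbitrary: p)
    case (Suc n)
    have "((\<lambda>x. poly p x * exp (- u * x\<^sup>2 / 2)) has_real_derivative
       poly (pderiv p - [:0,u:] * p) x * exp (- u * x\<^sup>2 / 2)) (at x)" for x
      by (auto intro!: derivative_eq_intros poly_DERIV simp: algebra_simps)
    from has_vector_derivative_of_real[OF this]
    have "\<forall>x. ((\<lambda>x. of_real (poly p x * exp (- u * x\<^sup>2 / 2)) :: complex) has_vector_derivative
       of_real (poly (pderiv p - [:0,u:] * p) x * exp (- u * x\<^sup>2 / 2))) (at x)" by blast
    then show ?case using Suc[of "pderiv p - [:0,u:] * p"] by (intro Ck_SucI) auto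
  qed simp
  from this[of _ 1] show ?thesis by (simp add: csmooth_def)
qed

text \<open>The classical function exp (-1/x) that is flat at 0, with a polynomial in 1/x in front
  so that the family is closed under differentiation.\<close>

definition flat :: "real poly \<Rightarrow> real \<Rightarrow> real" where
  "flat p x = (if x > 0 then poly p (1 / x) * exp (- 1 / x) else 0)"

lemma poly_exp_tendsto_0: "((\<lambda>y. poly p y * exp (- y)) \<longlongrightarrow> 0) at_top" for p :: "real poly"
proof -
  have "((\<lambda>y. \<Sum>i\<le>degree p. coeff p i * (y ^ i / exp y)) \<longlongrightarrow> (\<Sum>i\<le>degree p. coeff p i * 0)) at_top"
    by (intro tendsto_intros tendsto_power_div_exp_0)
  then show ?thesis by (simp add: poly_altdef exp_minus field_simps sum_distrib_left sum_divide_distrib)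
qed

text \<open>With y = 1/x the derivative for x > 0 is y^2 (p - p')(y) exp (-y). At 0 the right
  difference quotient is y p(y) exp (-y) with y tending to infinity, and the exponential beats every
  polynomial.\<close>

lemma flat_deriv:
  "(flat p has_real_derivative flat ([:0,0,1:] * (p - pderiv p)) x) (at x)"
proof -
  consider "x > 0" | "x < 0" | "x = 0" by linarith
  then show ?thesis
  proof cases
    case 1
    have "((\<lambda>x. poly p (1/x) * exp (-1/x)) has_real_derivative
        flat ([:0,0,1:] * (p - pderiv p)) x) (at x)"
      using 1 by (auto intro!: derivative_eq_intros DERIV_chain'[where g="poly p"] poly_DERIV
         simp: flat_def power2_eq_square field_simps)
    moreover have "\<forall>\<^sub>F y in nhds x. flat p y = poly p (1/y) * exp (-1/y)"
      using eventually_nhds_in_open[of "{0<..}" x] 1 by (auto elim!: eventually_mono simp: flat_def)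
    ultimately show ?thesis
      by (subst DERIV_cong_ev[OF refl _ refl])
  next
    case 2
    have "((\<lambda>x. 0) has_real_derivative flat ([:0,0,1:] * (p - pderiv p)) x) (at x)"
      using 2 by (auto simp: flat_def)
    moreover have "\<forall>\<^sub>F y in nhds x. flat p y = 0"
      using eventually_nhds_in_open[of "{..<0}" x] 2 by (auto elim!: eventually_mono simp: flat_def)
    ultimately show ?thesis
      by (subst DERIV_cong_ev[OF refl _ refl])
  next
    case 3
    have r: "((\<lambda>h. flat p h / h) \<longlongrightarrow> 0) (at_right 0)"
    proof -
      have "((\<lambda>y. poly ([:0,1:] * p) y * exp (- y)) \<longlongrightarrow> 0) at_top" by (rule poly_exp_tendsto_0)
      then have "((\<lambda>h. poly ([:0,1:] * p) (inverse h) * exp (- inverse h)) \<longlongrightarrow> 0) (at_right 0)"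
        by (subst (asm) filterlim_at_top_to_right)
      moreover have "\<forall>\<^sub>F h in at_right 0. poly ([:0,1:] * p) (inverse h) * exp (- inverse h) = flat p h / h"
        by (auto simp: eventually_at_right_less flat_def inverse_eq_divide
            intro!: eventually_mono[OF eventually_at_right_less])
      ultimately show ?thesis by (rule Lim_transform_eventually)
    qed
    have l: "((\<lambda>h. flat p h / h) \<longlongrightarrow> 0) (at_left 0)"
    proof -
      have "\<forall>\<^sub>F h in at_left 0. 0 = flat p h / h"
        using eventually_at_left_real[of "-1" 0] by (auto elim!: eventually_mono simp: flat_def)
      then show ?thesis by (rule Lim_transform_eventually[OF tendsto_const])
    qed
    have "((\<lambda>h. flat p h / h) \<longlongrightarrow> 0) (at 0)"
      using l r by (simp add: filterlim_split_at)
    then show ?thesis using 3 by (simp add: DERIV_def flat_def)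
  qed
qed

lemma Ck_flat: "Ck n (\<lambda>x. of_real (flat p x))"
proof (induction n arbitrary: p)
  case (Suc n)
  from has_vector_derivative_of_real[OF flat_deriv]
  have "\<forall>x. ((\<lambda>x. of_real (flat p x) :: complex) has_vector_derivative of_real (flat ([:0,0,1:] * (p - pderiv p)) x)) (at x)"
    by blast
  then show ?case using Suc[of "[:0,0,1:] * (p - pderiv p)"] by (intro Ck_SucI) auto
qed simp

text \<open>The factor exp 2 normalises the value at 0 to one, so that the bumps stretched by n+1
  tend to 1 pointwise and act as cutoffs.\<close>

definition bump :: "real \<Rightarrow> real" where
  "bump x = exp 2 * (flat 1 (1 + x) * flat 1 (1 - x))"

lemma csmooth_bump: "csmooth (\<lambda>x. of_real (bump x))"
proof -
  have "csmooth (\<lambda>x. of_real (flat 1 x))" by (simp add: csmooth_def Ck_flat)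
  from csmooth_affine[OF this, of 1 1] csmooth_affine[OF this, of "-1" 1]
  have "csmooth (\<lambda>x. of_real (exp 2) * (of_real (flat 1 (1 * x + 1)) * of_real (flat 1 (-1 * x + 1))))"
    by (intro csmooth_mult csmooth_const)
  then show ?thesis by (simp add: bump_def add.commute)
qed

lemma bump_0: "bump 0 = 1"
  by (simp add: bump_def flat_def flip: exp_add)

lemma bump_nonneg: "0 \<le> bump x"
  by (simp add: bump_def flat_def)

lemma bump_eq_0: "1 \<le> \<bar>x\<bar> \<Longrightarrow> bump x = 0"
  by (auto simp: bump_def flat_def)

lemma bump_pos: "\<bar>x\<bar> < 1 \<Longrightarrow> 0 < bump x"
  by (auto simp: bump_def flat_def)

lemma continuous_on_csmooth: "csmooth f \<Longrightarrow> continuous_on A f"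
  by (metis csmooth_deriv continuous_at_imp_continuous_on has_vector_derivative_continuous)

lemma bump_cont: "continuous_on A bump"
proof -
  have "continuous_on A (\<lambda>x. Re (of_real (bump x)))"
    by (intro continuous_on_Re continuous_on_csmooth csmooth_bump)
  then show ?thesis by simp
qed

lemma borel_measurable_bump[measurable]: "bump \<in> borel_measurable borel"
  by (rule borel_measurable_continuous_onI[OF bump_cont])

lemma bump_le: "bump x \<le> exp 2"
proof -
  have f: "flat 1 y \<le> 1" "0 \<le> flat 1 y" for y by (auto simp: flat_def)
  have "flat 1 (1 + x) * flat 1 (1 - x) \<le> 1 * 1" by (intro mult_mono f) auto
  then show ?thesis by (simp add: bump_def)
qed

section \<open>Tensor products of smooth factors\<close>

lemma smooth_fun_Re_prod:
  fixes f :: "'a::euclidean_space \<Rightarrow> real \<Rightarrow> complex"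
  assumes "\<And>b. b \<in> Basis \<Longrightarrow> csmooth (f b)"
  shows "smooth_fun (\<lambda>x::'a. Re (\<Prod>b\<in>Basis. f b (x \<bullet> b)))"
proof -
  define g where "g = (\<lambda>x::'a. Re (\<Prod>b\<in>Basis. f b (x \<bullet> b)))"
  \<comment> \<open>The coinduction invariant. A partial derivative in direction i replaces the
    factor i by its derivative, so real parts of tensor products form a closed class. Real parts are
    taken because products of complex exponentials then yield the cosines of the spectral
    formula.\<close>
  have "\<exists>f. g = (\<lambda>x::'a. Re (\<Prod>b\<in>Basis. f b (x \<bullet> b))) \<and> (\<forall>b\<in>Basis. csmooth (f b))"
    using assms by (auto simp: g_def)
  then have "smooth_fun g"
  proof (coinduction arbitrary: g)
    case smooth_fun
    then obtain f :: "'a \<Rightarrow> real \<Rightarrow> complex" where g: "g = (\<lambda>x::'a. Re (\<Prod>b\<in>Basis. f b (x \<bullet> b)))"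
      and f: "\<And>b. b \<in> Basis \<Longrightarrow> csmooth (f b)" by auto
    have "\<exists>f'. (\<forall>x. (f b has_vector_derivative f' x) (at x)) \<and> csmooth f'" if "b \<in> Basis" for b
      using csmooth_deriv[OF f[OF that]] by metis
    then obtain f' where f': "\<And>b x. b \<in> Basis \<Longrightarrow> (f b has_vector_derivative f' b x) (at x)"
       "\<And>b. b \<in> Basis \<Longrightarrow> csmooth (f' b)" by metis
    have fd: "((\<lambda>x::'a. f b (x \<bullet> b)) has_derivative (\<lambda>h. (h \<bullet> b) *\<^sub>R f' b (x \<bullet> b))) (at x)"
      if "b \<in> Basis" for b x
    proof -
      have "((\<lambda>x::'a. x \<bullet> b) has_derivative (\<lambda>h. h \<bullet> b)) (at x)" by (auto intro!: derivative_eq_intros)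
      from has_derivative_compose[OF this f'(1)[OF that, unfolded has_vector_derivative_def]]
      show ?thesis .
    qed
    have gd: "(g has_derivative (\<lambda>h. Re (\<Sum>i\<in>Basis. ((h \<bullet> i) *\<^sub>R f' i (x \<bullet> i)) * (\<Prod>b\<in>Basis - {i}. f b (x \<bullet> b))))) (at x)" for x
      unfolding g by (intro has_derivative_Re has_derivative_prod fd)
    have fg: "frechet_derivative g (at x) i = Re (\<Prod>b\<in>Basis. (f(i := f' i)) b (x \<bullet> b))" if i: "i \<in> Basis" for x i
    proof -
      have "frechet_derivative g (at x) i = Re (\<Sum>j\<in>Basis. ((i \<bullet> j) *\<^sub>R f' j (x \<bullet> j)) * (\<Prod>b\<in>Basis - {j}. f b (x \<bullet> b)))"
        by (simp add: frechet_derivative_at[OF gd, symmetric])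
      also have "(\<Sum>j\<in>Basis. ((i \<bullet> j) *\<^sub>R f' j (x \<bullet> j)) * (\<Prod>b\<in>Basis - {j}. f b (x \<bullet> b)))
          = (\<Sum>j\<in>Basis. if j = i then f' i (x \<bullet> i) * (\<Prod>b\<in>Basis - {i}. f b (x \<bullet> b)) else 0)"
        using i by (intro sum.cong) (auto simp: inner_Basis)
      also have "\<dots> = (\<Prod>b\<in>Basis. (f(i := f' i)) b (x \<bullet> b))"
        using i by (auto simp: prod.remove[OF finite_Basis i] intro!: prod.cong)
      finally show ?thesis .
    qed
    have "\<exists>F. (\<lambda>x. frechet_derivative g (at x) i) = (\<lambda>x. Re (\<Prod>b\<in>Basis. F b (x \<bullet> b))) \<and> (\<forall>b\<in>Basis. csmooth (F b))"
      if "i \<in> Basis" for i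
      by (rule exI[of _ "f(i := f' i)"]) (use fg[OF that] f f' that in auto)
    moreover have "\<forall>x. g differentiable (at x)" using gd differentiableI by blast
    ultimately show ?case by blast
  qed
  then show ?thesis by (simp add: g_def)
qed

lemma smooth_fun_lincomb:
  assumes "smooth_fun f" "smooth_fun g"
  shows "smooth_fun (\<lambda>x. a * f x + b * g x)"
proof -
  define h where "h = (\<lambda>x. a * f x + b * g x)"
  have "\<exists>f g. smooth_fun f \<and> smooth_fun g \<and> h = (\<lambda>x. a * f x + b * g x)" using assms h_def by auto
  then have "smooth_fun h"
  proof (coinduction arbitrary: h)
    case smooth_fun
    then obtain f g where h: "h = (\<lambda>x. a * f x + b * g x)" and f: "smooth_fun f" and g: "smooth_fun g" by auto
    have fd: "(f has_derivative frechet_derivative f (at x)) (at x)"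
      "(g has_derivative frechet_derivative g (at x)) (at x)" for x
      using f g by (auto elim: smooth_fun.cases simp: frechet_derivative_works)
    have hd: "(h has_derivative (\<lambda>v. a * frechet_derivative f (at x) v + b * frechet_derivative g (at x) v)) (at x)" for x
      unfolding h by (intro derivative_intros fd)
    have eq: "frechet_derivative h (at x) = (\<lambda>v. a * frechet_derivative f (at x) v + b * frechet_derivative g (at x) v)" for x
      using frechet_derivative_at[OF hd] by simp
    have "smooth_fun (\<lambda>x. frechet_derivative f (at x) i)" "smooth_fun (\<lambda>x. frechet_derivative g (at x) i)" if "i \<in> Basis" for i
      using f g that by (auto elim: smooth_fun.cases)
    then show ?case using hd eq differentiableI by (fastforce)
  qed
  then show ?thesis by (simp add: h_def)
qed

lemma compact_closure_box_support:
  fixes f :: "'a::euclidean_space \<Rightarrow> real"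
  assumes "\<And>x b. b \<in> Basis \<Longrightarrow> R < \<bar>x \<bullet> b\<bar> \<Longrightarrow> f x = 0"
  shows "compact (closure {x. f x \<noteq> 0})"
proof -
  have "{x. f x \<noteq> 0} \<subseteq> cbox (\<Sum>b\<in>Basis. (-R) *\<^sub>R b) (\<Sum>b\<in>Basis. R *\<^sub>R b)"
  proof
    fix x assume x: "x \<in> {x. f x \<noteq> 0}"
    have "-R \<le> x \<bullet> b \<and> x \<bullet> b \<le> R" if "b \<in> Basis" for b
      using x assms[OF that, of x] by (cases "R < \<bar>x \<bullet> b\<bar>") auto
    then show "x \<in> cbox (\<Sum>b\<in>Basis. (-R) *\<^sub>R b) (\<Sum>b\<in>Basis. R *\<^sub>R b)"
      by (auto simp: mem_box inner_sum_left inner_Basis if_distrib sum_negf cong: if_cong)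
  qed
  then have "bounded {x. f x \<noteq> 0}" using bounded_cbox bounded_subset by blast
  then show ?thesis by (simp add: compact_closure)
qed

section \<open>Heat kernel\<close>

lemma nn_integral_lborel_shift:
  fixes a :: "'a::euclidean_space"
  assumes [measurable]: "f \<in> borel_measurable borel" and c: "\<bar>c\<bar> = 1"
  shows "(\<integral>\<^sup>+x. f (a + c *\<^sub>R x) \<partial>lborel) = (\<integral>\<^sup>+x. f x \<partial>lborel)"
proof -
  have "c \<noteq> 0" using c by auto
  have "(\<integral>\<^sup>+x. f x \<partial>lborel) = (\<integral>\<^sup>+x. f x \<partial>density (distr lborel borel (\<lambda>x. a + c *\<^sub>R x)) (\<lambda>_. ennreal (\<bar>c\<bar> ^ DIM('a))))"
    using lborel_affine[OF \<open>c \<noteq> 0\<close>, of a] by simp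
  also have "\<dots> = (\<integral>\<^sup>+x. f (a + c *\<^sub>R x) \<partial>lborel)"
    by (simp add: c nn_integral_density nn_integral_distr)
  finally show ?thesis ..
qed

lemma nn_integral_lborel_minus:
  "f \<in> borel_measurable borel \<Longrightarrow> (\<integral>\<^sup>+x. f (a - x) \<partial>lborel) = (\<integral>\<^sup>+x. f x \<partial>lborel)" for a :: "'a::euclidean_space"
  using nn_integral_lborel_shift[of f "-1" a] by simp

lemma nn_integral_lborel_plus:
  "f \<in> borel_measurable borel \<Longrightarrow> (\<integral>\<^sup>+x. f (x + a) \<partial>lborel) = (\<integral>\<^sup>+x. f x \<partial>lborel)" for a :: "'a::euclidean_space"
  using nn_integral_lborel_shift[of f "1" a] by (simp add: add.commute)

lemma heat_kernel_measurable[measurable]: "heat_kernel t \<in> borel_measurable borel"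
  unfolding heat_kernel_def by measurable

lemma heat_kernel_nonneg[simp]: "0 \<le> heat_kernel t x"
  by (simp add: heat_kernel_def)

lemma heat_kernel_minus[simp]: "heat_kernel t (- x) = heat_kernel t x"
  by (simp add: heat_kernel_def)

lemma norm_sq_Basis: "(norm (x::'a::euclidean_space))\<^sup>2 = (\<Sum>b\<in>Basis. (x \<bullet> b)\<^sup>2)"
  unfolding power2_norm_eq_inner by (subst euclidean_inner) (simp only: power2_eq_square)

lemma heat_kernel_prod:
  fixes x :: "'a::euclidean_space"
  assumes "0 < t"
  shows "heat_kernel t x = (\<Prod>b\<in>Basis. normal_density 0 (sqrt t) (x \<bullet> b))"
proof -
  have "(2 * pi * t) powr (- real DIM('a) / 2) = (1 / sqrt (2 * pi * t)) ^ DIM('a)"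
  proof -
    have "(1 / sqrt (2 * pi * t)) = (2 * pi * t) powr (- 1/2)"
      using assms by (simp add: powr_minus powr_half_sqrt inverse_eq_divide)
    then have "(1 / sqrt (2 * pi * t)) ^ DIM('a) = ((2 * pi * t) powr (- 1/2)) powr (real DIM('a))"
      using assms by (simp add: powr_realpow)
    then show ?thesis by (simp add: powr_powr)
  qed
  moreover have "exp (- (norm x)\<^sup>2 / (2 * t)) = (\<Prod>b\<in>Basis. exp (- (x \<bullet> b)\<^sup>2 / (2 * t)))"
    by (simp add: norm_sq_Basis exp_sum[symmetric] sum_divide_distrib sum_negf)
  ultimately show ?thesis
    using assms by (simp add: heat_kernel_def normal_density_def prod_dividef prod.distrib power_one_over)
qed

lemma heat_kernel_semigroup:
  fixes x :: "'a::euclidean_space"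
  assumes "0 < s" "0 < t"
  shows "(\<integral>\<^sup>+y. ennreal (heat_kernel s (x - y) * heat_kernel t y) \<partial>lborel) = ennreal (heat_kernel (s + t) x)"
proof -
  have "(\<integral>\<^sup>+y. ennreal (heat_kernel s (x - y) * heat_kernel t y) \<partial>lborel)
     = (\<integral>\<^sup>+y. (\<Prod>b\<in>Basis. ennreal (normal_density 0 (sqrt s) (x \<bullet> b - y \<bullet> b) * normal_density 0 (sqrt t) (y \<bullet> b))) \<partial>lborel)"
    using assms by (intro nn_integral_cong) (simp add: heat_kernel_prod prod.distrib[symmetric] inner_diff_left prod_ennreal)
  also have "\<dots> = (\<Prod>b\<in>Basis. \<integral>\<^sup>+y. ennreal (normal_density 0 (sqrt s) (x \<bullet> b - y) * normal_density 0 (sqrt t) y) \<partial>lborel)"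
    by (intro nn_integral_lborel_prod) auto
  also have "\<dots> = (\<Prod>b\<in>Basis. ennreal (normal_density 0 (sqrt (s + t)) (x \<bullet> b)))"
  proof (intro prod.cong refl)
    fix b :: 'a
    show "(\<integral>\<^sup>+y. ennreal (normal_density 0 (sqrt s) (x \<bullet> b - y) * normal_density 0 (sqrt t) y) \<partial>lborel) = ennreal (normal_density 0 (sqrt (s + t)) (x \<bullet> b))"
      using fun_cong[OF conv_normal_density_zero_mean[of "sqrt s" "sqrt t"], of "x \<bullet> b"] assms by simp
  qed
  also have "\<dots> = ennreal (heat_kernel (s + t) x)"
    using assms by (simp add: heat_kernel_prod prod_ennreal)
  finally show ?thesis .
qed

text \<open>Valued in \<open>ennreal\<close>, so that the semigroup law and Tonelli are available
  before the convolution is known to be finite.\<close>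

definition heat_conv :: "('a::euclidean_space \<Rightarrow> real) \<Rightarrow> real \<Rightarrow> 'a \<Rightarrow> ennreal" where
  "heat_conv L u z = (\<integral>\<^sup>+w. ennreal (L w * heat_kernel u (z - w)) \<partial>lborel)"

lemma heat_conv_measurable[measurable]:
  assumes [measurable]: "L \<in> borel_measurable borel"
  shows "heat_conv L u \<in> borel_measurable borel"
  unfolding heat_conv_def by measurable

lemma heat_conv_semigroup:
  fixes L :: "'a::euclidean_space \<Rightarrow> real"
  assumes [measurable]: "L \<in> borel_measurable borel" and L: "\<And>x. 0 \<le> L x" and st: "0 < s" "0 < t"
  shows "(\<integral>\<^sup>+y. heat_conv L s (z + y) * ennreal (heat_kernel t y) \<partial>lborel) = heat_conv L (s + t) z"
proof -
  have "(\<integral>\<^sup>+y. heat_conv L s (z + y) * ennreal (heat_kernel t y) \<partial>lborel)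
     = (\<integral>\<^sup>+y. \<integral>\<^sup>+w. ennreal (L w * heat_kernel s (z + y - w)) * ennreal (heat_kernel t y) \<partial>lborel \<partial>lborel)"
    unfolding heat_conv_def by (intro nn_integral_cong nn_integral_multc[symmetric]) measurable
  also have "\<dots> = (\<integral>\<^sup>+w. \<integral>\<^sup>+y. ennreal (L w * heat_kernel s (z + y - w)) * ennreal (heat_kernel t y) \<partial>lborel \<partial>lborel)"
    by (intro lborel_pair.Fubini') measurable
  also have "\<dots> = (\<integral>\<^sup>+w. ennreal (L w * heat_kernel (s + t) (z - w)) \<partial>lborel)"
  proof (rule nn_integral_cong)
    fix w
    have "(\<integral>\<^sup>+y. ennreal (L w * heat_kernel s (z + y - w)) * ennreal (heat_kernel t y) \<partial>lborel)
       = (\<integral>\<^sup>+y. ennreal (L w) * ennreal (heat_kernel s (z + y - w) * heat_kernel t y) \<partial>lborel)"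
      using L[of w] by (intro nn_integral_cong) (simp add: ennreal_mult mult_ac)
    also have "\<dots> = ennreal (L w) * (\<integral>\<^sup>+y. ennreal (heat_kernel s ((z - w) + y) * heat_kernel t y) \<partial>lborel)"
      by (subst nn_integral_cmult) (auto simp: algebra_simps)
    also have "(\<integral>\<^sup>+y. ennreal (heat_kernel s ((z - w) + y) * heat_kernel t y) \<partial>lborel)
      = (\<integral>\<^sup>+y. ennreal (heat_kernel s ((z - w) - y) * heat_kernel t y) \<partial>lborel)"
      using nn_integral_lborel_minus[of "\<lambda>y. ennreal (heat_kernel s ((z - w) + y) * heat_kernel t y)" 0] by simp
    finally show "(\<integral>\<^sup>+y. ennreal (L w * heat_kernel s (z + y - w)) * ennreal (heat_kernel t y) \<partial>lborel)
       = ennreal (L w * heat_kernel (s + t) (z - w))"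
      using L[of w] heat_kernel_semigroup[OF st, of "z - w"] by (simp add: ennreal_mult'')
  qed
  finally show ?thesis unfolding heat_conv_def .
qed

text \<open>This is the covariance of two mollified point masses at a and b. Each mollification
  contributes e, hence the smoothing parameter 2 e here and \<open>2 * \<epsilon>\<close> in
  \<open>mol_cov\<close>.\<close>

lemma heat_conv_double:
  fixes L :: "'a::euclidean_space \<Rightarrow> real"
  assumes [measurable]: "L \<in> borel_measurable borel" and L: "\<And>x. 0 \<le> L x" and e: "0 < e"
  shows "(\<integral>\<^sup>+y. \<integral>\<^sup>+y'. ennreal (heat_kernel e (a - y) * heat_kernel e (b - y') * L (y - y')) \<partial>lborel \<partial>lborel) = heat_conv L (2 * e) (a - b)"
proof -
  have "(\<integral>\<^sup>+y. \<integral>\<^sup>+y'. ennreal (heat_kernel e (a - y) * heat_kernel e (b - y') * L (y - y')) \<partial>lborel \<partial>lborel)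
    = (\<integral>\<^sup>+y'. \<integral>\<^sup>+y. ennreal (heat_kernel e (a - y) * heat_kernel e (b - y') * L (y - y')) \<partial>lborel \<partial>lborel)"
    by (intro lborel_pair.Fubini') measurable
  also have "\<dots> = (\<integral>\<^sup>+y'. \<integral>\<^sup>+w. ennreal (heat_kernel e (a - (w + y')) * heat_kernel e (b - y') * L w) \<partial>lborel \<partial>lborel)"
  proof (rule nn_integral_cong)
    fix y'
    show "(\<integral>\<^sup>+y. ennreal (heat_kernel e (a - y) * heat_kernel e (b - y') * L (y - y')) \<partial>lborel) =
       (\<integral>\<^sup>+w. ennreal (heat_kernel e (a - (w + y')) * heat_kernel e (b - y') * L w) \<partial>lborel)"
      using nn_integral_lborel_plus[of "\<lambda>y. ennreal (heat_kernel e (a - y) * heat_kernel e (b - y') * L (y - y'))" y'] by simp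
  qed
  also have "\<dots> = (\<integral>\<^sup>+w. \<integral>\<^sup>+y'. ennreal (heat_kernel e (a - (w + y')) * heat_kernel e (b - y') * L w) \<partial>lborel \<partial>lborel)"
    by (intro lborel_pair.Fubini') measurable
  also have "\<dots> = (\<integral>\<^sup>+w. ennreal (L w * heat_kernel (2 * e) (a - b - w)) \<partial>lborel)"
  proof (rule nn_integral_cong)
    fix w
    have "(\<integral>\<^sup>+y'. ennreal (heat_kernel e (a - (w + y')) * heat_kernel e (b - y') * L w) \<partial>lborel)
       = (\<integral>\<^sup>+y. ennreal (heat_kernel e (a - (w + (b - y))) * heat_kernel e y * L w) \<partial>lborel)"
      using nn_integral_lborel_minus[of "\<lambda>y'. ennreal (heat_kernel e (a - (w + y')) * heat_kernel e (b - y') * L w)" b] by simp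
    also have "\<dots> = (\<integral>\<^sup>+y. ennreal (L w) * ennreal (heat_kernel e ((w + b - a) - y) * heat_kernel e y) \<partial>lborel)"
    proof (rule nn_integral_cong)
      fix y
      have "a - (w + (b - y)) = - ((w + b - a) - y)" by (simp add: algebra_simps)
      then have "heat_kernel e (a - (w + (b - y))) = heat_kernel e ((w + b - a) - y)" by (metis heat_kernel_minus)
      then show "ennreal (heat_kernel e (a - (w + (b - y))) * heat_kernel e y * L w) = ennreal (L w) * ennreal (heat_kernel e ((w + b - a) - y) * heat_kernel e y)"
        using L[of w] by (simp add: ennreal_mult mult_ac)
    qed
    also have "\<dots> = ennreal (L w) * ennreal (heat_kernel (2 * e) (w + b - a))"
      using e heat_kernel_semigroup[of e e "w + b - a"] by (subst nn_integral_cmult) auto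
    also have "heat_kernel (2 * e) (w + b - a) = heat_kernel (2 * e) (a - b - w)"
    proof -
      have "w + b - a = - (a - b - w)" by (simp add: algebra_simps)
      then show ?thesis by (metis heat_kernel_minus)
    qed
    finally show "(\<integral>\<^sup>+y'. ennreal (heat_kernel e (a - (w + y')) * heat_kernel e (b - y') * L w) \<partial>lborel) =
       ennreal (L w * heat_kernel (2 * e) (a - b - w))" using L[of w] by (simp add: ennreal_mult)
  qed
  finally show ?thesis unfolding heat_conv_def .
qed

lemma integral_lborel_prod:
  fixes f :: "'a::euclidean_space \<Rightarrow> real \<Rightarrow> complex"
  assumes f: "\<And>b. b \<in> Basis \<Longrightarrow> integrable lborel (f b)"
  shows "integrable lborel (\<lambda>x::'a. \<Prod>b\<in>Basis. f b (x \<bullet> b))"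
    and "integral\<^sup>L lborel (\<lambda>x::'a. \<Prod>b\<in>Basis. f b (x \<bullet> b)) = (\<Prod>b\<in>Basis. integral\<^sup>L lborel (f b))"
proof -
  interpret product_sigma_finite "\<lambda>_::'a. lborel :: real measure" ..
  have [measurable]: "f b \<in> borel_measurable borel" if "b \<in> Basis" for b using f[OF that] by (simp add: borel_measurable_integrable)
  have m: "(\<lambda>x::'a. \<Prod>b\<in>Basis. f b (x \<bullet> b)) \<in> borel_measurable borel" by measurable
  have T: "(\<lambda>f. \<Sum>b\<in>Basis. f b *\<^sub>R b) \<in> (\<Pi>\<^sub>M b\<in>(Basis::'a set). lborel) \<rightarrow>\<^sub>M borel" by measurable
  have e: "(\<Prod>b\<in>Basis. f b ((\<Sum>i\<in>Basis. g i *\<^sub>R i) \<bullet> b)) = (\<Prod>b\<in>Basis. f b (g b))" for g :: "'a \<Rightarrow> real"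
    by (intro prod.cong refl) (simp add: inner_sum_left inner_Basis if_distrib cong: if_cong)
  show "integrable lborel (\<lambda>x::'a. \<Prod>b\<in>Basis. f b (x \<bullet> b))"
    by (subst lborel_eq, subst integrable_distr_eq[OF T m]) (simp add: e product_integrable_prod f)
  show "integral\<^sup>L lborel (\<lambda>x::'a. \<Prod>b\<in>Basis. f b (x \<bullet> b)) = (\<Prod>b\<in>Basis. integral\<^sup>L lborel (f b))"
    by (subst lborel_eq, subst integral_distr[OF T m]) (simp add: e product_integral_prod f)
qed

section \<open>An integrable weight with quadratic decay in each coordinate\<close>

lemma integrable_inverse_1_plus_sq: "integrable lborel (\<lambda>x::real. 1 / (1 + x\<^sup>2))"
  using integrable_inverse_1_plus_square by (simp add: interval_lebesgue_integrable_def set_integrable_def einterval_def inverse_eq_divide)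

text \<open>The decay is fast enough for integrability and slow enough to dominate the Fourier
  transforms of cut-off Gaussians uniformly in the cutoff. It is the dominating weight in the
  passage to the spectral formula.\<close>

definition qweight :: "'a::euclidean_space \<Rightarrow> real" where
  "qweight x = (\<Prod>b\<in>Basis. 1 / (1 + (x \<bullet> b)\<^sup>2))"

lemma qweight_pos: "0 < qweight x"
  unfolding qweight_def by (intro prod_pos) (auto intro!: divide_pos_pos add_pos_nonneg)

lemma qweight_measurable[measurable]: "qweight \<in> borel_measurable borel"
  unfolding qweight_def by measurable

lemma nn_integral_qweight: "(\<integral>\<^sup>+x. ennreal (qweight (x::'a::euclidean_space)) \<partial>lborel) < \<infinity>"
proof -
  have "(\<integral>\<^sup>+x. ennreal (qweight (x::'a)) \<partial>lborel) = (\<integral>\<^sup>+x. (\<Prod>b\<in>Basis. ennreal (1 / (1 + ((x::'a) \<bullet> b)\<^sup>2))) \<partial>lborel)"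
    unfolding qweight_def by (intro nn_integral_cong) (simp add: prod_ennreal)
  also have "\<dots> = (\<Prod>b\<in>(Basis::'a set). \<integral>\<^sup>+x. ennreal (1 / (1 + x\<^sup>2)) \<partial>lborel)" by (intro nn_integral_lborel_prod) auto
  also have "\<dots> = ennreal (integral\<^sup>L lborel (\<lambda>x::real. 1 / (1 + x\<^sup>2))) ^ DIM('a)"
    by (simp add: nn_integral_eq_integral integrable_inverse_1_plus_sq)
  also have "\<dots> < \<infinity>" by (simp add: ennreal_power integral_nonneg_AE)
  finally show ?thesis .
qed

text \<open>In each coordinate 1 + (y + w)^2 \<le> 9 + 2 y^2 \<le> 10 (1 + y^2) when |w| \<le> 2.
  The 2 is the largest coordinate of a difference of two points of the box [-1,1]^d that carries
  \<open>bump_at 0\<close>.\<close>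

lemma qweight_shift:
  assumes "\<And>b. b \<in> Basis \<Longrightarrow> \<bar>v \<bullet> b\<bar> \<le> 2"
  shows "(1/10) ^ DIM('a) * qweight x \<le> qweight (x + v :: 'a::euclidean_space)"
proof -
  have "(1/10) ^ DIM('a) * qweight x = (\<Prod>b\<in>Basis. 1 / 10 * (1 / (1 + (x \<bullet> b)\<^sup>2)))"
    by (simp only: qweight_def prod.distrib prod_constant)
  also have "\<dots> \<le> qweight (x + v)" unfolding qweight_def
  proof (intro prod_mono conjI)
    fix b :: 'a assume b: "b \<in> Basis"
    define y w where "y = x \<bullet> b" and "w = v \<bullet> b"
    have w: "w\<^sup>2 \<le> 4" using assms[OF b] abs_le_square_iff[of w 2] by (simp add: w_def)
    have aux: "p \<le> 2 * q + 2 * r \<Longrightarrow> r \<le> 4 \<Longrightarrow> 0 \<le> q \<Longrightarrow> 1 + p \<le> 10 * (1 + q)" for p q r :: real by simp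
    have "0 \<le> (y - w)\<^sup>2" by simp
    then have "(y + w)\<^sup>2 \<le> 2 * y\<^sup>2 + 2 * w\<^sup>2" by (simp add: power2_sum power2_diff)
    then have "1 + (y + w)\<^sup>2 \<le> 10 * (1 + y\<^sup>2)" using w zero_le_power2[of y] aux by blast
    moreover have "0 < 1 + (y + w)\<^sup>2" "0 < 1 + y\<^sup>2" by (auto intro!: add_pos_nonneg)
    ultimately show "1 / 10 * (1 / (1 + (x \<bullet> b)\<^sup>2)) \<le> 1 / (1 + ((x + v) \<bullet> b)\<^sup>2)"
      unfolding inner_add_left y_def[symmetric] w_def[symmetric] by (simp add: field_simps)
  qed (auto intro!: divide_nonneg_nonneg add_nonneg_nonneg)
  finally show ?thesis .
qed

text \<open>An instance of Peetre's inequality: recentring the weight costs a factor that depends on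
  the shift only.\<close>

lemma inverse_1_plus_sq_diff: "1 / (1 + (a - b)\<^sup>2) \<le> 2 * (1 + a\<^sup>2) * (1 / (1 + b\<^sup>2))" for a b :: real
proof -
  have "0 \<le> (2 * a - b)\<^sup>2" by simp
  then have "b\<^sup>2 \<le> 2 * a\<^sup>2 + 2 * (a - b)\<^sup>2" by (simp add: power2_diff power_mult_distrib)
  moreover have "0 \<le> a\<^sup>2 * (a - b)\<^sup>2" by simp
  ultimately have "1 + b\<^sup>2 \<le> 2 * (1 + a\<^sup>2) * (1 + (a - b)\<^sup>2)"
    using zero_le_power2[of a] zero_le_power2[of "a - b"] by (simp only: distrib_left distrib_right mult_1_left mult_1_right mult.assoc)
  moreover have "0 < 1 + b\<^sup>2" "0 < 1 + (a - b)\<^sup>2" by (auto intro!: add_pos_nonneg)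
  ultimately show ?thesis by (simp add: field_simps)
qed

text \<open>The inequality 1 + v \<le> exp v turns Gaussian decay into quadratic decay in each
  coordinate, and Peetre's inequality moves the centre from z to 0.\<close>

lemma heat_kernel_le_qweight:
  assumes "0 < u" shows "\<exists>C\<ge>0. \<forall>w::'a::euclidean_space. heat_kernel u (z - w) \<le> C * qweight w"
proof -
  have g: "\<exists>c\<ge>0. \<forall>y::real. normal_density 0 (sqrt u) y \<le> c / (1 + y\<^sup>2)"
  proof (intro exI[of _ "1 / sqrt (2 * pi * u) * (1 + 2 * u)"] conjI allI)
    fix y :: real
    have "1 + y\<^sup>2 / (2 * u) \<le> exp (y\<^sup>2 / (2 * u))" by (rule exp_ge_add_one_self)
    then have "1 + y\<^sup>2 \<le> (1 + 2 * u) * exp (y\<^sup>2 / (2 * u))"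
    proof -
      assume a: "1 + y\<^sup>2 / (2 * u) \<le> exp (y\<^sup>2 / (2 * u))"
      have "1 + y\<^sup>2 \<le> (1 + 2 * u) * (1 + y\<^sup>2 / (2 * u))" using assms by (simp add: field_simps)
      also have "\<dots> \<le> (1 + 2 * u) * exp (y\<^sup>2 / (2 * u))" using a assms by (intro mult_left_mono) auto
      finally show ?thesis .
    qed
    then have "exp (- (y\<^sup>2 / (2 * u))) \<le> (1 + 2 * u) / (1 + y\<^sup>2)"
      by (simp add: exp_minus field_simps add_pos_nonneg)
    then have "1 / sqrt (2 * pi * u) * exp (- (y\<^sup>2 / (2 * u))) \<le> 1 / sqrt (2 * pi * u) * ((1 + 2 * u) / (1 + y\<^sup>2))"
      using assms by (intro mult_left_mono) auto
    then show "normal_density 0 (sqrt u) y \<le> 1 / sqrt (2 * pi * u) * (1 + 2 * u) / (1 + y\<^sup>2)"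
      using assms by (simp add: normal_density_def)
  qed (use assms in auto)
  then obtain c where c: "0 \<le> c" "\<And>y. normal_density 0 (sqrt u) y \<le> c / (1 + y\<^sup>2)" by auto
  show ?thesis
  proof (intro exI[of _ "\<Prod>b\<in>Basis. c * (2 * (1 + (z \<bullet> b)\<^sup>2))"] conjI allI)
    show "0 \<le> (\<Prod>b\<in>Basis. c * (2 * (1 + (z \<bullet> b)\<^sup>2)))" using c by (intro prod_nonneg) auto
    fix w :: 'a
    have "heat_kernel u (z - w) = (\<Prod>b\<in>Basis. normal_density 0 (sqrt u) (z \<bullet> b - w \<bullet> b))"
      using assms by (simp add: heat_kernel_prod inner_diff_left)
    also have "\<dots> \<le> (\<Prod>b\<in>Basis. c * (2 * (1 + (z \<bullet> b)\<^sup>2)) * (1 / (1 + (w \<bullet> b)\<^sup>2)))"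
    proof (intro prod_mono conjI)
      fix b :: 'a
      have "normal_density 0 (sqrt u) (z \<bullet> b - w \<bullet> b) \<le> c * (1 / (1 + (z \<bullet> b - w \<bullet> b)\<^sup>2))" using c(2) by simp
      also have "\<dots> \<le> c * (2 * (1 + (z \<bullet> b)\<^sup>2) * (1 / (1 + (w \<bullet> b)\<^sup>2)))" by (intro mult_left_mono inverse_1_plus_sq_diff c)
      finally show "normal_density 0 (sqrt u) (z \<bullet> b - w \<bullet> b) \<le> c * (2 * (1 + (z \<bullet> b)\<^sup>2)) * (1 / (1 + (w \<bullet> b)\<^sup>2))" by (simp add: mult_ac)
    qed auto
    also have "\<dots> = (\<Prod>b\<in>Basis. c * (2 * (1 + (z \<bullet> b)\<^sup>2))) * qweight w" by (simp only: qweight_def prod.distrib)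
    finally show "heat_kernel u (z - w) \<le> (\<Prod>b\<in>Basis. c * (2 * (1 + (z \<bullet> b)\<^sup>2))) * qweight w" .
  qed
qed

section \<open>Limits of centred Gaussian variables\<close>

text \<open>The moment of order 2k of the standard normal law.\<close>

definition gauss_moment :: "nat \<Rightarrow> real" where
  "gauss_moment k = fact (2 * k) / (2 ^ k * fact k)"

lemma gauss_moment_pos: "0 < gauss_moment k" by (simp add: gauss_moment_def)

text \<open>A characteristic function has modulus at most one, which at \<theta> = 1 forces the sign
  of s; later this gives nonnegativity of variance integrals whose integrand has no sign. Levy's
  uniqueness theorem identifies the law.\<close>

lemma gaussian_char_distr:
  assumes P: "prob_space P" and X[measurable]: "X \<in> borel_measurable P"
    and ch: "\<And>\<theta>. char (distr P borel X) \<theta> = exp (- complex_of_real (s * \<theta>\<^sup>2 / 2))"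
  shows "0 \<le> s" and "distr P borel X = distr std_normal_distribution borel (\<lambda>x. sqrt s * x)"
proof -
  interpret P: prob_space P by (rule P)
  interpret D: real_distribution "distr P borel X" by (rule P.real_distribution_distr) (rule X)
  have "norm (char (distr P borel X) 1) \<le> 1" by (rule D.cmod_char_le_1)
  then show s: "0 \<le> s" by (simp add: ch exp_of_real[symmetric] norm_exp_eq_Re)
  interpret N: prob_space std_normal_distribution by (rule prob_space_normal_density) simp
  show "distr P borel X = distr std_normal_distribution borel (\<lambda>x. sqrt s * x)"
  proof (rule Levy_uniqueness)
    show "real_distribution (distr P borel X)" by (rule D.real_distribution_axioms)
    show "real_distribution (distr std_normal_distribution borel (\<lambda>x. sqrt s * x))"
      by (rule N.real_distribution_distr) simp
    show "char (distr P borel X) = char (distr std_normal_distribution borel (\<lambda>x. sqrt s * x))"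
    proof
      fix \<theta>
      have "char (distr std_normal_distribution borel (\<lambda>x. sqrt s * x)) \<theta> = char std_normal_distribution (\<theta> * sqrt s)"
        unfolding char_def by (subst integral_distr) (auto simp: mult.assoc)
      also have "\<dots> = complex_of_real (exp (- (s * \<theta>\<^sup>2) / 2))"
        using s by (simp add: char_std_normal_distribution power_mult_distrib mult.commute)
      also have "\<dots> = exp (- complex_of_real (s * \<theta>\<^sup>2 / 2))"
        by (simp only: exp_of_real[symmetric]) simp
      finally show "char (distr P borel X) \<theta> = char (distr std_normal_distribution borel (\<lambda>x. sqrt s * x)) \<theta>"
        by (simp add: ch)
    qed
  qed
qed

lemma gaussian_nn_integral:
  assumes P: "prob_space P" and X[measurable]: "X \<in> borel_measurable P"
    and ch: "\<And>\<theta>. char (distr P borel X) \<theta> = exp (- complex_of_real (s * \<theta>\<^sup>2 / 2))"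
    and f[measurable]: "f \<in> borel_measurable borel"
  shows "(\<integral>\<^sup>+\<omega>. f (X \<omega>) \<partial>P) = (\<integral>\<^sup>+x. ennreal (std_normal_density x) * f (sqrt s * x) \<partial>lborel)"
proof -
  have "(\<integral>\<^sup>+\<omega>. f (X \<omega>) \<partial>P) = (\<integral>\<^sup>+x. f x \<partial>(distr P borel X))" by (simp add: nn_integral_distr)
  also have "\<dots> = (\<integral>\<^sup>+x. f (sqrt s * x) \<partial>std_normal_distribution)"
    unfolding gaussian_char_distr(2)[OF P X ch] by (subst nn_integral_distr) auto
  also have "\<dots> = (\<integral>\<^sup>+x. ennreal (std_normal_density x) * f (sqrt s * x) \<partial>lborel)"
    by (subst nn_integral_density) auto
  finally show ?thesis .
qed

lemma gaussian_moment_even: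
  assumes P: "prob_space P" and X[measurable]: "X \<in> borel_measurable P"
    and ch: "\<And>\<theta>. char (distr P borel X) \<theta> = exp (- complex_of_real (s * \<theta>\<^sup>2 / 2))"
  shows "(\<integral>\<^sup>+\<omega>. ennreal (X \<omega> ^ (2 * k)) \<partial>P) = ennreal (gauss_moment k * s ^ k)"
proof -
  have s: "0 \<le> s" by (rule gaussian_char_distr(1)[OF P X ch])
  have "(\<integral>\<^sup>+\<omega>. ennreal (X \<omega> ^ (2 * k)) \<partial>P) = (\<integral>\<^sup>+x. ennreal (std_normal_density x) * ennreal ((sqrt s * x) ^ (2 * k)) \<partial>lborel)"
    by (rule gaussian_nn_integral[OF P X ch]) measurable
  also have "\<dots> = (\<integral>\<^sup>+x. ennreal (s ^ k) * ennreal (std_normal_density x * x ^ (2 * k)) \<partial>lborel)"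
  proof -
    have "(sqrt s * x) ^ (2 * k) = s ^ k * x ^ (2 * k)" for x
      using s by (simp add: power_mult_distrib power_mult)
    then show ?thesis using s by (intro nn_integral_cong) (simp add: ennreal_mult'[symmetric] mult_ac)
  qed
  also have "\<dots> = ennreal (s ^ k) * ennreal (gauss_moment k)"
    using std_normal_moment_even[of k]
    by (simp add: nn_integral_cmult gauss_moment_def nn_integral_eq_integral has_bochner_integral_iff)
  also have "\<dots> = ennreal (gauss_moment k * s ^ k)"
    using s gauss_moment_pos[of k] by (simp add: ennreal_mult[symmetric] mult.commute)
  finally show ?thesis .
qed

lemma gaussian_exp_moment:
  assumes P: "prob_space P" and X[measurable]: "X \<in> borel_measurable P"
    and ch: "\<And>\<theta>. char (distr P borel X) \<theta> = exp (- complex_of_real (s * \<theta>\<^sup>2 / 2))"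
  shows "(\<integral>\<^sup>+\<omega>. ennreal (exp (a * X \<omega>)) \<partial>P) = ennreal (exp (a\<^sup>2 * s / 2))"
proof -
  have s: "0 \<le> s" by (rule gaussian_char_distr(1)[OF P X ch])
  define c where "c = a * sqrt s"
  have "(\<integral>\<^sup>+\<omega>. ennreal (exp (a * X \<omega>)) \<partial>P) = (\<integral>\<^sup>+x. ennreal (std_normal_density x) * ennreal (exp (a * (sqrt s * x))) \<partial>lborel)"
    by (rule gaussian_nn_integral[OF P X ch]) measurable
  also have "\<dots> = (\<integral>\<^sup>+x. ennreal (exp (c\<^sup>2 / 2)) * ennreal (normal_density c 1 x) \<partial>lborel)"
  proof (intro nn_integral_cong)
    fix x :: real
    have "- x\<^sup>2 / 2 + c * x = c\<^sup>2 / 2 + - (x - c)\<^sup>2 / 2" by (simp add: power2_diff field_simps)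
    then have "exp (- x\<^sup>2 / 2) * exp (c * x) = exp (c\<^sup>2 / 2) * exp (- (x - c)\<^sup>2 / 2)" by (simp flip: exp_add)
    then show "ennreal (std_normal_density x) * ennreal (exp (a * (sqrt s * x))) = ennreal (exp (c\<^sup>2 / 2)) * ennreal (normal_density c 1 x)"
      by (simp add: ennreal_mult[symmetric] std_normal_density_def normal_density_def c_def mult.assoc)
  qed
  also have "\<dots> = ennreal (exp (c\<^sup>2 / 2))" by (simp add: nn_integral_cmult nn_integral_eq_integral)
  finally show ?thesis using s by (simp add: c_def power_mult_distrib)
qed

lemma L2_conv_imp_AE_subseq:
  fixes X :: "real \<Rightarrow> 'w \<Rightarrow> real"
  assumes X[measurable]: "\<And>e. 0 < e \<Longrightarrow> X e \<in> borel_measurable P" and V[measurable]: "V \<in> borel_measurable P"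
    and lim: "((\<lambda>e. \<integral>\<^sup>+\<omega>. ennreal ((X e \<omega> - V \<omega>)\<^sup>2) \<partial>P) \<longlongrightarrow> 0) (at_right 0)"
  obtains e :: "nat \<Rightarrow> real" where "\<And>n. 0 < e n" "AE \<omega> in P. (\<lambda>n. X (e n) \<omega>) \<longlonglongrightarrow> V \<omega>"
    "\<And>n. (\<integral>\<^sup>+\<omega>. ennreal ((X (e n) \<omega> - V \<omega>)\<^sup>2) \<partial>P) \<le> ennreal ((1/2) ^ n)"
proof -
  have "\<exists>e>0. (\<integral>\<^sup>+\<omega>. ennreal ((X e \<omega> - V \<omega>)\<^sup>2) \<partial>P) \<le> ennreal ((1/2) ^ n)" for n
  proof -
    have "\<forall>\<^sub>F e in at_right 0. (\<integral>\<^sup>+\<omega>. ennreal ((X e \<omega> - V \<omega>)\<^sup>2) \<partial>P) < ennreal ((1/2) ^ n)"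
      by (rule order_tendstoD(2)[OF lim]) simp
    then have "\<forall>\<^sub>F e in at_right 0. 0 < e \<and> (\<integral>\<^sup>+\<omega>. ennreal ((X e \<omega> - V \<omega>)\<^sup>2) \<partial>P) < ennreal ((1/2) ^ n)"
      using eventually_at_right_less by (rule eventually_conj[rotated])
    from eventually_happens'[OF _ this] show ?thesis by (auto intro: less_imp_le)
  qed
  then obtain e where e: "\<And>n. 0 < e n" "\<And>n. (\<integral>\<^sup>+\<omega>. ennreal ((X (e n) \<omega> - V \<omega>)\<^sup>2) \<partial>P) \<le> ennreal ((1/2) ^ n)" by metis
  have [measurable]: "X (e n) \<in> borel_measurable P" for n using X[OF e(1)] .
  have "(\<integral>\<^sup>+\<omega>. (\<Sum>n. ennreal ((X (e n) \<omega> - V \<omega>)\<^sup>2)) \<partial>P) = (\<Sum>n. \<integral>\<^sup>+\<omega>. ennreal ((X (e n) \<omega> - V \<omega>)\<^sup>2) \<partial>P)"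
    by (intro nn_integral_suminf) measurable
  also have "\<dots> \<le> (\<Sum>n. ennreal ((1/2) ^ n))" by (intro suminf_le e summableI)
  also have "\<dots> < \<infinity>" by (subst suminf_ennreal2) (auto intro: summable_geometric)
  finally have "(\<integral>\<^sup>+\<omega>. (\<Sum>n. ennreal ((X (e n) \<omega> - V \<omega>)\<^sup>2)) \<partial>P) \<noteq> \<infinity>" by simp
  then have "AE \<omega> in P. (\<Sum>n. ennreal ((X (e n) \<omega> - V \<omega>)\<^sup>2)) \<noteq> \<infinity>"
    by (intro nn_integral_PInf_AE) measurable
  then have "AE \<omega> in P. (\<lambda>n. X (e n) \<omega>) \<longlonglongrightarrow> V \<omega>"
  proof eventually_elim
    fix \<omega> assume "(\<Sum>n. ennreal ((X (e n) \<omega> - V \<omega>)\<^sup>2)) \<noteq> \<infinity>"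
    then have "summable (\<lambda>n. (X (e n) \<omega> - V \<omega>)\<^sup>2)" by (intro summable_suminf_not_top) auto
    then have "(\<lambda>n. (X (e n) \<omega> - V \<omega>)\<^sup>2) \<longlonglongrightarrow> 0" by (rule summable_LIMSEQ_zero)
    then have "(\<lambda>n. X (e n) \<omega> - V \<omega>) \<longlonglongrightarrow> 0" by (simp add: tendsto_null_power)
    then show "(\<lambda>n. X (e n) \<omega>) \<longlonglongrightarrow> V \<omega>" by (simp add: LIM_zero_iff)
  qed
  with e show ?thesis using that by blast
qed

text \<open>One-sided bounds up to a factor 2 avoid identifying the law of the limit.\<close>
lemma gaussian_L2_limit:
  fixes X :: "real \<Rightarrow> 'w \<Rightarrow> real"
  assumes P: "prob_space P"
    and X[measurable]: "\<And>e. 0 < e \<Longrightarrow> X e \<in> borel_measurable P" and V[measurable]: "V \<in> borel_measurable P"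
    and ch: "\<And>e \<theta>. 0 < e \<Longrightarrow> char (distr P borel (X e)) \<theta> = exp (- complex_of_real (s e * \<theta>\<^sup>2 / 2))"
    and lim: "((\<lambda>e. \<integral>\<^sup>+\<omega>. ennreal ((X e \<omega> - V \<omega>)\<^sup>2) \<partial>P) \<longlongrightarrow> 0) (at_right 0)"
  defines "m \<equiv> \<integral>\<^sup>+\<omega>. ennreal ((V \<omega>)\<^sup>2) \<partial>P"
  shows "m < \<infinity>"
    and "(\<integral>\<^sup>+\<omega>. ennreal (V \<omega> ^ (2 * k)) \<partial>P) \<le> ennreal (gauss_moment k * (2 * enn2real m) ^ k)"
    and "(\<integral>\<^sup>+\<omega>. ennreal (exp (a * V \<omega>)) \<partial>P) \<le> ennreal (exp (a\<^sup>2 * enn2real m))"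
    and "\<And>h :: real \<Rightarrow> real. continuous_on UNIV h \<Longrightarrow> mono h \<Longrightarrow>
      ennreal (h (enn2real m)) \<le> liminf (\<lambda>n. ennreal (h (2 * s (1 / real (Suc n)))))"
proof -
  define \<delta> where "\<delta> e = (\<integral>\<^sup>+\<omega>. ennreal ((X e \<omega> - V \<omega>)\<^sup>2) \<partial>P)" for e
  have s0: "0 \<le> s e" if "0 < e" for e by (rule gaussian_char_distr(1)[OF P X[OF that] ch[OF that]])
  have sE: "(\<integral>\<^sup>+\<omega>. ennreal ((X e \<omega>)\<^sup>2) \<partial>P) = ennreal (s e)" if "0 < e" for e
    using gaussian_moment_even[OF P X[OF that] ch[OF that], of 1] by (simp add: gauss_moment_def fact_numeral)
  have sq: "(a::real)\<^sup>2 \<le> 2 * b\<^sup>2 + 2 * (b - a)\<^sup>2" "b\<^sup>2 \<le> 2 * a\<^sup>2 + 2 * (b - a)\<^sup>2" for a b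
  proof -
    have "0 \<le> (a - 2 * b)\<^sup>2" "0 \<le> (b - 2 * a)\<^sup>2" by simp_all
    then show "(a::real)\<^sup>2 \<le> 2 * b\<^sup>2 + 2 * (b - a)\<^sup>2" "b\<^sup>2 \<le> 2 * a\<^sup>2 + 2 * (b - a)\<^sup>2"
      by (simp_all add: power2_eq_square algebra_simps)
  qed
  have lin: "(\<integral>\<^sup>+\<omega>. ennreal (2 * f \<omega> + 2 * g \<omega>) \<partial>P) = 2 * (\<integral>\<^sup>+\<omega>. ennreal (f \<omega>) \<partial>P) + 2 * (\<integral>\<^sup>+\<omega>. ennreal (g \<omega>) \<partial>P)"
    if [measurable]: "f \<in> borel_measurable P" "g \<in> borel_measurable P" and "\<And>\<omega>. 0 \<le> f \<omega>" "\<And>\<omega>. 0 \<le> g \<omega>" for f g :: "'w \<Rightarrow> real"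
    using that by (simp add: ennreal_mult nn_integral_add nn_integral_cmult)
  have m_le: "m \<le> 2 * ennreal (s e) + 2 * \<delta> e" if e: "0 < e" for e
  proof -
    note [measurable] = X[OF e]
    have "m \<le> (\<integral>\<^sup>+\<omega>. ennreal (2 * (X e \<omega>)\<^sup>2 + 2 * (X e \<omega> - V \<omega>)\<^sup>2) \<partial>P)"
      unfolding m_def by (intro nn_integral_mono ennreal_leI sq)
    also have "\<dots> = 2 * ennreal (s e) + 2 * \<delta> e" by (subst lin) (auto simp: sE[OF e] \<delta>_def)
    finally show ?thesis .
  qed
  have s_le: "ennreal (s e) \<le> 2 * m + 2 * \<delta> e" if e: "0 < e" for e
  proof -
    note [measurable] = X[OF e]
    have "ennreal (s e) \<le> (\<integral>\<^sup>+\<omega>. ennreal (2 * (V \<omega>)\<^sup>2 + 2 * (X e \<omega> - V \<omega>)\<^sup>2) \<partial>P)"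
      unfolding sE[OF e, symmetric] by (intro nn_integral_mono ennreal_leI sq)
    also have "\<dots> = 2 * m + 2 * \<delta> e" by (subst lin) (auto simp: m_def \<delta>_def)
    finally show ?thesis .
  qed
  obtain e where e: "\<And>n. 0 < e n" "AE \<omega> in P. (\<lambda>n. X (e n) \<omega>) \<longlonglongrightarrow> V \<omega>" "\<And>n. \<delta> (e n) \<le> ennreal ((1/2) ^ n)"
    using L2_conv_imp_AE_subseq[OF X V lim] unfolding \<delta>_def by blast
  have [measurable]: "X (e n) \<in> borel_measurable P" for n using X[OF e(1)] .
  have "m \<le> 2 * ennreal (s (e 0)) + 2 * ennreal 1"
    using e(3)[of 0] by (intro order_trans[OF m_le[OF e(1)[of 0]]] add_left_mono mult_left_mono) auto
  also have "\<dots> < \<infinity>" by (simp add: ennreal_mult_less_top)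
  finally show fin: "m < \<infinity>" .
  define m' where "m' = enn2real m"
  have m': "m = ennreal m'" "0 \<le> m'" using fin by (auto simp: m'_def less_top)
  have sb: "s (e n) \<le> 2 * m' + 2 * (1/2) ^ n" for n
  proof -
    have "ennreal (s (e n)) \<le> 2 * ennreal m' + 2 * ennreal ((1/2) ^ n)"
      using e(3)[of n] unfolding m'(1)[symmetric] by (intro order_trans[OF s_le[OF e(1)[of n]]] add_left_mono mult_left_mono) auto
    also have "\<dots> = ennreal (2 * m' + 2 * (1/2) ^ n)" using m'(2) by (simp add: ennreal_mult)
    finally show ?thesis using m'(2) by (subst (asm) ennreal_le_iff) auto
  qed
  \<comment> \<open>Fatou's lemma along the almost surely convergent subsequence. Upper bounds
    \<open>c n\<close> with a limit are enough, so the crude bounds \<open>sb\<close> on the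
    variances can be inserted.\<close>
  have fatou: "(\<integral>\<^sup>+\<omega>. ennreal (h (V \<omega>)) \<partial>P) \<le> L"
    if h: "continuous_on UNIV h" and b: "\<And>n. (\<integral>\<^sup>+\<omega>. ennreal (h (X (e n) \<omega>)) \<partial>P) \<le> c n" and c: "c \<longlonglongrightarrow> L" for h :: "real \<Rightarrow> real" and c L
  proof -
    have [measurable]: "h \<in> borel_measurable borel" using h by (rule borel_measurable_continuous_onI)
    have "(\<integral>\<^sup>+\<omega>. ennreal (h (V \<omega>)) \<partial>P) = (\<integral>\<^sup>+\<omega>. liminf (\<lambda>n. ennreal (h (X (e n) \<omega>))) \<partial>P)"
    proof (rule nn_integral_cong_AE)
      show "AE \<omega> in P. ennreal (h (V \<omega>)) = liminf (\<lambda>n. ennreal (h (X (e n) \<omega>)))"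
        using e(2)
      proof eventually_elim
        fix \<omega> assume "(\<lambda>n. X (e n) \<omega>) \<longlonglongrightarrow> V \<omega>"
        then have "(\<lambda>n. h (X (e n) \<omega>)) \<longlonglongrightarrow> h (V \<omega>)"
          using h by (intro isCont_tendsto_compose[of _ h]) (auto simp: continuous_on_eq_continuous_at)
        then have "(\<lambda>n. ennreal (h (X (e n) \<omega>))) \<longlonglongrightarrow> ennreal (h (V \<omega>))" by (rule tendsto_ennrealI)
        then show "ennreal (h (V \<omega>)) = liminf (\<lambda>n. ennreal (h (X (e n) \<omega>)))"
          by (rule lim_imp_Liminf[symmetric, rotated]) simp
      qed
    qed
    also have "\<dots> \<le> liminf (\<lambda>n. \<integral>\<^sup>+\<omega>. ennreal (h (X (e n) \<omega>)) \<partial>P)" by (intro nn_integral_liminf) measurable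
    also have "\<dots> \<le> liminf c" by (intro Liminf_mono always_eventually allI b)
    also have "\<dots> = L" using c by (intro lim_imp_Liminf) auto
    finally show ?thesis .
  qed
  have half: "(\<lambda>n. 2 * m' + 2 * (1/2) ^ n) \<longlonglongrightarrow> 2 * m' + 2 * 0"
    by (intro tendsto_intros LIMSEQ_realpow_zero) auto
  show "(\<integral>\<^sup>+\<omega>. ennreal (V \<omega> ^ (2 * k)) \<partial>P) \<le> ennreal (gauss_moment k * (2 * enn2real m) ^ k)"
  proof (rule fatou[of "\<lambda>x. x ^ (2 * k)"])
    show "(\<integral>\<^sup>+\<omega>. ennreal (X (e n) \<omega> ^ (2 * k)) \<partial>P) \<le> ennreal (gauss_moment k * (2 * m' + 2 * (1/2) ^ n) ^ k)" for n
      unfolding gaussian_moment_even[OF P X[OF e(1)] ch[OF e(1)]]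
      using gauss_moment_pos[of k] by (intro ennreal_leI mult_left_mono power_mono sb s0 e) auto
    show "(\<lambda>n. ennreal (gauss_moment k * (2 * m' + 2 * (1/2) ^ n) ^ k)) \<longlonglongrightarrow> ennreal (gauss_moment k * (2 * enn2real m) ^ k)"
      unfolding m'_def[symmetric] using half by (intro tendsto_ennrealI tendsto_intros) auto
  qed (intro continuous_intros)
  show "(\<integral>\<^sup>+\<omega>. ennreal (exp (a * V \<omega>)) \<partial>P) \<le> ennreal (exp (a\<^sup>2 * enn2real m))"
  proof (rule fatou[of "\<lambda>x. exp (a * x)"])
    show "(\<integral>\<^sup>+\<omega>. ennreal (exp (a * X (e n) \<omega>)) \<partial>P) \<le> ennreal (exp (a\<^sup>2 * ((2 * m' + 2 * (1/2) ^ n) / 2)))" for n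
      unfolding gaussian_exp_moment[OF P X[OF e(1)] ch[OF e(1)]]
      using mult_left_mono[OF sb[of n], of "a\<^sup>2"] by (intro ennreal_leI) (auto simp: field_simps)
    have "(\<lambda>n. ennreal (exp (a\<^sup>2 * ((2 * m' + 2 * (1/2) ^ n) / 2)))) \<longlonglongrightarrow> ennreal (exp (a\<^sup>2 * ((2 * m' + 2 * 0) / 2)))"
      using half by (intro tendsto_ennrealI tendsto_intros) auto
    then show "(\<lambda>n. ennreal (exp (a\<^sup>2 * ((2 * m' + 2 * (1/2) ^ n) / 2)))) \<longlonglongrightarrow> ennreal (exp (a\<^sup>2 * enn2real m))"
      by (simp add: m'_def)
  qed (intro continuous_intros)
  \<comment> \<open>Here the sequence 1/(n+1) is fixed in advance, unlike \<open>e\<close>. The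
    lemma is applied to each Brownian path separately, and Fatou's lemma over the paths needs one
    sequence common to all of them.\<close>
  show "ennreal (h (enn2real m)) \<le> liminf (\<lambda>n. ennreal (h (2 * s (1 / real (Suc n)))))"
    if h: "continuous_on UNIV h" "mono h" for h :: "real \<Rightarrow> real"
  proof -
    let ?d = "\<lambda>n. \<delta> (1 / real (Suc n))"
    have at: "filterlim (\<lambda>n. 1 / real (Suc n)) (at_right 0) sequentially"
      unfolding filterlim_at using LIMSEQ_Suc[OF lim_const_over_n[of 1]] by auto
    have d: "?d \<longlonglongrightarrow> 0" using filterlim_compose[OF lim at] by (simp add: \<delta>_def o_def)
    have d1: "eventually (\<lambda>n. ?d n < 1) sequentially" by (rule order_tendstoD(2)[OF d]) simp
    have d': "(\<lambda>n. enn2real (?d n)) \<longlonglongrightarrow> 0" by (rule tendsto_enn2real) (use d in auto)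
    have "(\<lambda>n. m' - 2 * enn2real (?d n)) \<longlonglongrightarrow> m' - 2 * 0" by (intro tendsto_intros d')
    then have "(\<lambda>n. h (m' - 2 * enn2real (?d n))) \<longlonglongrightarrow> h (m' - 2 * 0)"
      using h(1) by (intro isCont_tendsto_compose[of _ h]) (auto simp: continuous_on_eq_continuous_at)
    then have "(\<lambda>n. ennreal (h (m' - 2 * enn2real (?d n)))) \<longlonglongrightarrow> ennreal (h (m' - 2 * 0))" by (rule tendsto_ennrealI)
    then have "ennreal (h (enn2real m)) = liminf (\<lambda>n. ennreal (h (m' - 2 * enn2real (?d n))))"
      by (intro lim_imp_Liminf[symmetric]) (auto simp: m'_def)
    also have "\<dots> \<le> liminf (\<lambda>n. ennreal (h (2 * s (1 / real (Suc n)))))"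
    proof (rule Liminf_mono)
      show "\<forall>\<^sub>F n in sequentially. ennreal (h (m' - 2 * enn2real (?d n))) \<le> ennreal (h (2 * s (1 / real (Suc n))))"
        using d1
      proof eventually_elim
        fix n assume "?d n < 1"
        then have dn: "?d n = ennreal (enn2real (?d n))" by (intro ennreal_enn2real[symmetric] order.strict_trans[OF _ ennreal_one_less_top])
        have s1: "0 \<le> s (1 / real (Suc n))" by (rule s0) simp
        have "ennreal m' \<le> 2 * ennreal (s (1 / real (Suc n))) + 2 * ennreal (enn2real (?d n))"
          using m_le[of "1 / real (Suc n)"] dn m'(1) by simp
        also have "\<dots> = ennreal (2 * s (1 / real (Suc n)) + 2 * enn2real (?d n))"
          using s1 by (simp add: ennreal_mult)
        finally have "m' \<le> 2 * s (1 / real (Suc n)) + 2 * enn2real (?d n)" using s1 by (subst (asm) ennreal_le_iff) auto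
        then show "ennreal (h (m' - 2 * enn2real (?d n))) \<le> ennreal (h (2 * s (1 / real (Suc n))))"
          by (intro ennreal_leI monoD[OF h(2)]) simp
      qed
    qed
    finally show ?thesis .
  qed
qed

section \<open>Spectral representation of the smoothed covariance\<close>

definition gauss_cut :: "real \<Rightarrow> nat \<Rightarrow> real \<Rightarrow> real" where
  "gauss_cut u n \<xi> = exp (- u * \<xi>\<^sup>2 / 2) * bump (\<xi> / real (Suc n))"

lemma csmooth_gauss_cut: "csmooth (\<lambda>\<xi>. of_real (gauss_cut u n \<xi>))"
proof -
  have "csmooth (\<lambda>x. of_real (exp (- u * x\<^sup>2 / 2)) * of_real (bump ((1 / real (Suc n)) * x + 0)))"
    by (intro csmooth_mult csmooth_gauss csmooth_affine[OF csmooth_bump])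
  then show ?thesis by (simp add: gauss_cut_def)
qed

lemma gauss_cut_measurable[measurable]: "gauss_cut u n \<in> borel_measurable borel"
  unfolding gauss_cut_def by measurable

lemma gauss_cut_nonneg: "0 \<le> gauss_cut u n x" by (simp add: gauss_cut_def bump_nonneg)

lemma gauss_cut_le: "gauss_cut u n x \<le> exp 2 * exp (- u * x\<^sup>2 / 2)"
  unfolding gauss_cut_def using bump_le by (subst mult.commute) (intro mult_right_mono, auto)

lemma integrable_gauss_moment:
  assumes "0 < u"
  shows "integrable lborel (\<lambda>x::real. x ^ k * exp (- u * x\<^sup>2 / 2))"
proof -
  have "integrable lborel (\<lambda>x. sqrt (2 * pi / u) * (normal_density 0 (1 / sqrt u) x * (x - 0) ^ k))"
    using assms by (intro integrable_mult_right integrable_normal_moment) auto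
  also have "(\<lambda>x. sqrt (2 * pi / u) * (normal_density 0 (1 / sqrt u) x * (x - 0) ^ k)) = (\<lambda>x. x ^ k * exp (- u * x\<^sup>2 / 2))"
    using assms by (auto simp: normal_density_def fun_eq_iff power_divide real_sqrt_divide real_sqrt_mult field_simps)
  finally show ?thesis .
qed

lemma deriv_vanish_outside:
  fixes f :: "real \<Rightarrow> complex"
  assumes "\<And>x. (f has_vector_derivative f' x) (at x)" "\<And>x. 1 < \<bar>x\<bar> \<Longrightarrow> f x = 0" "1 < \<bar>x\<bar>"
  shows "f' x = 0"
proof -
  have o: "open {x::real. 1 < \<bar>x\<bar>}" by (intro open_Collect_less continuous_intros)
  have "((\<lambda>_. 0) has_vector_derivative 0) (at x)" by auto
  then have "(f has_vector_derivative 0) (at x)"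
    by (rule has_vector_derivative_transform_within_open[OF _ o]) (use assms in auto)
  then show ?thesis using assms(1) vector_derivative_unique_at by blast
qed

lemma bounded_if_vanish_outside:
  fixes f :: "real \<Rightarrow> complex"
  assumes "continuous_on UNIV f" "\<And>x. 1 < \<bar>x\<bar> \<Longrightarrow> f x = 0"
  shows "\<exists>B\<ge>0. \<forall>x. norm (f x) \<le> B"
proof -
  have "bounded (f ` {-1..1})"
    by (intro compact_imp_bounded compact_continuous_image continuous_on_subset[OF assms(1)]) auto
  then obtain B where B: "\<And>x. x \<in> {-1..1} \<Longrightarrow> norm (f x) \<le> B" unfolding bounded_iff by blast
  have "norm (f x) \<le> max B 0" for x
  proof -
    have "x \<in> {-1..1} \<or> 1 < \<bar>x\<bar>" by auto
    then show ?thesis using B[of x] assms(2)[of x] by (auto simp: le_max_iff_disj)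
  qed
  then show ?thesis by (intro exI[of _ "max B 0"]) auto
qed

text \<open>Two integrations by parts: y^2 times the Fourier integral of the cut-off Gaussian g is
  minus that of g''. Both g and g'' are dominated by integrable functions free of n, and this
  uniformity is what dominated convergence needs later.\<close>

lemma gauss_cut_fourier_bound:
  assumes u: "0 < u"
  shows "\<exists>C\<ge>0. \<forall>n y. norm (CLINT \<xi>|lborel. iexp (y * \<xi>) * of_real (gauss_cut u n \<xi>)) \<le> C / (1 + y\<^sup>2)"
proof -
  define b0 where "b0 = (\<lambda>x. complex_of_real (bump x))"
  obtain b1 where b1: "\<And>x. (b0 has_vector_derivative b1 x) (at x)" "csmooth b1"
    using csmooth_deriv[OF csmooth_bump] unfolding b0_def by metis
  obtain b2 where b2: "\<And>x. (b1 has_vector_derivative b2 x) (at x)" "csmooth b2"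
    using csmooth_deriv[OF b1(2)] by metis
  have v0: "b0 x = 0" if "1 < \<bar>x\<bar>" for x using bump_eq_0[of x] that by (simp add: b0_def)
  have v1: "b1 x = 0" if "1 < \<bar>x\<bar>" for x using deriv_vanish_outside[OF b1(1) v0 that] .
  have v2: "b2 x = 0" if "1 < \<bar>x\<bar>" for x using deriv_vanish_outside[OF b2(1) v1 that] .
  obtain B0 where B0: "0 \<le> B0" "\<And>x. norm (b0 x) \<le> B0"
    using bounded_if_vanish_outside[OF continuous_on_csmooth[of b0] v0] csmooth_bump by (auto simp: b0_def[symmetric])
  obtain B1 where B1: "0 \<le> B1" "\<And>x. norm (b1 x) \<le> B1"
    using bounded_if_vanish_outside[OF continuous_on_csmooth[of b1] v1] b1(2) by auto
  obtain B2 where B2: "0 \<le> B2" "\<And>x. norm (b2 x) \<le> B2"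
    using bounded_if_vanish_outside[OF continuous_on_csmooth[of b2] v2] b2(2) by auto
  define E where "E x = exp (- u * x\<^sup>2 / 2)" for x :: real
  define B where "B = B0 + B1 + B2"
  have BB: "0 \<le> B" "norm (b0 x) \<le> B" "norm (b1 x) \<le> B" "norm (b2 x) \<le> B" for x
    using B0(1) B1(1) B2(1) B0(2)[of x] B1(2)[of x] B2(2)[of x] by (simp_all add: B_def)
  \<comment> \<open>Dominates g'' for all n at once: a derivative falling on the rescaled bump
    carries a factor 1/m \<le> 1, and |x| is replaced by 1 + x^2.\<close>
  define w where "w x = B * (x ^ 0 * E x) + (2 * u * B) * ((x ^ 0 * E x) + x ^ 2 * E x) + (u\<^sup>2 * B) * (x ^ 2 * E x) + (u * B) * (x ^ 0 * E x)" for x :: real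
  have wi: "integrable lborel w"
    unfolding w_def E_def using u by (intro integrable_mult_right integrable_gauss_moment Bochner_Integration.integrable_add)
  have Ei: "integrable lborel (\<lambda>x. B * E x)" unfolding E_def using integrable_gauss_moment[OF u, of 0] by simp
  define C where "C = (\<integral>x. w x \<partial>lborel) + (\<integral>x. B * E x \<partial>lborel)"
  have E0: "0 < E x" for x by (simp add: E_def)
  have w0: "0 \<le> w x" for x using E0[of x] BB(1) u by (simp add: w_def)
  have C0: "0 \<le> C" unfolding C_def using w0 BB(1) E0 by (intro add_nonneg_nonneg integral_nonneg_AE) (auto simp: less_imp_le)
  have "norm (CLINT \<xi>|lborel. iexp (y * \<xi>) * of_real (gauss_cut u n \<xi>)) \<le> C / (1 + y\<^sup>2)" for n y
  proof -
    define m where "m = real (Suc n)"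
    have m: "1 \<le> m" by (simp add: m_def)
    then have m0: "m \<noteq> 0" by linarith
    define e where "e = (\<lambda>x. complex_of_real (E x))"
    define e1 where "e1 = (\<lambda>x. complex_of_real (- u * x * E x))"
    define e2 where "e2 = (\<lambda>x. complex_of_real ((u\<^sup>2 * x\<^sup>2 - u) * E x))"
    have de: "(e has_vector_derivative e1 x) (at x)" for x
      unfolding e_def e1_def E_def
      by (rule has_vector_derivative_of_real) (auto intro!: derivative_eq_intros simp: power2_eq_square)
    have de1: "(e1 has_vector_derivative e2 x) (at x)" for x
      unfolding e1_def e2_def E_def
      by (rule has_vector_derivative_of_real) (auto intro!: derivative_eq_intros simp: power2_eq_square algebra_simps)
    have sc: "((\<lambda>x. f (x / m)) has_vector_derivative f' (x / m) / m) (at x)"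
      if "\<And>x. (f has_vector_derivative f' x) (at x)" for f f' :: "real \<Rightarrow> complex" and x
    proof -
      have "((\<lambda>x. x / m) has_vector_derivative (1 / m)) (at x)"
        by (auto intro!: derivative_eq_intros simp: m0 has_real_derivative_iff_has_vector_derivative[symmetric])
      from vector_diff_chain_at[OF this that] show ?thesis
        by (simp add: o_def scaleR_conv_of_real)
    qed
    define g where "g = (\<lambda>x. e x * b0 (x / m))"
    define g1 where "g1 = (\<lambda>x. e x * (b1 (x / m) / m) + e1 x * b0 (x / m))"
    define g2 where "g2 = (\<lambda>x. (e x * (b2 (x / m) / m / m) + e1 x * (b1 (x / m) / m)) + (e1 x * (b1 (x / m) / m) + e2 x * b0 (x / m)))"
    have dg: "(g has_vector_derivative g1 x) (at x)" for x
      unfolding g_def g1_def by (intro has_vector_derivative_mult de sc b1)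
    have dg1: "(g1 has_vector_derivative g2 x) (at x)" for x
    proof -
      have "((\<lambda>x. b1 (x / m) / m) has_vector_derivative (b2 (x / m) / m / m)) (at x)"
        using has_vector_derivative_mult[OF sc[OF b2(1)] has_vector_derivative_const[of "1 / complex_of_real m"], of x]
        by (simp add: field_simps)
      then show ?thesis
        unfolding g1_def g2_def
        by (rule has_vector_derivative_add[OF has_vector_derivative_mult[OF de] has_vector_derivative_mult[OF de1 sc[OF b1(1)]]])
    qed
    have gcont: "continuous_on UNIV g" using dg by (meson continuous_at_imp_continuous_on has_vector_derivative_continuous)
    have g2cont: "continuous_on UNIV g2"
      unfolding g2_def e_def e1_def e2_def E_def b0_def
      by (intro continuous_intros continuous_on_compose2[OF continuous_on_csmooth[OF b2(2), of UNIV]]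
          continuous_on_compose2[OF continuous_on_csmooth[OF b1(2), of UNIV]] continuous_on_compose2[OF bump_cont[of UNIV]]) (auto simp: m0)
    \<comment> \<open>An antiderivative that performs both integrations by parts at once. It
      vanishes at m+1 and -(m+1), which lie outside the support of the bump.\<close>
    define P where "P = (\<lambda>x. iexp (y * x) * (g1 x - \<i> * y * g x))"
    have dP: "(P has_vector_derivative iexp (y * x) * (g2 x + y\<^sup>2 * g x)) (at x)" for x
    proof -
      have di: "((\<lambda>x. iexp (y * x)) has_vector_derivative (\<i> * y * iexp (y * x))) (at x)"
      proof -
        have "((\<lambda>x. exp ((\<i> * y) * of_real x)) has_vector_derivative (\<i> * y * exp ((\<i> * y) * of_real x))) (at x)"
          by (rule has_vector_derivative_real_field) (auto intro!: derivative_eq_intros)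
        then show ?thesis by (simp add: mult.assoc)
      qed
      have "((\<lambda>x. \<i> * y * g x) has_vector_derivative (\<i> * y * g1 x)) (at x)"
        using has_vector_derivative_mult[OF has_vector_derivative_const[of "\<i> * y"] dg, of x] by simp
      from has_vector_derivative_mult[OF di has_vector_derivative_diff[OF dg1 this]]
      have "(P has_vector_derivative (iexp (y * x) * (g2 x - \<i> * y * g1 x) + \<i> * y * iexp (y * x) * (g1 x - \<i> * y * g x))) (at x)"
        unfolding P_def .
      also have "(iexp (y * x) * (g2 x - \<i> * y * g1 x) + \<i> * y * iexp (y * x) * (g1 x - \<i> * y * g x)) = iexp (y * x) * (g2 x + y\<^sup>2 * g x)"
        by (simp add: algebra_simps power2_eq_square)
      finally show ?thesis .
    qed
    have icont: "continuous_on A (\<lambda>x. iexp (y * x))" for A by (intro continuous_intros)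
    have hb: "has_bochner_integral lborel (\<lambda>x. indicator {-(m+1)..m+1} x *\<^sub>R (iexp (y * x) * (g2 x + y\<^sup>2 * g x))) (P (m+1) - P (-(m+1)))"
    proof (rule has_bochner_integral_FTC_Icc)
      show "continuous_on {-(m+1)..m+1} (\<lambda>x. iexp (y * x) * (g2 x + y\<^sup>2 * g x))"
        by (intro continuous_intros continuous_on_subset[OF gcont] continuous_on_subset[OF g2cont]) auto
    qed (use m dP in \<open>auto intro: has_vector_derivative_at_within\<close>)
    have out: "1 < \<bar>x / m\<bar>" if "m < \<bar>x\<bar>" for x using that m by (simp add: field_simps abs_divide)
    have P0: "P (m+1) = 0" "P (-(m+1)) = 0"
      using v0[OF out] v1[OF out] m by (auto simp: P_def g_def g1_def)
    have "indicator {-(m+1)..m+1} x *\<^sub>R (iexp (y * x) * (g2 x + y\<^sup>2 * g x)) = iexp (y * x) * g2 x + y\<^sup>2 * (iexp (y * x) * g x)" for x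
    proof (cases "x \<in> {-(m+1)..m+1}")
      case False
      then have "m < \<bar>x\<bar>" by auto
      then show ?thesis using v0[OF out] v1[OF out] v2[OF out] False by (simp add: g_def g2_def)
    qed (simp add: algebra_simps)
    with hb P0 have hb0: "has_bochner_integral lborel (\<lambda>x. iexp (y * x) * g2 x + y\<^sup>2 * (iexp (y * x) * g x)) 0" by simp
    have ge: "norm (g x) \<le> B * E x" for x
      using mult_mono[OF order_refl BB(2)[of "x/m"], of "E x"] E0[of x] by (simp add: g_def e_def norm_mult mult.commute)
    have g2e: "norm (g2 x) \<le> w x" for x
    proof -
      have i: "1 / m \<le> 1" using m by simp
      have n1: "norm (b1 (x / m) / m) \<le> B"
        using mult_mono[OF BB(3)[of "x/m"] i] BB(1) m by (simp add: norm_divide)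
      have n2: "norm (b2 (x / m) / m / m) \<le> B"
        using mult_mono[OF mult_mono[OF BB(4)[of "x/m"] i] i] BB(1) m by (simp add: norm_divide norm_mult)
      have ne: "norm (e x) = E x" "norm (e1 x) = u * \<bar>x\<bar> * E x" using E0[of x] u by (auto simp: e_def e1_def norm_mult abs_mult)
      have ne2: "norm (e2 x) \<le> (u\<^sup>2 * x\<^sup>2 + u) * E x"
      proof -
        have "\<bar>u\<^sup>2 * x\<^sup>2 - u\<bar> \<le> u\<^sup>2 * x\<^sup>2 + u" using u by (intro order_trans[OF abs_triangle_ineq4]) auto
        then show ?thesis unfolding e2_def norm_of_real abs_mult using E0[of x] by (intro mult_mono) auto
      qed
      have x1: "\<bar>x\<bar> \<le> 1 + x\<^sup>2"
      proof -
        have "0 \<le> (\<bar>x\<bar> - 1)\<^sup>2" by simp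
        then have "2 * \<bar>x\<bar> \<le> 1 + x\<^sup>2" by (simp add: power2_diff)
        then show ?thesis by simp
      qed
      have t1: "norm (e x * (b2 (x / m) / m / m)) \<le> E x * B" unfolding norm_mult ne using n2 E0[of x] by (intro mult_left_mono) auto
      have t2: "norm (e1 x * (b1 (x / m) / m)) \<le> u * (1 + x\<^sup>2) * E x * B"
        unfolding norm_mult[of "e1 x"] ne using n1 x1 E0[of x] u BB(1) by (intro mult_mono) auto
      have t3: "norm (e2 x * b0 (x / m)) \<le> (u\<^sup>2 * x\<^sup>2 + u) * E x * B"
        unfolding norm_mult[of "e2 x"] using ne2 BB(1) BB(2)[of "x/m"] E0[of x] u by (intro mult_mono) auto
      have "norm (g2 x) \<le> (E x * B + u * (1 + x\<^sup>2) * E x * B) + (u * (1 + x\<^sup>2) * E x * B + (u\<^sup>2 * x\<^sup>2 + u) * E x * B)"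
        unfolding g2_def by (intro norm_triangle_mono t1 t2 t3)
      also have "\<dots> = w x" by (simp add: w_def algebra_simps)
      finally show ?thesis .
    qed
    have gm: "(\<lambda>x. iexp (y * x) * g x) \<in> borel_measurable lborel" "(\<lambda>x. iexp (y * x) * g2 x) \<in> borel_measurable lborel"
      using borel_measurable_continuous_onI[OF continuous_on_mult[OF icont gcont]]
        borel_measurable_continuous_onI[OF continuous_on_mult[OF icont g2cont]] by simp_all
    have gi: "integrable lborel (\<lambda>x. iexp (y * x) * g x)"
      by (rule Bochner_Integration.integrable_bound[OF Ei gm(1)])
        (use ge in \<open>auto intro: order_trans[OF _ abs_ge_self] simp: norm_mult\<close>)
    have g2i: "integrable lborel (\<lambda>x. iexp (y * x) * g2 x)"
      by (rule Bochner_Integration.integrable_bound[OF wi gm(2)])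
        (use g2e in \<open>auto intro: order_trans[OF _ abs_ge_self] simp: norm_mult\<close>)
    define I where "I = (CLINT x|lborel. iexp (y * x) * g x)"
    define I2 where "I2 = (CLINT x|lborel. iexp (y * x) * g2 x)"
    have "I2 + y\<^sup>2 * I = 0"
      using has_bochner_integral_integral_eq[OF hb0] gi g2i by (simp add: I_def I2_def)
    then have yI: "y\<^sup>2 * I = - I2" by (simp add: eq_neg_iff_add_eq_0 add.commute)
    have nI: "norm I \<le> (\<integral>x. B * E x \<partial>lborel)"
      unfolding I_def by (rule order_trans[OF integral_norm_bound integral_mono[OF integrable_norm[OF gi] Ei]]) (use ge in \<open>auto simp: norm_mult\<close>)
    have nI2: "norm I2 \<le> (\<integral>x. w x \<partial>lborel)"
      unfolding I2_def by (rule order_trans[OF integral_norm_bound integral_mono[OF integrable_norm[OF g2i] wi]]) (use g2e in \<open>auto simp: norm_mult\<close>)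
    have "(1 + y\<^sup>2) * norm I = norm I + norm (y\<^sup>2 * I)" by (simp add: norm_mult norm_power algebra_simps)
    also have "\<dots> \<le> C" unfolding yI C_def using nI nI2 by simp
    finally have "norm I \<le> C / (1 + y\<^sup>2)" by (simp add: field_simps add_pos_nonneg)
    moreover have "(\<lambda>x. iexp (y * x) * of_real (gauss_cut u n x)) = (\<lambda>x. iexp (y * x) * g x)"
      by (simp add: gauss_cut_def g_def e_def E_def b0_def m_def)
    ultimately show ?thesis by (simp add: I_def)
  qed
  then show ?thesis using C0 by blast
qed

lemma gauss_fourier:
  assumes u: "0 < u"
  shows "(CLINT \<xi>|lborel. iexp (y * \<xi>) * of_real (exp (- u * \<xi>\<^sup>2 / 2))) = of_real (2 * pi * normal_density 0 (sqrt u) y)"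
proof -
  have "(CLINT \<xi>|lborel. iexp (y * \<xi>) * of_real (exp (- u * \<xi>\<^sup>2 / 2)))
     = \<bar>1 / sqrt u\<bar> *\<^sub>R (CLINT x|lborel. iexp (y * (0 + 1 / sqrt u * x)) * of_real (exp (- u * (0 + 1 / sqrt u * x)\<^sup>2 / 2)))"
    using u by (intro lborel_integral_real_affine) auto
  also have "(CLINT x|lborel. iexp (y * (0 + 1 / sqrt u * x)) * of_real (exp (- u * (0 + 1 / sqrt u * x)\<^sup>2 / 2)))
     = (CLINT x|lborel. of_real (sqrt (2 * pi)) * (std_normal_density x *\<^sub>R iexp ((y / sqrt u) * x)))"
    using u by (intro Bochner_Integration.integral_cong refl)
      (simp add: std_normal_density_def power_divide scaleR_conv_of_real)
  also have "\<dots> = of_real (sqrt (2 * pi)) * (CLINT x|lborel. std_normal_density x *\<^sub>R iexp ((y / sqrt u) * x))"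
    by (rule integral_mult_right_zero)
  also have "(CLINT x|lborel. std_normal_density x *\<^sub>R iexp ((y / sqrt u) * x)) = char std_normal_distribution (y / sqrt u)"
    unfolding char_def by (subst integral_density) auto
  also have "\<dots> = of_real (exp (- (y / sqrt u)\<^sup>2 / 2))" by (simp add: char_std_normal_distribution exp_of_real)
  finally have "(CLINT \<xi>|lborel. iexp (y * \<xi>) * of_real (exp (- u * \<xi>\<^sup>2 / 2)))
     = of_real (1 / sqrt u * (sqrt (2 * pi) * exp (- (y / sqrt u)\<^sup>2 / 2)))"
    using u by (simp add: scaleR_conv_of_real)
  also have "1 / sqrt u * (sqrt (2 * pi) * exp (- (y / sqrt u)\<^sup>2 / 2)) = 2 * pi * normal_density 0 (sqrt u) y"
  proof -
    have "1 / sqrt u * sqrt (2 * pi) = 2 * pi * (1 / sqrt (2 * pi * u))"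
      using u real_sqrt_mult_self[of "2 * pi"] by (simp add: real_sqrt_mult field_simps)
    moreover have "exp (- (y / sqrt u)\<^sup>2 / 2) = exp (- (y - 0)\<^sup>2 / (2 * (sqrt u)\<^sup>2))" using u by (simp add: power_divide)
    ultimately show ?thesis using u by (simp only: normal_density_def real_sqrt_pow2 less_imp_le mult.assoc[symmetric])
  qed
  finally show ?thesis .
qed

lemma integrable_iexp_mult:
  assumes "integrable M f" "g \<in> borel_measurable M"
  shows "integrable M (\<lambda>x. iexp (g x) * complex_of_real (f x))"
  using assms by (intro Bochner_Integration.integrable_bound[OF assms(1)]) (auto simp: norm_mult)

lemma integrable_gauss_cut: "0 < u \<Longrightarrow> integrable lborel (gauss_cut u n)"
  using integrable_gauss_moment[of u 0]
  by (intro Bochner_Integration.integrable_bound[of lborel "\<lambda>x. exp 2 * exp (- u * x\<^sup>2 / 2)" "gauss_cut u n"])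
    (use gauss_cut_le[of u n] in \<open>auto simp: gauss_cut_nonneg\<close>)

lemma gauss_cut_fourier_limit:
  assumes u: "0 < u"
  shows "(\<lambda>n. CLINT \<xi>|lborel. iexp (y * \<xi>) * of_real (gauss_cut u n \<xi>)) \<longlonglongrightarrow> of_real (2 * pi * normal_density 0 (sqrt u) y)"
  unfolding gauss_fourier[OF u, symmetric]
proof (rule integral_dominated_convergence[where w="\<lambda>x. exp 2 * exp (- u * x\<^sup>2 / 2)"])
  show "integrable lborel (\<lambda>x. exp 2 * exp (- u * x\<^sup>2 / 2))" using integrable_gauss_moment[OF u, of 0] by simp
  show "AE x in lborel. (\<lambda>n. iexp (y * x) * of_real (gauss_cut u n x)) \<longlonglongrightarrow> iexp (y * x) * of_real (exp (- u * x\<^sup>2 / 2))"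
  proof (rule AE_I2)
    fix x :: real
    have "(\<lambda>n. x / real (Suc n)) \<longlonglongrightarrow> 0" by (rule LIMSEQ_Suc[OF lim_const_over_n])
    then have "(\<lambda>n. bump (x / real (Suc n))) \<longlonglongrightarrow> bump 0"
      using bump_cont[of UNIV] by (intro isCont_tendsto_compose[of _ bump]) (auto simp: continuous_on_eq_continuous_at)
    then have "(\<lambda>n. iexp (y * x) * of_real (exp (- u * x\<^sup>2 / 2) * bump (x / real (Suc n)))) \<longlonglongrightarrow> iexp (y * x) * of_real (exp (- u * x\<^sup>2 / 2) * 1)"
      unfolding bump_0 by (intro tendsto_intros)
    then show "(\<lambda>n. iexp (y * x) * of_real (gauss_cut u n x)) \<longlonglongrightarrow> iexp (y * x) * of_real (exp (- u * x\<^sup>2 / 2))"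
      by (simp add: gauss_cut_def)
  qed
  show "AE x in lborel. norm (iexp (y * x) * of_real (gauss_cut u n x)) \<le> exp 2 * exp (- u * x\<^sup>2 / 2)" for n
    using gauss_cut_le gauss_cut_nonneg by (auto simp: norm_mult)
qed measurable

section \<open>Local mass of a nonnegative definite function\<close>

lemma test_fun_lincomb:
  assumes "test_fun f" "test_fun g"
  shows "test_fun (\<lambda>x. a * f x + b * g x)"
proof -
  have "bounded (closure {x. f x \<noteq> 0} \<union> closure {x. g x \<noteq> 0})"
    using assms unfolding test_fun_def by (auto intro: compact_imp_bounded)
  moreover have "{x. a * f x + b * g x \<noteq> 0} \<subseteq> closure {x. f x \<noteq> 0} \<union> closure {x. g x \<noteq> 0}"
    using closure_subset[of "{x. f x \<noteq> 0}"] closure_subset[of "{x. g x \<noteq> 0}"] by fastforce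
  ultimately have "bounded {x. a * f x + b * g x \<noteq> 0}" by (rule bounded_subset)
  then show ?thesis using assms by (auto simp: test_fun_def compact_closure intro: smooth_fun_lincomb)
qed

definition bump_at :: "'a::euclidean_space \<Rightarrow> 'a \<Rightarrow> real" where
  "bump_at z x = (\<Prod>b\<in>Basis. bump ((x - z) \<bullet> b))"

lemma bump_at_measurable[measurable]: "bump_at z \<in> borel_measurable borel"
  unfolding bump_at_def by measurable

lemma bump_at_measurable2[measurable (raw)]:
  "f \<in> borel_measurable M \<Longrightarrow> g \<in> borel_measurable M \<Longrightarrow> (\<lambda>x. bump_at (f x :: 'a::euclidean_space) (g x)) \<in> borel_measurable M"
  unfolding bump_at_def
  by (intro borel_measurable_prod measurable_compose[OF _ borel_measurable_bump] borel_measurable_inner borel_measurable_diff) auto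

lemma bump_at_nonneg[simp]: "0 \<le> bump_at z x"
  unfolding bump_at_def by (intro prod_nonneg) (auto simp: bump_nonneg)

lemma bump_at_eq_0: "b \<in> Basis \<Longrightarrow> 1 \<le> \<bar>(x - z) \<bullet> b\<bar> \<Longrightarrow> bump_at z x = 0"
  using bump_eq_0[of "(x - z) \<bullet> b"] by (auto simp: bump_at_def intro!: prod_zero bexI[of _ b])

lemma test_fun_bump_at: "test_fun (bump_at (z::'a::euclidean_space))"
  unfolding test_fun_def
proof
  have "csmooth (\<lambda>y. of_real (bump (y - c)))" for c
    using csmooth_affine[OF csmooth_bump, of 1 "- c"] by simp
  then have "smooth_fun (\<lambda>x::'a. Re (\<Prod>b\<in>Basis. of_real (bump (x \<bullet> b - z \<bullet> b))))"
    by (intro smooth_fun_Re_prod)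
  then show "smooth_fun (bump_at z)"
    by (simp add: bump_at_def[abs_def] inner_diff_left flip: of_real_prod)
  show "compact (closure {x. bump_at z x \<noteq> 0})"
  proof (rule compact_closure_box_support[of "1 + norm z"])
    fix x b :: 'a assume b: "b \<in> Basis" "1 + norm z < \<bar>x \<bullet> b\<bar>"
    then have "1 \<le> \<bar>(x - z) \<bullet> b\<bar>" using Basis_le_norm[OF b(1), of z] by (auto simp: inner_diff_left)
    then show "bump_at z x = 0" using bump_at_eq_0 b by blast
  qed
qed

lemma nn_integral_bump_pos: "0 < (\<integral>\<^sup>+x. ennreal (bump_at 0 (x::'a::euclidean_space)) \<partial>lborel)"
proof -
  have "(\<integral>\<^sup>+x. ennreal (bump x) \<partial>lborel) \<noteq> 0"
  proof
    assume "(\<integral>\<^sup>+x. ennreal (bump x) \<partial>lborel) = 0"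
    then have "AE x in lborel. bump x = 0"
      by (subst (asm) nn_integral_0_iff_AE) (auto elim!: eventually_mono intro: antisym bump_nonneg simp: ennreal_eq_0_iff)
    then have "AE x in lborel. x \<notin> {-1<..<1::real}"
      by eventually_elim (use bump_pos in \<open>fastforce simp: abs_less_iff\<close>)
    then have "emeasure lborel {-1<..<1::real} = 0" by (subst (asm) AE_iff_null_sets[symmetric]) auto
    then show False by simp
  qed
  moreover have "(\<integral>\<^sup>+x. ennreal (bump_at 0 (x::'a)) \<partial>lborel) = (\<Prod>b\<in>(Basis::'a set). \<integral>\<^sup>+x. ennreal (bump x) \<partial>lborel)"
  proof -
    have "(\<integral>\<^sup>+x. ennreal (bump_at 0 (x::'a)) \<partial>lborel) = (\<integral>\<^sup>+x. (\<Prod>b\<in>Basis. ennreal (bump ((x::'a) \<bullet> b))) \<partial>lborel)"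
      by (intro nn_integral_cong) (simp add: bump_at_def prod_ennreal bump_nonneg)
    also have "\<dots> = (\<Prod>b\<in>(Basis::'a set). \<integral>\<^sup>+x. ennreal (bump x) \<partial>lborel)"
      by (intro nn_integral_lborel_prod) auto
    finally show ?thesis .
  qed
  ultimately show ?thesis by (simp add: zero_less_iff_neq_zero)
qed

text \<open>Testing nonnegative definiteness against \<open>bump_at 0 - bump_at z\<close> bounds the local mass of
  \<open>L\<close> near \<open>z\<close> by its mass near the origin.\<close>
lemma nonneg_definite_local_bound:
  fixes L :: "'a::euclidean_space \<Rightarrow> real"
  assumes [measurable]: "L \<in> borel_measurable borel" and L: "\<And>x. 0 \<le> L x" and pd: "nonneg_definite L"
  obtains A :: real where "\<And>z. (\<integral>\<^sup>+y. \<integral>\<^sup>+x. ennreal (bump_at z x * bump_at 0 y * L (x - y)) \<partial>lborel \<partial>lborel) \<le> ennreal A"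
proof -
  define I where "I f g = (\<integral>p. f (fst p) * g (snd p) * L (fst p - snd p) \<partial>(lborel \<Otimes>\<^sub>M lborel))" for f g :: "'a \<Rightarrow> real"
  define N where "N f g = (\<integral>\<^sup>+p. ennreal (f (fst p) * g (snd p) * L (fst p - snd p)) \<partial>(lborel \<Otimes>\<^sub>M lborel))" for f g :: "'a \<Rightarrow> real"
  have key: "N (bump_at z) (bump_at 0) \<le> ennreal (2 * I (bump_at 0) (bump_at 0))" for z :: 'a
  proof -
    let ?f = "bump_at 0 :: 'a \<Rightarrow> real" let ?g = "bump_at z"
    \<comment> \<open>The sum of the two bumps dominates all four mixed products and supplies their
      integrability; the difference carries the inequality.\<close>
    have t1: "test_fun (\<lambda>x. 1 * ?f x + 1 * ?g x)" and t2: "test_fun (\<lambda>x. 1 * ?f x + (-1) * ?g x)"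
      by (intro test_fun_lincomb test_fun_bump_at)+
    have i1: "integrable (lborel \<Otimes>\<^sub>M lborel) (\<lambda>p. (?f (fst p) + ?g (fst p)) * (?f (snd p) + ?g (snd p)) * L (fst p - snd p))"
      using pd[unfolded nonneg_definite_def] t1 by auto
    have dom: "integrable (lborel \<Otimes>\<^sub>M lborel) (\<lambda>p. a (fst p) * b (snd p) * L (fst p - snd p))"
      if ab: "a \<in> {?f, ?g}" "b \<in> {?f, ?g}" for a b
    proof (rule Bochner_Integration.integrable_bound[OF i1])
      have [measurable]: "a \<in> borel_measurable borel" "b \<in> borel_measurable borel" using ab by auto
      show "(\<lambda>p. a (fst p) * b (snd p) * L (fst p - snd p)) \<in> borel_measurable (lborel \<Otimes>\<^sub>M lborel)" by measurable
      have "0 \<le> a x" "a x \<le> ?f x + ?g x" "0 \<le> b x" "b x \<le> ?f x + ?g x" for x using ab by auto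
      then have "a (fst p) * b (snd p) * L (fst p - snd p) \<le> (?f (fst p) + ?g (fst p)) * (?f (snd p) + ?g (snd p)) * L (fst p - snd p)"
        "0 \<le> a (fst p) * b (snd p) * L (fst p - snd p)" for p
        using L by (auto intro!: mult_right_mono mult_mono)
      then show "AE p in lborel \<Otimes>\<^sub>M lborel. norm (a (fst p) * b (snd p) * L (fst p - snd p)) \<le> norm ((?f (fst p) + ?g (fst p)) * (?f (snd p) + ?g (snd p)) * L (fst p - snd p))"
        by (auto intro!: order_trans[OF _ abs_ge_self])
    qed
    have dff: "integrable (lborel \<Otimes>\<^sub>M lborel) (\<lambda>p. ?f (fst p) * ?f (snd p) * L (fst p - snd p))"
     and dfg: "integrable (lborel \<Otimes>\<^sub>M lborel) (\<lambda>p. ?f (fst p) * ?g (snd p) * L (fst p - snd p))"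
     and dgf: "integrable (lborel \<Otimes>\<^sub>M lborel) (\<lambda>p. ?g (fst p) * ?f (snd p) * L (fst p - snd p))"
     and dgg: "integrable (lborel \<Otimes>\<^sub>M lborel) (\<lambda>p. ?g (fst p) * ?g (snd p) * L (fst p - snd p))"
      by (rule dom; simp)+
    have NI: "N a b = ennreal (I a b)" if ab: "a \<in> {?f, ?g}" "b \<in> {?f, ?g}" for a b
      unfolding N_def I_def using ab L by (intro nn_integral_eq_integral dom AE_I2) auto
    have pos: "0 \<le> I a b" if "a \<in> {?f, ?g}" "b \<in> {?f, ?g}" for a b
      unfolding I_def using that L by (intro integral_nonneg_AE AE_I2) auto
    have "0 \<le> (\<integral>p. (1 * ?f (fst p) + (-1) * ?g (fst p)) * (1 * ?f (snd p) + (-1) * ?g (snd p)) * L (fst p - snd p) \<partial>(lborel \<Otimes>\<^sub>M lborel))"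
      using pd[unfolded nonneg_definite_def] t2 by blast
    also have "\<dots> = (\<integral>p. (?f (fst p) * ?f (snd p) * L (fst p - snd p) + ?g (fst p) * ?g (snd p) * L (fst p - snd p))
         - (?f (fst p) * ?g (snd p) * L (fst p - snd p) + ?g (fst p) * ?f (snd p) * L (fst p - snd p)) \<partial>(lborel \<Otimes>\<^sub>M lborel))"
      by (intro Bochner_Integration.integral_cong refl) (simp add: algebra_simps)
    also have "\<dots> = (I ?f ?f + I ?g ?g) - (I ?f ?g + I ?g ?f)"
      unfolding I_def by (simp only: Bochner_Integration.integral_diff Bochner_Integration.integral_add
        Bochner_Integration.integrable_add dff dfg dgf dgg)
    finally have le: "I ?g ?f \<le> I ?f ?f + I ?g ?g" using pos[of ?f ?g] by simp
    \<comment> \<open>Shifting both variables by z leaves L (x - y) unchanged, so the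
      self-interaction of the shifted bump equals the one at the origin. This makes the bound
      uniform in z.\<close>
    have "N ?g ?g = (\<integral>\<^sup>+x. \<integral>\<^sup>+y. ennreal (?g x * ?g y * L (x - y)) \<partial>lborel \<partial>lborel)"
      unfolding N_def by (subst lborel.nn_integral_fst[symmetric]) auto
    also have "\<dots> = (\<integral>\<^sup>+x. \<integral>\<^sup>+y. ennreal (?g (x + z) * ?g y * L (x + z - y)) \<partial>lborel \<partial>lborel)"
      using nn_integral_lborel_plus[of "\<lambda>x. \<integral>\<^sup>+y. ennreal (?g x * ?g y * L (x - y)) \<partial>lborel" z] by simp
    also have "\<dots> = (\<integral>\<^sup>+x. \<integral>\<^sup>+y. ennreal (?g (x + z) * ?g (y + z) * L (x + z - (y + z))) \<partial>lborel \<partial>lborel)"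
      using nn_integral_lborel_plus[of "\<lambda>y. ennreal (?g (x + z) * ?g y * L (x + z - y))" z for x] by simp
    also have "\<dots> = (\<integral>\<^sup>+x. \<integral>\<^sup>+y. ennreal (?f x * ?f y * L (x - y)) \<partial>lborel \<partial>lborel)"
      by (simp add: bump_at_def)
    also have "\<dots> = N ?f ?f"
      unfolding N_def by (subst lborel.nn_integral_fst[symmetric]) auto
    finally have "I ?g ?g = I ?f ?f" using NI pos by simp
    with le show ?thesis using NI[of ?g ?f] by (simp add: ennreal_leI)
  qed
  have "N (bump_at z) (bump_at 0) = (\<integral>\<^sup>+y. \<integral>\<^sup>+x. ennreal (bump_at z x * bump_at 0 y * L (x - y)) \<partial>lborel \<partial>lborel)" for z
    unfolding N_def by (subst lborel_pair.nn_integral_snd[symmetric]) auto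
  with key show ?thesis using that by metis
qed

text \<open>The local bound is averaged over the centres z with the integrable weight
  \<open>qweight z\<close>. By Tonelli this average dominates a positive multiple of the integral of
  L * qweight, because \<open>qweight\<close> changes by a bounded factor only over the supports of
  the bumps.\<close>

lemma nn_integral_mult_qweight:
  fixes L :: "'a::euclidean_space \<Rightarrow> real"
  assumes [measurable]: "L \<in> borel_measurable borel" and L: "\<And>x. 0 \<le> L x" and pd: "nonneg_definite L"
  shows "(\<integral>\<^sup>+x. ennreal (L x * qweight x) \<partial>lborel) < \<infinity>"
proof -
  obtain A :: real where A: "\<And>z. (\<integral>\<^sup>+y. \<integral>\<^sup>+x. ennreal (bump_at z x * bump_at 0 y * L (x - y)) \<partial>lborel \<partial>lborel) \<le> ennreal A"
    using nonneg_definite_local_bound[OF assms] by blast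
  let ?q = "qweight :: 'a \<Rightarrow> real"
  define c where "c = (1/10 :: real) ^ DIM('a)"
  have c0: "0 < c" by (simp add: c_def)
  define K where "K = (\<integral>\<^sup>+x. ennreal (bump_at 0 (x::'a)) \<partial>lborel)"
  have "ennreal c * (K * K) * (\<integral>\<^sup>+w. ennreal (L w * ?q w) \<partial>lborel)
     = (\<integral>\<^sup>+w. ennreal (L w) * (\<integral>\<^sup>+y. ennreal (bump_at 0 (y::'a)) * (\<integral>\<^sup>+v. ennreal (c * ?q w) * ennreal (bump_at 0 (v::'a)) \<partial>lborel) \<partial>lborel) \<partial>lborel)"
  proof -
    have "ennreal (L w) * (\<integral>\<^sup>+y. ennreal (bump_at 0 (y::'a)) * (\<integral>\<^sup>+v. ennreal (c * ?q w) * ennreal (bump_at 0 (v::'a)) \<partial>lborel) \<partial>lborel)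
       = ennreal c * (K * K) * ennreal (L w * ?q w)" for w
      using L[of w] c0 qweight_pos[of w]
      by (simp add: nn_integral_cmult nn_integral_multc K_def ennreal_mult mult_ac)
    then show ?thesis by (simp add: nn_integral_cmult)
  qed
  also have "\<dots> \<le> (\<integral>\<^sup>+w. ennreal (L w) * (\<integral>\<^sup>+y. ennreal (bump_at 0 y) * (\<integral>\<^sup>+v. ennreal (?q (w + (y - v))) * ennreal (bump_at 0 v) \<partial>lborel) \<partial>lborel) \<partial>lborel)"
  proof (rule nn_integral_mono, rule mult_left_mono, rule nn_integral_mono)
    fix w y :: 'a
    show "ennreal (bump_at 0 (y::'a)) * (\<integral>\<^sup>+v. ennreal (c * ?q w) * ennreal (bump_at 0 (v::'a)) \<partial>lborel) \<le> ennreal (bump_at 0 y) * (\<integral>\<^sup>+v. ennreal (?q (w + (y - v))) * ennreal (bump_at 0 v) \<partial>lborel)"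
    proof (cases "bump_at 0 y = 0")
      case False
      show ?thesis
      proof (intro mult_left_mono nn_integral_mono)
        fix v :: 'a
        show "ennreal (c * ?q w) * ennreal (bump_at 0 v) \<le> ennreal (?q (w + (y - v))) * ennreal (bump_at 0 v)"
        proof (cases "bump_at 0 v = 0")
          case v: False
          have "\<bar>(y - v) \<bullet> b\<bar> \<le> 2" if "b \<in> Basis" for b
            using bump_at_eq_0[OF that, of y 0] bump_at_eq_0[OF that, of v 0] False v by (force simp: inner_diff_left)
          then show ?thesis unfolding c_def by (intro mult_right_mono ennreal_leI qweight_shift) auto
        qed simp
      qed simp
    qed simp
  qed simp
  also have "\<dots> = (\<integral>\<^sup>+w. \<integral>\<^sup>+y. \<integral>\<^sup>+z. ennreal (?q z * bump_at z (w + y) * bump_at 0 y * L w) \<partial>lborel \<partial>lborel \<partial>lborel)"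
  proof (rule nn_integral_cong)
    fix w :: 'a
    have "ennreal (L w) * (\<integral>\<^sup>+y. ennreal (bump_at 0 y) * (\<integral>\<^sup>+v. ennreal (?q (w + (y - v))) * ennreal (bump_at 0 v) \<partial>lborel) \<partial>lborel)
       = (\<integral>\<^sup>+y. (\<integral>\<^sup>+v. ennreal (L w) * (ennreal (bump_at 0 y) * (ennreal (?q (w + (y - v))) * ennreal (bump_at 0 v))) \<partial>lborel) \<partial>lborel)"
      by (simp add: nn_integral_cmult)
    also have "\<dots> = (\<integral>\<^sup>+y. (\<integral>\<^sup>+v. ennreal (?q (w + y - v) * bump_at (w + y - v) (w + y) * bump_at 0 y * L w) \<partial>lborel) \<partial>lborel)"
    proof (intro nn_integral_cong)
      fix y v :: 'a
      have "bump_at (w + y - v) (w + y) = bump_at 0 v" by (simp add: bump_at_def)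
      then show "ennreal (L w) * (ennreal (bump_at 0 y) * (ennreal (?q (w + (y - v))) * ennreal (bump_at 0 v))) =
        ennreal (?q (w + y - v) * bump_at (w + y - v) (w + y) * bump_at 0 y * L w)"
        using L[of w] less_imp_le[OF qweight_pos[of "w + y - v"]] by (simp add: ennreal_mult mult_ac add_diff_eq)
    qed
    also have "\<dots> = (\<integral>\<^sup>+y. \<integral>\<^sup>+z. ennreal (?q z * bump_at z (w + y) * bump_at 0 y * L w) \<partial>lborel \<partial>lborel)"
    proof (rule nn_integral_cong)
      fix y
      show "(\<integral>\<^sup>+v. ennreal (?q (w + y - v) * bump_at (w + y - v) (w + y) * bump_at 0 y * L w) \<partial>lborel) = (\<integral>\<^sup>+z. ennreal (?q z * bump_at z (w + y) * bump_at 0 y * L w) \<partial>lborel)"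
        by (rule nn_integral_lborel_minus[of "\<lambda>z. ennreal (?q z * bump_at z (w + y) * bump_at 0 y * L w)" "w + y"]) measurable
    qed
    finally show "ennreal (L w) * (\<integral>\<^sup>+y. ennreal (bump_at 0 y) * (\<integral>\<^sup>+v. ennreal (?q (w + (y - v))) * ennreal (bump_at 0 v) \<partial>lborel) \<partial>lborel)
       = (\<integral>\<^sup>+y. \<integral>\<^sup>+z. ennreal (?q z * bump_at z (w + y) * bump_at 0 y * L w) \<partial>lborel \<partial>lborel)" .
  qed
  also have "\<dots> = (\<integral>\<^sup>+y. \<integral>\<^sup>+w. \<integral>\<^sup>+z. ennreal (?q z * bump_at z (w + y) * bump_at 0 y * L w) \<partial>lborel \<partial>lborel \<partial>lborel)"
    by (rule lborel_pair.Fubini') measurable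
  also have "\<dots> = (\<integral>\<^sup>+y. \<integral>\<^sup>+z. \<integral>\<^sup>+w. ennreal (?q z * bump_at z (w + y) * bump_at 0 y * L w) \<partial>lborel \<partial>lborel \<partial>lborel)"
    by (rule nn_integral_cong, rule lborel_pair.Fubini') measurable
  also have "\<dots> = (\<integral>\<^sup>+z. \<integral>\<^sup>+y. \<integral>\<^sup>+w. ennreal (?q z * bump_at z (w + y) * bump_at 0 y * L w) \<partial>lborel \<partial>lborel \<partial>lborel)"
    by (rule lborel_pair.Fubini') measurable
  also have "\<dots> \<le> (\<integral>\<^sup>+z. ennreal (?q z) * ennreal A \<partial>lborel)"
  proof (rule nn_integral_mono)
    fix z :: 'a
    have "(\<integral>\<^sup>+y. \<integral>\<^sup>+w. ennreal (?q z * bump_at z (w + y) * bump_at 0 y * L w) \<partial>lborel \<partial>lborel)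
       = (\<integral>\<^sup>+y. \<integral>\<^sup>+x. ennreal (?q z * bump_at z x * bump_at 0 y * L (x - y)) \<partial>lborel \<partial>lborel)"
      using nn_integral_lborel_plus[of "\<lambda>x. ennreal (?q z * bump_at z x * bump_at 0 y * L (x - y))" y for y] by simp
    also have "\<dots> = ennreal (?q z) * (\<integral>\<^sup>+y. \<integral>\<^sup>+x. ennreal (bump_at z x * bump_at 0 y * L (x - y)) \<partial>lborel \<partial>lborel)"
    proof -
      have "ennreal (?q z * bump_at z x * bump_at 0 y * L (x - y)) = ennreal (?q z) * ennreal (bump_at z x * bump_at 0 y * L (x - y))" for x y
        using L[of "x - y"] qweight_pos[of z] by (simp add: ennreal_mult[symmetric] mult_ac)
      then show ?thesis by (simp add: nn_integral_cmult)
    qed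
    also have "\<dots> \<le> ennreal (?q z) * ennreal A" by (intro mult_left_mono A) auto
    finally show "(\<integral>\<^sup>+y. \<integral>\<^sup>+w. ennreal (?q z * bump_at z (w + y) * bump_at 0 y * L w) \<partial>lborel \<partial>lborel) \<le> ennreal (?q z) * ennreal A" .
  qed
  also have "\<dots> < \<infinity>" using nn_integral_qweight[where 'a='a] by (simp add: nn_integral_multc ennreal_mult_less_top)
  finally have fin: "ennreal c * (K * K) * (\<integral>\<^sup>+w. ennreal (L w * ?q w) \<partial>lborel) < \<infinity>" .
  have "ennreal c * (K * K) \<noteq> 0" using nn_integral_bump_pos[where 'a='a] c0 by (auto simp: K_def)
  then show ?thesis using fin by (auto simp: ennreal_mult_less_top ennreal_mult_eq_top_iff less_top)
qed

section \<open>Gaussian test functions reached through cutoffs\<close>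

definition gauss_cut_hat :: "real \<Rightarrow> nat \<Rightarrow> real \<Rightarrow> complex" where
  "gauss_cut_hat u n y = (CLINT \<xi>|lborel. iexp (y * \<xi>) * of_real (gauss_cut u n \<xi>))"

text \<open>Test functions are real, so a cosine takes the place of the character at z. The
  resulting spectral formula therefore concerns the sum of the values at z and -z.\<close>

definition cutoff_test :: "real \<Rightarrow> 'a::euclidean_space \<Rightarrow> nat \<Rightarrow> 'a \<Rightarrow> real" where
  "cutoff_test u z n \<xi> = cos (z \<bullet> \<xi>) * (\<Prod>b\<in>Basis. gauss_cut u n (\<xi> \<bullet> b))"

lemma prod_iexp: "(\<Prod>b\<in>Basis. iexp ((z \<bullet> b) * (\<xi> \<bullet> b))) = iexp (z \<bullet> (\<xi>::'a::euclidean_space))"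
  by (subst euclidean_inner[of z \<xi>]) (simp add: exp_sum[symmetric] sum_distrib_left)

lemma cutoff_test_eq: "cutoff_test u z n \<xi> = Re (\<Prod>b\<in>Basis. iexp ((z \<bullet> b) * (\<xi> \<bullet> b)) * of_real (gauss_cut u n (\<xi> \<bullet> b)))"
proof -
  have "Re (w * complex_of_real c) = Re w * c" for w c by simp
  then show ?thesis by (simp only: cutoff_test_def prod.distrib prod_iexp flip: of_real_prod) (simp add: Re_exp)
qed

lemma cutoff_test_measurable[measurable]: "cutoff_test u z n \<in> borel_measurable borel"
  unfolding cutoff_test_def by measurable

lemma test_fun_cutoff_test: "test_fun (cutoff_test u (z::'a::euclidean_space) n)"
  unfolding test_fun_def
proof
  have "csmooth (\<lambda>x. iexp (c * x) * of_real (gauss_cut u n x))" for c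
    using csmooth_mult[OF csmooth_cis[of "\<i> * of_real c"] csmooth_gauss_cut] by (simp add: mult.assoc)
  from smooth_fun_Re_prod[of "\<lambda>b x. iexp ((z \<bullet> b) * x) * of_real (gauss_cut u n x)", OF this]
  show "smooth_fun (cutoff_test u z n)" unfolding cutoff_test_eq[abs_def] .
  show "compact (closure {x. cutoff_test u z n x \<noteq> 0})"
  proof (rule compact_closure_box_support[of "real (Suc n)"])
    fix x b :: 'a assume b: "b \<in> Basis" "real (Suc n) < \<bar>x \<bullet> b\<bar>"
    then have "gauss_cut u n (x \<bullet> b) = 0" by (simp add: gauss_cut_def bump_eq_0 abs_divide field_simps)
    with b show "cutoff_test u z n x = 0" by (auto simp: cutoff_test_def)
  qed
qed

text \<open>Writing the cosine as two exponentials splits the transform into two tensor products,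
  centred at z and at -z, and Fubini factorises each.\<close>

lemma fourier_cutoff_test:
  fixes z x :: "'a::euclidean_space"
  assumes u: "0 < u"
  shows "fourier (cutoff_test u z n) x = ((\<Prod>b\<in>Basis. gauss_cut_hat u n ((z - x) \<bullet> b)) + (\<Prod>b\<in>Basis. gauss_cut_hat u n ((- z - x) \<bullet> b))) / 2"
proof -
  define F where "F v \<xi> = (\<Prod>b\<in>Basis. iexp ((v \<bullet> b) * (\<xi> \<bullet> b)) * complex_of_real (gauss_cut u n (\<xi> \<bullet> b)))" for v \<xi> :: 'a
  have I: "integrable lborel (\<lambda>\<xi>. iexp (c * \<xi>) * complex_of_real (gauss_cut u n \<xi>))" for c
    by (intro integrable_iexp_mult integrable_gauss_cut u) simp
  have FI: "integrable lborel (F v)" for v unfolding F_def by (intro integral_lborel_prod(1) I)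
  have Feq: "integral\<^sup>L lborel (F v) = (\<Prod>b\<in>Basis. gauss_cut_hat u n (v \<bullet> b))" for v
    unfolding F_def gauss_cut_hat_def by (intro integral_lborel_prod(2) I)
  have Fe: "F v \<xi> = iexp (v \<bullet> \<xi>) * of_real (\<Prod>b\<in>Basis. gauss_cut u n (\<xi> \<bullet> b))" for v \<xi>
    by (simp only: F_def prod.distrib prod_iexp flip: of_real_prod)
  have "iexp (- (x \<bullet> \<xi>)) * complex_of_real (cutoff_test u z n \<xi>) = (F (z - x) \<xi> + F (- z - x) \<xi>) / 2" for \<xi>
  proof -
    have c: "complex_of_real (cos (z \<bullet> \<xi>)) = (iexp (z \<bullet> \<xi>) + iexp (- (z \<bullet> \<xi>))) / 2"
      by (simp add: cos_exp_eq cos_of_real[symmetric] algebra_simps)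
    have "(z - x) \<bullet> \<xi> = - (x \<bullet> \<xi>) + z \<bullet> \<xi>" "(- z - x) \<bullet> \<xi> = - (x \<bullet> \<xi>) + - (z \<bullet> \<xi>)"
      by (simp_all add: inner_diff_left)
    then have e: "iexp ((z - x) \<bullet> \<xi>) = iexp (- (x \<bullet> \<xi>)) * iexp (z \<bullet> \<xi>)" "iexp ((- z - x) \<bullet> \<xi>) = iexp (- (x \<bullet> \<xi>)) * iexp (- (z \<bullet> \<xi>))"
      by (simp_all only: of_real_add distrib_left exp_add)
    have alg: "i * ((p + q) / 2 * G) = (i * p * G + i * q * G) / 2" for i p q G :: complex by (simp add: algebra_simps)
    show ?thesis unfolding Fe cutoff_test_def of_real_mult c e by (rule alg)
  qed
  then have "fourier (cutoff_test u z n) x = (CLINT \<xi>|lborel. (F (z - x) \<xi> + F (- z - x) \<xi>) / 2)"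
    unfolding fourier_def by (simp only:)
  also have "\<dots> = (integral\<^sup>L lborel (F (z - x)) + integral\<^sup>L lborel (F (- z - x))) / 2"
    using FI by simp
  finally show ?thesis unfolding Feq .
qed

lemma fourier_cutoff_test_limit:
  fixes z x :: "'a::euclidean_space"
  assumes u: "0 < u"
  shows "(\<lambda>n. fourier (cutoff_test u z n) x) \<longlonglongrightarrow>
    of_real ((2 * pi) ^ DIM('a) * (heat_kernel u (z - x) + heat_kernel u (- z - x)) / 2)"
proof -
  have "(\<lambda>n. \<Prod>b\<in>Basis. gauss_cut_hat u n (v \<bullet> b)) \<longlonglongrightarrow> (\<Prod>b\<in>Basis. of_real (2 * pi * normal_density 0 (sqrt u) (v \<bullet> b)))" for v :: 'a
    unfolding gauss_cut_hat_def by (intro tendsto_prod gauss_cut_fourier_limit u)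
  moreover have "(\<Prod>b\<in>Basis. complex_of_real (2 * pi * normal_density 0 (sqrt u) (v \<bullet> b))) = of_real ((2 * pi) ^ DIM('a) * heat_kernel u v)" for v :: 'a
    using u by (simp only: heat_kernel_prod of_real_prod[symmetric] prod.distrib prod_constant power_mult_distrib)
  ultimately have *: "(\<lambda>n. \<Prod>b\<in>Basis. gauss_cut_hat u n (v \<bullet> b)) \<longlonglongrightarrow> of_real ((2 * pi) ^ DIM('a) * heat_kernel u v)" for v :: 'a by simp
  have "(\<lambda>n. fourier (cutoff_test u z n) x) \<longlonglongrightarrow>
    (of_real ((2 * pi) ^ DIM('a) * heat_kernel u (z - x)) + of_real ((2 * pi) ^ DIM('a) * heat_kernel u (- z - x))) / 2"
    unfolding fourier_cutoff_test[OF u] by (intro tendsto_intros *) auto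
  then show ?thesis by (simp add: algebra_simps)
qed

text \<open>The one-dimensional bound C / (1 + y^2) is multiplied over the coordinates and recentred
  from z and -z to 0 by Peetre's inequality.\<close>

lemma fourier_cutoff_test_bound:
  fixes z :: "'a::euclidean_space"
  assumes u: "0 < u"
  shows "\<exists>C\<ge>0. \<forall>n x. norm (fourier (cutoff_test u z n) x) \<le> C * qweight x"
proof -
  obtain C where C: "0 \<le> C" "\<And>n y. norm (gauss_cut_hat u n y) \<le> C / (1 + y\<^sup>2)"
    using gauss_cut_fourier_bound[OF u] unfolding gauss_cut_hat_def by blast
  define D where "D v = (\<Prod>b\<in>Basis. C * (2 * (1 + (v \<bullet> b)\<^sup>2)))" for v :: 'a
  have D0: "0 \<le> D v" for v unfolding D_def using C by (intro prod_nonneg) auto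
  have 1: "norm (\<Prod>b\<in>Basis. gauss_cut_hat u n ((v - x) \<bullet> b)) \<le> D v * qweight x" for v x :: 'a and n
  proof -
    have "norm (\<Prod>b\<in>Basis. gauss_cut_hat u n ((v - x) \<bullet> b)) = (\<Prod>b\<in>Basis. norm (gauss_cut_hat u n ((v - x) \<bullet> b)))" by (simp add: prod_norm)
    also have "\<dots> \<le> (\<Prod>b\<in>Basis. C * (2 * (1 + (v \<bullet> b)\<^sup>2)) * (1 / (1 + (x \<bullet> b)\<^sup>2)))"
    proof (intro prod_mono conjI)
      fix b :: 'a
      have "norm (gauss_cut_hat u n ((v - x) \<bullet> b)) \<le> C * (1 / (1 + (v \<bullet> b - x \<bullet> b)\<^sup>2))" using C(2)[of n "(v - x) \<bullet> b"] by (simp add: inner_diff_left)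
      also have "\<dots> \<le> C * (2 * (1 + (v \<bullet> b)\<^sup>2) * (1 / (1 + (x \<bullet> b)\<^sup>2)))" by (intro mult_left_mono inverse_1_plus_sq_diff C)
      finally show "norm (gauss_cut_hat u n ((v - x) \<bullet> b)) \<le> C * (2 * (1 + (v \<bullet> b)\<^sup>2)) * (1 / (1 + (x \<bullet> b)\<^sup>2))" by (simp add: mult_ac)
    qed auto
    also have "\<dots> = D v * qweight x" by (simp only: D_def qweight_def prod.distrib)
    finally show ?thesis .
  qed
  have "norm (fourier (cutoff_test u z n) x) \<le> (D z + D (- z)) * qweight x" for n x
  proof -
    have "norm (fourier (cutoff_test u z n) x) \<le> (D z * qweight x + D (- z) * qweight x) / 2"
      unfolding fourier_cutoff_test[OF u] norm_divide using 1[of n z x] 1[of n "- z" x]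
      by (auto intro!: divide_right_mono norm_triangle_mono)
    also have "\<dots> \<le> (D z + D (- z)) * qweight x"
      using D0[of z] D0[of "- z"] qweight_pos[of x] by (simp add: algebra_simps)
    finally show ?thesis .
  qed
  then show ?thesis using D0[of z] D0[of "-z"] by (intro exI[of _ "D z + D (- z)"]) auto
qed

text \<open>Since the definition of the spectral measure only admits compactly supported test functions,
  the Gaussian is reached through the cutoffs \<open>cutoff_test\<close>.\<close>
lemma heat_conv_spectral:
  fixes L :: "'a::euclidean_space \<Rightarrow> real" and \<mu> :: "'a measure"
  assumes L[measurable]: "L \<in> borel_measurable borel" and Lp: "\<And>x. 0 \<le> L x" and pd: "nonneg_definite L"
    and mu: "sets \<mu> = sets borel" and ft: "is_fourier_transform \<mu> L" and u: "0 < u"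
    and gi: "integrable \<mu> (\<lambda>\<xi>. exp (- u * (norm \<xi>)\<^sup>2 / 2))"
  shows "heat_conv L u z < \<infinity>"
    and "enn2real (heat_conv L u z) + enn2real (heat_conv L u (- z)) =
       2 / (2 * pi) ^ DIM('a) * (\<integral>\<xi>. cos (z \<bullet> \<xi>) * exp (- u * (norm \<xi>)\<^sup>2 / 2) \<partial>\<mu>)"
proof -
  have mm[measurable_cong]: "sets \<mu> = sets borel" by (rule mu)
  have Lq: "integrable lborel (\<lambda>x. L x * qweight x)"
    using nn_integral_mult_qweight[OF L Lp pd]
    by (intro integrableI_nonneg AE_I2 mult_nonneg_nonneg Lp less_imp_le[OF qweight_pos]) auto
  have Lh: "integrable lborel (\<lambda>w. L w * heat_kernel u (v - w))" for v
  proof -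
    obtain C where C: "0 \<le> C" "\<And>w. heat_kernel u (v - w) \<le> C * qweight w" using heat_kernel_le_qweight[OF u, of v] by auto
    have "integrable lborel (\<lambda>w. C * (L w * qweight w))" using Lq by simp
    then show ?thesis
    proof (rule Bochner_Integration.integrable_bound)
      have "L w * heat_kernel u (v - w) \<le> L w * (C * qweight w)" for w by (intro mult_left_mono C Lp)
      then show "AE w in lborel. norm (L w * heat_kernel u (v - w)) \<le> norm (C * (L w * qweight w))"
        using Lp by (auto intro!: order_trans[OF _ abs_ge_self] simp: mult_ac)
    qed measurable
  qed
  have hc: "heat_conv L u v = ennreal (\<integral>w. L w * heat_kernel u (v - w) \<partial>lborel)" for v
    unfolding heat_conv_def using Lp by (intro nn_integral_eq_integral Lh) auto
  then show "heat_conv L u z < \<infinity>" by simp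
  obtain C where C: "0 \<le> C" "\<And>n x. norm (fourier (cutoff_test u z n) x) \<le> C * qweight x"
    using fourier_cutoff_test_bound[OF u, of z] by blast
  define R where "R x = (2 * pi) ^ DIM('a) * (heat_kernel u (z - x) + heat_kernel u (- z - x)) / 2" for x :: 'a
  have lim: "(\<lambda>n. complex_of_real (L x) * fourier (cutoff_test u z n) x) \<longlonglongrightarrow> complex_of_real (L x) * of_real (R x)" for x
    unfolding R_def by (intro tendsto_intros fourier_cutoff_test_limit u)
  have ftn: "integrable lborel (\<lambda>x. complex_of_real (L x) * fourier (cutoff_test u z n) x)"
    "(CLINT x|lborel. complex_of_real (L x) * fourier (cutoff_test u z n) x) = complex_of_real (\<integral>\<xi>. cutoff_test u z n \<xi> \<partial>\<mu>)" for n
    using ft test_fun_cutoff_test[of u z n] unfolding is_fourier_transform_def by auto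
  \<comment> \<open>On the physical side the domination is by L * qweight, whose integrability comes
    from nonnegative definiteness. On the spectral side, in \<open>l2\<close>, the Gaussian itself
    dominates up to a factor exp 2 per coordinate.\<close>
  have l1: "(\<lambda>n. CLINT x|lborel. complex_of_real (L x) * fourier (cutoff_test u z n) x) \<longlonglongrightarrow> (CLINT x|lborel. complex_of_real (L x) * of_real (R x))"
  proof (rule integral_dominated_convergence[where w="\<lambda>x. C * (L x * qweight x)"])
    show "integrable lborel (\<lambda>x. C * (L x * qweight x))" using Lq by simp
    show "(\<lambda>x. complex_of_real (L x) * of_real (R x)) \<in> borel_measurable lborel" unfolding R_def by measurable
    show "(\<lambda>x. complex_of_real (L x) * fourier (cutoff_test u z n) x) \<in> borel_measurable lborel" for n
      using ftn(1) by (rule borel_measurable_integrable)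
    show "AE x in lborel. norm (complex_of_real (L x) * fourier (cutoff_test u z n) x) \<le> C * (L x * qweight x)" for n
    proof (rule AE_I2)
      fix x
      have "L x * norm (fourier (cutoff_test u z n) x) \<le> L x * (C * qweight x)" by (intro mult_left_mono C Lp)
      then show "norm (complex_of_real (L x) * fourier (cutoff_test u z n) x) \<le> C * (L x * qweight x)"
        using Lp[of x] by (simp add: norm_mult mult_ac)
    qed
  qed (use lim in auto)
  have glim: "(\<lambda>n. cutoff_test u z n \<xi>) \<longlonglongrightarrow> cos (z \<bullet> \<xi>) * exp (- u * (norm \<xi>)\<^sup>2 / 2)" for \<xi>
  proof -
    have "(\<lambda>n. bump (y / real (Suc n))) \<longlonglongrightarrow> bump 0" for y
      using bump_cont[of UNIV] LIMSEQ_Suc[OF lim_const_over_n[of y]]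
      by (intro isCont_tendsto_compose[of _ bump]) (auto simp: continuous_on_eq_continuous_at)
    then have "(\<lambda>n. cutoff_test u z n \<xi>) \<longlonglongrightarrow> cos (z \<bullet> \<xi>) * (\<Prod>b\<in>Basis. exp (- u * (\<xi> \<bullet> b)\<^sup>2 / 2) * 1)"
      unfolding cutoff_test_def gauss_cut_def bump_0 by (intro tendsto_intros)
    also have "(\<Prod>b\<in>Basis. exp (- u * (\<xi> \<bullet> b)\<^sup>2 / 2) * 1) = exp (- u * (norm \<xi>)\<^sup>2 / 2)"
      by (simp add: norm_sq_Basis exp_sum[symmetric] sum_distrib_left sum_divide_distrib sum_negf)
    finally show ?thesis .
  qed
  have l2: "(\<lambda>n. \<integral>\<xi>. cutoff_test u z n \<xi> \<partial>\<mu>) \<longlonglongrightarrow> (\<integral>\<xi>. cos (z \<bullet> \<xi>) * exp (- u * (norm \<xi>)\<^sup>2 / 2) \<partial>\<mu>)"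
  proof (rule integral_dominated_convergence[where w="\<lambda>\<xi>. exp 2 ^ DIM('a) * exp (- u * (norm \<xi>)\<^sup>2 / 2)"])
    show "AE \<xi> in \<mu>. norm (cutoff_test u z n \<xi>) \<le> exp 2 ^ DIM('a) * exp (- u * (norm \<xi>)\<^sup>2 / 2)" for n
    proof (rule AE_I2)
      fix \<xi> :: 'a
      have "norm (cutoff_test u z n \<xi>) \<le> 1 * (\<Prod>b\<in>Basis. gauss_cut u n (\<xi> \<bullet> b))"
        unfolding cutoff_test_def norm_mult by (intro mult_mono) (auto simp: prod_nonneg gauss_cut_nonneg)
      also have "\<dots> \<le> 1 * (\<Prod>b\<in>Basis. exp 2 * exp (- u * (\<xi> \<bullet> b)\<^sup>2 / 2))"
        by (intro mult_left_mono prod_mono conjI gauss_cut_nonneg gauss_cut_le) auto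
      also have "\<dots> = exp 2 ^ DIM('a) * exp (- u * (norm \<xi>)\<^sup>2 / 2)"
        by (simp add: norm_sq_Basis prod.distrib exp_sum[symmetric] sum_distrib_left sum_divide_distrib sum_negf)
      finally show "norm (cutoff_test u z n \<xi>) \<le> exp 2 ^ DIM('a) * exp (- u * (norm \<xi>)\<^sup>2 / 2)" .
    qed
  qed (use gi glim in \<open>auto\<close>)
  have "(CLINT x|lborel. complex_of_real (L x) * of_real (R x)) = complex_of_real (\<integral>\<xi>. cos (z \<bullet> \<xi>) * exp (- u * (norm \<xi>)\<^sup>2 / 2) \<partial>\<mu>)"
    using l1 tendsto_of_real[OF l2] unfolding ftn(2) by (rule LIMSEQ_unique)
  also have "(CLINT x|lborel. complex_of_real (L x) * of_real (R x)) = complex_of_real (\<integral>x. L x * R x \<partial>lborel)"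
    by (simp flip: of_real_mult)
  finally have "(\<integral>x. L x * R x \<partial>lborel) = (\<integral>\<xi>. cos (z \<bullet> \<xi>) * exp (- u * (norm \<xi>)\<^sup>2 / 2) \<partial>\<mu>)" by (simp only: of_real_eq_iff)
  moreover have "(\<integral>x. L x * R x \<partial>lborel) = (2 * pi) ^ DIM('a) / 2 * ((\<integral>w. L w * heat_kernel u (z - w) \<partial>lborel) + (\<integral>w. L w * heat_kernel u (- z - w) \<partial>lborel))"
  proof -
    have "(\<integral>x. L x * R x \<partial>lborel) = (\<integral>x. (2 * pi) ^ DIM('a) / 2 * (L x * heat_kernel u (z - x) + L x * heat_kernel u (- z - x)) \<partial>lborel)"
      by (intro Bochner_Integration.integral_cong) (auto simp: R_def algebra_simps)
    then show ?thesis using Lh by simp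
  qed
  moreover have "0 \<le> (\<integral>w. L w * heat_kernel u (v - w) \<partial>lborel)" for v using Lp by (intro integral_nonneg_AE) auto
  ultimately show "enn2real (heat_conv L u z) + enn2real (heat_conv L u (- z)) =
       2 / (2 * pi) ^ DIM('a) * (\<integral>\<xi>. cos (z \<bullet> \<xi>) * exp (- u * (norm \<xi>)\<^sup>2 / 2) \<partial>\<mu>)"
    unfolding hc by (simp add: field_simps)
qed

section \<open>Brownian motion\<close>

text \<open>A continuous path is the pointwise limit of its values at the times k/(n+1) just below
  the given time. Each approximation is glued from countably many measurable pieces, hence jointly
  measurable.\<close>

lemma bm_joint_measurable:
  fixes B :: "real \<Rightarrow> 'b \<Rightarrow> 'd::euclidean_space"
  assumes m: "\<And>t. B t \<in> borel_measurable P" and c: "\<And>\<omega>. continuous_on {0..} (\<lambda>t. B t \<omega>)"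
  shows "(\<lambda>z. B (max 0 (fst z)) (snd z)) \<in> borel_measurable (borel \<Otimes>\<^sub>M P)"
proof (rule borel_measurable_LIMSEQ_metric)
  let ?k = "\<lambda>n z. nat \<lfloor>max 0 (fst z) * real (Suc n)\<rfloor>"
  show "(\<lambda>z. B (real (?k n z) / real (Suc n)) (snd z)) \<in> borel_measurable (borel \<Otimes>\<^sub>M P)" for n
    by (rule measurable_compose_countable[of "\<lambda>k z. B (real k / real (Suc n)) (snd z)" _ _ "?k n"])
      (auto intro!: measurable_compose[OF measurable_snd m])
  fix z :: "real \<times> 'b"
  define a where "a = max 0 (fst z)"
  have a: "0 \<le> a" by (simp add: a_def)
  have lim: "(\<lambda>n. real (nat \<lfloor>a * real (Suc n)\<rfloor>) / real (Suc n)) \<longlonglongrightarrow> a"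
  proof (rule tendsto_sandwich[of "\<lambda>n. a - 1 / real (Suc n)" _ _ "\<lambda>_. a"])
    show "\<forall>\<^sub>F n in sequentially. a - 1 / real (Suc n) \<le> real (nat \<lfloor>a * real (Suc n)\<rfloor>) / real (Suc n)"
    proof (intro always_eventually allI)
      fix n
      have "a * real (Suc n) - 1 \<le> real (nat \<lfloor>a * real (Suc n)\<rfloor>)" using a by linarith
      then show "a - 1 / real (Suc n) \<le> real (nat \<lfloor>a * real (Suc n)\<rfloor>) / real (Suc n)"
        by (subst le_divide_eq) (simp add: left_diff_distrib)
    qed
    show "\<forall>\<^sub>F n in sequentially. real (nat \<lfloor>a * real (Suc n)\<rfloor>) / real (Suc n) \<le> a"
    proof (intro always_eventually allI)
      fix n
      have "0 \<le> a * real (Suc n)" using a by simp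
      then have "real (nat \<lfloor>a * real (Suc n)\<rfloor>) \<le> a * real (Suc n)" by linarith
      then show "real (nat \<lfloor>a * real (Suc n)\<rfloor>) / real (Suc n) \<le> a"
        by (subst divide_le_eq) simp
    qed
    have "(\<lambda>n. a - 1 / real (Suc n)) \<longlonglongrightarrow> a - 0" by (intro tendsto_intros LIMSEQ_Suc[OF lim_const_over_n])
    then show "(\<lambda>n. a - 1 / real (Suc n)) \<longlonglongrightarrow> a" by simp
  qed auto
  show "(\<lambda>n. B (real (?k n z) / real (Suc n)) (snd z)) \<longlonglongrightarrow> B (max 0 (fst z)) (snd z)"
    unfolding a_def[symmetric] by (rule continuous_on_tendsto_compose[OF c lim]) (use a in auto)
qed

locale brownian =
  fixes P :: "'b measure" and B :: "real \<Rightarrow> 'b \<Rightarrow> 'd::euclidean_space"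
  assumes bm: "std_brownian_motion P B"

sublocale brownian \<subseteq> prob_space P
  using bm by (simp add: std_brownian_motion_def)

context brownian begin

lemma B_measurable[measurable]: "B t \<in> borel_measurable P"
  and B_cont: "continuous_on {0..} (\<lambda>t. B t \<omega>)"
  and B_distr: "0 \<le> s \<Longrightarrow> s < t \<Longrightarrow> distributed P lborel (\<lambda>\<omega>. B t \<omega> - B s \<omega>) (\<lambda>y. ennreal (heat_kernel (t - s) y))"
  and B_indep: "0 \<le> ts 0 \<Longrightarrow> (\<And>i. i < n \<Longrightarrow> ts i < ts (Suc i)) \<Longrightarrow>
     indep_vars (\<lambda>_. borel) (\<lambda>i \<omega>. B (ts (Suc i)) \<omega> - B (ts i) \<omega>) {..<n}"
  using bm by (auto simp: std_brownian_motion_def)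

text \<open>Paths frozen at negative times, so that they are continuous on the whole line.\<close>
definition B_ext :: "real \<Rightarrow> 'b \<Rightarrow> 'd" where "B_ext t = B (max 0 t)"

lemma B_ext_eq: "0 \<le> t \<Longrightarrow> B_ext t = B t" by (simp add: B_ext_def max_def)

lemma B_ext_measurable2: "(\<lambda>z. B_ext (fst z) (snd z)) \<in> borel_measurable (borel \<Otimes>\<^sub>M P)"
  unfolding B_ext_def by (rule bm_joint_measurable) (auto intro: B_cont)

lemma B_ext_measurable[measurable (raw)]:
  assumes "f \<in> borel_measurable M" "g \<in> M \<rightarrow>\<^sub>M P"
  shows "(\<lambda>x. B_ext (f x) (g x)) \<in> borel_measurable M"
  using measurable_compose[OF measurable_Pair[OF assms] B_ext_measurable2] by simp

lemma B_ext_cont: "continuous_on A (\<lambda>t. B_ext t \<omega>)"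
  unfolding B_ext_def by (rule continuous_on_compose2[OF B_cont[of \<omega>]]) (auto intro!: continuous_intros)

lemma nn_increment:
  assumes "0 \<le> s" "s < t" and [measurable]: "f \<in> borel_measurable borel"
  shows "(\<integral>\<^sup>+\<omega>. f (B t \<omega> - B s \<omega>) \<partial>P) = (\<integral>\<^sup>+y. ennreal (heat_kernel (t - s) y) * f y \<partial>lborel)"
  using distributed_nn_integral[OF B_distr[OF assms(1,2)], of f] by simp

text \<open>The increment has a heat kernel as its density, so by the semigroup law averaging adds
  the elapsed time to the smoothing parameter. Exchanging s and t changes the sign of the increment,
  and the kernel is even.\<close>

lemma nn_heat_conv:
  assumes L[measurable]: "L \<in> borel_measurable borel" and Lp: "\<And>x. 0 \<le> L x" and u: "0 < u" and st: "0 \<le> s" "0 \<le> t"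
  shows "(\<integral>\<^sup>+\<omega>. heat_conv L u (z + (B_ext t \<omega> - B_ext s \<omega>)) \<partial>P) = heat_conv L (u + \<bar>t - s\<bar>) z"
proof -
  have up: "(\<integral>\<^sup>+\<omega>. heat_conv L u (z + c *\<^sub>R (B b \<omega> - B a \<omega>)) \<partial>P) = heat_conv L (u + (b - a)) z"
    if ab: "0 \<le> a" "a < b" and c: "\<bar>c\<bar> = 1" for a b c
  proof -
    have "(\<integral>\<^sup>+\<omega>. heat_conv L u (z + c *\<^sub>R (B b \<omega> - B a \<omega>)) \<partial>P)
       = (\<integral>\<^sup>+y. ennreal (heat_kernel (b - a) y) * heat_conv L u (z + c *\<^sub>R y) \<partial>lborel)"
      by (rule nn_increment[OF ab, of "\<lambda>y. heat_conv L u (z + c *\<^sub>R y)"]) measurable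
    also have "\<dots> = (\<integral>\<^sup>+y. heat_conv L u (z + c *\<^sub>R y) * ennreal (heat_kernel (b - a) (0 + c *\<^sub>R y)) \<partial>lborel)"
    proof (rule nn_integral_cong)
      fix y :: 'd
      have "heat_kernel (b - a) (c *\<^sub>R y) = heat_kernel (b - a) y" using c by (simp add: heat_kernel_def)
      then show "ennreal (heat_kernel (b - a) y) * heat_conv L u (z + c *\<^sub>R y) = heat_conv L u (z + c *\<^sub>R y) * ennreal (heat_kernel (b - a) (0 + c *\<^sub>R y))"
        by (simp add: mult.commute)
    qed
    also have "\<dots> = (\<integral>\<^sup>+y. heat_conv L u (z + y) * ennreal (heat_kernel (b - a) y) \<partial>lborel)"
      using nn_integral_lborel_shift[of "\<lambda>y. heat_conv L u (z + y) * ennreal (heat_kernel (b - a) y)" c 0] c by simp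
    also have "\<dots> = heat_conv L (u + (b - a)) z" using ab by (intro heat_conv_semigroup L Lp u) auto
    finally show ?thesis .
  qed
  consider "s < t" | "t < s" | "s = t" by linarith
  then show ?thesis
  proof cases
    case 1 then show ?thesis using up[of s t 1] st by (simp add: B_ext_eq)
  next
    case 2 then show ?thesis using up[of t s "-1"] st by (simp add: B_ext_eq)
  next
    case 3 then show ?thesis by (simp add: emeasure_space_1)
  qed
qed

text \<open>Conditioning on X in the form of an inequality: by independence the pair has a product
  law, so Y is integrated first with X frozen.\<close>

lemma nn_indep_bound:
  assumes ind: "indep_var M1 X M2 Y"
    and g[measurable]: "g \<in> borel_measurable M1" and h[measurable]: "(\<lambda>z. h (fst z) (snd z)) \<in> borel_measurable (M1 \<Otimes>\<^sub>M M2)"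
    and b: "\<And>x. x \<in> space M1 \<Longrightarrow> (\<integral>\<^sup>+\<omega>. h x (Y \<omega>) \<partial>P) \<le> c"
  shows "(\<integral>\<^sup>+\<omega>. g (X \<omega>) * h (X \<omega>) (Y \<omega>) \<partial>P) \<le> (\<integral>\<^sup>+\<omega>. g (X \<omega>) \<partial>P) * c"
proof -
  have X[measurable]: "X \<in> P \<rightarrow>\<^sub>M M1" and Y[measurable]: "Y \<in> P \<rightarrow>\<^sub>M M2"
    and d: "distr P M1 X \<Otimes>\<^sub>M distr P M2 Y = distr P (M1 \<Otimes>\<^sub>M M2) (\<lambda>x. (X x, Y x))"
    using ind unfolding indep_var_distribution_eq by auto
  interpret D1: prob_space "distr P M1 X" by (rule prob_space_distr) simp
  interpret D2: prob_space "distr P M2 Y" by (rule prob_space_distr) simp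
  have "(\<integral>\<^sup>+\<omega>. g (X \<omega>) * h (X \<omega>) (Y \<omega>) \<partial>P) = (\<integral>\<^sup>+z. g (fst z) * h (fst z) (snd z) \<partial>distr P (M1 \<Otimes>\<^sub>M M2) (\<lambda>x. (X x, Y x)))"
    by (subst nn_integral_distr) auto
  also have "\<dots> = (\<integral>\<^sup>+x. \<integral>\<^sup>+y. g x * h x y \<partial>distr P M2 Y \<partial>distr P M1 X)"
    unfolding d[symmetric] by (subst D2.nn_integral_fst[symmetric]) auto
  also have "\<dots> = (\<integral>\<^sup>+x. g x * (\<integral>\<^sup>+\<omega>. h x (Y \<omega>) \<partial>P) \<partial>distr P M1 X)"
  proof (rule nn_integral_cong)
    fix x assume "x \<in> space (distr P M1 X)"
    then have x: "x \<in> space M1" by simp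
    have [measurable]: "h x \<in> borel_measurable M2" using measurable_compose[OF measurable_Pair1'[OF x] h] by simp
    show "(\<integral>\<^sup>+y. g x * h x y \<partial>distr P M2 Y) = g x * (\<integral>\<^sup>+\<omega>. h x (Y \<omega>) \<partial>P)"
      by (simp add: nn_integral_cmult nn_integral_distr)
  qed
  also have "\<dots> \<le> (\<integral>\<^sup>+x. g x * c \<partial>distr P M1 X)" by (intro nn_integral_mono mult_left_mono b) auto
  also have "\<dots> = (\<integral>\<^sup>+\<omega>. g (X \<omega>) \<partial>P) * c" by (simp add: nn_integral_multc nn_integral_distr)
  finally show ?thesis .
qed

text \<open>Induction on the number of times. The last position is the previous one plus an
  independent increment, and \<open>K u\<close> bounds the mean over an increment of length u
  uniformly in the starting point. Positions are rewritten as partial sums because independence is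
  available for increments.\<close>

lemma prefix_bound:
  fixes q :: "'d \<Rightarrow> ennreal"
  assumes q[measurable]: "q \<in> borel_measurable borel"
    and K: "\<And>u z. 0 < u \<Longrightarrow> (\<integral>\<^sup>+y. ennreal (heat_kernel u y) * q (z + y) \<partial>lborel) \<le> K u"
    and t0: "0 \<le> ts 0" and inc: "\<And>i. i < n \<Longrightarrow> ts i < ts (Suc i)"
  shows "(\<integral>\<^sup>+\<omega>. (\<Prod>i<n. q (B (ts (Suc i)) \<omega> - B (ts 0) \<omega>)) \<partial>P) \<le> (\<Prod>i<n. K (ts (Suc i) - ts i))"
  using inc
proof (induction n)
  case 0
  then show ?case by (simp add: emeasure_space_1)
next
  case (Suc n)
  define D where "D i \<omega> = B (ts (Suc i)) \<omega> - B (ts i) \<omega>" for i \<omega>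
  have tsn: "0 \<le> ts k" if "k \<le> n" for k using that
  proof (induction k)
    case (Suc k)
    then have "ts k < ts (Suc k)" using Suc.prems \<open>\<And>i. i < Suc n \<Longrightarrow> ts i < ts (Suc i)\<close> by auto
    then show ?case using Suc by auto
  qed (use t0 in simp)
  have tel: "(\<Sum>i<k. D i \<omega>) = B (ts k) \<omega> - B (ts 0) \<omega>" for k \<omega>
    unfolding D_def by (rule sum_lessThan_telescope)
  have ind: "indep_var (PiM {..<n} (\<lambda>_. borel)) (\<lambda>\<omega>. restrict (\<lambda>i. D i \<omega>) {..<n}) (PiM {n} (\<lambda>_. borel)) (\<lambda>\<omega>. restrict (\<lambda>i. D i \<omega>) {n})"
    by (rule indep_var_restrict[OF B_indep[of ts "Suc n", folded D_def]]) (use t0 Suc.prems in auto)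
  let ?X = "\<lambda>\<omega>. restrict (\<lambda>i. D i \<omega>) {..<n}" and ?Y = "\<lambda>\<omega>. restrict (\<lambda>i. D i \<omega>) {n}"
  define g where "g a = (\<Prod>i<n. q (\<Sum>j<Suc i. a j))" for a :: "nat \<Rightarrow> 'd"
  define h where "h a b = q ((\<Sum>j<n. a j) + b n)" for a b :: "nat \<Rightarrow> 'd"
  have gX: "g (?X \<omega>) = (\<Prod>i<n. q (B (ts (Suc i)) \<omega> - B (ts 0) \<omega>))" for \<omega>
    unfolding g_def
  proof (intro prod.cong refl)
    fix i assume "i \<in> {..<n}"
    then have "(\<Sum>j<Suc i. ?X \<omega> j) = (\<Sum>j<Suc i. D j \<omega>)" by (intro sum.cong) auto
    then show "q (\<Sum>j<Suc i. ?X \<omega> j) = q (B (ts (Suc i)) \<omega> - B (ts 0) \<omega>)" by (simp only: tel)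
  qed
  have hXY: "h (?X \<omega>) (?Y \<omega>) = q (B (ts (Suc n)) \<omega> - B (ts 0) \<omega>)" for \<omega>
  proof -
    have "(\<Sum>j<n. ?X \<omega> j) + ?Y \<omega> n = (\<Sum>j<Suc n. D j \<omega>)" by simp
    then show ?thesis unfolding h_def by (simp only: tel)
  qed
  have "(\<integral>\<^sup>+\<omega>. (\<Prod>i<Suc n. q (B (ts (Suc i)) \<omega> - B (ts 0) \<omega>)) \<partial>P) = (\<integral>\<^sup>+\<omega>. g (?X \<omega>) * h (?X \<omega>) (?Y \<omega>) \<partial>P)"
    unfolding gX hXY by simp
  also have "\<dots> \<le> (\<integral>\<^sup>+\<omega>. g (?X \<omega>) \<partial>P) * K (ts (Suc n) - ts n)"
  proof (rule nn_indep_bound[OF ind])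
    have mc: "(\<lambda>a. \<Sum>j<k. a j) \<in> borel_measurable (PiM {..<n} (\<lambda>_. borel :: 'd measure))" if "k \<le> n" for k
      using that by (intro borel_measurable_sum measurable_component_singleton) auto
    show "g \<in> borel_measurable (PiM {..<n} (\<lambda>_. borel))"
      unfolding g_def by (intro borel_measurable_prod_ennreal measurable_compose[OF mc q]) auto
    show "(\<lambda>z. h (fst z) (snd z)) \<in> borel_measurable (PiM {..<n} (\<lambda>_. borel) \<Otimes>\<^sub>M PiM {n} (\<lambda>_. borel))"
      unfolding h_def
      by (intro measurable_compose[OF _ q] borel_measurable_add measurable_compose[OF measurable_fst mc]
          measurable_compose[OF measurable_snd measurable_component_singleton]) auto
    fix a
    have "(\<integral>\<^sup>+\<omega>. h a (?Y \<omega>) \<partial>P) = (\<integral>\<^sup>+\<omega>. q ((\<Sum>j<n. a j) + (B (ts (Suc n)) \<omega> - B (ts n) \<omega>)) \<partial>P)"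
      by (simp add: h_def D_def)
    also have "\<dots> = (\<integral>\<^sup>+y. ennreal (heat_kernel (ts (Suc n) - ts n) y) * q ((\<Sum>j<n. a j) + y) \<partial>lborel)"
      by (rule nn_increment[of "ts n" "ts (Suc n)" "\<lambda>y. q ((\<Sum>j<n. a j) + y)"]) (use tsn[of n] Suc.prems[of n] in auto)
    also have "\<dots> \<le> K (ts (Suc n) - ts n)" using Suc.prems[of n] by (intro K) auto
    finally show "(\<integral>\<^sup>+\<omega>. h a (?Y \<omega>) \<partial>P) \<le> K (ts (Suc n) - ts n)" .
  qed
  also have "\<dots> \<le> (\<Prod>i<n. K (ts (Suc i) - ts i)) * K (ts (Suc n) - ts n)"
    unfolding gX by (intro mult_right_mono Suc.IH Suc.prems) auto
  finally show ?case by simp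
qed

end

text \<open>The function exp F solves (exp F)' = - f exp F with exp F = 1 at R, so the fundamental
  theorem of calculus applies. It needs a continuous f, which is why the singular kernel is
  regularised before Khasminskii's lemma.\<close>

lemma exp_integral_identity:
  fixes f :: "real \<Rightarrow> real"
  assumes f: "continuous_on UNIV f" and f0: "\<And>v. 0 \<le> f v" and aR: "a \<le> R"
  defines "F \<equiv> \<lambda>v. LINT u|lborel. f u * indicator {v..R} u"
  shows "ennreal (exp (F a)) = 1 + (\<integral>\<^sup>+v. ennreal (f v * exp (F v)) * indicator {a..R} v \<partial>lborel)"
proof -
  \<comment> \<open>Starting the primitive at a - 1 makes its derivative at the endpoint a
    two-sided.\<close>
  define \<Phi> where "\<Phi> v = integral {a - 1..v} f" for v
  have d: "(\<Phi> has_real_derivative f v) (at v)" if "v \<in> {a..R}" for v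
  proof -
    have "(\<Phi> has_real_derivative f v) (at v within {a - 1..R + 1})"
      unfolding \<Phi>_def using that by (intro integral_has_real_derivative continuous_on_subset[OF f]) auto
    moreover have "at v within {a - 1..R + 1} = at v" using that by (intro at_within_Icc_at) auto
    ultimately show ?thesis by simp
  qed
  have [measurable]: "f \<in> borel_measurable borel" using f by (rule borel_measurable_continuous_onI)
  have F: "F v = \<Phi> R - \<Phi> v" if "v \<in> {a..R}" for v
    unfolding F_def using that by (intro integral_FTC_Icc_nonneg d f0) auto
  define G where "G v = - exp (\<Phi> R - \<Phi> v)" for v
  define g where "g v = (if v \<in> {a..R} then f v * exp (\<Phi> R - \<Phi> v) else 0)" for v
  have cont: "continuous_on {a..R} (\<lambda>v. f v * exp (\<Phi> R - \<Phi> v))"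
  proof -
    have "continuous_on {a..R} \<Phi>"
      by (rule DERIV_continuous_on[where D=f]) (rule has_field_derivative_at_within[OF d])
    moreover have "continuous_on {a..R} f" by (rule continuous_on_subset[OF f]) simp
    ultimately show ?thesis by (intro continuous_intros)
  qed
  have [measurable]: "g \<in> borel_measurable borel"
    unfolding g_def by (rule borel_measurable_continuous_on_if[OF _ cont]) auto
  have "(\<integral>\<^sup>+v. ennreal (g v) * indicator {a..R} v \<partial>lborel) = G R - G a"
  proof (rule nn_integral_FTC_Icc)
    fix v assume v: "v \<in> {a..R}"
    show "(G has_real_derivative g v) (at v)"
      unfolding G_def using v by (auto intro!: derivative_eq_intros d simp: g_def)
    show "0 \<le> g v" using f0 by (simp add: g_def)
  qed (use aR in auto)
  also have "G R - G a = exp (F a) - 1" using F[of a] aR by (simp add: G_def)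
  also have "(\<integral>\<^sup>+v. ennreal (g v) * indicator {a..R} v \<partial>lborel) = (\<integral>\<^sup>+v. ennreal (f v * exp (F v)) * indicator {a..R} v \<partial>lborel)"
    by (intro nn_integral_cong) (auto simp: g_def F split: split_indicator)
  finally have e: "(\<integral>\<^sup>+v. ennreal (f v * exp (F v)) * indicator {a..R} v \<partial>lborel) = ennreal (exp (F a) - 1)" .
  have "0 \<le> F a" unfolding F_def using f0 by (intro integral_nonneg_AE) auto
  then have "1 + ennreal (exp (F a) - 1) = ennreal (1 + (exp (F a) - 1))" by (subst ennreal_plus) auto
  then show ?thesis unfolding e by simp
qed

section \<open>Khasminskii's lemma\<close>

context brownian begin

text \<open>The energy collected during [a, R] relative to the base time t0. Base time and lower
  limit are separate parameters, because the iteration moves the lower limit to later times while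
  the base stays.\<close>

definition path_energy :: "(real \<Rightarrow> real) \<Rightarrow> ('d \<Rightarrow> real) \<Rightarrow> real \<Rightarrow> real \<Rightarrow> real \<Rightarrow> 'b \<Rightarrow> real" where
  "path_energy w q R t0 a \<omega> = (LINT v|lborel. (w (v - t0) * q (B_ext v \<omega> - B_ext t0 \<omega>)) * indicator {a..R} v)"

lemma path_energy_measurable:
  assumes [measurable]: "w \<in> borel_measurable borel" "q \<in> borel_measurable borel"
    "t \<in> borel_measurable M" "a \<in> borel_measurable M" "X \<in> M \<rightarrow>\<^sub>M P"
  shows "(\<lambda>x. path_energy w q R (t x) (a x) (X x)) \<in> borel_measurable M"
proof -
  have "(\<lambda>x. path_energy w q R (t x) (a x) (X x)) =
    (\<lambda>x. LINT v|lborel. (w (v - t x) * q (B_ext v (X x) - B_ext (t x) (X x))) * (if a x \<le> v \<and> v \<le> R then 1 else 0))"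
    unfolding path_energy_def by (intro ext Bochner_Integration.integral_cong) (auto simp: indicator_def)
  also have "\<dots> \<in> borel_measurable M" by measurable
  finally show ?thesis .
qed

lemma path_cont:
  fixes w :: "real \<Rightarrow> real" and q :: "'d \<Rightarrow> real"
  assumes w: "continuous_on UNIV w" and q: "continuous_on UNIV q"
  shows "continuous_on A (\<lambda>v. w (v - t0) * q (B_ext v \<omega> - B_ext t0 \<omega>))"
proof (rule continuous_on_mult)
  show "continuous_on A (\<lambda>v. w (v - t0))"
    by (rule continuous_on_compose2[OF w]) (auto intro!: continuous_intros)
  show "continuous_on A (\<lambda>v. q (B_ext v \<omega> - B_ext t0 \<omega>))"
    by (rule continuous_on_compose2[OF q]) (auto intro!: continuous_on_diff B_ext_cont)
qed

lemma path_energy_bounds: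
  assumes w: "continuous_on UNIV w" "\<And>u. 0 \<le> w u" "\<And>u v. 0 \<le> u \<Longrightarrow> u \<le> v \<Longrightarrow> w v \<le> w u"
    and q: "continuous_on UNIV q" "\<And>z. 0 \<le> q z" "\<And>z. q z \<le> Q" and t: "t0 \<le> a" "a \<le> R"
  shows "0 \<le> path_energy w q R t0 a \<omega>" "path_energy w q R t0 a \<omega> \<le> w 0 * Q * (R - a)"
proof -
  show "0 \<le> path_energy w q R t0 a \<omega>"
    unfolding path_energy_def using w(2) q(2) by (intro integral_nonneg_AE) auto
  have int: "integrable lborel (\<lambda>v. indicator {a..R} v *\<^sub>R (w (v - t0) * q (B_ext v \<omega> - B_ext t0 \<omega>)))"
    by (rule borel_integrable_compact[OF _ path_cont]) (use w q in auto)
  have "path_energy w q R t0 a \<omega> \<le> (LINT v|lborel. (w 0 * Q) * indicator {a..R} v)"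
    unfolding path_energy_def
  proof (rule integral_mono)
    show "integrable lborel (\<lambda>v. w (v - t0) * q (B_ext v \<omega> - B_ext t0 \<omega>) * indicator {a..R} v)" using int by (simp add: mult.commute)
    show "w (v - t0) * q (B_ext v \<omega> - B_ext t0 \<omega>) * indicator {a..R} v \<le> (w 0 * Q) * indicator {a..R} v" for v
      using w(2) w(3)[of 0 "v - t0"] q(2,3) t by (auto intro!: mult_mono split: split_indicator)
  qed (auto intro!: integrable_mult_right integrable_real_indicator simp: emeasure_lborel_Icc_eq)
  also have "\<dots> = w 0 * Q * (R - a)" using t by simp
  finally show "path_energy w q R t0 a \<omega> \<le> w 0 * Q * (R - a)" .
qed

text \<open>Iterating \<open>exp F = 1 + \<integral> f exp F\<close> and integrating out the last increment of a finite prefix of the path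
  at every step.\<close>
lemma khasminskii:
  fixes q :: "'d \<Rightarrow> real" and K :: "real \<Rightarrow> ennreal"
  assumes w: "continuous_on UNIV w" "\<And>u. 0 \<le> w u" "\<And>u v. 0 \<le> u \<Longrightarrow> u \<le> v \<Longrightarrow> w v \<le> w u"
    and q: "continuous_on UNIV q" "\<And>z. 0 \<le> q z" "\<And>z. q z \<le> Q"
    and K: "\<And>u z. 0 < u \<Longrightarrow> (\<integral>\<^sup>+y. ennreal (heat_kernel u y) * ennreal (q (z + y)) \<partial>lborel) \<le> K u"
    and Km[measurable]: "K \<in> borel_measurable borel"
    and N: "0 \<le> N" and small: "(\<integral>\<^sup>+u. ennreal (w u * exp (- N * u)) * K u * indicator {0..T} u \<partial>lborel) \<le> ennreal (1/2)"
    and t0: "0 \<le> t0" "t0 \<le> R" "R - t0 \<le> T"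
  shows "(\<integral>\<^sup>+\<omega>. ennreal (exp (path_energy w q R t0 t0 \<omega>)) \<partial>P) \<le> ennreal (2 * exp (N * (R - t0)))"
proof -
  have [measurable]: "w \<in> borel_measurable borel" "q \<in> borel_measurable borel"
    using w(1) q(1) by (auto intro: borel_measurable_continuous_onI)
  define G where "G u = ennreal (w u * exp (- N * u)) * K u * indicator {0..T} u" for u
  have Gm: "G \<in> borel_measurable borel" unfolding G_def by measurable
  define F where "F = path_energy w q R t0"
  have F_m[measurable]: "(\<lambda>x. F (f x) (g x)) \<in> borel_measurable M" if "f \<in> borel_measurable M" "g \<in> M \<rightarrow>\<^sub>M P" for f g and M :: "'c measure"
    unfolding F_def using that by (intro path_energy_measurable) auto
  define c0 where "c0 = exp (w 0 * Q * (R - t0))"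
  have Q0: "0 \<le> Q" using q(2,3) order_trans by blast
  have Fc: "exp (F a \<omega>) \<le> c0" if "t0 \<le> a" "a \<le> R" for a \<omega>
  proof -
    have "F a \<omega> \<le> w 0 * Q * (R - a)" unfolding F_def by (rule path_energy_bounds[OF w q that])
    also have "\<dots> \<le> w 0 * Q * (R - t0)" using that Q0 w(2) by (intro mult_left_mono) auto
    finally show ?thesis by (simp add: c0_def)
  qed
  \<comment> \<open>The map c -> 1 + c/2 has the fixed point 2. The a priori bound c0 depends on the
    supremum of q, hence on the mollification; it is halved in every iteration and disappears in the
    limit.\<close>
  define C where "C n = 2 + (1/2) ^ n * c0" for n :: nat
  have C0: "0 \<le> C n" for n by (auto simp: C_def c0_def)
  have C00: "c0 \<le> C 0" by (simp add: C_def)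
  define A where "A n a = ennreal (exp (N * (R - a)) * C n)" for n a
  define Pre where "Pre ts m \<omega> = (\<Prod>i<m. ennreal (q (B (ts (Suc i)) \<omega> - B (ts 0) \<omega>)))" for ts :: "nat \<Rightarrow> real" and m \<omega>
  have Pre_m[measurable]: "Pre ts m \<in> borel_measurable P" for ts m unfolding Pre_def by measurable
  define KP where "KP ts m = (\<Prod>i<m. K (ts (Suc i) - ts i))" for ts :: "nat \<Rightarrow> real" and m
  have PreK: "(\<integral>\<^sup>+\<omega>. Pre ts m \<omega> \<partial>P) \<le> KP ts m" if "ts 0 = t0" "\<And>i. i < m \<Longrightarrow> ts i < ts (Suc i)" for ts m
    unfolding Pre_def KP_def by (rule prefix_bound[OF _ K]) (use that t0 in auto)
  \<comment> \<open>Stated for every prefix of times: the induction step appends the integration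
    variable v as a further time and applies the hypothesis to the longer prefix.\<close>
  have claim: "(\<integral>\<^sup>+\<omega>. Pre ts m \<omega> * ennreal (exp (F (ts m) \<omega>)) \<partial>P) \<le> KP ts m * A n (ts m)"
    if "ts 0 = t0" "\<And>i. i < m \<Longrightarrow> ts i < ts (Suc i)" "ts m \<le> R" for n ts m
    using that
  proof (induction n arbitrary: ts m)
    case 0
    have mono: "t0 \<le> ts k" if "k \<le> m" for k using that
    proof (induction k)
      case (Suc k) then show ?case using 0(2)[of k] by auto
    qed (use 0 in simp)
    have "(\<integral>\<^sup>+\<omega>. Pre ts m \<omega> * ennreal (exp (F (ts m) \<omega>)) \<partial>P) \<le> (\<integral>\<^sup>+\<omega>. Pre ts m \<omega> * ennreal c0 \<partial>P)"
      using mono[of m] 0 by (intro nn_integral_mono mult_left_mono ennreal_leI Fc) auto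
    also have "\<dots> = (\<integral>\<^sup>+\<omega>. Pre ts m \<omega> \<partial>P) * ennreal c0" by (simp add: nn_integral_multc)
    also have "\<dots> \<le> KP ts m * A 0 (ts m)"
    proof (intro mult_mono PreK 0)
      have "1 * c0 \<le> exp (N * (R - ts m)) * C 0" using 0 N C00 by (intro mult_mono) (auto simp: c0_def)
      then show "ennreal c0 \<le> A 0 (ts m)" unfolding A_def by (intro ennreal_leI) simp
    qed auto
    finally show ?case .
  next
    case (Suc n)
    let ?a = "ts m"
    have mono: "t0 \<le> ts k" if "k \<le> m" for k using that
    proof (induction k)
      case (Suc k) then show ?case using \<open>\<And>i. i < m \<Longrightarrow> ts i < ts (Suc i)\<close>[of k] by auto
    qed (use Suc in simp)
    let ?f = "\<lambda>v \<omega>. w (v - t0) * q (B_ext v \<omega> - B_ext t0 \<omega>)"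
    have id: "ennreal (exp (F ?a \<omega>)) = 1 + (\<integral>\<^sup>+v. ennreal (?f v \<omega> * exp (F v \<omega>)) * indicator {?a..R} v \<partial>lborel)" for \<omega>
      unfolding F_def path_energy_def
      by (rule exp_integral_identity[of "\<lambda>v. ?f v \<omega>"]) (use Suc w q in \<open>auto intro: path_cont\<close>)
    have "(\<integral>\<^sup>+\<omega>. Pre ts m \<omega> * ennreal (exp (F ?a \<omega>)) \<partial>P) =
       (\<integral>\<^sup>+\<omega>. Pre ts m \<omega> + (\<integral>\<^sup>+v. Pre ts m \<omega> * (ennreal (?f v \<omega> * exp (F v \<omega>)) * indicator {?a..R} v) \<partial>lborel) \<partial>P)"
      unfolding id by (intro nn_integral_cong) (simp add: distrib_left nn_integral_cmult)
    also have "\<dots> = (\<integral>\<^sup>+\<omega>. Pre ts m \<omega> \<partial>P) + (\<integral>\<^sup>+\<omega>. \<integral>\<^sup>+v. Pre ts m \<omega> * (ennreal (?f v \<omega> * exp (F v \<omega>)) * indicator {?a..R} v) \<partial>lborel \<partial>P)"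
      by (rule nn_integral_add) measurable
    finally have E: "(\<integral>\<^sup>+\<omega>. Pre ts m \<omega> * ennreal (exp (F ?a \<omega>)) \<partial>P) =
      (\<integral>\<^sup>+\<omega>. Pre ts m \<omega> \<partial>P) + (\<integral>\<^sup>+\<omega>. \<integral>\<^sup>+v. Pre ts m \<omega> * (ennreal (?f v \<omega> * exp (F v \<omega>)) * indicator {?a..R} v) \<partial>lborel \<partial>P)" .
    have "(\<integral>\<^sup>+\<omega>. \<integral>\<^sup>+v. Pre ts m \<omega> * (ennreal (?f v \<omega> * exp (F v \<omega>)) * indicator {?a..R} v) \<partial>lborel \<partial>P)
       = (\<integral>\<^sup>+v. \<integral>\<^sup>+\<omega>. Pre ts m \<omega> * (ennreal (?f v \<omega> * exp (F v \<omega>)) * indicator {?a..R} v) \<partial>P \<partial>lborel)"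
    proof -
      interpret pair_sigma_finite lborel P by standard
      show ?thesis by (rule Fubini') measurable
    qed
    also have "\<dots> \<le> (\<integral>\<^sup>+v. KP ts m * ennreal (exp (N * (R - ?a)) * C n) * G (v - ?a) \<partial>lborel)"
    proof (rule nn_integral_mono_AE)
      have "AE v in lborel. v \<noteq> ?a" by (rule AE_lborel_singleton)
      then show "AE v in lborel. (\<integral>\<^sup>+\<omega>. Pre ts m \<omega> * (ennreal (?f v \<omega> * exp (F v \<omega>)) * indicator {?a..R} v) \<partial>P)
          \<le> KP ts m * ennreal (exp (N * (R - ?a)) * C n) * G (v - ?a)"
      proof eventually_elim
        fix v assume va: "v \<noteq> ?a"
        show "(\<integral>\<^sup>+\<omega>. Pre ts m \<omega> * (ennreal (?f v \<omega> * exp (F v \<omega>)) * indicator {?a..R} v) \<partial>P)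
          \<le> KP ts m * ennreal (exp (N * (R - ?a)) * C n) * G (v - ?a)"
        proof (cases "v \<in> {?a..R}")
          case True
          then have v: "?a < v" "v \<le> R" "0 \<le> v" using va mono[of m] t0 by auto
          define ts' where "ts' = ts(Suc m := v)"
          have ts': "ts' 0 = t0" "\<And>i. i < Suc m \<Longrightarrow> ts' i < ts' (Suc i)" "ts' (Suc m) = v"
            using Suc.prems v by (auto simp: ts'_def less_Suc_eq)
          have KP': "KP ts' (Suc m) = KP ts m * K (v - ?a)"
            unfolding KP_def by (simp add: ts'_def)
          have Pre': "Pre ts' (Suc m) \<omega> = Pre ts m \<omega> * ennreal (q (B_ext v \<omega> - B_ext t0 \<omega>))" for \<omega>
            unfolding Pre_def using t0 v Suc.prems(1) by (simp add: ts'_def B_ext_eq)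
          have "(\<integral>\<^sup>+\<omega>. Pre ts m \<omega> * (ennreal (?f v \<omega> * exp (F v \<omega>)) * indicator {?a..R} v) \<partial>P)
             = (\<integral>\<^sup>+\<omega>. ennreal (w (v - t0)) * (Pre ts' (Suc m) \<omega> * ennreal (exp (F v \<omega>))) \<partial>P)"
            unfolding Pre' using True w(2) q(2) by (intro nn_integral_cong) (simp add: ennreal_mult mult_ac)
          also have "\<dots> = ennreal (w (v - t0)) * (\<integral>\<^sup>+\<omega>. Pre ts' (Suc m) \<omega> * ennreal (exp (F (ts' (Suc m)) \<omega>)) \<partial>P)"
            unfolding ts'(3) by (rule nn_integral_cmult) measurable
          also have "\<dots> \<le> ennreal (w (v - t0)) * (KP ts' (Suc m) * A n (ts' (Suc m)))"
            using v ts' by (intro mult_left_mono Suc.IH) auto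
          \<comment> \<open>Monotonicity of w replaces the distance to the base t0 by the distance
            to the last time of the prefix, so that weight and increment bound depend on the same v
            - a.\<close>
          also have "\<dots> \<le> ennreal (w (v - ?a)) * (KP ts' (Suc m) * A n v)"
            unfolding ts'(3) using mono[of m] v by (intro mult_right_mono ennreal_leI w(3)) auto
          also have "A n v = ennreal (exp (N * (R - ?a)) * C n) * ennreal (exp (- N * (v - ?a)))"
            unfolding A_def using C0[of n] by (simp add: ennreal_mult[symmetric] mult_exp_exp algebra_simps)
          finally show ?thesis unfolding KP' using v t0 mono[of m] w(2)[of "v - ?a"] by (simp add: G_def ennreal_mult mult_ac)
        qed simp
      qed
    qed
    also have "\<dots> = KP ts m * ennreal (exp (N * (R - ?a)) * C n) * (\<integral>\<^sup>+v. G (v - ?a) \<partial>lborel)"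
    proof (rule nn_integral_cmult)
      have "(\<lambda>v. v - ?a) \<in> lborel \<rightarrow>\<^sub>M borel" by simp
      from measurable_compose[OF this Gm] show "(\<lambda>v. G (v - ?a)) \<in> borel_measurable lborel" .
    qed
    also have "\<dots> \<le> KP ts m * ennreal (exp (N * (R - ?a)) * C n) * ennreal (1/2)"
    proof (rule mult_left_mono)
      show "(\<integral>\<^sup>+v. G (v - ?a) \<partial>lborel) \<le> ennreal (1/2)"
        using nn_integral_lborel_plus[OF Gm, of "- ?a"] small by (simp add: G_def)
    qed simp
    finally have "(\<integral>\<^sup>+\<omega>. Pre ts m \<omega> * ennreal (exp (F ?a \<omega>)) \<partial>P) \<le> (\<integral>\<^sup>+\<omega>. Pre ts m \<omega> \<partial>P) + KP ts m * ennreal (exp (N * (R - ?a)) * C n) * ennreal (1/2)"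
      unfolding E by (rule add_left_mono)
    also have "\<dots> \<le> KP ts m * 1 + KP ts m * ennreal (exp (N * (R - ?a)) * C n * (1/2))"
    proof (rule add_mono)
      show "(\<integral>\<^sup>+\<omega>. Pre ts m \<omega> \<partial>P) \<le> KP ts m * 1" using PreK[of ts m] Suc.prems by simp
      have "KP ts m * ennreal (exp (N * (R - ?a)) * C n) * ennreal (1/2) = KP ts m * ennreal (exp (N * (R - ?a)) * C n * (1/2))"
        using C0[of n] by (simp only: mult.assoc) (subst (1) ennreal_mult[symmetric], auto simp: mult.assoc)
      then show "KP ts m * ennreal (exp (N * (R - ?a)) * C n) * ennreal (1/2) \<le> KP ts m * ennreal (exp (N * (R - ?a)) * C n * (1/2))" by simp
    qed
    also have "\<dots> = KP ts m * (1 + ennreal (exp (N * (R - ?a)) * C n * (1/2)))" by (simp add: distrib_left)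
    also have "\<dots> \<le> KP ts m * A (Suc n) ?a"
    proof (rule mult_left_mono)
      have "1 + ennreal (exp (N * (R - ?a)) * C n * (1/2)) = ennreal (1 + exp (N * (R - ?a)) * C n * (1/2))"
        using C0[of n] by (subst ennreal_plus) auto
      also have "\<dots> \<le> A (Suc n) ?a" unfolding A_def
      proof (rule ennreal_leI)
        have "1 \<le> exp (N * (R - ?a))" using N Suc.prems by simp
        then show "1 + exp (N * (R - ?a)) * C n * (1/2) \<le> exp (N * (R - ?a)) * C (Suc n)" by (simp add: C_def algebra_simps)
      qed
      finally show "1 + ennreal (exp (N * (R - ?a)) * C n * (1/2)) \<le> A (Suc n) ?a" .
    qed simp
    finally show ?case .
  qed
  have "(\<integral>\<^sup>+\<omega>. ennreal (exp (F t0 \<omega>)) \<partial>P) \<le> A n t0" for n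
    using claim[of "\<lambda>_. t0" 0 n] t0 by (simp add: Pre_def KP_def)
  moreover have "(\<lambda>n. A n t0) \<longlonglongrightarrow> ennreal (exp (N * (R - t0)) * (2 + 0 * c0))"
    unfolding A_def C_def by (intro tendsto_ennrealI tendsto_intros LIMSEQ_realpow_zero) auto
  ultimately have "(\<integral>\<^sup>+\<omega>. ennreal (exp (F t0 \<omega>)) \<partial>P) \<le> ennreal (exp (N * (R - t0)) * (2 + 0 * c0))"
    by (intro LIMSEQ_le_const) auto
  then show ?thesis by (simp add: F_def mult.commute)
qed

text \<open>Jensen's inequality for the uniform law on [0, T] reduces a double time integral to the
  one-sided energies with varying starting time. The division by T is compensated later by a factor
  T in the weight.\<close>

lemma khasminskii_average:
  fixes q :: "'d \<Rightarrow> real" and K :: "real \<Rightarrow> ennreal"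
  assumes w: "continuous_on UNIV w" "\<And>u. 0 \<le> w u" "\<And>u v. 0 \<le> u \<Longrightarrow> u \<le> v \<Longrightarrow> w v \<le> w u"
    and q: "continuous_on UNIV q" "\<And>z. 0 \<le> q z" "\<And>z. q z \<le> Q"
    and K: "\<And>u z. 0 < u \<Longrightarrow> (\<integral>\<^sup>+y. ennreal (heat_kernel u y) * ennreal (q (z + y)) \<partial>lborel) \<le> K u"
    and Km[measurable]: "K \<in> borel_measurable borel"
    and N: "0 \<le> N" and small: "(\<integral>\<^sup>+u. ennreal (w u * exp (- N * u)) * K u * indicator {0..T} u \<partial>lborel) \<le> ennreal (1/2)"
    and T: "0 < T"
  shows "(\<integral>\<^sup>+\<omega>. ennreal (exp (1 / T * (LINT t|lborel. path_energy w q T t t \<omega> * indicator {0..T} t))) \<partial>P) \<le> ennreal (2 * exp (N * T))"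
proof -
  have [measurable]: "w \<in> borel_measurable borel" "q \<in> borel_measurable borel"
    using w(1) q(1) by (auto intro: borel_measurable_continuous_onI)
  have m[measurable]: "(\<lambda>x. path_energy w q T (f x) (f x) (g x)) \<in> borel_measurable M" if "f \<in> borel_measurable M" "g \<in> M \<rightarrow>\<^sub>M P" for f g and M :: "'c measure"
    using that by (intro path_energy_measurable) auto
  have Q0: "0 \<le> Q" using q(2,3) order_trans by blast
  define D where "D = w 0 * Q * T"
  have D0: "0 \<le> D" using w(2) Q0 T by (simp add: D_def)
  have b: "0 \<le> path_energy w q T t t \<omega>" "path_energy w q T t t \<omega> \<le> D" if "t \<in> {0..T}" for t \<omega>
  proof -
    show "0 \<le> path_energy w q T t t \<omega>" using that by (intro path_energy_bounds[OF w q]) auto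
    have "path_energy w q T t t \<omega> \<le> w 0 * Q * (T - t)" using that by (intro path_energy_bounds[OF w q]) auto
    also have "\<dots> \<le> D" unfolding D_def using that w(2) Q0 by (intro mult_left_mono) auto
    finally show "path_energy w q T t t \<omega> \<le> D" .
  qed
  have jensen: "ennreal (exp (1 / T * (LINT t|lborel. path_energy w q T t t \<omega> * indicator {0..T} t)))
      \<le> ennreal (1 / T) * (\<integral>\<^sup>+t. ennreal (exp (path_energy w q T t t \<omega>)) * indicator {0..T} t \<partial>lborel)" if \<omega>: "\<omega> \<in> space P" for \<omega>
  proof -
    define g where "g t = path_energy w q T t t \<omega>" for t
    have [measurable]: "g \<in> borel_measurable borel" unfolding g_def using \<omega> by (intro m) auto
    have gauss_cut: "0 \<le> g t" "g t \<le> D" if "t \<in> {0..T}" for t using b[OF that] by (auto simp: g_def)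
    define c where "c = 1 / T * (LINT t|lborel. g t * indicator {0..T} t)"
    have ind: "integrable lborel (\<lambda>t. c' * indicator {0..T} t :: real)" for c'
      by (intro integrable_mult_right integrable_real_indicator) (auto simp: emeasure_lborel_Icc_eq)
    have gi: "integrable lborel (\<lambda>t. g t * indicator {0..T} t)"
      by (rule Bochner_Integration.integrable_bound[OF ind[of D]]) (use gauss_cut D0 in \<open>auto split: split_indicator\<close>)
    have ei: "integrable lborel (\<lambda>t. exp (g t) * indicator {0..T} t)"
      by (rule Bochner_Integration.integrable_bound[OF ind[of "exp D"]]) (use gauss_cut D0 in \<open>auto split: split_indicator\<close>)
    \<comment> \<open>Towards the tangent inequality exp c (1 + g - c) \<le> exp g at the mean c,
      integrated over [0, T].\<close>
    have "T * exp c = exp c * ((1 - c) * T + T * c)" by (simp add: algebra_simps)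
    also have "T * c = (LINT t|lborel. g t * indicator {0..T} t)" using T by (simp add: c_def)
    also have "exp c * ((1 - c) * T + (LINT t|lborel. g t * indicator {0..T} t)) = (LINT t|lborel. exp c * ((1 - c) * indicator {0..T} t + g t * indicator {0..T} t))"
      using gi ind[of "1 - c"] T by simp
    also have "\<dots> \<le> (LINT t|lborel. exp (g t) * indicator {0..T} t)"
    proof (rule integral_mono)
      show "integrable lborel (\<lambda>t. exp c * ((1 - c) * indicator {0..T} t + g t * indicator {0..T} t))" using gi ind[of "1 - c"] by simp
      fix t
      have "exp c * (1 + (g t - c)) \<le> exp c * exp (g t - c)" by (intro mult_left_mono exp_ge_add_one_self) auto
      then have "exp c * (1 - c + g t) \<le> exp (g t)" by (simp add: mult_exp_exp algebra_simps)
      then show "exp c * ((1 - c) * indicator {0..T} t + g t * indicator {0..T} t) \<le> exp (g t) * indicator {0..T} t"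
        by (auto split: split_indicator)
    qed (rule ei)
    finally have "exp c \<le> 1 / T * (LINT t|lborel. exp (g t) * indicator {0..T} t)" using T by (simp add: field_simps)
    then have "ennreal (exp c) \<le> ennreal (1 / T) * ennreal (LINT t|lborel. exp (g t) * indicator {0..T} t)"
      using T by (subst ennreal_mult[symmetric]) (auto intro!: ennreal_leI)
    also have "ennreal (LINT t|lborel. exp (g t) * indicator {0..T} t) = (\<integral>\<^sup>+t. ennreal (exp (g t)) * indicator {0..T} t \<partial>lborel)"
      by (subst nn_integral_eq_integral[OF ei, symmetric]) (auto intro!: nn_integral_cong split: split_indicator)
    finally show ?thesis by (simp add: c_def g_def)
  qed
  have "(\<integral>\<^sup>+\<omega>. ennreal (exp (1 / T * (LINT t|lborel. path_energy w q T t t \<omega> * indicator {0..T} t))) \<partial>P)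
    \<le> (\<integral>\<^sup>+\<omega>. ennreal (1 / T) * (\<integral>\<^sup>+t. ennreal (exp (path_energy w q T t t \<omega>)) * indicator {0..T} t \<partial>lborel) \<partial>P)"
    by (intro nn_integral_mono jensen)
  also have "\<dots> = ennreal (1 / T) * (\<integral>\<^sup>+\<omega>. \<integral>\<^sup>+t. ennreal (exp (path_energy w q T t t \<omega>)) * indicator {0..T} t \<partial>lborel \<partial>P)"
    by (rule nn_integral_cmult) measurable
  also have "(\<integral>\<^sup>+\<omega>. \<integral>\<^sup>+t. ennreal (exp (path_energy w q T t t \<omega>)) * indicator {0..T} t \<partial>lborel \<partial>P)
     = (\<integral>\<^sup>+t. \<integral>\<^sup>+\<omega>. ennreal (exp (path_energy w q T t t \<omega>)) * indicator {0..T} t \<partial>P \<partial>lborel)"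
  proof -
    interpret pair_sigma_finite lborel P by standard
    show ?thesis by (rule Fubini') measurable
  qed
  also have "\<dots> \<le> (\<integral>\<^sup>+t. ennreal (2 * exp (N * T)) * indicator {0..T} t \<partial>lborel)"
  proof (rule nn_integral_mono)
    fix t :: real
    show "(\<integral>\<^sup>+\<omega>. ennreal (exp (path_energy w q T t t \<omega>)) * indicator {0..T} t \<partial>P) \<le> ennreal (2 * exp (N * T)) * indicator {0..T} t"
    proof (cases "t \<in> {0..T}")
      case True
      have "(\<integral>\<^sup>+\<omega>. ennreal (exp (path_energy w q T t t \<omega>)) \<partial>P) \<le> ennreal (2 * exp (N * (T - t)))"
        by (rule khasminskii[OF w q K Km N small]) (use True in auto)
      also have "\<dots> \<le> ennreal (2 * exp (N * T))" using True N by (intro ennreal_leI) (auto intro!: mult_left_mono)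
      finally show ?thesis using True by simp
    qed simp
  qed
  also have "\<dots> = ennreal (2 * exp (N * T)) * ennreal T" using T by (subst nn_integral_cmult) auto
  also have "ennreal (1 / T) * (ennreal (2 * exp (N * T)) * ennreal T) = ennreal (2 * exp (N * T))"
    using T by (simp add: ennreal_mult[symmetric])
  finally show ?thesis by (simp add: mult_left_mono)
qed

end

section \<open>Covariance bounds\<close>

locale covariance =
  fixes \<gamma> :: "real \<Rightarrow> real" and \<Lambda> :: "'d::euclidean_space \<Rightarrow> real" and \<mu> :: "'d measure" and \<beta> C\<^sub>\<beta> \<alpha> :: real
  assumes gamma_meas[measurable]: "\<gamma> \<in> borel_measurable borel"
    and Lambda_meas[measurable]: "\<Lambda> \<in> borel_measurable borel"
    and Lambda_nonneg: "\<And>x. 0 \<le> \<Lambda> x"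
    and Lambda_pd: "nonneg_definite \<Lambda>"
    and mu_sets[measurable_cong]: "sets \<mu> = sets borel"
    and mu_FLambda: "is_fourier_transform \<mu> \<Lambda>"
    and beta: "0 < \<beta>" "\<beta> < 1" and Cbeta: "0 < C\<^sub>\<beta>"
    and gamma_nonneg: "\<And>t. 0 \<le> \<gamma> t" and gamma_le: "\<And>t. t \<noteq> 0 \<Longrightarrow> \<gamma> t \<le> C\<^sub>\<beta> * \<bar>t\<bar> powr (- \<beta>)"
    and alpha: "0 < \<alpha>" "\<alpha> < 1 - \<beta>"
    and mu_integral: "(\<integral>\<^sup>+\<xi>. ennreal (1 / (1 + norm \<xi> powr (2 * (1 - \<beta> - \<alpha>)))) \<partial>\<mu>) < \<infinity>"
begin

definition spec_weight :: "'d \<Rightarrow> real" where "spec_weight \<xi> = 1 / (1 + norm \<xi> powr (2 * (1 - \<beta> - \<alpha>)))"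

lemma spec_weight_measurable[measurable]: "spec_weight \<in> borel_measurable borel" unfolding spec_weight_def by measurable

lemma spec_weight_pos: "0 < spec_weight \<xi>" unfolding spec_weight_def by (intro divide_pos_pos add_pos_nonneg) auto

lemma spec_weight_fin: "(\<integral>\<^sup>+\<xi>. ennreal (spec_weight \<xi>) \<partial>\<mu>) < \<infinity>" using mu_integral by (simp add: spec_weight_def)

text \<open>The weight is positive and integrable, so its superlevel sets have finite measure and
  exhaust the space. Tonelli with \<mu> as a factor rests on this.\<close>

lemma sigma_finite_mu: "sigma_finite_measure \<mu>"
proof
  show "\<exists>A. countable A \<and> A \<subseteq> sets \<mu> \<and> \<Union> A = space \<mu> \<and> (\<forall>a\<in>A. emeasure \<mu> a \<noteq> \<infinity>)"
  proof (intro exI[of _ "range (\<lambda>n::nat. {\<xi>. 1 / real (Suc n) \<le> spec_weight \<xi>})"] conjI ballI)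
    have "space \<mu> = UNIV" using sets_eq_imp_space_eq[OF mu_sets] by simp
    moreover have "\<exists>n::nat. 1 / real (Suc n) \<le> spec_weight \<xi>" for \<xi>
      using reals_Archimedean[OF spec_weight_pos[of \<xi>]] by (auto simp: inverse_eq_divide intro: less_imp_le)
    ultimately show "\<Union> (range (\<lambda>n::nat. {\<xi>. 1 / real (Suc n) \<le> spec_weight \<xi>})) = space \<mu>" by auto
    fix a assume "a \<in> range (\<lambda>n::nat. {\<xi>. 1 / real (Suc n) \<le> spec_weight \<xi>})"
    then obtain n :: nat where a: "a = {\<xi>. 1 / real (Suc n) \<le> spec_weight \<xi>}" by auto
    have [measurable]: "a \<in> sets \<mu>" unfolding a by measurable
    have "emeasure \<mu> a = (\<integral>\<^sup>+\<xi>. indicator a \<xi> \<partial>\<mu>)" by simp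
    also have "\<dots> \<le> (\<integral>\<^sup>+\<xi>. ennreal (real (Suc n)) * ennreal (spec_weight \<xi>) \<partial>\<mu>)"
    proof (rule nn_integral_mono)
      fix \<xi>
      have "1 \<le> real (Suc n) * spec_weight \<xi>" if "\<xi> \<in> a" using that by (auto simp: a field_simps)
      then show "indicator a \<xi> \<le> ennreal (real (Suc n)) * ennreal (spec_weight \<xi>)"
        using spec_weight_pos[of \<xi>] by (auto simp: ennreal_mult[symmetric] simp del: of_nat_Suc split: split_indicator)
    qed
    also have "\<dots> = ennreal (real (Suc n)) * (\<integral>\<^sup>+\<xi>. ennreal (spec_weight \<xi>) \<partial>\<mu>)" by (rule nn_integral_cmult) measurable
    also have "\<dots> < \<infinity>" using spec_weight_fin by (simp add: ennreal_mult_less_top)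
    finally show "emeasure \<mu> a \<noteq> \<infinity>" by simp
  qed (auto simp: mu_sets)
qed

text \<open>The exponent 2 (1-\<beta>-\<alpha>) lies below 2, so the inverse of the weight is at
  most 2 + |\<xi>|^2, and exp v \<ge> 1 + v with v = u |\<xi>|^2 / 2 dominates this up to the factor
  2 + 2/u.\<close>

lemma gauss_le_spec_weight:
  assumes u: "0 < u"
  shows "exp (- u * (norm \<xi>)\<^sup>2 / 2) \<le> (2 + 2 / u) * spec_weight \<xi>"
proof -
  define s where "s = norm \<xi>"
  define \<rho> where "\<rho> = 1 - \<beta> - \<alpha>"
  have \<rho>: "0 < \<rho>" "\<rho> < 1" using alpha beta by (auto simp: \<rho>_def)
  have s: "0 \<le> s" by (simp add: s_def)
  have p: "s powr (2 * \<rho>) \<le> 1 + s\<^sup>2"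
  proof (cases "s \<le> 1")
    case True
    have "s powr (2 * \<rho>) \<le> 1 powr (2 * \<rho>)" using s True \<rho> by (intro powr_mono2) auto
    then show ?thesis by (simp add: add_increasing2)
  next
    case False
    have "s powr (2 * \<rho>) \<le> s powr 2" using False \<rho> by (intro powr_mono) auto
    then show ?thesis using False by (simp add: powr_numeral)
  qed
  have "1 + u * s\<^sup>2 / 2 \<le> exp (u * s\<^sup>2 / 2)" by (rule exp_ge_add_one_self)
  then have "(2 + 2 / u) * (1 + u * s\<^sup>2 / 2) \<le> (2 + 2 / u) * exp (u * s\<^sup>2 / 2)" using u by (intro mult_left_mono) auto
  moreover have "2 + s\<^sup>2 \<le> (2 + 2 / u) * (1 + u * s\<^sup>2 / 2)" using u by (simp add: field_simps)
  ultimately have "1 + s powr (2 * \<rho>) \<le> (2 + 2 / u) * exp (u * s\<^sup>2 / 2)" using p by linarith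
  moreover have "0 < 1 + s powr (2 * \<rho>)" by (intro add_pos_nonneg) auto
  ultimately show ?thesis unfolding spec_weight_def s_def[symmetric] \<rho>_def[symmetric]
    by (simp add: exp_minus field_simps)
qed

lemma integrable_gauss: "0 < u \<Longrightarrow> integrable \<mu> (\<lambda>\<xi>. exp (- u * (norm \<xi>)\<^sup>2 / 2))"
proof -
  assume u: "0 < u"
  have "integrable \<mu> spec_weight" using spec_weight_fin spec_weight_pos by (intro integrableI_nonneg) (auto intro: less_imp_le)
  then have "integrable \<mu> (\<lambda>\<xi>. (2 + 2 / u) * spec_weight \<xi>)" by simp
  then show ?thesis
  proof (rule Bochner_Integration.integrable_bound)
    show "AE \<xi> in \<mu>. norm (exp (- u * (norm \<xi>)\<^sup>2 / 2)) \<le> norm ((2 + 2 / u) * spec_weight \<xi>)"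
      using gauss_le_spec_weight[OF u] by (intro AE_I2) (auto intro!: order_trans[OF _ abs_ge_self])
  qed measurable
qed

section \<open>The smoothed covariance and its value at the origin\<close>

definition fourier_const :: real where "fourier_const = 1 / (2 * pi) ^ DIM('d)"

lemma fourier_const_pos: "0 < fourier_const" by (simp add: fourier_const_def)

text \<open>The value at z = 0, see \<open>smooth_cov_0\<close>. Through the spectral measure its
  positivity and monotonicity in u can be read off, and all other values are compared with
  it.\<close>

definition smooth_cov0 :: "real \<Rightarrow> real" where "smooth_cov0 u = fourier_const * (\<integral>\<xi>. exp (- u * (norm \<xi>)\<^sup>2 / 2) \<partial>\<mu>)"

definition smooth_cov :: "real \<Rightarrow> 'd \<Rightarrow> real" where "smooth_cov u z = enn2real (heat_conv \<Lambda> u z)"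

lemma heat_conv_smooth_cov: "0 < u \<Longrightarrow> heat_conv \<Lambda> u z = ennreal (smooth_cov u z)"
  unfolding smooth_cov_def using heat_conv_spectral(1)[OF Lambda_meas Lambda_nonneg Lambda_pd mu_sets mu_FLambda _ integrable_gauss] by simp

lemma smooth_cov_nonneg[simp]: "0 \<le> smooth_cov u z" by (simp add: smooth_cov_def)

lemma smooth_cov_measurable[measurable]: "smooth_cov u \<in> borel_measurable borel" unfolding smooth_cov_def by measurable

lemma smooth_cov_sum: "0 < u \<Longrightarrow> smooth_cov u z + smooth_cov u (- z) = 2 * fourier_const * (\<integral>\<xi>. cos (z \<bullet> \<xi>) * exp (- u * (norm \<xi>)\<^sup>2 / 2) \<partial>\<mu>)"
  unfolding smooth_cov_def fourier_const_def
  using heat_conv_spectral(2)[OF Lambda_meas Lambda_nonneg Lambda_pd mu_sets mu_FLambda _ integrable_gauss] by simp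

lemma smooth_cov_0: "0 < u \<Longrightarrow> smooth_cov u 0 = smooth_cov0 u" using smooth_cov_sum[of u 0] by (simp add: smooth_cov0_def)

lemma smooth_cov0_nonneg: "0 \<le> smooth_cov0 u" unfolding smooth_cov0_def using fourier_const_pos by (intro mult_nonneg_nonneg integral_nonneg_AE) auto

lemma integrable_cos_gauss: "0 < u \<Longrightarrow> integrable \<mu> (\<lambda>\<xi>. cos (z \<bullet> \<xi>) * exp (- u * (norm \<xi>)\<^sup>2 / 2))"
  by (rule Bochner_Integration.integrable_bound[OF integrable_gauss[of u]]) (auto simp: abs_mult intro!: mult_left_le_one_le)

lemma smooth_cov_sum_le: assumes u: "0 < u" shows "smooth_cov u z + smooth_cov u (- z) \<le> 2 * smooth_cov0 u"
proof -
  have "(\<integral>\<xi>. cos (z \<bullet> \<xi>) * exp (- u * (norm \<xi>)\<^sup>2 / 2) \<partial>\<mu>) \<le> (\<integral>\<xi>. exp (- u * (norm \<xi>)\<^sup>2 / 2) \<partial>\<mu>)"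
    by (intro integral_mono integrable_cos_gauss integrable_gauss u) (auto intro!: mult_left_le_one_le)
  then show ?thesis using fourier_const_pos by (simp add: smooth_cov_sum[OF u] smooth_cov0_def mult_left_mono mult.assoc)
qed

text \<open>The spectral formula bounds the sum of the values at z and -z; dropping the second,
  nonnegative one costs the factor 2.\<close>

lemma smooth_cov_le: "0 < u \<Longrightarrow> smooth_cov u z \<le> 2 * smooth_cov0 u"
  using smooth_cov_sum_le[of u z] smooth_cov_nonneg[of u "- z"] by linarith

lemma smooth_cov0_antimono: "0 < u \<Longrightarrow> u \<le> v \<Longrightarrow> smooth_cov0 v \<le> smooth_cov0 u"
  unfolding smooth_cov0_def using fourier_const_pos
  by (intro mult_left_mono integral_mono integrable_gauss) (auto intro!: divide_right_mono mult_right_mono)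

text \<open>The spectral integrand is continuous in z and dominated by a Gaussian. Khasminskii's
  lemma is applied to this symmetrised function, since it asks for a continuous q.\<close>

lemma smooth_cov_sum_cont: assumes u: "0 < u" shows "continuous_on UNIV (\<lambda>z. smooth_cov u z + smooth_cov u (- z))"
  unfolding smooth_cov_sum[OF u] continuous_on_sequentially
proof (intro ballI allI impI, elim conjE)
  fix x :: "nat \<Rightarrow> 'd" and a assume "x \<longlonglongrightarrow> a"
  have "(\<lambda>n. \<integral>\<xi>. cos (x n \<bullet> \<xi>) * exp (- u * (norm \<xi>)\<^sup>2 / 2) \<partial>\<mu>) \<longlonglongrightarrow> (\<integral>\<xi>. cos (a \<bullet> \<xi>) * exp (- u * (norm \<xi>)\<^sup>2 / 2) \<partial>\<mu>)"
  proof (rule integral_dominated_convergence[where w="\<lambda>\<xi>. exp (- u * (norm \<xi>)\<^sup>2 / 2)"])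
    show "AE \<xi> in \<mu>. (\<lambda>n. cos (x n \<bullet> \<xi>) * exp (- u * (norm \<xi>)\<^sup>2 / 2)) \<longlonglongrightarrow> cos (a \<bullet> \<xi>) * exp (- u * (norm \<xi>)\<^sup>2 / 2)"
      using \<open>x \<longlonglongrightarrow> a\<close> by (intro AE_I2 tendsto_intros)
    show "AE \<xi> in \<mu>. norm (cos (x n \<bullet> \<xi>) * exp (- u * (norm \<xi>)\<^sup>2 / 2)) \<le> exp (- u * (norm \<xi>)\<^sup>2 / 2)" for n
      by (auto simp: abs_mult intro!: mult_left_le_one_le)
  qed (use integrable_gauss[OF u] in auto)
  then show "((\<lambda>z. 2 * fourier_const * (\<integral>\<xi>. cos (z \<bullet> \<xi>) * exp (- u * (norm \<xi>)\<^sup>2 / 2) \<partial>\<mu>)) \<circ> x) \<longlonglongrightarrow> 2 * fourier_const * (\<integral>\<xi>. cos (a \<bullet> \<xi>) * exp (- u * (norm \<xi>)\<^sup>2 / 2) \<partial>\<mu>)"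
    unfolding o_def by (intro tendsto_intros)
qed

text \<open>\<open>frac_cov0\<close> dominates both the heat kernel at the origin and its fractional increments.\<close>
definition frac_cov0 :: "real \<Rightarrow> ennreal" where
  "frac_cov0 u = ennreal fourier_const * (\<integral>\<^sup>+\<xi>. ennreal ((1 + norm \<xi> powr (2 * \<alpha>)) * exp (- u * (norm \<xi>)\<^sup>2 / 2)) \<partial>\<mu>)"

lemma frac_cov0_measurable[measurable]: "frac_cov0 \<in> borel_measurable borel"
proof -
  interpret sigma_finite_measure \<mu> by (rule sigma_finite_mu)
  show ?thesis unfolding frac_cov0_def by measurable
qed

lemma smooth_cov0_eq: "0 < u \<Longrightarrow> ennreal (smooth_cov0 u) = ennreal fourier_const * (\<integral>\<^sup>+\<xi>. ennreal (exp (- u * (norm \<xi>)\<^sup>2 / 2)) \<partial>\<mu>)"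
  unfolding smooth_cov0_def using fourier_const_pos integrable_gauss[of u]
  by (subst nn_integral_eq_integral) (auto simp: ennreal_mult intro!: integral_nonneg_AE)

text \<open>Dropping the exponential gives the bound in T. The other bound has the scaling of l =
  s^2/2: below u = 1/l the singularity alone is integrated, above it u^(-\<beta>) \<le> l^\<beta>
  and the exponential is integrated.\<close>

lemma time_singular_integral:
  assumes T: "0 \<le> T" and s: "0 < s"
  shows "(\<integral>\<^sup>+u. ennreal (u powr (- \<beta>) * exp (- u * s\<^sup>2 / 2)) * indicator {0..T} u \<partial>lborel)
     \<le> ennreal (min (T powr (1 - \<beta>) / (1 - \<beta>)) ((1 / (1 - \<beta>) + 1) * (s\<^sup>2 / 2) powr (\<beta> - 1)))"
proof -
  define l where "l = s\<^sup>2 / 2"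
  have l: "0 < l" using s by (simp add: l_def)
  have pw: "(\<integral>\<^sup>+u. ennreal (u powr (- \<beta>)) * indicator {0..a} u \<partial>lborel) = ennreal (a powr (1 - \<beta>) / (1 - \<beta>))" if "0 \<le> a" for a
    using nn_integral_has_integral_lebesgue'[OF _ has_integral_powr_from_0[of "- \<beta>" a]] that beta by (simp add: add.commute)
  have 1: "(\<integral>\<^sup>+u. ennreal (u powr (- \<beta>) * exp (- u * s\<^sup>2 / 2)) * indicator {0..T} u \<partial>lborel) \<le> ennreal (T powr (1 - \<beta>) / (1 - \<beta>))"
    unfolding pw[OF T, symmetric]
    by (intro nn_integral_mono) (auto intro!: ennreal_leI mult_left_le split: split_indicator)
  have ex: "(\<integral>\<^sup>+u. ennreal (exp (- l * u)) * indicator {0..} u \<partial>lborel) = ennreal (0 - (- exp (- l * 0) / l))"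
  proof (rule nn_integral_FTC_atLeast)
    show "((\<lambda>u. - exp (- l * u) / l) has_real_derivative exp (- l * u)) (at u)" for u
      using l by (auto intro!: derivative_eq_intros)
    have "LIM u at_top. l * u :> at_top" using l by (intro filterlim_tendsto_pos_mult_at_top[OF tendsto_const]) (auto intro: filterlim_ident)
    then have "((\<lambda>u. exp (- (l * u))) \<longlongrightarrow> 0) at_top"
      by (intro filterlim_compose[OF exp_at_bot]) (simp add: filterlim_uminus_at_bot)
    then have "((\<lambda>u. - exp (- (l * u)) / l) \<longlongrightarrow> - 0 / l) at_top" using l by (intro tendsto_intros) auto
    then show "((\<lambda>u. - exp (- l * u) / l) \<longlongrightarrow> 0) at_top" by simp
  qed auto
  have "(\<integral>\<^sup>+u. ennreal (u powr (- \<beta>) * exp (- u * s\<^sup>2 / 2)) * indicator {0..T} u \<partial>lborel)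
    \<le> (\<integral>\<^sup>+u. ennreal (u powr (- \<beta>)) * indicator {0..1/l} u + ennreal (l powr \<beta>) * (ennreal (exp (- l * u)) * indicator {0..} u) \<partial>lborel)"
  proof (rule nn_integral_mono)
    fix u :: real
    show "ennreal (u powr (- \<beta>) * exp (- u * s\<^sup>2 / 2)) * indicator {0..T} u
       \<le> ennreal (u powr (- \<beta>)) * indicator {0..1/l} u + ennreal (l powr \<beta>) * (ennreal (exp (- l * u)) * indicator {0..} u)"
    proof (cases "u \<in> {0..T}")
      case True
      show ?thesis
      proof (cases "u \<le> 1 / l")
        case ul: True
        have "u powr (- \<beta>) * exp (- u * s\<^sup>2 / 2) \<le> u powr (- \<beta>)" using True by (intro mult_left_le) auto
        then have "ennreal (u powr (- \<beta>) * exp (- u * s\<^sup>2 / 2)) \<le> ennreal (u powr (- \<beta>))" by (rule ennreal_leI)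
        then show ?thesis using True ul by (auto intro: add_increasing2)
      next
        case False
        have "u powr (- \<beta>) \<le> (1 / l) powr (- \<beta>)" using False l beta by (intro powr_mono2') auto
        also have "\<dots> = l powr \<beta>" using l by (simp add: powr_minus powr_divide)
        finally have "u powr (- \<beta>) * exp (- u * s\<^sup>2 / 2) \<le> l powr \<beta> * exp (- l * u)"
          by (auto simp: l_def mult.commute intro!: mult_right_mono)
        then have "ennreal (u powr (- \<beta>) * exp (- u * s\<^sup>2 / 2)) \<le> ennreal (l powr \<beta> * exp (- l * u))" by (rule ennreal_leI)
        then show ?thesis using True False by (simp add: ennreal_mult)
      qed
    qed simp
  qed
  also have "\<dots> = ennreal ((1/l) powr (1 - \<beta>) / (1 - \<beta>)) + ennreal (l powr \<beta>) * ennreal (1 / l)"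
    using l pw[of "1/l"] ex by (subst nn_integral_add) (auto simp: nn_integral_cmult)
  also have "\<dots> = ennreal ((1/l) powr (1 - \<beta>) / (1 - \<beta>) + l powr \<beta> * (1 / l))"
    using l beta by (simp add: ennreal_mult[symmetric])
  also have "(1/l) powr (1 - \<beta>) / (1 - \<beta>) + l powr \<beta> * (1 / l) = (1 / (1 - \<beta>) + 1) * l powr (\<beta> - 1)"
  proof -
    have "(1/l) powr (1 - \<beta>) = l powr (\<beta> - 1)" using l powr_minus[of l "\<beta> - 1"] by (simp add: powr_divide powr_minus inverse_eq_divide)
    moreover have "l powr \<beta> * (1 / l) = l powr (\<beta> - 1)" using l by (simp add: powr_diff)
    ultimately show ?thesis by (simp add: algebra_simps)
  qed
  finally show ?thesis using 1 unfolding l_def[symmetric] by (auto simp: min_def)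
qed

text \<open>By Tonelli the time integral is computed for each frequency. For |\<xi>| > 1 it is of
  order |\<xi>|^(-2 (1-\<beta>)), and the factor |\<xi>|^(2 \<alpha>) turns this into the decay of
  \<open>spec_weight\<close>. This is the point where the integrability of \<mu> meets the time
  singularity.\<close>

lemma frac_cov0_time_integral:
  assumes T: "0 \<le> T"
  shows "(\<integral>\<^sup>+u. ennreal (u powr (- \<beta>)) * frac_cov0 u * indicator {0..T} u \<partial>lborel) < \<infinity>"
proof -
  interpret sigma_finite_measure \<mu> by (rule sigma_finite_mu)
  interpret LM: pair_sigma_finite lborel \<mu> ..
  define b where "b = 1 - \<beta>"
  have b: "0 < b" using beta by (simp add: b_def)
  \<comment> \<open>The first entry serves |\<xi>| \<le> 1, where the weight is at least 1/2 and 1 +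
    |\<xi>|^(2 \<alpha>) \<le> 2; the second serves |\<xi>| > 1, where the weight is at least half
    its leading power.\<close>
  define D where "D = max (4 * T powr b / b) (4 * (1 / b + 1) * 2 powr b)"
  have D0: "0 \<le> D" using b by (auto simp: D_def le_max_iff_disj)
  have "(\<integral>\<^sup>+u. ennreal (u powr (- \<beta>)) * frac_cov0 u * indicator {0..T} u \<partial>lborel)
     = ennreal fourier_const * (\<integral>\<^sup>+u. \<integral>\<^sup>+\<xi>. ennreal (1 + norm \<xi> powr (2 * \<alpha>)) * (ennreal (u powr (- \<beta>) * exp (- u * (norm \<xi>)\<^sup>2 / 2)) * indicator {0..T} u) \<partial>\<mu> \<partial>lborel)"
  proof -
    have "ennreal (u powr (- \<beta>)) * frac_cov0 u * indicator {0..T} u = ennreal fourier_const * (\<integral>\<^sup>+\<xi>. ennreal (1 + norm \<xi> powr (2 * \<alpha>)) * (ennreal (u powr (- \<beta>) * exp (- u * (norm \<xi>)\<^sup>2 / 2)) * indicator {0..T} u) \<partial>\<mu>)" for u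
    proof -
      have "(\<integral>\<^sup>+\<xi>. ennreal (1 + norm \<xi> powr (2 * \<alpha>)) * (ennreal (u powr (- \<beta>) * exp (- u * (norm \<xi>)\<^sup>2 / 2)) * indicator {0..T} u) \<partial>\<mu>)
         = (\<integral>\<^sup>+\<xi>. (ennreal (u powr (- \<beta>)) * indicator {0..T} u) * ennreal ((1 + norm \<xi> powr (2 * \<alpha>)) * exp (- u * (norm \<xi>)\<^sup>2 / 2)) \<partial>\<mu>)"
        by (intro nn_integral_cong) (simp add: ennreal_mult mult_ac add_nonneg_nonneg del: ennreal_plus)
      also have "\<dots> = (ennreal (u powr (- \<beta>)) * indicator {0..T} u) * (\<integral>\<^sup>+\<xi>. ennreal ((1 + norm \<xi> powr (2 * \<alpha>)) * exp (- u * (norm \<xi>)\<^sup>2 / 2)) \<partial>\<mu>)"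
        by (rule nn_integral_cmult) measurable
      finally show ?thesis by (simp add: frac_cov0_def mult_ac)
    qed
    then show ?thesis by (simp add: nn_integral_cmult)
  qed
  also have "(\<integral>\<^sup>+u. \<integral>\<^sup>+\<xi>. ennreal (1 + norm \<xi> powr (2 * \<alpha>)) * (ennreal (u powr (- \<beta>) * exp (- u * (norm \<xi>)\<^sup>2 / 2)) * indicator {0..T} u) \<partial>\<mu> \<partial>lborel)
     = (\<integral>\<^sup>+\<xi>. \<integral>\<^sup>+u. ennreal (1 + norm \<xi> powr (2 * \<alpha>)) * (ennreal (u powr (- \<beta>) * exp (- u * (norm \<xi>)\<^sup>2 / 2)) * indicator {0..T} u) \<partial>lborel \<partial>\<mu>)"
    by (rule LM.Fubini'[symmetric]) measurable
  also have "\<dots> \<le> (\<integral>\<^sup>+\<xi>. ennreal D * ennreal (spec_weight \<xi>) \<partial>\<mu>)"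
  proof (rule nn_integral_mono)
    fix \<xi> :: 'd
    define s where "s = norm \<xi>"
    have s0: "0 \<le> s" by (simp add: s_def)
    have "(\<integral>\<^sup>+u. ennreal (1 + s powr (2 * \<alpha>)) * (ennreal (u powr (- \<beta>) * exp (- u * s\<^sup>2 / 2)) * indicator {0..T} u) \<partial>lborel)
      = ennreal (1 + s powr (2 * \<alpha>)) * (\<integral>\<^sup>+u. ennreal (u powr (- \<beta>) * exp (- u * s\<^sup>2 / 2)) * indicator {0..T} u \<partial>lborel)"
      by (rule nn_integral_cmult) measurable
    also have "\<dots> \<le> ennreal (D * spec_weight \<xi>)"
    proof (cases "s \<le> 1")
      case True
      have "s powr (2 * \<alpha>) \<le> 1 powr (2 * \<alpha>)" "s powr (2 * (1 - \<beta> - \<alpha>)) \<le> 1 powr (2 * (1 - \<beta> - \<alpha>))"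
        using s0 True alpha by (intro powr_mono2; simp)+
      then have p: "s powr (2 * \<alpha>) \<le> 1" and w: "1 / 2 \<le> spec_weight \<xi>"
        unfolding spec_weight_def s_def[symmetric] by (auto simp: field_simps add_pos_nonneg)
      have "(\<integral>\<^sup>+u. ennreal (u powr (- \<beta>) * exp (- u * s\<^sup>2 / 2)) * indicator {0..T} u \<partial>lborel) \<le> (\<integral>\<^sup>+u. ennreal (u powr (- \<beta>)) * indicator {0..T} u \<partial>lborel)"
        by (intro nn_integral_mono) (auto intro!: ennreal_leI mult_left_le split: split_indicator)
      also have "\<dots> = ennreal (T powr b / b)"
        using nn_integral_has_integral_lebesgue'[OF _ has_integral_powr_from_0[of "- \<beta>" T]] T beta by (simp add: add.commute b_def)
      finally have "ennreal (1 + s powr (2 * \<alpha>)) * (\<integral>\<^sup>+u. ennreal (u powr (- \<beta>) * exp (- u * s\<^sup>2 / 2)) * indicator {0..T} u \<partial>lborel) \<le> ennreal 2 * ennreal (T powr b / b)"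
        using p by (intro mult_mono ennreal_leI) auto
      also have "\<dots> = ennreal (2 * (T powr b / b))" using b by (subst ennreal_mult) auto
      also have "\<dots> \<le> ennreal (D * spec_weight \<xi>)"
      proof (rule ennreal_leI)
        have "2 * (T powr b / b) = (4 * T powr b / b) * (1/2)" by simp
        also have "\<dots> \<le> D * spec_weight \<xi>" using w D0 b by (intro mult_mono) (auto simp: D_def)
        finally show "2 * (T powr b / b) \<le> D * spec_weight \<xi>" .
      qed
      finally show ?thesis .
    next
      case False
      then have s1: "1 < s" by simp
      have p: "1 \<le> s powr (2 * \<alpha>)" "1 \<le> s powr (2 * (1 - \<beta> - \<alpha>))" using s1 alpha by (auto intro!: ge_one_powr_ge_zero)
      then have w: "s powr (- 2 * (1 - \<beta> - \<alpha>)) / 2 \<le> spec_weight \<xi>"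
      proof -
        define x where "x = 2 * (1 - \<beta> - \<alpha>)"
        have P: "1 \<le> s powr x" using p by (simp add: x_def)
        have "s powr (- x) / 2 = 1 / (2 * s powr x)" by (simp add: powr_minus inverse_eq_divide)
        also have "\<dots> \<le> 1 / (1 + s powr x)" using P by (intro divide_left_mono mult_pos_pos) linarith+
        finally show ?thesis unfolding spec_weight_def s_def[symmetric] x_def by simp
      qed
      have "(\<integral>\<^sup>+u. ennreal (u powr (- \<beta>) * exp (- u * s\<^sup>2 / 2)) * indicator {0..T} u \<partial>lborel) \<le> ennreal ((1 / b + 1) * (s\<^sup>2 / 2) powr (- b))"
        using time_singular_integral[OF T, of s] s1 by (intro order_trans[OF time_singular_integral[OF T] ennreal_leI]) (auto simp: b_def)
      also have "(s\<^sup>2 / 2) powr (- b) = 2 powr b * s powr (- 2 * b)"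
      proof -
        have e: "s\<^sup>2 = s powr 2" using s1 by (simp add: powr_numeral)
        have "(s\<^sup>2 / 2) powr (- b) = s\<^sup>2 powr (- b) / 2 powr (- b)" by (rule powr_divide)
        also have "s\<^sup>2 powr (- b) = s powr (2 * (- b))" unfolding e by (rule powr_powr)
        also have "s powr (2 * (- b)) / 2 powr (- b) = 2 powr b * s powr (- 2 * b)" by (simp add: powr_minus divide_inverse)
        finally show ?thesis .
      qed
      finally have "ennreal (1 + s powr (2 * \<alpha>)) * (\<integral>\<^sup>+u. ennreal (u powr (- \<beta>) * exp (- u * s\<^sup>2 / 2)) * indicator {0..T} u \<partial>lborel)
          \<le> ennreal (2 * s powr (2 * \<alpha>)) * ennreal ((1 / b + 1) * (2 powr b * s powr (- 2 * b)))"
        using p by (intro mult_mono ennreal_leI) auto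
      also have "\<dots> = ennreal (2 * s powr (2 * \<alpha>) * ((1 / b + 1) * (2 powr b * s powr (- 2 * b))))"
        using b by (subst ennreal_mult) auto
      also have "2 * s powr (2 * \<alpha>) * ((1 / b + 1) * (2 powr b * s powr (- 2 * b))) = (4 * (1 / b + 1) * 2 powr b) * (s powr (- 2 * (1 - \<beta> - \<alpha>)) / 2)"
      proof -
        have "s powr (2 * \<alpha>) * s powr (- 2 * b) = s powr (- 2 * (1 - \<beta> - \<alpha>))"
          unfolding powr_add[symmetric] by (rule arg_cong[where f="\<lambda>e. s powr e"]) (simp add: b_def algebra_simps)
        then show ?thesis by (simp add: mult_ac)
      qed
      also have "ennreal \<dots> \<le> ennreal (D * spec_weight \<xi>)"
        using w D0 b by (intro ennreal_leI mult_mono) (auto simp: D_def)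
      finally show ?thesis .
    qed
    finally show "(\<integral>\<^sup>+u. ennreal (1 + norm \<xi> powr (2 * \<alpha>)) * (ennreal (u powr (- \<beta>) * exp (- u * (norm \<xi>)\<^sup>2 / 2)) * indicator {0..T} u) \<partial>lborel) \<le> ennreal D * ennreal (spec_weight \<xi>)"
      using D0 spec_weight_pos[of \<xi>] by (simp add: s_def ennreal_mult)
  qed
  also have "\<dots> = ennreal D * (\<integral>\<^sup>+\<xi>. ennreal (spec_weight \<xi>) \<partial>\<mu>)" by (rule nn_integral_cmult) measurable
  finally have "(\<integral>\<^sup>+u. ennreal (u powr (- \<beta>)) * frac_cov0 u * indicator {0..T} u \<partial>lborel) \<le> ennreal fourier_const * (ennreal D * (\<integral>\<^sup>+\<xi>. ennreal (spec_weight \<xi>) \<partial>\<mu>))"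
    by (simp add: mult_left_mono)
  also have "\<dots> < \<infinity>" using spec_weight_fin by (simp add: ennreal_mult_less_top)
  finally show ?thesis .
qed

end

section \<open>The mollified integrands\<close>

locale covariance_brownian = covariance \<gamma> \<Lambda> \<mu> \<beta> C\<^sub>\<beta> \<alpha> + brownian PB B
  for \<gamma> :: "real \<Rightarrow> real" and \<Lambda> :: "'d::euclidean_space \<Rightarrow> real" and \<mu> :: "'d measure" and \<beta> C\<^sub>\<beta> \<alpha> :: real
    and PB :: "'b measure" and B :: "real \<Rightarrow> 'b \<Rightarrow> 'd"

section \<open>The time covariance as a measure on pairs of times\<close>

context covariance begin

text \<open>All four covariances in the variance of an increment are integrated against this one
  measure on [0,T]^2; the upper limits t and s sit in the integrand \<open>mol_cov\<close>.\<close>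

definition gamma_measure :: "real \<Rightarrow> (real \<times> real) measure" where
  "gamma_measure T = density (lborel \<Otimes>\<^sub>M lborel) (\<lambda>p. ennreal (\<gamma> (fst p - snd p) * indicator {0..T} (fst p) * indicator {0..T} (snd p)))"

lemma sets_gamma_measure[measurable_cong]: "sets (gamma_measure T) = sets (borel \<Otimes>\<^sub>M borel)"
  by (simp add: gamma_measure_def cong: sets_pair_measure_cong)

lemma nn_integral_gamma_measure:
  assumes [measurable]: "f \<in> borel_measurable (borel \<Otimes>\<^sub>M borel)"
  shows "(\<integral>\<^sup>+p. f p \<partial>gamma_measure T) = (\<integral>\<^sup>+r. \<integral>\<^sup>+r'. ennreal (\<gamma> (r - r') * indicator {0..T} r * indicator {0..T} r') * f (r, r') \<partial>lborel \<partial>lborel)"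
proof -
  have "(\<integral>\<^sup>+p. f p \<partial>gamma_measure T) = (\<integral>\<^sup>+p. ennreal (\<gamma> (fst p - snd p) * indicator {0..T} (fst p) * indicator {0..T} (snd p)) * f p \<partial>(lborel \<Otimes>\<^sub>M lborel))"
    unfolding gamma_measure_def by (rule nn_integral_density) measurable
  also have "\<dots> = (\<integral>\<^sup>+r. \<integral>\<^sup>+r'. ennreal (\<gamma> (r - r') * indicator {0..T} r * indicator {0..T} r') * f (r, r') \<partial>lborel \<partial>lborel)"
    by (subst lborel.nn_integral_fst[symmetric]) auto
  finally show ?thesis .
qed

text \<open>A bound, uniform in r, for the integral of \<gamma>(r - r') f(|r - r'|) over r' in
  [0,T]; the factor 2 counts the two sides of r.\<close>

definition gamma_average :: "real \<Rightarrow> (real \<Rightarrow> ennreal) \<Rightarrow> ennreal" where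
  "gamma_average T f = ennreal (2 * C\<^sub>\<beta>) * (\<integral>\<^sup>+u. ennreal (u powr (- \<beta>)) * f u * indicator {0..T} u \<partial>lborel)"

text \<open>The kernel is not assumed even, so the sign c covers integration over either of the two
  variables. The bound on \<gamma> excludes the origin, which removes the null set r' = r.\<close>

lemma gamma_kernel_bound:
  assumes [measurable]: "f \<in> borel_measurable borel" and c: "\<bar>c\<bar> = 1"
  shows "(\<integral>\<^sup>+r'. ennreal (\<gamma> (c * (r - r')) * indicator {0..T} r * indicator {0..T} r') * f \<bar>r - r'\<bar> \<partial>lborel) \<le> gamma_average T f"
proof -
  define g where "g v = ennreal (v powr (- \<beta>)) * f v * indicator {0..T} v" for v
  have [measurable]: "g \<in> borel_measurable borel" unfolding g_def by measurable
  have "(\<integral>\<^sup>+r'. ennreal (\<gamma> (c * (r - r')) * indicator {0..T} r * indicator {0..T} r') * f \<bar>r - r'\<bar> \<partial>lborel)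
    \<le> (\<integral>\<^sup>+r'. ennreal C\<^sub>\<beta> * (g (r - r') + g (r' - r)) \<partial>lborel)"
  proof (rule nn_integral_mono_AE)
    have "AE r' in lborel. r' \<noteq> r" by (rule AE_lborel_singleton)
    then show "AE r' in lborel. ennreal (\<gamma> (c * (r - r')) * indicator {0..T} r * indicator {0..T} r') * f \<bar>r - r'\<bar> \<le> ennreal C\<^sub>\<beta> * (g (r - r') + g (r' - r))"
    proof eventually_elim
      fix r' assume n: "r' \<noteq> r"
      show "ennreal (\<gamma> (c * (r - r')) * indicator {0..T} r * indicator {0..T} r') * f \<bar>r - r'\<bar> \<le> ennreal C\<^sub>\<beta> * (g (r - r') + g (r' - r))"
      proof (cases "r \<in> {0..T} \<and> r' \<in> {0..T}")
        case True
        have "\<gamma> (c * (r - r')) \<le> C\<^sub>\<beta> * \<bar>c * (r - r')\<bar> powr (- \<beta>)" using n c by (intro gamma_le) auto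
        also have "\<bar>c * (r - r')\<bar> = \<bar>r - r'\<bar>" using c by (simp add: abs_mult)
        finally have "ennreal (\<gamma> (c * (r - r')) * indicator {0..T} r * indicator {0..T} r') * f \<bar>r - r'\<bar> \<le> ennreal (C\<^sub>\<beta> * \<bar>r - r'\<bar> powr (- \<beta>)) * f \<bar>r - r'\<bar>"
          using True by (intro mult_right_mono ennreal_leI) auto
        also have "\<dots> = ennreal C\<^sub>\<beta> * (ennreal (\<bar>r - r'\<bar> powr (- \<beta>)) * f \<bar>r - r'\<bar>)" using Cbeta by (simp add: ennreal_mult mult.assoc)
        also have "\<dots> \<le> ennreal C\<^sub>\<beta> * (g (r - r') + g (r' - r))"
        proof (rule mult_left_mono)
          show "ennreal (\<bar>r - r'\<bar> powr (- \<beta>)) * f \<bar>r - r'\<bar> \<le> g (r - r') + g (r' - r)"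
            using True by (cases "r \<le> r'") (auto simp: g_def abs_if intro: add_increasing add_increasing2)
        qed simp
        finally show ?thesis .
      qed auto
    qed
  qed
  also have "\<dots> = ennreal C\<^sub>\<beta> * ((\<integral>\<^sup>+r'. g (r - r') \<partial>lborel) + (\<integral>\<^sup>+r'. g (r' - r) \<partial>lborel))"
    by (simp add: nn_integral_cmult nn_integral_add)
  also have "(\<integral>\<^sup>+r'. g (r - r') \<partial>lborel) = (\<integral>\<^sup>+v. g v \<partial>lborel)" by (rule nn_integral_lborel_minus) measurable
  also have "(\<integral>\<^sup>+r'. g (r' - r) \<partial>lborel) = (\<integral>\<^sup>+v. g v \<partial>lborel)" using nn_integral_lborel_plus[of g "- r"] by simp
  also have "ennreal C\<^sub>\<beta> * ((\<integral>\<^sup>+v. g v \<partial>lborel) + (\<integral>\<^sup>+v. g v \<partial>lborel)) = gamma_average T f"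
    using Cbeta by (simp add: gamma_average_def g_def ennreal_mult mult.assoc mult_2[symmetric] mult.left_commute)
  finally show ?thesis .
qed

text \<open>In the application A is all of the line or the strip {s<..t} of noise times seen by the
  later integral alone; the length of the strip supplies a factor t - s.\<close>

lemma gamma_measure_fst_bound:
  assumes [measurable]: "f \<in> borel_measurable borel" "A \<in> sets borel"
  shows "(\<integral>\<^sup>+p. indicator A (fst p) * f \<bar>fst p - snd p\<bar> \<partial>gamma_measure T) \<le> emeasure lborel (A \<inter> {0..T}) * gamma_average T f"
proof -
  have "(\<integral>\<^sup>+p. indicator A (fst p) * f \<bar>fst p - snd p\<bar> \<partial>gamma_measure T) =
    (\<integral>\<^sup>+r. \<integral>\<^sup>+r'. ennreal (\<gamma> (r - r') * indicator {0..T} r * indicator {0..T} r') * (indicator A r * f \<bar>r - r'\<bar>) \<partial>lborel \<partial>lborel)"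
    by (subst nn_integral_gamma_measure) auto
  also have "\<dots> \<le> (\<integral>\<^sup>+r. indicator (A \<inter> {0..T}) r * gamma_average T f \<partial>lborel)"
  proof (rule nn_integral_mono)
    fix r
    show "(\<integral>\<^sup>+r'. ennreal (\<gamma> (r - r') * indicator {0..T} r * indicator {0..T} r') * (indicator A r * f \<bar>r - r'\<bar>) \<partial>lborel) \<le> indicator (A \<inter> {0..T}) r * gamma_average T f"
      using gamma_kernel_bound[of f 1 r T] by (auto split: split_indicator)
  qed
  also have "\<dots> = emeasure lborel (A \<inter> {0..T}) * gamma_average T f" by (subst nn_integral_multc) auto
  finally show ?thesis .
qed

lemma gamma_measure_snd_bound:
  assumes [measurable]: "f \<in> borel_measurable borel" "A \<in> sets borel"
  shows "(\<integral>\<^sup>+p. indicator A (snd p) * f \<bar>fst p - snd p\<bar> \<partial>gamma_measure T) \<le> emeasure lborel (A \<inter> {0..T}) * gamma_average T f"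
proof -
  have "(\<integral>\<^sup>+p. indicator A (snd p) * f \<bar>fst p - snd p\<bar> \<partial>gamma_measure T) =
    (\<integral>\<^sup>+r. \<integral>\<^sup>+r'. ennreal (\<gamma> (r - r') * indicator {0..T} r * indicator {0..T} r') * (indicator A r' * f \<bar>r - r'\<bar>) \<partial>lborel \<partial>lborel)"
    by (subst nn_integral_gamma_measure) auto
  also have "\<dots> = (\<integral>\<^sup>+r'. \<integral>\<^sup>+r. ennreal (\<gamma> (r - r') * indicator {0..T} r * indicator {0..T} r') * (indicator A r' * f \<bar>r - r'\<bar>) \<partial>lborel \<partial>lborel)"
    by (rule lborel_pair.Fubini') measurable
  also have "\<dots> \<le> (\<integral>\<^sup>+r'. indicator (A \<inter> {0..T}) r' * gamma_average T f \<partial>lborel)"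
  proof (rule nn_integral_mono)
    fix r'
    show "(\<integral>\<^sup>+r. ennreal (\<gamma> (r - r') * indicator {0..T} r * indicator {0..T} r') * (indicator A r' * f \<bar>r - r'\<bar>) \<partial>lborel) \<le> indicator (A \<inter> {0..T}) r' * gamma_average T f"
      using gamma_kernel_bound[of f "-1" r' T] by (auto simp: mult_ac abs_minus_commute split: split_indicator)
  qed
  also have "\<dots> = emeasure lborel (A \<inter> {0..T}) * gamma_average T f" by (subst nn_integral_multc) auto
  finally show ?thesis .
qed

lemma gamma_average_frac_cov0_finite: "0 \<le> T \<Longrightarrow> gamma_average T frac_cov0 < \<infinity>"
  using frac_cov0_time_integral[of T] by (simp add: gamma_average_def ennreal_mult_less_top)

lemma gamma_average_1_finite: "0 \<le> T \<Longrightarrow> gamma_average T (\<lambda>_. 1) < \<infinity>"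
  using nn_integral_has_integral_lebesgue'[OF _ has_integral_powr_from_0[of "- \<beta>" T]] beta
  by (simp add: gamma_average_def ennreal_mult_less_top)

lemma finite_gamma_measure: assumes T: "0 \<le> T" shows "finite_measure (gamma_measure T)"
proof
  have "emeasure (gamma_measure T) (space (gamma_measure T)) = (\<integral>\<^sup>+p. indicator UNIV (fst p) * 1 \<partial>gamma_measure T)" by simp
  also have "\<dots> \<le> emeasure lborel (UNIV \<inter> {0..T}) * gamma_average T (\<lambda>_. 1)" by (rule gamma_measure_fst_bound[of "\<lambda>_. 1" UNIV]) auto
  also have "\<dots> < \<infinity>" using gamma_average_1_finite[OF T] T by (simp add: ennreal_mult_less_top)
  finally show "emeasure (gamma_measure T) (space (gamma_measure T)) \<noteq> \<infinity>" by simp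
qed

end

section \<open>Conditional covariances of the mollified integrals\<close>

context covariance_brownian begin

definition mollif :: "real \<Rightarrow> 'd \<Rightarrow> 'b \<Rightarrow> real \<Rightarrow> real \<times> 'd \<Rightarrow> real" where
  "mollif t x \<omega> \<epsilon> = mollified_integrand B t x \<omega> \<epsilon>"

lemma mollif_eq: "mollif t x \<omega> \<epsilon> z = (if 0 \<le> fst z \<and> fst z \<le> t then heat_kernel \<epsilon> (x + B_ext (t - fst z) \<omega> - snd z) else 0)"
  by (simp add: mollif_def mollified_integrand_def B_ext_def case_prod_beta max_def)

lemma mollif_nonneg[simp]: "0 \<le> mollif t x \<omega> \<epsilon> z" by (simp add: mollif_eq)

lemma mollif_measurable:
  assumes \<omega>: "\<omega> \<in> space PB" shows "mollif t x \<omega> \<epsilon> \<in> borel_measurable borel"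
proof -
  have [measurable]: "(\<lambda>r. B_ext (t - r) \<omega>) \<in> borel_measurable borel" using \<omega> by measurable
  show ?thesis unfolding mollif_eq[abs_def] borel_prod[symmetric] by measurable
qed

text \<open>The spatial part of the conditional covariance, given the Brownian path, of the
  mollified integrals for (t, x) and (s, y) at the noise times p. The lower limits are supplied by
  \<open>gamma_measure\<close>, which lives on [0,T]^2.\<close>

definition mol_cov :: "real \<Rightarrow> real \<Rightarrow> 'd \<Rightarrow> real \<Rightarrow> 'd \<Rightarrow> 'b \<Rightarrow> real \<times> real \<Rightarrow> real" where
  "mol_cov \<epsilon> t x s y \<omega> p = (if fst p \<le> t \<and> snd p \<le> s then smooth_cov (2 * \<epsilon>) (x + B_ext (t - fst p) \<omega> - (y + B_ext (s - snd p) \<omega>)) else 0)"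

lemma mol_cov_nonneg[simp]: "0 \<le> mol_cov \<epsilon> t x s y \<omega> p" by (simp add: mol_cov_def)

lemma mol_cov_le: "0 < \<epsilon> \<Longrightarrow> mol_cov \<epsilon> t x s y \<omega> p \<le> 2 * smooth_cov0 (2 * \<epsilon>)"
  using smooth_cov0_nonneg[of "2 * \<epsilon>"] by (simp add: mol_cov_def smooth_cov_le)

lemma mol_cov_measurable: "(\<lambda>z. mol_cov \<epsilon> t x s y (snd z) (fst z)) \<in> borel_measurable ((borel \<Otimes>\<^sub>M borel) \<Otimes>\<^sub>M PB)"
  unfolding mol_cov_def by measurable

lemma mol_cov_measurable1: assumes \<omega>: "\<omega> \<in> space PB" shows "mol_cov \<epsilon> t x s y \<omega> \<in> borel_measurable (borel \<Otimes>\<^sub>M borel)"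
proof -
  have [measurable]: "(\<lambda>r. B_ext (f r) \<omega>) \<in> borel_measurable M" if "f \<in> borel_measurable M" for f and M :: "'c measure"
    using that \<omega> by measurable
  show ?thesis unfolding mol_cov_def by measurable
qed

lemma nn_integral_lborel_pair:
  fixes f :: "real \<times> 'd \<Rightarrow> ennreal"
  assumes [measurable]: "f \<in> borel_measurable borel"
  shows "(\<integral>\<^sup>+z. f z \<partial>lborel) = (\<integral>\<^sup>+r. \<integral>\<^sup>+y. f (r, y) \<partial>lborel \<partial>lborel)"
  unfolding lborel_prod[symmetric] by (subst lborel.nn_integral_fst) (auto simp: lborel_prod)

text \<open>Tonelli brings the two space integrals inside, where \<open>heat_conv_double\<close>
  evaluates them. The time cutoff at T can be inserted because t and s are at most T.\<close>

lemma cross_nn: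
  assumes \<omega>: "\<omega> \<in> space PB" and e: "0 < \<epsilon>" and ts: "t \<le> T" "s \<le> T"
  shows "(\<integral>\<^sup>+z. ennreal (mollif t x \<omega> \<epsilon> (fst z) * mollif s y \<omega> \<epsilon> (snd z) * H_kernel \<gamma> \<Lambda> z) \<partial>(lborel \<Otimes>\<^sub>M lborel))
    = (\<integral>\<^sup>+p. ennreal (mol_cov \<epsilon> t x s y \<omega> p) \<partial>gamma_measure T)"
proof -
  note [measurable] = mollif_measurable[OF \<omega>] mol_cov_measurable1[OF \<omega>]
  have [measurable]: "(\<lambda>r. B_ext (f r) \<omega>) \<in> borel_measurable M" if "f \<in> borel_measurable M" for f and M :: "'c measure"
    using that \<omega> by measurable
  define G where "G r y1 r' y2 = ennreal (mollif t x \<omega> \<epsilon> (r, y1) * mollif s y \<omega> \<epsilon> (r', y2) * (\<gamma> (r - r') * \<Lambda> (y1 - y2)))" for r y1 r' y2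
  have Gm[measurable]: "(\<lambda>x. G (f1 x) (f2 x) (f3 x) (f4 x)) \<in> borel_measurable M"
    if [measurable]: "f1 \<in> borel_measurable M" "f2 \<in> borel_measurable M" "f3 \<in> borel_measurable M" "f4 \<in> borel_measurable M" for f1 f2 f3 f4 and M :: "'c measure"
    unfolding G_def mollif_eq by measurable
  have Hm: "(\<lambda>z. ennreal (mollif t x \<omega> \<epsilon> (fst z) * mollif s y \<omega> \<epsilon> (snd z) * H_kernel \<gamma> \<Lambda> z)) \<in> borel_measurable (borel \<Otimes>\<^sub>M borel)"
  proof -
    have "(\<lambda>z. ennreal (mollif t x \<omega> \<epsilon> (fst z) * mollif s y \<omega> \<epsilon> (snd z) * H_kernel \<gamma> \<Lambda> z)) = (\<lambda>z. G (fst (fst z)) (snd (fst z)) (fst (snd z)) (snd (snd z)))"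
      by (simp add: G_def H_kernel_def)
    also have "\<dots> \<in> borel_measurable (borel \<Otimes>\<^sub>M borel)"
      unfolding borel_prod[symmetric, where 'a=real and 'b='d] by measurable
    finally show ?thesis .
  qed
  have "(\<integral>\<^sup>+z. ennreal (mollif t x \<omega> \<epsilon> (fst z) * mollif s y \<omega> \<epsilon> (snd z) * H_kernel \<gamma> \<Lambda> z) \<partial>(lborel \<Otimes>\<^sub>M lborel))
     = (\<integral>\<^sup>+z1. \<integral>\<^sup>+z2. G (fst z1) (snd z1) (fst z2) (snd z2) \<partial>lborel \<partial>lborel)"
    using Hm by (subst lborel.nn_integral_fst[symmetric]) (auto simp: G_def H_kernel_def)
  also have "\<dots> = (\<integral>\<^sup>+z1. \<integral>\<^sup>+r'. \<integral>\<^sup>+y2. G (fst z1) (snd z1) r' y2 \<partial>lborel \<partial>lborel \<partial>lborel)"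
    by (rule nn_integral_cong, subst nn_integral_lborel_pair) (auto simp: borel_prod[symmetric])
  also have "\<dots> = (\<integral>\<^sup>+r. \<integral>\<^sup>+y1. \<integral>\<^sup>+r'. \<integral>\<^sup>+y2. G r y1 r' y2 \<partial>lborel \<partial>lborel \<partial>lborel \<partial>lborel)"
    by (subst nn_integral_lborel_pair) (auto simp: borel_prod[symmetric])
  also have "\<dots> = (\<integral>\<^sup>+r. \<integral>\<^sup>+r'. \<integral>\<^sup>+y1. \<integral>\<^sup>+y2. G r y1 r' y2 \<partial>lborel \<partial>lborel \<partial>lborel \<partial>lborel)"
    by (rule nn_integral_cong, rule lborel_pair.Fubini'[symmetric]) measurable
  also have "\<dots> = (\<integral>\<^sup>+r. \<integral>\<^sup>+r'. ennreal (\<gamma> (r - r') * indicator {0..T} r * indicator {0..T} r') * ennreal (mol_cov \<epsilon> t x s y \<omega> (r, r')) \<partial>lborel \<partial>lborel)"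
  proof (rule nn_integral_cong, rule nn_integral_cong)
    fix r r' :: real
    show "(\<integral>\<^sup>+y1. \<integral>\<^sup>+y2. G r y1 r' y2 \<partial>lborel \<partial>lborel) = ennreal (\<gamma> (r - r') * indicator {0..T} r * indicator {0..T} r') * ennreal (mol_cov \<epsilon> t x s y \<omega> (r, r'))"
    proof (cases "0 \<le> r \<and> r \<le> t \<and> 0 \<le> r' \<and> r' \<le> s")
      case True
      define a where "a = x + B_ext (t - r) \<omega>"
      define b where "b = y + B_ext (s - r') \<omega>"
      have "(\<integral>\<^sup>+y1. \<integral>\<^sup>+y2. G r y1 r' y2 \<partial>lborel \<partial>lborel)
         = (\<integral>\<^sup>+y1. \<integral>\<^sup>+y2. ennreal (\<gamma> (r - r')) * ennreal (heat_kernel \<epsilon> (a - y1) * heat_kernel \<epsilon> (b - y2) * \<Lambda> (y1 - y2)) \<partial>lborel \<partial>lborel)"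
        using True gamma_nonneg Lambda_nonneg
        by (intro nn_integral_cong) (simp add: G_def mollif_eq a_def b_def ennreal_mult[symmetric] mult_ac)
      also have "\<dots> = ennreal (\<gamma> (r - r')) * (\<integral>\<^sup>+y1. \<integral>\<^sup>+y2. ennreal (heat_kernel \<epsilon> (a - y1) * heat_kernel \<epsilon> (b - y2) * \<Lambda> (y1 - y2)) \<partial>lborel \<partial>lborel)"
        by (simp add: nn_integral_cmult)
      also have "\<dots> = ennreal (\<gamma> (r - r')) * ennreal (smooth_cov (2 * \<epsilon>) (a - b))"
        using heat_conv_double[OF Lambda_meas Lambda_nonneg e, of a b] e by (simp add: heat_conv_smooth_cov)
      finally show ?thesis using True ts by (simp add: mol_cov_def a_def b_def)
    next
      case False
      then have G0: "G r y1 r' y2 = 0" for y1 y2 by (auto simp: G_def mollif_eq)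
      show ?thesis unfolding G0 using False by (auto simp: mol_cov_def split: split_indicator)
    qed
  qed
  also have "\<dots> = (\<integral>\<^sup>+p. ennreal (mol_cov \<epsilon> t x s y \<omega> p) \<partial>gamma_measure T)" by (subst nn_integral_gamma_measure) auto
  finally show ?thesis .
qed

lemma H_measurable:
  assumes [measurable]: "f \<in> borel_measurable borel" "g \<in> borel_measurable borel"
  shows "(\<lambda>z. f (fst z) * g (snd z) * H_kernel \<gamma> \<Lambda> z) \<in> borel_measurable (lborel \<Otimes>\<^sub>M (lborel :: (real \<times> 'd) measure))"
proof -
  have [measurable]: "(\<lambda>z. H_kernel \<gamma> \<Lambda> z) \<in> borel_measurable (borel \<Otimes>\<^sub>M borel)"
    unfolding H_kernel_def borel_prod[symmetric, where 'a=real and 'b='d] by measurable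
  show ?thesis by measurable
qed

lemma H_kernel_nonneg: "0 \<le> H_kernel \<gamma> \<Lambda> z" by (simp add: H_kernel_def gamma_nonneg Lambda_nonneg)

lemma mol_cov_integrable:
  assumes \<omega>: "\<omega> \<in> space PB" and e: "0 < \<epsilon>" and T: "0 \<le> T"
  shows "integrable (gamma_measure T) (mol_cov \<epsilon> t x s y \<omega>)"
proof -
  interpret finite_measure "gamma_measure T" by (rule finite_gamma_measure[OF T])
  show ?thesis
    by (rule integrable_const_bound[where B="2 * smooth_cov0 (2 * \<epsilon>)"])
      (use mol_cov_le[OF e] mol_cov_measurable1[OF \<omega>] in \<open>auto\<close>)
qed

lemma cross_integral:
  assumes \<omega>: "\<omega> \<in> space PB" and e: "0 < \<epsilon>" and ts: "t \<le> T" "s \<le> T" "0 \<le> T"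
  shows "integrable (lborel \<Otimes>\<^sub>M lborel) (\<lambda>z. mollif t x \<omega> \<epsilon> (fst z) * mollif s y \<omega> \<epsilon> (snd z) * H_kernel \<gamma> \<Lambda> z)"
    and "H_inner \<gamma> \<Lambda> (mollif t x \<omega> \<epsilon>) (mollif s y \<omega> \<epsilon>) = (\<integral>p. mol_cov \<epsilon> t x s y \<omega> p \<partial>gamma_measure T)"
proof -
  have nn: "(\<integral>\<^sup>+z. ennreal (mollif t x \<omega> \<epsilon> (fst z) * mollif s y \<omega> \<epsilon> (snd z) * H_kernel \<gamma> \<Lambda> z) \<partial>(lborel \<Otimes>\<^sub>M lborel))
    = ennreal (\<integral>p. mol_cov \<epsilon> t x s y \<omega> p \<partial>gamma_measure T)"
    unfolding cross_nn[OF \<omega> e ts(1,2)] by (intro nn_integral_eq_integral mol_cov_integrable \<omega> e ts) auto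
  show int: "integrable (lborel \<Otimes>\<^sub>M lborel) (\<lambda>z. mollif t x \<omega> \<epsilon> (fst z) * mollif s y \<omega> \<epsilon> (snd z) * H_kernel \<gamma> \<Lambda> z)"
    by (rule integrableI_nonneg[OF H_measurable]) (use nn mollif_measurable[OF \<omega>] H_kernel_nonneg in auto)
  have "ennreal (H_inner \<gamma> \<Lambda> (mollif t x \<omega> \<epsilon>) (mollif s y \<omega> \<epsilon>)) = ennreal (\<integral>p. mol_cov \<epsilon> t x s y \<omega> p \<partial>gamma_measure T)"
    unfolding nn[symmetric] H_inner_def using H_kernel_nonneg by (intro nn_integral_eq_integral[symmetric] int) auto
  then show "H_inner \<gamma> \<Lambda> (mollif t x \<omega> \<epsilon>) (mollif s y \<omega> \<epsilon>) = (\<integral>p. mol_cov \<epsilon> t x s y \<omega> p \<partial>gamma_measure T)"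
    by (subst (asm) ennreal_inj) (auto simp: H_inner_def H_kernel_nonneg intro!: integral_nonneg_AE)
qed

lemma mollif_admissible:
  assumes \<omega>: "\<omega> \<in> space PB" and e: "0 < \<epsilon>"
  shows "H_admissible \<gamma> \<Lambda> (mollif t x \<omega> \<epsilon>)"
proof -
  have "integrable (lborel \<Otimes>\<^sub>M lborel) (\<lambda>z. mollif t x \<omega> \<epsilon> (fst z) * mollif t x \<omega> \<epsilon> (snd z) * H_kernel \<gamma> \<Lambda> z)"
    by (rule cross_integral[OF \<omega> e, of t "max t 0"]) auto
  then show ?thesis unfolding H_admissible_def using mollif_measurable[OF \<omega>] by (auto simp: mollif_eq)
qed

text \<open>Written as 1 * f + (-1) * g to match the linearity clause of
  \<open>gaussian_noise\<close> literally.\<close>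

definition mollif_diff :: "real \<Rightarrow> 'd \<Rightarrow> real \<Rightarrow> 'd \<Rightarrow> 'b \<Rightarrow> real \<Rightarrow> real \<times> 'd \<Rightarrow> real" where
  "mollif_diff t x s y \<omega> \<epsilon> = (\<lambda>z. 1 * mollif t x \<omega> \<epsilon> z + (-1) * mollif s y \<omega> \<epsilon> z)"

text \<open>The integrand of the variance of a difference. Both mixed terms are kept because neither
  \<gamma> nor \<open>smooth_cov\<close> is assumed even. Its sign is not fixed, although its
  integral is a variance.\<close>

definition mol_incr_cov :: "real \<Rightarrow> real \<Rightarrow> 'd \<Rightarrow> real \<Rightarrow> 'd \<Rightarrow> 'b \<Rightarrow> real \<times> real \<Rightarrow> real" where
  "mol_incr_cov \<epsilon> t x s y \<omega> p = (mol_cov \<epsilon> t x t x \<omega> p + mol_cov \<epsilon> s y s y \<omega> p) - (mol_cov \<epsilon> t x s y \<omega> p + mol_cov \<epsilon> s y t x \<omega> p)"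

lemma mollif_diff:
  assumes \<omega>: "\<omega> \<in> space PB" and e: "0 < \<epsilon>" and ts: "t \<le> T" "s \<le> T" "0 \<le> T"
  shows "H_admissible \<gamma> \<Lambda> (mollif_diff t x s y \<omega> \<epsilon>)"
    and "H_inner \<gamma> \<Lambda> (mollif_diff t x s y \<omega> \<epsilon>) (mollif_diff t x s y \<omega> \<epsilon>) = (\<integral>p. mol_incr_cov \<epsilon> t x s y \<omega> p \<partial>gamma_measure T)"
proof -
  let ?f = "mollif t x \<omega> \<epsilon>" and ?g = "mollif s y \<omega> \<epsilon>" and ?H = "H_kernel \<gamma> \<Lambda>"
  note i = cross_integral[OF \<omega> e]
  note I1 = i(1)[of t T t x x] i(1)[of t T s x y] i(1)[of s T t y x] i(1)[of s T s y y]
  note [measurable] = mollif_measurable[OF \<omega>]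
  have dm[measurable]: "mollif_diff t x s y \<omega> \<epsilon> \<in> borel_measurable borel" unfolding mollif_diff_def by measurable
  have sum: "integrable (lborel \<Otimes>\<^sub>M lborel) (\<lambda>z. (?f (fst z) * ?f (snd z) * ?H z + ?g (fst z) * ?g (snd z) * ?H z)
     + (?f (fst z) * ?g (snd z) * ?H z + ?g (fst z) * ?f (snd z) * ?H z))"
    using I1 ts by (intro Bochner_Integration.integrable_add) auto
  have "integrable (lborel \<Otimes>\<^sub>M lborel) (\<lambda>z. \<bar>mollif_diff t x s y \<omega> \<epsilon> (fst z)\<bar> * \<bar>mollif_diff t x s y \<omega> \<epsilon> (snd z)\<bar> * ?H z)"
  proof (rule Bochner_Integration.integrable_bound[OF sum])
    show "(\<lambda>z. \<bar>mollif_diff t x s y \<omega> \<epsilon> (fst z)\<bar> * \<bar>mollif_diff t x s y \<omega> \<epsilon> (snd z)\<bar> * ?H z) \<in> borel_measurable (lborel \<Otimes>\<^sub>M lborel)"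
      by (rule H_measurable) measurable
    show "AE z in lborel \<Otimes>\<^sub>M lborel. norm (\<bar>mollif_diff t x s y \<omega> \<epsilon> (fst z)\<bar> * \<bar>mollif_diff t x s y \<omega> \<epsilon> (snd z)\<bar> * ?H z) \<le>
      norm ((?f (fst z) * ?f (snd z) * ?H z + ?g (fst z) * ?g (snd z) * ?H z) + (?f (fst z) * ?g (snd z) * ?H z + ?g (fst z) * ?f (snd z) * ?H z))"
    proof (rule AE_I2)
      fix z :: "(real \<times> 'd) \<times> real \<times> 'd"
      have d: "\<bar>mollif_diff t x s y \<omega> \<epsilon> v\<bar> \<le> ?f v + ?g v" for v
        unfolding mollif_diff_def using mollif_nonneg[of t x \<omega> \<epsilon> v] mollif_nonneg[of s y \<omega> \<epsilon> v] by linarith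
      have "\<bar>mollif_diff t x s y \<omega> \<epsilon> (fst z)\<bar> * \<bar>mollif_diff t x s y \<omega> \<epsilon> (snd z)\<bar> * ?H z \<le> (?f (fst z) + ?g (fst z)) * (?f (snd z) + ?g (snd z)) * ?H z"
        by (intro mult_right_mono mult_mono d H_kernel_nonneg) auto
      also have "\<dots> = (?f (fst z) * ?f (snd z) * ?H z + ?g (fst z) * ?g (snd z) * ?H z) + (?f (fst z) * ?g (snd z) * ?H z + ?g (fst z) * ?f (snd z) * ?H z)"
        by (simp add: algebra_simps)
      finally show "norm (\<bar>mollif_diff t x s y \<omega> \<epsilon> (fst z)\<bar> * \<bar>mollif_diff t x s y \<omega> \<epsilon> (snd z)\<bar> * ?H z) \<le>
        norm ((?f (fst z) * ?f (snd z) * ?H z + ?g (fst z) * ?g (snd z) * ?H z) + (?f (fst z) * ?g (snd z) * ?H z + ?g (fst z) * ?f (snd z) * ?H z))"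
        using H_kernel_nonneg[of z] by (auto simp: abs_mult intro: order_trans[OF _ abs_ge_self])
    qed
  qed
  then show "H_admissible \<gamma> \<Lambda> (mollif_diff t x s y \<omega> \<epsilon>)"
    unfolding H_admissible_def using dm by (auto simp: mollif_diff_def mollif_eq)
  have "H_inner \<gamma> \<Lambda> (mollif_diff t x s y \<omega> \<epsilon>) (mollif_diff t x s y \<omega> \<epsilon>) =
    (\<integral>z. (?f (fst z) * ?f (snd z) * ?H z + ?g (fst z) * ?g (snd z) * ?H z)
     - (?f (fst z) * ?g (snd z) * ?H z + ?g (fst z) * ?f (snd z) * ?H z) \<partial>(lborel \<Otimes>\<^sub>M lborel))"
    unfolding H_inner_def mollif_diff_def by (intro Bochner_Integration.integral_cong refl) (simp add: algebra_simps)
  also have "\<dots> = (H_inner \<gamma> \<Lambda> ?f ?f + H_inner \<gamma> \<Lambda> ?g ?g) - (H_inner \<gamma> \<Lambda> ?f ?g + H_inner \<gamma> \<Lambda> ?g ?f)"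
    unfolding H_inner_def using I1 ts by (simp only: Bochner_Integration.integral_diff Bochner_Integration.integral_add Bochner_Integration.integrable_add)
  also have "\<dots> = (\<integral>p. mol_incr_cov \<epsilon> t x s y \<omega> p \<partial>gamma_measure T)"
    unfolding mol_incr_cov_def using i(2)[of t T t x x] i(2)[of t T s x y] i(2)[of s T t y x] i(2)[of s T s y y] ts
    by (simp add: mol_cov_integrable \<omega> e)
  finally show "H_inner \<gamma> \<Lambda> (mollif_diff t x s y \<omega> \<epsilon>) (mollif_diff t x s y \<omega> \<epsilon>) = (\<integral>p. mol_incr_cov \<epsilon> t x s y \<omega> p \<partial>gamma_measure T)" .
qed

end

section \<open>Exponential moments of the conditional variance\<close>

text \<open>It suffices to approach h x from values below x, so continuity and monotonicity of h
  give the exchange. Nonnegativity of y covers negative thresholds, which \<open>ennreal\<close>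
  cannot see.\<close>

lemma ennreal_le_liminf_compose:
  fixes h :: "real \<Rightarrow> real"
  assumes h: "continuous_on UNIV h" "mono h" and y: "\<And>k. 0 \<le> y k" and le: "ennreal x \<le> liminf (\<lambda>k. ennreal (y k))"
  shows "ennreal (h x) \<le> liminf (\<lambda>k::nat. ennreal (h (y k)))"
  unfolding le_Liminf_iff
proof (intro allI impI)
  fix z assume z: "z < ennreal (h x)"
  then obtain z' where z': "z = ennreal z'" "0 \<le> z'" by (cases z) auto
  have "z' < h x" using z unfolding z' by (simp add: ennreal_less_iff z'(2))
  moreover have "(h \<longlongrightarrow> h x) (at_left x)"
    using h(1) by (auto simp: continuous_on_eq_continuous_at isCont_def intro: tendsto_within_subset)
  ultimately have "\<forall>\<^sub>F a in at_left x. z' < h a" by (intro order_tendstoD(1))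
  then obtain b where b: "b < x" "\<And>a. b < a \<Longrightarrow> a < x \<Longrightarrow> z' < h a" by (auto simp: eventually_at_left_field)
  define a where "a = (b + x) / 2"
  have a: "z' < h a" "a < x" using b(1) b(2)[of a] by (auto simp: a_def)
  have "\<forall>\<^sub>F k in sequentially. a < y k"
  proof (cases "0 \<le> a")
    case True
    then have "ennreal a < ennreal x" using a by (simp add: ennreal_less_iff)
    then have "\<forall>\<^sub>F k in sequentially. ennreal a < ennreal (y k)" using le unfolding le_Liminf_iff by blast
    then show ?thesis by eventually_elim (simp add: ennreal_less_iff True)
  next
    case False
    then show ?thesis using y by (intro always_eventually allI) (meson less_le_trans not_le)
  qed
  then show "\<forall>\<^sub>F k in sequentially. z < ennreal (h (y k))"
  proof eventually_elim
    fix k assume "a < y k"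
    then have "h a \<le> h (y k)" by (intro monoD[OF h(2)]) simp
    then show "z < ennreal (h (y k))" using a z' by (simp add: ennreal_less_iff)
  qed
qed

context covariance_brownian begin

text \<open>The discount exp (- N u) tends to 0 for u > 0 under an integrable majorant. Dominated
  convergence then makes one step of Khasminskii's iteration a contraction by 1/2, with no smallness
  condition on T.\<close>

lemma small_parameter:
  assumes T: "0 \<le> T" and c: "0 \<le> c"
  shows "\<exists>N::nat. (\<integral>\<^sup>+u. ennreal (c * u powr (- \<beta>) * exp (- real N * u)) * (2 * frac_cov0 u) * indicator {0..T} u \<partial>lborel) \<le> ennreal (1/2)"
proof -
  define F where "F u = ennreal (u powr (- \<beta>)) * frac_cov0 u * indicator {0..T} u" for u
  have Fm[measurable]: "F \<in> borel_measurable borel" unfolding F_def by measurable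
  have Ff: "(\<integral>\<^sup>+u. F u \<partial>lborel) < \<infinity>" unfolding F_def by (rule frac_cov0_time_integral[OF T])
  have "(\<lambda>N. \<integral>\<^sup>+u. ennreal (2 * c * exp (- real N * u)) * F u \<partial>lborel) \<longlonglongrightarrow> (\<integral>\<^sup>+u. 0 \<partial>(lborel :: real measure))"
  proof (rule nn_integral_dominated_convergence[where w="\<lambda>u. ennreal (2 * c) * F u"])
    show "AE u in lborel. ennreal (2 * c * exp (- real N * u)) * F u \<le> ennreal (2 * c) * F u" for N
    proof (rule AE_I2)
      fix u :: real
      show "ennreal (2 * c * exp (- real N * u)) * F u \<le> ennreal (2 * c) * F u"
      proof (cases "0 \<le> u")
        case True
        then show ?thesis using c by (intro mult_right_mono ennreal_leI) (auto intro!: mult_left_le)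
      qed (simp add: F_def)
    qed
    show "(\<integral>\<^sup>+u. ennreal (2 * c) * F u \<partial>lborel) < \<infinity>" using Ff by (simp add: nn_integral_cmult ennreal_mult_less_top)
    have "AE u in lborel. F u \<noteq> \<infinity>" using Ff by (intro nn_integral_PInf_AE) auto
    moreover have "AE u in lborel. u \<noteq> (0::real)" by (rule AE_lborel_singleton)
    ultimately show "AE u in lborel. (\<lambda>N. ennreal (2 * c * exp (- real N * u)) * F u) \<longlonglongrightarrow> 0"
    proof eventually_elim
      fix u assume Fu: "F u \<noteq> \<infinity>" and u: "u \<noteq> 0"
      show "(\<lambda>N. ennreal (2 * c * exp (- real N * u)) * F u) \<longlonglongrightarrow> 0"
      proof (cases "0 < u")
        case True
        have "(\<lambda>N. exp (- u) ^ N) \<longlonglongrightarrow> 0" using True by (intro LIMSEQ_realpow_zero) auto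
        then have "(\<lambda>N. 2 * c * exp (- real N * u)) \<longlonglongrightarrow> 2 * c * 0"
          by (intro tendsto_intros) (simp add: exp_of_nat_mult[symmetric])
        then have "(\<lambda>N. ennreal (2 * c * exp (- real N * u))) \<longlonglongrightarrow> ennreal 0" by (intro tendsto_ennrealI) simp
        then have "(\<lambda>N. F u * ennreal (2 * c * exp (- real N * u))) \<longlonglongrightarrow> F u * ennreal 0"
          using Fu by (intro ennreal_tendsto_cmult) (auto simp: less_top)
        then show ?thesis by (simp add: mult.commute)
      qed (use u in \<open>simp add: F_def\<close>)
    qed
  qed auto
  then have "\<forall>\<^sub>F N in sequentially. (\<integral>\<^sup>+u. ennreal (2 * c * exp (- real N * u)) * F u \<partial>lborel) < ennreal (1/2)"
  proof (rule order_tendstoD(2))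
    have z: "(\<integral>\<^sup>+u. 0 \<partial>(lborel :: real measure)) = 0" by simp
    show "(\<integral>\<^sup>+u. 0 \<partial>(lborel :: real measure)) < ennreal (1/2)" unfolding z by (simp only: ennreal_less_zero_iff)
  qed
  then obtain N :: nat where N: "(\<integral>\<^sup>+u. ennreal (2 * c * exp (- real N * u)) * F u \<partial>lborel) < ennreal (1/2)"
    using eventually_happens'[OF sequentially_bot] by blast
  have "ennreal (c * u powr (- \<beta>) * exp (- real N * u)) * (2 * frac_cov0 u) * indicator {0..T} u = ennreal (2 * c * exp (- real N * u)) * F u" for u
    using c by (simp add: F_def ennreal_mult mult_ac)
  with N show ?thesis by (intro exI[of _ N]) simp
qed

lemma smooth_cov0_shift_le_frac_cov0: "0 < e \<Longrightarrow> 0 \<le> u \<Longrightarrow> ennreal (smooth_cov0 (e + u)) \<le> frac_cov0 u"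
  unfolding smooth_cov0_eq[OF add_pos_nonneg] frac_cov0_def
proof (intro mult_left_mono nn_integral_mono ennreal_leI)
  fix \<xi> :: 'd assume e: "0 < e" "0 \<le> u"
  have "exp (- (e + u) * (norm \<xi>)\<^sup>2 / 2) \<le> 1 * exp (- u * (norm \<xi>)\<^sup>2 / 2)" using e by (simp add: algebra_simps)
  also have "\<dots> \<le> (1 + norm \<xi> powr (2 * \<alpha>)) * exp (- u * (norm \<xi>)\<^sup>2 / 2)" by (intro mult_right_mono) auto
  finally show "exp (- (e + u) * (norm \<xi>)\<^sup>2 / 2) \<le> (1 + norm \<xi> powr (2 * \<alpha>)) * exp (- u * (norm \<xi>)\<^sup>2 / 2)" .
qed simp

text \<open>This supplies the bound \<open>K\<close> of Khasminskii's lemma. Averaging over an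
  increment of length u adds u to the smoothing, and the result is bounded independently of e and
  z.\<close>

lemma heat_smoothing_bound:
  assumes e: "0 < e" and u: "0 < u"
  shows "(\<integral>\<^sup>+y. ennreal (heat_kernel u y) * ennreal (smooth_cov e (z + y) + smooth_cov e (- (z + y))) \<partial>lborel) \<le> 2 * frac_cov0 u"
proof -
  have "(\<integral>\<^sup>+y. ennreal (heat_kernel u y) * ennreal (smooth_cov e (z + y) + smooth_cov e (- (z + y))) \<partial>lborel)
     = (\<integral>\<^sup>+y. heat_conv \<Lambda> e (z + y) * ennreal (heat_kernel u y) + heat_conv \<Lambda> e (- z - y) * ennreal (heat_kernel u y) \<partial>lborel)"
    using e by (intro nn_integral_cong) (simp add: heat_conv_smooth_cov distrib_left mult.commute)
  also have "\<dots> = (\<integral>\<^sup>+y. heat_conv \<Lambda> e (z + y) * ennreal (heat_kernel u y) \<partial>lborel) + (\<integral>\<^sup>+y. heat_conv \<Lambda> e (- z - y) * ennreal (heat_kernel u y) \<partial>lborel)"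
    by (rule nn_integral_add) measurable
  also have "(\<integral>\<^sup>+y. heat_conv \<Lambda> e (- z - y) * ennreal (heat_kernel u y) \<partial>lborel) = (\<integral>\<^sup>+y. heat_conv \<Lambda> e (- z + y) * ennreal (heat_kernel u y) \<partial>lborel)"
    using nn_integral_lborel_minus[of "\<lambda>y. heat_conv \<Lambda> e (- z + y) * ennreal (heat_kernel u y)" 0] by simp
  also have "(\<integral>\<^sup>+y. heat_conv \<Lambda> e (z + y) * ennreal (heat_kernel u y) \<partial>lborel) = heat_conv \<Lambda> (e + u) z"
    by (rule heat_conv_semigroup[OF Lambda_meas Lambda_nonneg e u])
  also have "(\<integral>\<^sup>+y. heat_conv \<Lambda> e (- z + y) * ennreal (heat_kernel u y) \<partial>lborel) = heat_conv \<Lambda> (e + u) (- z)"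
    by (rule heat_conv_semigroup[OF Lambda_meas Lambda_nonneg e u])
  also have "heat_conv \<Lambda> (e + u) z + heat_conv \<Lambda> (e + u) (- z) = ennreal (smooth_cov (e + u) z + smooth_cov (e + u) (- z))"
    using e u by (simp add: heat_conv_smooth_cov)
  also have "\<dots> \<le> ennreal (2 * smooth_cov0 (e + u))" using e u by (intro ennreal_leI smooth_cov_sum_le) simp
  also have "\<dots> = 2 * ennreal (smooth_cov0 (e + u))" using smooth_cov0_nonneg by (simp add: ennreal_mult)
  also have "\<dots> \<le> 2 * frac_cov0 u" using e u by (intro mult_left_mono smooth_cov0_shift_le_frac_cov0) auto
  finally show ?thesis .
qed

text \<open>Time reversal and symmetrisation turn the variance into the one-sided functional of Khasminskii's lemma.\<close>
lemma variance_le_one_sided: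
  assumes \<omega>: "\<omega> \<in> space PB" and e: "0 < \<epsilon>" and t: "0 \<le> t" "t \<le> T"
  shows "ennreal (\<integral>p. mol_cov \<epsilon> t x t x \<omega> p \<partial>gamma_measure T) \<le>
    (\<integral>\<^sup>+a. \<integral>\<^sup>+v. ennreal (C\<^sub>\<beta> * (v - a) powr (- \<beta>) * (smooth_cov (2 * \<epsilon>) (B_ext v \<omega> - B_ext a \<omega>) + smooth_cov (2 * \<epsilon>) (- (B_ext v \<omega> - B_ext a \<omega>))) * indicator {0..T} a * indicator {a..T} v) \<partial>lborel \<partial>lborel)"
proof -
  note [measurable] = mol_cov_measurable1[OF \<omega>]
  have [measurable]: "(\<lambda>r. B_ext (f r) \<omega>) \<in> borel_measurable M" if "f \<in> borel_measurable M" for f and M :: "'c measure"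
    using that \<omega> by measurable
  let ?h = "\<lambda>r r'. smooth_cov (2 * \<epsilon>) (B_ext r \<omega> - B_ext r' \<omega>)"
  define G where "G r r' = ennreal (C\<^sub>\<beta> * \<bar>r - r'\<bar> powr (- \<beta>) * ?h r r' * (if 0 \<le> r \<and> r \<le> t \<and> 0 \<le> r' \<and> r' \<le> t then 1 else 0))" for r r'
  have Gm[measurable]: "(\<lambda>x. G (f x) (g x)) \<in> borel_measurable M" if [measurable]: "f \<in> borel_measurable M" "g \<in> borel_measurable M" for f g and M :: "'c measure"
    unfolding G_def by measurable
  \<comment> \<open>The flag tells which of the two original variables is the later time, hence the
    sign of the displacement; adding both cases symmetrises the smoothed covariance.\<close>
  define U where "U a v b = ennreal (C\<^sub>\<beta> * (v - a) powr (- \<beta>) * (if b then ?h v a else ?h a v) * (if 0 \<le> a \<and> a \<le> T \<and> a \<le> v \<and> v \<le> T then 1 else 0))" for a v b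
  have Um[measurable]: "(\<lambda>x. U (f x) (g x) b) \<in> borel_measurable M" if [measurable]: "f \<in> borel_measurable M" "g \<in> borel_measurable M" for f g b and M :: "'c measure"
    unfolding U_def by measurable
  have "ennreal (\<integral>p. mol_cov \<epsilon> t x t x \<omega> p \<partial>gamma_measure T) = (\<integral>\<^sup>+p. ennreal (mol_cov \<epsilon> t x t x \<omega> p) \<partial>gamma_measure T)"
    using t by (intro nn_integral_eq_integral[symmetric] mol_cov_integrable \<omega> e) auto
  also have "\<dots> = (\<integral>\<^sup>+r. \<integral>\<^sup>+r'. ennreal (\<gamma> (r - r') * indicator {0..T} r * indicator {0..T} r') * ennreal (mol_cov \<epsilon> t x t x \<omega> (r, r')) \<partial>lborel \<partial>lborel)"
    by (subst nn_integral_gamma_measure) auto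
  also have "\<dots> \<le> (\<integral>\<^sup>+r. \<integral>\<^sup>+r'. G (t - r) (t - r') \<partial>lborel \<partial>lborel)"
  proof (rule nn_integral_mono, rule nn_integral_mono_AE)
    fix r :: real
    have "AE r' in lborel. r' \<noteq> r" by (rule AE_lborel_singleton)
    then show "AE r' in lborel. ennreal (\<gamma> (r - r') * indicator {0..T} r * indicator {0..T} r') * ennreal (mol_cov \<epsilon> t x t x \<omega> (r, r')) \<le> G (t - r) (t - r')"
    proof eventually_elim
      fix r' assume n: "r' \<noteq> r"
      show "ennreal (\<gamma> (r - r') * indicator {0..T} r * indicator {0..T} r') * ennreal (mol_cov \<epsilon> t x t x \<omega> (r, r')) \<le> G (t - r) (t - r')"
      proof (cases "0 \<le> r \<and> r \<le> t \<and> 0 \<le> r' \<and> r' \<le> t")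
        case True
        have "\<gamma> (r - r') * ?h (t - r) (t - r') \<le> C\<^sub>\<beta> * \<bar>r - r'\<bar> powr (- \<beta>) * ?h (t - r) (t - r')"
          using n by (intro mult_right_mono gamma_le) auto
        then show ?thesis using True t gamma_nonneg by (auto simp: G_def mol_cov_def ennreal_mult[symmetric] abs_minus_commute intro!: ennreal_leI)
      next
        case False
        then show ?thesis by (auto simp: mol_cov_def split: split_indicator)
      qed
    qed
  qed
  also have "\<dots> = (\<integral>\<^sup>+r. \<integral>\<^sup>+r'. G (t - r) r' \<partial>lborel \<partial>lborel)"
    by (rule nn_integral_cong, rule nn_integral_lborel_minus) measurable
  also have "\<dots> = (\<integral>\<^sup>+r. \<integral>\<^sup>+r'. G r r' \<partial>lborel \<partial>lborel)"
    by (rule nn_integral_lborel_minus[of "\<lambda>r. \<integral>\<^sup>+r'. G r r' \<partial>lborel"]) measurable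
  also have "\<dots> \<le> (\<integral>\<^sup>+r. \<integral>\<^sup>+r'. U r r' False + U r' r True \<partial>lborel \<partial>lborel)"
  proof (rule nn_integral_mono, rule nn_integral_mono)
    fix r r' :: real
    show "G r r' \<le> U r r' False + U r' r True"
    proof (cases "r \<le> r'")
      case True
      have "G r r' \<le> U r r' False" unfolding G_def U_def using True t Cbeta by (intro ennreal_leI) (auto simp: abs_if)
      then show ?thesis by (rule order_trans) simp
    next
      case False
      have "G r r' \<le> U r' r True" unfolding G_def U_def using False t Cbeta by (intro ennreal_leI) (auto simp: abs_if)
      then show ?thesis by (rule order_trans) simp
    qed
  qed
  also have "\<dots> = (\<integral>\<^sup>+r. \<integral>\<^sup>+r'. U r r' False \<partial>lborel \<partial>lborel) + (\<integral>\<^sup>+r. \<integral>\<^sup>+r'. U r' r True \<partial>lborel \<partial>lborel)"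
    by (simp add: nn_integral_add)
  also have "(\<integral>\<^sup>+r. \<integral>\<^sup>+r'. U r' r True \<partial>lborel \<partial>lborel) = (\<integral>\<^sup>+r'. \<integral>\<^sup>+r. U r' r True \<partial>lborel \<partial>lborel)"
    by (rule lborel_pair.Fubini') measurable
  also have "(\<integral>\<^sup>+r. \<integral>\<^sup>+r'. U r r' False \<partial>lborel \<partial>lborel) + (\<integral>\<^sup>+r'. \<integral>\<^sup>+r. U r' r True \<partial>lborel \<partial>lborel)
     = (\<integral>\<^sup>+a. \<integral>\<^sup>+v. U a v False + U a v True \<partial>lborel \<partial>lborel)"
    by (simp add: nn_integral_add)
  also have "\<dots> = (\<integral>\<^sup>+a. \<integral>\<^sup>+v. ennreal (C\<^sub>\<beta> * (v - a) powr (- \<beta>) * (smooth_cov (2 * \<epsilon>) (B_ext v \<omega> - B_ext a \<omega>) + smooth_cov (2 * \<epsilon>) (- (B_ext v \<omega> - B_ext a \<omega>))) * indicator {0..T} a * indicator {a..T} v) \<partial>lborel \<partial>lborel)"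
  proof (rule nn_integral_cong, rule nn_integral_cong)
    fix a v :: real
    show "U a v False + U a v True = ennreal (C\<^sub>\<beta> * (v - a) powr (- \<beta>) * (smooth_cov (2 * \<epsilon>) (B_ext v \<omega> - B_ext a \<omega>) + smooth_cov (2 * \<epsilon>) (- (B_ext v \<omega> - B_ext a \<omega>))) * indicator {0..T} a * indicator {a..T} v)"
      unfolding U_def using Cbeta by (subst ennreal_plus[symmetric]) (auto simp: algebra_simps split: split_indicator)
  qed
  finally show ?thesis .
qed

text \<open>The start x cancels and the bound is uniform in t and \<epsilon>. Khasminskii's lemma is
  applied to weights whose singularity is removed; Fatou's lemma restores it, first in the time
  integrals of a fixed path and then in the expectation over paths.\<close>

lemma variance_exp_moment:
  assumes T: "0 < T" and l: "0 \<le> l"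
  shows "\<exists>M. \<forall>t x \<epsilon>. 0 \<le> t \<longrightarrow> t \<le> T \<longrightarrow> 0 < \<epsilon> \<longrightarrow> (\<integral>\<^sup>+\<omega>. ennreal (exp (l * (\<integral>p. mol_cov \<epsilon> t x t x \<omega> p \<partial>gamma_measure T))) \<partial>PB) \<le> ennreal M"
proof -
  \<comment> \<open>The factor T cancels the 1/T of the Jensen step.\<close>
  define c where "c = l * T * C\<^sub>\<beta>"
  have c: "0 \<le> c" using T l Cbeta by (simp add: c_def)
  obtain N :: nat where N: "(\<integral>\<^sup>+u. ennreal (c * u powr (- \<beta>) * exp (- real N * u)) * (2 * frac_cov0 u) * indicator {0..T} u \<partial>lborel) \<le> ennreal (1/2)"
    using small_parameter[OF less_imp_le[OF T] c] by blast
  have "(\<integral>\<^sup>+\<omega>. ennreal (exp (l * (\<integral>p. mol_cov \<epsilon> t x t x \<omega> p \<partial>gamma_measure T))) \<partial>PB) \<le> ennreal (2 * exp (real N * T))"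
    if t: "0 \<le> t" "t \<le> T" and e: "0 < \<epsilon>" for t x \<epsilon>
  proof -
    define q where "q z = smooth_cov (2 * \<epsilon>) z + smooth_cov (2 * \<epsilon>) (- z)" for z
    have q: "continuous_on UNIV q" "\<And>z. 0 \<le> q z" "\<And>z. q z \<le> 2 * smooth_cov0 (2 * \<epsilon>)"
      using smooth_cov_sum_cont[of "2 * \<epsilon>"] smooth_cov_sum_le[of "2 * \<epsilon>"] e by (auto simp: q_def)
    have [measurable]: "q \<in> borel_measurable borel" unfolding q_def by measurable
    \<comment> \<open>Adding 1/(k+1) makes the weight continuous and keeps it below c u^(-\<beta>)
      for u > 0, so the same N serves all k.\<close>
    define w where "w k u = c * (\<bar>u\<bar> + 1 / real (Suc k)) powr (- \<beta>)" for k u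
    have pos: "0 < \<bar>u\<bar> + 1 / real (Suc k)" for u k by (intro add_nonneg_pos) auto
    have w: "continuous_on UNIV (w k)" "\<And>u. 0 \<le> w k u" "\<And>u v. 0 \<le> u \<Longrightarrow> u \<le> v \<Longrightarrow> w k v \<le> w k u" for k
    proof -
      show "continuous_on UNIV (w k)" unfolding w_def
        using pos by (intro continuous_intros) (auto simp: less_le)
      show "0 \<le> w k u" for u using c by (simp add: w_def)
      show "w k v \<le> w k u" if "0 \<le> u" "u \<le> v" for u v
        unfolding w_def using that c beta pos[of u k] by (intro mult_left_mono powr_mono2') auto
    qed
    have [measurable]: "w k \<in> borel_measurable borel" for k unfolding w_def by measurable
    have small: "(\<integral>\<^sup>+u. ennreal (w k u * exp (- real N * u)) * (2 * frac_cov0 u) * indicator {0..T} u \<partial>lborel) \<le> ennreal (1/2)" for k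
    proof (rule order_trans[OF nn_integral_mono_AE N])
      have "AE u in lborel. u \<noteq> (0::real)" by (rule AE_lborel_singleton)
      then show "AE u in lborel. ennreal (w k u * exp (- real N * u)) * (2 * frac_cov0 u) * indicator {0..T} u \<le> ennreal (c * u powr (- \<beta>) * exp (- real N * u)) * (2 * frac_cov0 u) * indicator {0..T} u"
      proof eventually_elim
        fix u :: real assume u: "u \<noteq> 0"
        have "w k u \<le> c * u powr (- \<beta>)" if "0 \<le> u"
          unfolding w_def using that u c beta by (intro mult_left_mono powr_mono2') auto
        then show "ennreal (w k u * exp (- real N * u)) * (2 * frac_cov0 u) * indicator {0..T} u \<le> ennreal (c * u powr (- \<beta>) * exp (- real N * u)) * (2 * frac_cov0 u) * indicator {0..T} u"
          by (auto intro!: mult_right_mono ennreal_leI split: split_indicator)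
      qed
    qed
    define Y where "Y k \<omega> = (LINT a|lborel. path_energy (w k) q T a a \<omega> * indicator {0..T} a)" for k \<omega>
    have EY: "(\<integral>\<^sup>+\<omega>. ennreal (exp (1 / T * Y k \<omega>)) \<partial>PB) \<le> ennreal (2 * exp (real N * T))" for k
      unfolding Y_def
      by (rule khasminskii_average[OF w q _ _ _ small T]) (use heat_smoothing_bound[of "2 * \<epsilon>"] e in \<open>auto simp: q_def\<close>)
    have Ym[measurable]: "Y k \<in> borel_measurable PB" for k
    proof -
      have [measurable]: "(\<lambda>x. path_energy (w k) q T (f x) (f x) (g x)) \<in> borel_measurable M" if "f \<in> borel_measurable M" "g \<in> M \<rightarrow>\<^sub>M PB" for f g and M :: "'c measure"
        using that by (intro path_energy_measurable) auto
      show ?thesis unfolding Y_def by measurable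
    qed
    have Yb: "0 \<le> Y k \<omega>" for k \<omega>
      unfolding Y_def
    proof (intro integral_nonneg_AE AE_I2)
      fix a :: real
      show "0 \<le> path_energy (w k) q T a a \<omega> * indicator {0..T} a"
        using path_energy_bounds(1)[OF w q, of a a T k \<omega>] by (auto split: split_indicator)
    qed
    have path: "ennreal (exp (l * (\<integral>p. mol_cov \<epsilon> t x t x \<omega> p \<partial>gamma_measure T))) \<le> liminf (\<lambda>k. ennreal (exp (1 / T * Y k \<omega>)))" if \<omega>: "\<omega> \<in> space PB" for \<omega>
    proof -
      have [measurable]: "(\<lambda>r. B_ext (f r) \<omega>) \<in> borel_measurable M" if "f \<in> borel_measurable M" for f and M :: "'c measure"
        using that \<omega> by measurable
      define f where "f k a v = ennreal (w k (v - a) * q (B_ext v \<omega> - B_ext a \<omega>) * (if 0 \<le> a \<and> a \<le> T \<and> a \<le> v \<and> v \<le> T then 1 else 0))" for k a v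
      have fm[measurable]: "(\<lambda>x. f k (g x) (h x)) \<in> borel_measurable M" if [measurable]: "g \<in> borel_measurable M" "h \<in> borel_measurable M" for g h k and M :: "'c measure"
        unfolding f_def by measurable
      have Yf: "ennreal (Y k \<omega>) = (\<integral>\<^sup>+a. \<integral>\<^sup>+v. f k a v \<partial>lborel \<partial>lborel)" for k
      proof -
        have pm[measurable]: "(\<lambda>a. path_energy (w k) q T a a \<omega>) \<in> borel_measurable borel" using \<omega> by (intro path_energy_measurable) auto
        have kb: "0 \<le> w k 0 * (2 * smooth_cov0 (2 * \<epsilon>)) * T" using w(2)[of k 0] smooth_cov0_nonneg[of "2*\<epsilon>"] T by simp
        have pb: "0 \<le> path_energy (w k) q T a a \<omega>" "path_energy (w k) q T a a \<omega> \<le> w k 0 * (2 * smooth_cov0 (2 * \<epsilon>)) * T" if "a \<in> {0..T}" for a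
        proof -
          show "0 \<le> path_energy (w k) q T a a \<omega>" using that by (intro path_energy_bounds[OF w q]) auto
          have "path_energy (w k) q T a a \<omega> \<le> w k 0 * (2 * smooth_cov0 (2 * \<epsilon>)) * (T - a)" using that by (intro path_energy_bounds[OF w q]) auto
          also have "\<dots> \<le> w k 0 * (2 * smooth_cov0 (2 * \<epsilon>)) * T" using that w(2)[of k 0] smooth_cov0_nonneg[of "2*\<epsilon>"] by (intro mult_left_mono) auto
          finally show "path_energy (w k) q T a a \<omega> \<le> w k 0 * (2 * smooth_cov0 (2 * \<epsilon>)) * T" .
        qed
        have int: "integrable lborel (\<lambda>a. path_energy (w k) q T a a \<omega> * indicator {0..T} a)"
        proof (rule Bochner_Integration.integrable_bound[of _ "\<lambda>a. w k 0 * (2 * smooth_cov0 (2 * \<epsilon>)) * T * indicator {0..T} a"])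
          show "integrable lborel (\<lambda>a. w k 0 * (2 * smooth_cov0 (2 * \<epsilon>)) * T * indicator {0..T} a :: real)"
            by (intro integrable_mult_right integrable_real_indicator) (auto simp: emeasure_lborel_Icc_eq)
          show "AE a in lborel. norm (path_energy (w k) q T a a \<omega> * indicator {0..T} a) \<le> norm (w k 0 * (2 * smooth_cov0 (2 * \<epsilon>)) * T * indicator {0..T} a :: real)"
            using pb kb by (intro AE_I2) (auto split: split_indicator simp: abs_of_nonneg)
        qed measurable
        have "ennreal (Y k \<omega>) = (\<integral>\<^sup>+a. ennreal (path_energy (w k) q T a a \<omega> * indicator {0..T} a) \<partial>lborel)"
          unfolding Y_def using pb by (intro nn_integral_eq_integral[symmetric] int) (auto split: split_indicator)
        also have "\<dots> = (\<integral>\<^sup>+a. \<integral>\<^sup>+v. f k a v \<partial>lborel \<partial>lborel)"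
        proof (rule nn_integral_cong)
          fix a :: real
          show "ennreal (path_energy (w k) q T a a \<omega> * indicator {0..T} a) = (\<integral>\<^sup>+v. f k a v \<partial>lborel)"
          proof (cases "a \<in> {0..T}")
            case True
            have "integrable lborel (\<lambda>v. indicator {a..T} v *\<^sub>R (w k (v - a) * q (B_ext v \<omega> - B_ext a \<omega>)))"
              by (rule borel_integrable_compact[OF _ path_cont]) (use w q in auto)
            then have "ennreal (path_energy (w k) q T a a \<omega>) = (\<integral>\<^sup>+v. ennreal (w k (v - a) * q (B_ext v \<omega> - B_ext a \<omega>) * indicator {a..T} v) \<partial>lborel)"
              unfolding path_energy_def using w(2) q(2) by (intro nn_integral_eq_integral[symmetric]) (auto simp: mult.commute)
            then show ?thesis using True by (auto simp: f_def intro!: nn_integral_cong split: split_indicator)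
          next
            case False
            then have "f k a v = 0" for v by (auto simp: f_def)
            then show ?thesis using False by simp
          qed
        qed
        finally show ?thesis .
      qed
      have "ennreal (l * T) * ennreal (\<integral>p. mol_cov \<epsilon> t x t x \<omega> p \<partial>gamma_measure T) \<le> ennreal (l * T) *
        (\<integral>\<^sup>+a. \<integral>\<^sup>+v. ennreal (C\<^sub>\<beta> * (v - a) powr (- \<beta>) * (smooth_cov (2 * \<epsilon>) (B_ext v \<omega> - B_ext a \<omega>) + smooth_cov (2 * \<epsilon>) (- (B_ext v \<omega> - B_ext a \<omega>))) * indicator {0..T} a * indicator {a..T} v) \<partial>lborel \<partial>lborel)"
        by (intro mult_left_mono variance_le_one_sided \<omega> e t) auto
      also have "\<dots> = (\<integral>\<^sup>+a. \<integral>\<^sup>+v. ennreal (l * T) * ennreal (C\<^sub>\<beta> * (v - a) powr (- \<beta>) * q (B_ext v \<omega> - B_ext a \<omega>) * (if 0 \<le> a \<and> a \<le> T \<and> a \<le> v \<and> v \<le> T then 1 else 0)) \<partial>lborel \<partial>lborel)"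
      proof -
        have "ennreal (C\<^sub>\<beta> * (v - a) powr (- \<beta>) * (smooth_cov (2 * \<epsilon>) (B_ext v \<omega> - B_ext a \<omega>) + smooth_cov (2 * \<epsilon>) (- (B_ext v \<omega> - B_ext a \<omega>))) * indicator {0..T} a * indicator {a..T} v)
           = ennreal (C\<^sub>\<beta> * (v - a) powr (- \<beta>) * q (B_ext v \<omega> - B_ext a \<omega>) * (if 0 \<le> a \<and> a \<le> T \<and> a \<le> v \<and> v \<le> T then 1 else 0))" for a v
          by (auto simp: q_def split: split_indicator)
        then show ?thesis by (simp add: nn_integral_cmult)
      qed
      also have "\<dots> \<le> (\<integral>\<^sup>+a. \<integral>\<^sup>+v. liminf (\<lambda>k. f k a v) \<partial>lborel \<partial>lborel)"
      proof (rule nn_integral_mono, rule nn_integral_mono_AE)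
        fix a :: real
        have "AE v in lborel. v \<noteq> a" by (rule AE_lborel_singleton)
        then show "AE v in lborel. ennreal (l * T) * ennreal (C\<^sub>\<beta> * (v - a) powr (- \<beta>) * q (B_ext v \<omega> - B_ext a \<omega>) * (if 0 \<le> a \<and> a \<le> T \<and> a \<le> v \<and> v \<le> T then 1 else 0)) \<le> liminf (\<lambda>k. f k a v)"
        proof eventually_elim
          fix v assume v: "v \<noteq> a"
          show "ennreal (l * T) * ennreal (C\<^sub>\<beta> * (v - a) powr (- \<beta>) * q (B_ext v \<omega> - B_ext a \<omega>) * (if 0 \<le> a \<and> a \<le> T \<and> a \<le> v \<and> v \<le> T then 1 else 0)) \<le> liminf (\<lambda>k. f k a v)"
          proof (cases "0 \<le> a \<and> a \<le> T \<and> a \<le> v \<and> v \<le> T")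
            case True
            have "(\<lambda>k. \<bar>v - a\<bar> + 1 / real (Suc k)) \<longlonglongrightarrow> \<bar>v - a\<bar> + 0"
              by (intro tendsto_intros LIMSEQ_Suc[OF lim_const_over_n])
            then have "(\<lambda>k. w k (v - a) * q (B_ext v \<omega> - B_ext a \<omega>)) \<longlonglongrightarrow> c * (v - a) powr (- \<beta>) * q (B_ext v \<omega> - B_ext a \<omega>)"
              unfolding w_def using True v by (intro tendsto_intros) auto
            then have "(\<lambda>k. f k a v) \<longlonglongrightarrow> ennreal (c * (v - a) powr (- \<beta>) * q (B_ext v \<omega> - B_ext a \<omega>))"
              unfolding f_def using True by (intro tendsto_ennrealI) simp
            then have "liminf (\<lambda>k. f k a v) = ennreal (c * (v - a) powr (- \<beta>) * q (B_ext v \<omega> - B_ext a \<omega>))"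
              by (intro lim_imp_Liminf) auto
            then show ?thesis using True l T Cbeta q(2) by (simp add: c_def ennreal_mult[symmetric] mult_ac)
          qed auto
        qed
      qed
      also have "\<dots> \<le> (\<integral>\<^sup>+a. liminf (\<lambda>k. \<integral>\<^sup>+v. f k a v \<partial>lborel) \<partial>lborel)"
        by (rule nn_integral_mono, rule nn_integral_liminf) measurable
      also have "\<dots> \<le> liminf (\<lambda>k. \<integral>\<^sup>+a. \<integral>\<^sup>+v. f k a v \<partial>lborel \<partial>lborel)"
        by (rule nn_integral_liminf) measurable
      also have "\<dots> = liminf (\<lambda>k. ennreal (Y k \<omega>))" by (simp add: Yf)
      finally have "ennreal (l * T) * ennreal (\<integral>p. mol_cov \<epsilon> t x t x \<omega> p \<partial>gamma_measure T) \<le> liminf (\<lambda>k. ennreal (Y k \<omega>))" .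
      moreover have "ennreal (l * T) * ennreal (\<integral>p. mol_cov \<epsilon> t x t x \<omega> p \<partial>gamma_measure T) = ennreal (l * T * (\<integral>p. mol_cov \<epsilon> t x t x \<omega> p \<partial>gamma_measure T))"
        using l T by (intro ennreal_mult[symmetric] integral_nonneg_AE) auto
      ultimately have "ennreal (l * T * (\<integral>p. mol_cov \<epsilon> t x t x \<omega> p \<partial>gamma_measure T)) \<le> liminf (\<lambda>k. ennreal (Y k \<omega>))" by simp
      moreover have "continuous_on UNIV (\<lambda>y. exp (1 / T * y))" "mono (\<lambda>y. exp (1 / T * y))"
        using T by (auto simp: mono_def divide_right_mono intro!: continuous_on_exp continuous_on_divide)
      ultimately show ?thesis
        using ennreal_le_liminf_compose[of "\<lambda>y. exp (1 / T * y)" "\<lambda>k. Y k \<omega>" "l * T * (\<integral>p. mol_cov \<epsilon> t x t x \<omega> p \<partial>gamma_measure T)"] Yb T by simp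
    qed
    have "(\<integral>\<^sup>+\<omega>. ennreal (exp (l * (\<integral>p. mol_cov \<epsilon> t x t x \<omega> p \<partial>gamma_measure T))) \<partial>PB) \<le> (\<integral>\<^sup>+\<omega>. liminf (\<lambda>k. ennreal (exp (1 / T * Y k \<omega>))) \<partial>PB)"
      by (intro nn_integral_mono path)
    also have "\<dots> \<le> liminf (\<lambda>k. \<integral>\<^sup>+\<omega>. ennreal (exp (1 / T * Y k \<omega>)) \<partial>PB)" by (rule nn_integral_liminf) measurable
    also have "\<dots> \<le> liminf (\<lambda>k::nat. ennreal (2 * exp (real N * T)))" by (intro Liminf_mono always_eventually allI EY)
    also have "\<dots> = ennreal (2 * exp (real N * T))" by (intro Liminf_const) simp
    finally show ?thesis .
  qed
  then show ?thesis by blast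
qed

end

section \<open>Conditional variance of increments\<close>

lemma one_minus_exp_le_powr:
  fixes a \<alpha> :: real
  assumes "0 \<le> a" "0 < \<alpha>" "\<alpha> < 1"
  shows "1 - exp (- a) \<le> a powr \<alpha>"
proof (cases "a \<le> 1")
  case True
  have "1 - exp (- a) \<le> a" using exp_ge_add_one_self[of "- a"] by simp
  also have "a \<le> a powr \<alpha>"
  proof (cases "a = 0")
    case False
    then have "a powr 1 \<le> a powr \<alpha>" using assms True by (intro powr_mono') auto
    then show ?thesis using assms by simp
  qed simp
  finally show ?thesis .
next
  case False
  have "1 - exp (- a) \<le> 1" by simp
  also have "1 \<le> a powr \<alpha>" using False assms by (intro ge_one_powr_ge_zero) auto
  finally show ?thesis .
qed

lemma exp_gauss_mono:
  fixes a b n :: real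
  assumes "a \<le> b" shows "exp (- b * n\<^sup>2 / 2) \<le> exp (- a * n\<^sup>2 / 2)"
proof -
  have "a * n\<^sup>2 \<le> b * n\<^sup>2" using assms by (intro mult_right_mono) auto
  then show ?thesis by simp
qed

lemma one_minus_cos_le_powr:
  fixes a \<alpha> :: real
  assumes "0 < \<alpha>" "\<alpha> < 1"
  shows "1 - cos a \<le> 2 * \<bar>a\<bar> powr (2 * \<alpha>)"
proof (cases "\<bar>a\<bar> \<le> 1")
  case True
  have "1 - cos a = 2 * (sin (a / 2))\<^sup>2" using cos_double_sin[of "a / 2"] by simp
  also have "\<dots> \<le> 2 * (a / 2)\<^sup>2"
  proof -
    have "\<bar>sin (a / 2)\<bar> \<le> \<bar>a / 2\<bar>" by (rule abs_sin_x_le_abs_x)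
    then show ?thesis by (simp only: abs_le_square_iff mult_left_mono zero_le_numeral)
  qed
  also have "\<dots> \<le> 2 * \<bar>a\<bar> powr 2" by (simp add: powr_numeral power_divide)
  also have "\<bar>a\<bar> powr 2 \<le> \<bar>a\<bar> powr (2 * \<alpha>)"
  proof (cases "a = 0")
    case False
    then show ?thesis using assms True by (intro powr_mono') auto
  qed simp
  finally show ?thesis by simp
next
  case False
  have "1 - cos a \<le> 2" using cos_ge_minus_one[of a] by simp
  moreover have "1 \<le> \<bar>a\<bar> powr (2 * \<alpha>)" using False assms by (intro ge_one_powr_ge_zero) auto
  ultimately show ?thesis by linarith
qed

context covariance_brownian begin

lemma alpha_less_1: "\<alpha> < 1" using alpha beta by simp

text \<open>The path is evaluated at the times t - r and s - r', so averaging over the increment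
  between them adds the difference of these times to the smoothing parameter.\<close>

lemma mol_cov_expectation:
  assumes e: "0 < \<epsilon>" and r: "0 \<le> fst p" "0 \<le> snd p"
  shows "integrable PB (\<lambda>\<omega>. mol_cov \<epsilon> t x s y \<omega> p)"
    and "(\<integral>\<omega>. mol_cov \<epsilon> t x s y \<omega> p \<partial>PB) = (if fst p \<le> t \<and> snd p \<le> s then smooth_cov (2 * \<epsilon> + \<bar>(t - fst p) - (s - snd p)\<bar>) (x - y) else 0)"
proof -
  have m: "(\<lambda>\<omega>. mol_cov \<epsilon> t x s y \<omega> p) \<in> borel_measurable PB" unfolding mol_cov_def by measurable
  show int: "integrable PB (\<lambda>\<omega>. mol_cov \<epsilon> t x s y \<omega> p)"
    by (rule integrable_const_bound[where B="2 * smooth_cov0 (2 * \<epsilon>)"]) (use mol_cov_le[OF e] m in auto)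
  show "(\<integral>\<omega>. mol_cov \<epsilon> t x s y \<omega> p \<partial>PB) = (if fst p \<le> t \<and> snd p \<le> s then smooth_cov (2 * \<epsilon> + \<bar>(t - fst p) - (s - snd p)\<bar>) (x - y) else 0)"
  proof (cases "fst p \<le> t \<and> snd p \<le> s")
    case True
    have "ennreal (\<integral>\<omega>. mol_cov \<epsilon> t x s y \<omega> p \<partial>PB) = (\<integral>\<^sup>+\<omega>. ennreal (mol_cov \<epsilon> t x s y \<omega> p) \<partial>PB)"
      by (intro nn_integral_eq_integral[symmetric] int) auto
    also have "\<dots> = (\<integral>\<^sup>+\<omega>. heat_conv \<Lambda> (2 * \<epsilon>) ((x - y) + (B_ext (t - fst p) \<omega> - B_ext (s - snd p) \<omega>)) \<partial>PB)"
      using True e by (intro nn_integral_cong) (simp add: mol_cov_def heat_conv_smooth_cov algebra_simps)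
    also have "\<dots> = heat_conv \<Lambda> (2 * \<epsilon> + \<bar>(t - fst p) - (s - snd p)\<bar>) (x - y)"
      using True e by (intro nn_heat_conv Lambda_meas Lambda_nonneg) auto
    also have "\<dots> = ennreal (smooth_cov (2 * \<epsilon> + \<bar>(t - fst p) - (s - snd p)\<bar>) (x - y))" using e by (intro heat_conv_smooth_cov) simp
    finally have "ennreal (\<integral>\<omega>. mol_cov \<epsilon> t x s y \<omega> p \<partial>PB) = ennreal (smooth_cov (2 * \<epsilon> + \<bar>(t - fst p) - (s - snd p)\<bar>) (x - y))" .
    then show ?thesis using True by (subst (asm) ennreal_inj) (auto intro!: integral_nonneg_AE)
  next
    case False
    then show ?thesis by (auto simp: mol_cov_def)
  qed
qed

lemma mol_incr_cov_expectation:
  assumes e: "0 < \<epsilon>" and r: "0 \<le> fst p" "0 \<le> snd p"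
  shows "(\<integral>\<omega>. mol_incr_cov \<epsilon> t x s y \<omega> p \<partial>PB) =
    ((\<integral>\<omega>. mol_cov \<epsilon> t x t x \<omega> p \<partial>PB) + (\<integral>\<omega>. mol_cov \<epsilon> s y s y \<omega> p \<partial>PB)) - ((\<integral>\<omega>. mol_cov \<epsilon> t x s y \<omega> p \<partial>PB) + (\<integral>\<omega>. mol_cov \<epsilon> s y t x \<omega> p \<partial>PB))"
  unfolding mol_incr_cov_def using mol_cov_expectation(1)[OF e r] by simp

text \<open>When both noise times are at most t, the four covariances carry the same smoothing
  parameter, and the second difference in space becomes the factor 1 - cos under the spectral
  integral. The resulting |\<xi>|^(2 \<alpha>) is absorbed by \<open>frac_cov0\<close>.\<close>

lemma space_increment_pointwise:
  assumes e: "0 < \<epsilon>" and r: "0 \<le> fst p" "0 \<le> snd p"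
  shows "ennreal (\<integral>\<omega>. mol_incr_cov \<epsilon> t x t y \<omega> p \<partial>PB) \<le> ennreal (4 * norm (x - y) powr (2 * \<alpha>)) * frac_cov0 \<bar>fst p - snd p\<bar>"
proof (cases "fst p \<le> t \<and> snd p \<le> t")
  case True
  define u where "u = 2 * \<epsilon> + \<bar>fst p - snd p\<bar>"
  have u: "0 < u" using e by (simp add: u_def add_pos_nonneg)
  have au: "2 * \<epsilon> + \<bar>(t - fst p) - (t - snd p)\<bar> = u" by (simp add: u_def abs_minus_commute)
  define E where "E \<xi> = exp (- u * (norm \<xi>)\<^sup>2 / 2)" for \<xi> :: 'd
  have Ei: "integrable \<mu> E" unfolding E_def by (rule integrable_gauss[OF u])
  have Ci: "integrable \<mu> (\<lambda>\<xi>. cos ((x - y) \<bullet> \<xi>) * E \<xi>)" unfolding E_def by (rule integrable_cos_gauss[OF u])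
  have "(\<integral>\<omega>. mol_incr_cov \<epsilon> t x t y \<omega> p \<partial>PB) = 2 * smooth_cov0 u - (smooth_cov u (x - y) + smooth_cov u (- (x - y)))"
    unfolding mol_incr_cov_expectation[OF e r] mol_cov_expectation(2)[OF e r] au using True by (simp add: smooth_cov_0[OF u])
  also have "\<dots> = 2 * fourier_const * (\<integral>\<xi>. (1 - cos ((x - y) \<bullet> \<xi>)) * E \<xi> \<partial>\<mu>)"
  proof -
    have I: "(\<integral>\<xi>. (1 - cos ((x - y) \<bullet> \<xi>)) * E \<xi> \<partial>\<mu>) = (\<integral>\<xi>. E \<xi> \<partial>\<mu>) - (\<integral>\<xi>. cos ((x - y) \<bullet> \<xi>) * E \<xi> \<partial>\<mu>)"
      using Ei Ci by (simp only: left_diff_distrib mult_1_left Bochner_Integration.integral_diff)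
    show ?thesis unfolding smooth_cov_sum[OF u] smooth_cov0_def E_def[symmetric] I by (simp only: right_diff_distrib mult.assoc)
  qed
  finally have eq: "(\<integral>\<omega>. mol_incr_cov \<epsilon> t x t y \<omega> p \<partial>PB) = 2 * fourier_const * (\<integral>\<xi>. (1 - cos ((x - y) \<bullet> \<xi>)) * E \<xi> \<partial>\<mu>)" .
  have Di: "integrable \<mu> (\<lambda>\<xi>. (1 - cos ((x - y) \<bullet> \<xi>)) * E \<xi>)"
    using Ei Ci by (simp only: left_diff_distrib mult_1_left Bochner_Integration.integrable_diff)
  have "ennreal (\<integral>\<xi>. (1 - cos ((x - y) \<bullet> \<xi>)) * E \<xi> \<partial>\<mu>) = (\<integral>\<^sup>+\<xi>. ennreal ((1 - cos ((x - y) \<bullet> \<xi>)) * E \<xi>) \<partial>\<mu>)"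
    by (intro nn_integral_eq_integral[symmetric] Di) (auto simp: E_def)
  also have "\<dots> \<le> (\<integral>\<^sup>+\<xi>. ennreal (2 * norm (x - y) powr (2 * \<alpha>)) * ennreal ((1 + norm \<xi> powr (2 * \<alpha>)) * exp (- \<bar>fst p - snd p\<bar> * (norm \<xi>)\<^sup>2 / 2)) \<partial>\<mu>)"
  proof (rule nn_integral_mono)
    fix \<xi> :: 'd
    have "1 - cos ((x - y) \<bullet> \<xi>) \<le> 2 * \<bar>(x - y) \<bullet> \<xi>\<bar> powr (2 * \<alpha>)" by (rule one_minus_cos_le_powr[OF alpha(1) alpha_less_1])
    also have "\<dots> \<le> 2 * (norm (x - y) * norm \<xi>) powr (2 * \<alpha>)"
      using alpha Cauchy_Schwarz_ineq2[of "x - y" \<xi>] by (intro mult_left_mono powr_mono2) auto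
    also have "\<dots> = 2 * norm (x - y) powr (2 * \<alpha>) * norm \<xi> powr (2 * \<alpha>)" by (simp add: powr_mult)
    also have "\<dots> \<le> 2 * norm (x - y) powr (2 * \<alpha>) * (1 + norm \<xi> powr (2 * \<alpha>))" by (intro mult_left_mono) auto
    finally have "1 - cos ((x - y) \<bullet> \<xi>) \<le> 2 * norm (x - y) powr (2 * \<alpha>) * (1 + norm \<xi> powr (2 * \<alpha>))" .
    moreover have "E \<xi> \<le> exp (- \<bar>fst p - snd p\<bar> * (norm \<xi>)\<^sup>2 / 2)"
      unfolding E_def u_def using e by (intro exp_gauss_mono) simp
    ultimately have "(1 - cos ((x - y) \<bullet> \<xi>)) * E \<xi> \<le> 2 * norm (x - y) powr (2 * \<alpha>) * (1 + norm \<xi> powr (2 * \<alpha>)) * exp (- \<bar>fst p - snd p\<bar> * (norm \<xi>)\<^sup>2 / 2)"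
      by (intro mult_mono) (auto simp: E_def)
    then show "ennreal ((1 - cos ((x - y) \<bullet> \<xi>)) * E \<xi>) \<le> ennreal (2 * norm (x - y) powr (2 * \<alpha>)) * ennreal ((1 + norm \<xi> powr (2 * \<alpha>)) * exp (- \<bar>fst p - snd p\<bar> * (norm \<xi>)\<^sup>2 / 2))"
      by (subst ennreal_mult[symmetric]) (auto intro!: ennreal_leI simp: mult.assoc)
  qed
  also have "\<dots> = ennreal (2 * norm (x - y) powr (2 * \<alpha>)) * (\<integral>\<^sup>+\<xi>. ennreal ((1 + norm \<xi> powr (2 * \<alpha>)) * exp (- \<bar>fst p - snd p\<bar> * (norm \<xi>)\<^sup>2 / 2)) \<partial>\<mu>)"
    by (rule nn_integral_cmult) measurable
  finally have le: "ennreal (2 * fourier_const) * ennreal (\<integral>\<xi>. (1 - cos ((x - y) \<bullet> \<xi>)) * E \<xi> \<partial>\<mu>) \<le>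
     ennreal (2 * fourier_const) * (ennreal (2 * norm (x - y) powr (2 * \<alpha>)) * (\<integral>\<^sup>+\<xi>. ennreal ((1 + norm \<xi> powr (2 * \<alpha>)) * exp (- \<bar>fst p - snd p\<bar> * (norm \<xi>)\<^sup>2 / 2)) \<partial>\<mu>))"
    by (rule mult_left_mono) simp
  have "ennreal (\<integral>\<omega>. mol_incr_cov \<epsilon> t x t y \<omega> p \<partial>PB) = ennreal (2 * fourier_const) * ennreal (\<integral>\<xi>. (1 - cos ((x - y) \<bullet> \<xi>)) * E \<xi> \<partial>\<mu>)"
    unfolding eq using fourier_const_pos by (intro ennreal_mult integral_nonneg_AE) (auto simp: E_def)
  also note le
  also have "ennreal (2 * fourier_const) * (ennreal (2 * norm (x - y) powr (2 * \<alpha>)) * (\<integral>\<^sup>+\<xi>. ennreal ((1 + norm \<xi> powr (2 * \<alpha>)) * exp (- \<bar>fst p - snd p\<bar> * (norm \<xi>)\<^sup>2 / 2)) \<partial>\<mu>))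
    = ennreal (4 * norm (x - y) powr (2 * \<alpha>)) * frac_cov0 \<bar>fst p - snd p\<bar>"
  proof -
    have "ennreal (2 * fourier_const) * ennreal (2 * norm (x - y) powr (2 * \<alpha>)) = ennreal (4 * norm (x - y) powr (2 * \<alpha>)) * ennreal fourier_const"
      using fourier_const_pos by (simp add: ennreal_mult[symmetric] mult_ac)
    then show ?thesis by (simp add: frac_cov0_def mult.assoc[symmetric])
  qed
  finally show ?thesis .
next
  case False
  then have "(\<integral>\<omega>. mol_incr_cov \<epsilon> t x t y \<omega> p \<partial>PB) = 0"
    unfolding mol_incr_cov_expectation[OF e r] mol_cov_expectation(2)[OF e r] by auto
  then show ?thesis by simp
qed

text \<open>Under the spectral integral the difference is exp (- (e+v) |\<xi>|^2 / 2) times 1 - exp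
  (- \<tau> |\<xi>|^2 / 2). The second factor is at most \<tau>^\<alpha> |\<xi>|^(2 \<alpha>), again
  absorbed by \<open>frac_cov0\<close> uniformly in e.\<close>

lemma smooth_cov0_increment:
  assumes e: "0 < e" and v: "0 \<le> v" and tau: "0 \<le> \<tau>"
  shows "ennreal (2 * (smooth_cov0 (e + v) - smooth_cov0 (e + v + \<tau>))) \<le> ennreal (2 * \<tau> powr \<alpha>) * frac_cov0 v"
proof -
  define E where "E u \<xi> = exp (- u * (norm \<xi>)\<^sup>2 / 2)" for u and \<xi> :: 'd
  have Ei: "integrable \<mu> (E u)" if "0 < u" for u unfolding E_def by (rule integrable_gauss[OF that])
  have p: "0 < e + v" "0 < e + v + \<tau>" using e v tau by auto
  have Di: "integrable \<mu> (\<lambda>\<xi>. E (e + v) \<xi> - E (e + v + \<tau>) \<xi>)" using Ei p by simp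
  have Dn: "E (e + v + \<tau>) \<xi> \<le> E (e + v) \<xi>" for \<xi>
    unfolding E_def using tau by (intro exp_gauss_mono) simp
  have eq: "2 * (smooth_cov0 (e + v) - smooth_cov0 (e + v + \<tau>)) = 2 * fourier_const * (\<integral>\<xi>. E (e + v) \<xi> - E (e + v + \<tau>) \<xi> \<partial>\<mu>)"
  proof -
    have I: "(\<integral>\<xi>. E (e + v) \<xi> - E (e + v + \<tau>) \<xi> \<partial>\<mu>) = (\<integral>\<xi>. E (e + v) \<xi> \<partial>\<mu>) - (\<integral>\<xi>. E (e + v + \<tau>) \<xi> \<partial>\<mu>)"
      by (rule Bochner_Integration.integral_diff[OF Ei[OF p(1)] Ei[OF p(2)]])
    show ?thesis unfolding smooth_cov0_def E_def[symmetric] I by (simp only: right_diff_distrib mult.assoc)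
  qed
  have "ennreal (\<integral>\<xi>. E (e + v) \<xi> - E (e + v + \<tau>) \<xi> \<partial>\<mu>) = (\<integral>\<^sup>+\<xi>. ennreal (E (e + v) \<xi> - E (e + v + \<tau>) \<xi>) \<partial>\<mu>)"
    by (intro nn_integral_eq_integral[symmetric] Di) (auto simp: Dn)
  also have "\<dots> \<le> (\<integral>\<^sup>+\<xi>. ennreal (\<tau> powr \<alpha>) * ennreal ((1 + norm \<xi> powr (2 * \<alpha>)) * exp (- v * (norm \<xi>)\<^sup>2 / 2)) \<partial>\<mu>)"
  proof (rule nn_integral_mono)
    fix \<xi> :: 'd
    have "E (e + v) \<xi> - E (e + v + \<tau>) \<xi> = E (e + v) \<xi> * (1 - exp (- (\<tau> * (norm \<xi>)\<^sup>2 / 2)))"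
    proof -
      have "- (e + v + \<tau>) * (norm \<xi>)\<^sup>2 / 2 = - (e + v) * (norm \<xi>)\<^sup>2 / 2 + - (\<tau> * (norm \<xi>)\<^sup>2 / 2)" by (simp add: field_simps)
      then have "E (e + v + \<tau>) \<xi> = E (e + v) \<xi> * exp (- (\<tau> * (norm \<xi>)\<^sup>2 / 2))" unfolding E_def by (simp only: exp_add)
      then show ?thesis by (simp only: right_diff_distrib mult_1_right)
    qed
    also have "\<dots> \<le> exp (- v * (norm \<xi>)\<^sup>2 / 2) * (\<tau> powr \<alpha> * norm \<xi> powr (2 * \<alpha>))"
    proof (intro mult_mono)
      show "E (e + v) \<xi> \<le> exp (- v * (norm \<xi>)\<^sup>2 / 2)" unfolding E_def using e by (intro exp_gauss_mono) simp
      have "1 - exp (- (\<tau> * (norm \<xi>)\<^sup>2 / 2)) \<le> (\<tau> * (norm \<xi>)\<^sup>2 / 2) powr \<alpha>"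
        using tau by (intro one_minus_exp_le_powr alpha alpha_less_1) auto
      also have "\<dots> \<le> (\<tau> * (norm \<xi>)\<^sup>2) powr \<alpha>" using tau alpha by (intro powr_mono2) auto
      also have "\<dots> = \<tau> powr \<alpha> * (norm \<xi> powr (2 * \<alpha>))"
      proof -
        have "((norm \<xi>)\<^sup>2) powr \<alpha> = norm \<xi> powr (2 * \<alpha>)"
        proof (cases "\<xi> = 0")
          case False
          then have "(norm \<xi>)\<^sup>2 = norm \<xi> powr 2" by (simp add: powr_numeral)
          then show ?thesis by (simp only: powr_powr)
        qed simp
        then show ?thesis using tau by (simp add: powr_mult)
      qed
      finally show "1 - exp (- (\<tau> * (norm \<xi>)\<^sup>2 / 2)) \<le> \<tau> powr \<alpha> * norm \<xi> powr (2 * \<alpha>)" .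
    qed (use tau in auto)
    also have "\<dots> \<le> \<tau> powr \<alpha> * ((1 + norm \<xi> powr (2 * \<alpha>)) * exp (- v * (norm \<xi>)\<^sup>2 / 2))"
      by (simp add: algebra_simps)
    finally show "ennreal (E (e + v) \<xi> - E (e + v + \<tau>) \<xi>) \<le> ennreal (\<tau> powr \<alpha>) * ennreal ((1 + norm \<xi> powr (2 * \<alpha>)) * exp (- v * (norm \<xi>)\<^sup>2 / 2))"
      by (subst ennreal_mult[symmetric]) (auto intro!: ennreal_leI)
  qed
  also have "\<dots> = ennreal (\<tau> powr \<alpha>) * (\<integral>\<^sup>+\<xi>. ennreal ((1 + norm \<xi> powr (2 * \<alpha>)) * exp (- v * (norm \<xi>)\<^sup>2 / 2)) \<partial>\<mu>)"
    by (rule nn_integral_cmult) measurable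
  finally have le: "ennreal (2 * fourier_const) * ennreal (\<integral>\<xi>. E (e + v) \<xi> - E (e + v + \<tau>) \<xi> \<partial>\<mu>) \<le>
     ennreal (2 * fourier_const) * (ennreal (\<tau> powr \<alpha>) * (\<integral>\<^sup>+\<xi>. ennreal ((1 + norm \<xi> powr (2 * \<alpha>)) * exp (- v * (norm \<xi>)\<^sup>2 / 2)) \<partial>\<mu>))"
    by (rule mult_left_mono) simp
  have "ennreal (2 * (smooth_cov0 (e + v) - smooth_cov0 (e + v + \<tau>))) = ennreal (2 * fourier_const) * ennreal (\<integral>\<xi>. E (e + v) \<xi> - E (e + v + \<tau>) \<xi> \<partial>\<mu>)"
    unfolding eq using fourier_const_pos Dn by (intro ennreal_mult integral_nonneg_AE) auto
  also note le
  also have "ennreal (2 * fourier_const) * (ennreal (\<tau> powr \<alpha>) * (\<integral>\<^sup>+\<xi>. ennreal ((1 + norm \<xi> powr (2 * \<alpha>)) * exp (- v * (norm \<xi>)\<^sup>2 / 2)) \<partial>\<mu>)) = ennreal (2 * \<tau> powr \<alpha>) * frac_cov0 v"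
  proof -
    have "ennreal (2 * fourier_const) * ennreal (\<tau> powr \<alpha>) = ennreal (2 * \<tau> powr \<alpha>) * ennreal fourier_const"
      using fourier_const_pos by (simp add: ennreal_mult[symmetric] mult_ac)
    then show ?thesis by (simp add: frac_cov0_def mult.assoc[symmetric])
  qed
  finally show ?thesis .
qed

text \<open>Three regions of noise times. If both are at most s, the mixed terms differ from the
  others by the lag \<tau> = t - s; since |\<tau> - v| and |\<tau> + v| are at most |v| + \<tau>,
  monotonicity reduces to \<open>smooth_cov0_increment\<close>. If one lies in (s, t], the variance
  term of the later integral is the only positive one. Beyond t everything vanishes.\<close>

lemma time_increment_pointwise:
  assumes e: "0 < \<epsilon>" and r: "0 \<le> fst p" "0 \<le> snd p" and st: "0 \<le> s" "s \<le> t"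
  shows "ennreal (\<integral>\<omega>. mol_incr_cov \<epsilon> t x s x \<omega> p \<partial>PB) \<le> ennreal (2 * (t - s) powr \<alpha>) * frac_cov0 \<bar>fst p - snd p\<bar>
     + (indicator {s<..t} (fst p) * frac_cov0 \<bar>fst p - snd p\<bar> + indicator {s<..t} (snd p) * frac_cov0 \<bar>fst p - snd p\<bar>)"
proof -
  define v where "v = fst p - snd p"
  define \<tau> where "\<tau> = t - s"
  have tau: "0 \<le> \<tau>" using st by (simp add: \<tau>_def)
  define \<kappa> where "\<kappa> u = smooth_cov0 (2 * \<epsilon> + \<bar>u\<bar>)" for u
  have pos: "0 < 2 * \<epsilon> + \<bar>u\<bar>" for u using e by (intro add_pos_nonneg) auto
  have k0: "0 \<le> \<kappa> u" for u unfolding \<kappa>_def by (rule smooth_cov0_nonneg)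
  have hk0: "smooth_cov (2 * \<epsilon> + \<bar>u\<bar>) (x - x) = \<kappa> u" for u using smooth_cov_0[OF pos] by (simp add: \<kappa>_def)
  have a: "(t - fst p) - (t - snd p) = - v" "(s - fst p) - (s - snd p) = - v" "(t - fst p) - (s - snd p) = \<tau> - v" "(s - fst p) - (t - snd p) = - (\<tau> + v)"
    by (auto simp: v_def \<tau>_def)
  have km: "\<kappa> (- u) = \<kappa> u" for u by (simp add: \<kappa>_def)
  have eq: "(\<integral>\<omega>. mol_incr_cov \<epsilon> t x s x \<omega> p \<partial>PB) =
     ((if fst p \<le> t \<and> snd p \<le> t then \<kappa> v else 0) + (if fst p \<le> s \<and> snd p \<le> s then \<kappa> v else 0))
     - ((if fst p \<le> t \<and> snd p \<le> s then \<kappa> (\<tau> - v) else 0) + (if fst p \<le> s \<and> snd p \<le> t then \<kappa> (\<tau> + v) else 0))"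
    unfolding mol_incr_cov_expectation[OF e r] mol_cov_expectation(2)[OF e r] a hk0 km ..
  have kJ: "ennreal (\<kappa> v) \<le> frac_cov0 \<bar>v\<bar>" unfolding \<kappa>_def using e by (intro smooth_cov0_shift_le_frac_cov0) auto
  show ?thesis
  proof (cases "fst p \<le> s \<and> snd p \<le> s")
    case True
    have anti: "\<kappa> (\<tau> - v) \<ge> smooth_cov0 (2 * \<epsilon> + \<bar>v\<bar> + \<tau>)" "\<kappa> (\<tau> + v) \<ge> smooth_cov0 (2 * \<epsilon> + \<bar>v\<bar> + \<tau>)"
      unfolding \<kappa>_def using tau by (auto intro!: smooth_cov0_antimono pos)
    have "(\<integral>\<omega>. mol_incr_cov \<epsilon> t x s x \<omega> p \<partial>PB) \<le> 2 * (smooth_cov0 (2 * \<epsilon> + \<bar>v\<bar>) - smooth_cov0 (2 * \<epsilon> + \<bar>v\<bar> + \<tau>))"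
      unfolding eq using True st anti by (simp add: \<kappa>_def)
    then have "ennreal (\<integral>\<omega>. mol_incr_cov \<epsilon> t x s x \<omega> p \<partial>PB) \<le> ennreal (2 * (smooth_cov0 (2 * \<epsilon> + \<bar>v\<bar>) - smooth_cov0 (2 * \<epsilon> + \<bar>v\<bar> + \<tau>)))" by (rule ennreal_leI)
    also have "\<dots> \<le> ennreal (2 * \<tau> powr \<alpha>) * frac_cov0 \<bar>v\<bar>" using e tau by (intro smooth_cov0_increment) auto
    also have "\<dots> \<le> ennreal (2 * \<tau> powr \<alpha>) * frac_cov0 \<bar>v\<bar> + (indicator {s<..t} (fst p) * frac_cov0 \<bar>v\<bar> + indicator {s<..t} (snd p) * frac_cov0 \<bar>v\<bar>)" by simp
    finally show ?thesis by (simp add: v_def \<tau>_def)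
  next
    case False
    show ?thesis
    proof (cases "fst p \<le> t \<and> snd p \<le> t")
      case t: True
      have "(\<integral>\<omega>. mol_incr_cov \<epsilon> t x s x \<omega> p \<partial>PB) \<le> \<kappa> v"
        unfolding eq using False k0[of "\<tau> - v"] k0[of "\<tau> + v"] k0[of v] by auto
      then have "ennreal (\<integral>\<omega>. mol_incr_cov \<epsilon> t x s x \<omega> p \<partial>PB) \<le> frac_cov0 \<bar>v\<bar>" using kJ by (blast intro: order_trans ennreal_leI)
      also have "\<dots> \<le> indicator {s<..t} (fst p) * frac_cov0 \<bar>v\<bar> + indicator {s<..t} (snd p) * frac_cov0 \<bar>v\<bar>"
        using False t by (auto simp: not_le split: split_indicator)
      also have "\<dots> \<le> ennreal (2 * \<tau> powr \<alpha>) * frac_cov0 \<bar>v\<bar> + (indicator {s<..t} (fst p) * frac_cov0 \<bar>v\<bar> + indicator {s<..t} (snd p) * frac_cov0 \<bar>v\<bar>)" by simp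
      finally show ?thesis by (simp add: v_def \<tau>_def)
    next
      case t: False
      then have "(\<integral>\<omega>. mol_incr_cov \<epsilon> t x s x \<omega> p \<partial>PB) \<le> 0" unfolding eq using False k0 st by auto
      then show ?thesis by (simp add: ennreal_neg)
    qed
  qed
qed

lemma AE_gamma_measure_nonneg: "AE p in gamma_measure T. 0 \<le> fst p \<and> 0 \<le> snd p"
  unfolding gamma_measure_def by (subst AE_density) (auto split: split_indicator)

text \<open>The exchange of integrals is an equality for real integrals. The second claim is an
  inequality because the inner expectation may be negative and \<open>ennreal\<close> truncates it
  at zero.\<close>

lemma mol_incr_cov_fubini:
  assumes e: "0 < \<epsilon>" and T: "0 \<le> T"
  shows "integrable PB (\<lambda>\<omega>. \<integral>p. mol_incr_cov \<epsilon> t x s y \<omega> p \<partial>gamma_measure T)"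
    and "ennreal (\<integral>\<omega>. (\<integral>p. mol_incr_cov \<epsilon> t x s y \<omega> p \<partial>gamma_measure T) \<partial>PB) \<le> (\<integral>\<^sup>+p. ennreal (\<integral>\<omega>. mol_incr_cov \<epsilon> t x s y \<omega> p \<partial>PB) \<partial>gamma_measure T)"
proof -
  interpret N: finite_measure "gamma_measure T" by (rule finite_gamma_measure[OF T])
  interpret NP: pair_sigma_finite "gamma_measure T" PB ..
  interpret PN: finite_measure "gamma_measure T \<Otimes>\<^sub>M PB" by (rule finite_measure_pair_measure) unfold_locales
  have m: "(\<lambda>z. mol_incr_cov \<epsilon> t x s y (snd z) (fst z)) \<in> borel_measurable (gamma_measure T \<Otimes>\<^sub>M PB)"
  proof -
    have "(\<lambda>z. mol_incr_cov \<epsilon> t x s y (snd z) (fst z)) \<in> borel_measurable ((borel \<Otimes>\<^sub>M borel) \<Otimes>\<^sub>M PB)"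
      unfolding mol_incr_cov_def by (intro borel_measurable_diff borel_measurable_add mol_cov_measurable)
    then show ?thesis by (simp cong: measurable_cong_sets sets_pair_measure_cong add: sets_gamma_measure)
  qed
  have int: "integrable (gamma_measure T \<Otimes>\<^sub>M PB) (\<lambda>(p, \<omega>). mol_incr_cov \<epsilon> t x s y \<omega> p)"
    unfolding case_prod_beta
  proof (rule PN.integrable_const_bound[OF _ m])
    have "\<bar>mol_incr_cov \<epsilon> t x s y \<omega> p\<bar> \<le> 4 * (2 * smooth_cov0 (2 * \<epsilon>))" for \<omega> p
      unfolding mol_incr_cov_def using mol_cov_le[OF e, of t x t x \<omega> p] mol_cov_le[OF e, of s y s y \<omega> p] mol_cov_le[OF e, of t x s y \<omega> p] mol_cov_le[OF e, of s y t x \<omega> p]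
         mol_cov_nonneg[of \<epsilon> t x t x \<omega> p] mol_cov_nonneg[of \<epsilon> s y s y \<omega> p] mol_cov_nonneg[of \<epsilon> t x s y \<omega> p] mol_cov_nonneg[of \<epsilon> s y t x \<omega> p] by linarith
    then show "AE z in gamma_measure T \<Otimes>\<^sub>M PB. norm (mol_incr_cov \<epsilon> t x s y (snd z) (fst z)) \<le> 4 * (2 * smooth_cov0 (2 * \<epsilon>))" by simp
  qed
  show "integrable PB (\<lambda>\<omega>. \<integral>p. mol_incr_cov \<epsilon> t x s y \<omega> p \<partial>gamma_measure T)" by (rule NP.integrable_snd[OF int])
  have "(\<integral>\<omega>. (\<integral>p. mol_incr_cov \<epsilon> t x s y \<omega> p \<partial>gamma_measure T) \<partial>PB) = (\<integral>p. (\<integral>\<omega>. mol_incr_cov \<epsilon> t x s y \<omega> p \<partial>PB) \<partial>gamma_measure T)"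
    by (rule NP.Fubini_integral[OF int])
  also have "ennreal \<dots> \<le> (\<integral>\<^sup>+p. ennreal (\<integral>\<omega>. mol_incr_cov \<epsilon> t x s y \<omega> p \<partial>PB) \<partial>gamma_measure T)"
  proof -
    have i: "integrable (gamma_measure T) (\<lambda>p. \<integral>\<omega>. mol_incr_cov \<epsilon> t x s y \<omega> p \<partial>PB)" by (rule NP.integrable_fst[OF int])
    have "(\<integral>p. (\<integral>\<omega>. mol_incr_cov \<epsilon> t x s y \<omega> p \<partial>PB) \<partial>gamma_measure T) \<le> (\<integral>p. max 0 (\<integral>\<omega>. mol_incr_cov \<epsilon> t x s y \<omega> p \<partial>PB) \<partial>gamma_measure T)"
      by (rule integral_mono[OF i]) (use i in auto)
    then have "ennreal (\<integral>p. (\<integral>\<omega>. mol_incr_cov \<epsilon> t x s y \<omega> p \<partial>PB) \<partial>gamma_measure T) \<le> ennreal (\<integral>p. max 0 (\<integral>\<omega>. mol_incr_cov \<epsilon> t x s y \<omega> p \<partial>PB) \<partial>gamma_measure T)" by (rule ennreal_leI)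
    also have "\<dots> = (\<integral>\<^sup>+p. ennreal (max 0 (\<integral>\<omega>. mol_incr_cov \<epsilon> t x s y \<omega> p \<partial>PB)) \<partial>gamma_measure T)"
      using i by (intro nn_integral_eq_integral[symmetric]) auto
    also have "\<dots> = (\<integral>\<^sup>+p. ennreal (\<integral>\<omega>. mol_incr_cov \<epsilon> t x s y \<omega> p \<partial>PB) \<partial>gamma_measure T)"
      by (intro nn_integral_cong) (auto simp: max_def ennreal_neg)
    finally show ?thesis .
  qed
  finally show "ennreal (\<integral>\<omega>. (\<integral>p. mol_incr_cov \<epsilon> t x s y \<omega> p \<partial>gamma_measure T) \<partial>PB) \<le> (\<integral>\<^sup>+p. ennreal (\<integral>\<omega>. mol_incr_cov \<epsilon> t x s y \<omega> p \<partial>PB) \<partial>gamma_measure T)" .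
qed

lemma space_increment:
  assumes e: "0 < \<epsilon>" and T: "0 \<le> T"
  shows "ennreal (\<integral>\<omega>. (\<integral>p. mol_incr_cov \<epsilon> t x t y \<omega> p \<partial>gamma_measure T) \<partial>PB) \<le> ennreal (4 * T * norm (x - y) powr (2 * \<alpha>)) * gamma_average T frac_cov0"
proof -
  have "ennreal (\<integral>\<omega>. (\<integral>p. mol_incr_cov \<epsilon> t x t y \<omega> p \<partial>gamma_measure T) \<partial>PB) \<le> (\<integral>\<^sup>+p. ennreal (\<integral>\<omega>. mol_incr_cov \<epsilon> t x t y \<omega> p \<partial>PB) \<partial>gamma_measure T)"
    by (rule mol_incr_cov_fubini[OF e T])
  also have "\<dots> \<le> (\<integral>\<^sup>+p. ennreal (4 * norm (x - y) powr (2 * \<alpha>)) * (indicator UNIV (fst p) * frac_cov0 \<bar>fst p - snd p\<bar>) \<partial>gamma_measure T)"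
    using AE_gamma_measure_nonneg by (intro nn_integral_mono_AE, eventually_elim) (use space_increment_pointwise[OF e] in auto)
  also have "\<dots> = ennreal (4 * norm (x - y) powr (2 * \<alpha>)) * (\<integral>\<^sup>+p. indicator UNIV (fst p) * frac_cov0 \<bar>fst p - snd p\<bar> \<partial>gamma_measure T)"
    by (rule nn_integral_cmult) measurable
  also have "\<dots> \<le> ennreal (4 * norm (x - y) powr (2 * \<alpha>)) * (emeasure lborel (UNIV \<inter> {0..T}) * gamma_average T frac_cov0)"
    by (intro mult_left_mono gamma_measure_fst_bound) auto
  also have "\<dots> = ennreal (4 * T * norm (x - y) powr (2 * \<alpha>)) * gamma_average T frac_cov0"
  proof -
    have "emeasure lborel (UNIV \<inter> {0..T}) = ennreal T" using T by simp
    moreover have "ennreal (4 * T * norm (x - y) powr (2 * \<alpha>)) = ennreal (4 * norm (x - y) powr (2 * \<alpha>)) * ennreal T"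
      using T by (subst ennreal_mult[symmetric]) (auto simp: mult_ac)
    ultimately show ?thesis by (simp only: mult.assoc)
  qed
  finally show ?thesis .
qed

text \<open>The linear term 2 (t - s) comes from the two strips in which one noise time exceeds s;
  the first term comes from the lag between the two integrals.\<close>

lemma time_increment:
  assumes e: "0 < \<epsilon>" and st: "0 \<le> s" "s \<le> t" "t \<le> T"
  shows "ennreal (\<integral>\<omega>. (\<integral>p. mol_incr_cov \<epsilon> t x s x \<omega> p \<partial>gamma_measure T) \<partial>PB) \<le> ennreal (2 * T * (t - s) powr \<alpha> + 2 * (t - s)) * gamma_average T frac_cov0"
proof -
  have T: "0 \<le> T" using st by simp
  have "ennreal (\<integral>\<omega>. (\<integral>p. mol_incr_cov \<epsilon> t x s x \<omega> p \<partial>gamma_measure T) \<partial>PB) \<le> (\<integral>\<^sup>+p. ennreal (\<integral>\<omega>. mol_incr_cov \<epsilon> t x s x \<omega> p \<partial>PB) \<partial>gamma_measure T)"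
    by (rule mol_incr_cov_fubini[OF e T])
  also have "\<dots> \<le> (\<integral>\<^sup>+p. ennreal (2 * (t - s) powr \<alpha>) * (indicator UNIV (fst p) * frac_cov0 \<bar>fst p - snd p\<bar>)
     + (indicator {s<..t} (fst p) * frac_cov0 \<bar>fst p - snd p\<bar> + indicator {s<..t} (snd p) * frac_cov0 \<bar>fst p - snd p\<bar>) \<partial>gamma_measure T)"
    using AE_gamma_measure_nonneg by (intro nn_integral_mono_AE, eventually_elim) (use time_increment_pointwise[OF e _ _ st(1,2)] in auto)
  also have "\<dots> = ennreal (2 * (t - s) powr \<alpha>) * (\<integral>\<^sup>+p. indicator UNIV (fst p) * frac_cov0 \<bar>fst p - snd p\<bar> \<partial>gamma_measure T)
     + ((\<integral>\<^sup>+p. indicator {s<..t} (fst p) * frac_cov0 \<bar>fst p - snd p\<bar> \<partial>gamma_measure T) + (\<integral>\<^sup>+p. indicator {s<..t} (snd p) * frac_cov0 \<bar>fst p - snd p\<bar> \<partial>gamma_measure T))"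
    by (subst nn_integral_add, measurable, subst nn_integral_add, measurable, subst nn_integral_cmult, measurable)
  also have "\<dots> \<le> ennreal (2 * (t - s) powr \<alpha>) * (emeasure lborel (UNIV \<inter> {0..T}) * gamma_average T frac_cov0)
     + (emeasure lborel ({s<..t} \<inter> {0..T}) * gamma_average T frac_cov0 + emeasure lborel ({s<..t} \<inter> {0..T}) * gamma_average T frac_cov0)"
    by (intro add_mono mult_left_mono gamma_measure_fst_bound gamma_measure_snd_bound) auto
  also have "{s<..t} \<inter> {0..T} = {s<..t}" using st by auto
  also have "ennreal (2 * (t - s) powr \<alpha>) * (emeasure lborel (UNIV \<inter> {0..T}) * gamma_average T frac_cov0) + (emeasure lborel {s<..t} * gamma_average T frac_cov0 + emeasure lborel {s<..t} * gamma_average T frac_cov0)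
    = ennreal (2 * T * (t - s) powr \<alpha> + 2 * (t - s)) * gamma_average T frac_cov0"
  proof -
    have "emeasure lborel (UNIV \<inter> {0..T}) = ennreal T" "emeasure lborel {s<..t} = ennreal (t - s)" using T st by auto
    moreover have "ennreal (2 * T * (t - s) powr \<alpha> + 2 * (t - s)) = ennreal (2 * T * (t - s) powr \<alpha>) + ennreal (2 * (t - s))"
      using st T by (intro ennreal_plus) auto
    moreover have "ennreal (2 * T * (t - s) powr \<alpha>) = ennreal (2 * (t - s) powr \<alpha>) * ennreal T"
      using T by (subst ennreal_mult[symmetric]) (auto simp: mult_ac)
    moreover have "ennreal (2 * (t - s)) = ennreal (t - s) + ennreal (t - s)"
      using st by (subst ennreal_plus[symmetric]) auto
    ultimately show ?thesis by (simp only: distrib_right mult.assoc)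
  qed
  finally show ?thesis .
qed

end

section \<open>Moments of the Feynman-Kac functional\<close>

text \<open>The tangent to A^p at c, from Bernoulli's inequality for A/c. Keeping c free allows the
  optimal tangent point to be chosen after integration.\<close>

lemma young_power:
  fixes A c :: real assumes "0 \<le> A" "0 < c" "0 < p"
  shows "real p * c ^ (p - 1) * A \<le> A ^ p + (real p - 1) * c ^ p"
proof -
  obtain n where p: "p = Suc n" using assms(3) by (cases p) auto
  have "1 + real p * (A / c - 1) \<le> (1 + (A / c - 1)) ^ p" using assms by (intro Bernoulli_inequality) (simp add: field_simps)
  then have "c ^ p * (1 + real p * (A / c - 1)) \<le> c ^ p * (A / c) ^ p" using assms by (intro mult_left_mono) auto
  also have "c ^ p * (A / c) ^ p = A ^ p" using assms by (simp flip: power_mult_distrib)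
  also have "c ^ p * (1 + real p * (A / c - 1)) = real p * c ^ (p - 1) * A - (real p - 1) * c ^ p"
    using assms(2) unfolding p by (simp add: field_simps)
  finally show ?thesis by linarith
qed

text \<open>Jensen's inequality with respect to the measure with density \<open>w\<close>.\<close>
lemma nn_integral_power_weighted:
  fixes Y w :: "'a \<Rightarrow> real"
  assumes [measurable]: "Y \<in> borel_measurable M" "w \<in> borel_measurable M"
    and Y: "\<And>x. 0 \<le> Y x" and w: "\<And>x. 0 < w x" and p: "0 < p"
    and Z: "(\<integral>\<^sup>+x. ennreal (w x) \<partial>M) \<le> ennreal z" "0 < z"
  shows "(\<integral>\<^sup>+x. ennreal (Y x) \<partial>M) ^ p \<le> ennreal (z ^ (p - 1)) * (\<integral>\<^sup>+x. ennreal (Y x ^ p / w x ^ (p - 1)) \<partial>M)"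
proof -
  define I where "I = (\<integral>\<^sup>+x. ennreal (Y x) \<partial>M)"
  define R where "R = (\<integral>\<^sup>+x. ennreal (Y x ^ p / w x ^ (p - 1)) \<partial>M)"
  have young: "ennreal (real p * c ^ (p - 1)) * I \<le> R + ennreal ((real p - 1) * c ^ p) * ennreal z" if c: "0 < c" for c
  proof -
    have "ennreal (real p * c ^ (p - 1)) * I = (\<integral>\<^sup>+x. ennreal (real p * c ^ (p - 1)) * ennreal (Y x) \<partial>M)"
      unfolding I_def by (rule nn_integral_cmult[symmetric]) measurable
    also have "\<dots> \<le> (\<integral>\<^sup>+x. ennreal (Y x ^ p / w x ^ (p - 1)) + ennreal ((real p - 1) * c ^ p) * ennreal (w x) \<partial>M)"
    proof (rule nn_integral_mono)
      fix x
      have "real p * c ^ (p - 1) * (Y x / w x) \<le> (Y x / w x) ^ p + (real p - 1) * c ^ p"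
        using Y[of x] w[of x] c p by (intro young_power) auto
      then have "w x * (real p * c ^ (p - 1) * (Y x / w x)) \<le> w x * ((Y x / w x) ^ p + (real p - 1) * c ^ p)"
        using w[of x] by (intro mult_left_mono) auto
      also have "w x * (real p * c ^ (p - 1) * (Y x / w x)) = real p * c ^ (p - 1) * Y x" using w[of x] by simp
      also have "w x * ((Y x / w x) ^ p + (real p - 1) * c ^ p) = Y x ^ p / w x ^ (p - 1) + (real p - 1) * c ^ p * w x"
        using w[of x] p by (cases p) (auto simp: field_simps power_divide)
      finally have "ennreal (real p * c ^ (p - 1) * Y x) \<le> ennreal (Y x ^ p / w x ^ (p - 1) + (real p - 1) * c ^ p * w x)" by (rule ennreal_leI)
      then show "ennreal (real p * c ^ (p - 1)) * ennreal (Y x) \<le> ennreal (Y x ^ p / w x ^ (p - 1)) + ennreal ((real p - 1) * c ^ p) * ennreal (w x)"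
        using Y[of x] w[of x] c p by (simp add: ennreal_mult[symmetric] less_imp_le Suc_leI)
    qed
    also have "\<dots> = R + ennreal ((real p - 1) * c ^ p) * (\<integral>\<^sup>+x. ennreal (w x) \<partial>M)"
      unfolding R_def by (subst nn_integral_add) (auto simp: nn_integral_cmult)
    also have "\<dots> \<le> R + ennreal ((real p - 1) * c ^ p) * ennreal z" using Z by (intro add_left_mono mult_left_mono) auto
    finally show ?thesis .
  qed
  show ?thesis
  proof (cases "R = \<infinity>")
    case True
    then show ?thesis using Z unfolding R_def[symmetric] by (simp add: ennreal_mult_top)
  next
    case False
    then obtain r where r: "R = ennreal r" "0 \<le> r" by (cases R) auto
    have p1: "0 \<le> (real p - 1)" using p by simp
    have "I \<noteq> \<infinity>"
    proof
      assume "I = \<infinity>"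
      then have "\<infinity> \<le> R + ennreal ((real p - 1) * 1 ^ p) * ennreal z" using young[of 1] p by (simp add: ennreal_mult_top)
      then have "ennreal (real p - 1) * ennreal z = \<infinity>" using r by (simp add: top_unique)
      then show False by (simp add: ennreal_mult_eq_top_iff)
    qed
    then obtain i where i: "I = ennreal i" "0 \<le> i" by (cases I) auto
    have "i ^ p \<le> z ^ (p - 1) * r"
    proof (cases "i = 0")
      case True
      then show ?thesis using r Z p by (simp add: power_0_left)
    next
      case False
      \<comment> \<open>The optimal tangent point: the mean of Y/w with respect to the weight,
        computed with the mass bound z in place of the mass.\<close>
      define c where "c = i / z"
      have c: "0 < c" using False i Z by (simp add: c_def)
      have "ennreal (real p * c ^ (p - 1) * i) \<le> ennreal (r + (real p - 1) * c ^ p * z)"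
        using young[OF c] c i r p1 Z by (simp add: ennreal_mult[symmetric] mult_nonneg_nonneg less_imp_le flip: ennreal_plus)
      then have "real p * c ^ (p - 1) * i \<le> r + (real p - 1) * c ^ p * z"
        using c i r p1 Z by (subst (asm) ennreal_le_iff) auto
      moreover have "c ^ p * z = c ^ (p - 1) * i" using p Z by (cases p) (auto simp: c_def)
      ultimately have "real p * (c ^ (p - 1) * i) \<le> r + (real p - 1) * (c ^ (p - 1) * i)" by (simp only: mult.assoc)
      then have "c ^ (p - 1) * i \<le> r" by (simp only: left_diff_distrib)
      then have "z ^ (p - 1) * (c ^ (p - 1) * i) \<le> z ^ (p - 1) * r" using Z by (intro mult_left_mono) auto
      also have "z ^ (p - 1) * (c ^ (p - 1) * i) = i ^ p"
        using p Z by (cases p) (auto simp: c_def power_divide)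
      finally show ?thesis .
    qed
    then have "ennreal (i ^ p) \<le> ennreal (z ^ (p - 1) * r)" by (rule ennreal_leI)
    then show ?thesis unfolding I_def[symmetric] R_def[symmetric] using i r Z by (simp add: ennreal_power ennreal_mult)
  qed
qed

lemma exp_diff_le: "\<bar>exp a - exp b\<bar> \<le> \<bar>a - b\<bar> * (exp a + exp b)" for a b :: real
proof -
  have le: "exp a - exp b \<le> \<bar>a - b\<bar> * (exp a + exp b)" for a b :: real
  proof -
    have "exp a * (1 + (b - a)) \<le> exp a * exp (b - a)" by (intro mult_left_mono exp_ge_add_one_self) auto
    then have "exp a - exp b \<le> (a - b) * exp a" by (simp add: mult_exp_exp algebra_simps)
    also have "\<dots> \<le> \<bar>a - b\<bar> * (exp a + exp b)" by (intro mult_mono) auto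
    finally show ?thesis .
  qed
  show ?thesis using le[of a b] le[of b a] by (auto simp: abs_le_iff abs_minus_commute add.commute)
qed

section \<open>Conditional second moments of the limit\<close>

locale feynman_kac = covariance_brownian \<gamma> \<Lambda> \<mu> \<beta> C\<^sub>\<beta> \<alpha> PB B
  for \<gamma> :: "real \<Rightarrow> real" and \<Lambda> :: "'d::euclidean_space \<Rightarrow> real" and \<mu> :: "'d measure" and \<beta> C\<^sub>\<beta> \<alpha> :: real
    and PB :: "'b measure" and B :: "real \<Rightarrow> 'b \<Rightarrow> 'd" +
  fixes PW :: "'w measure" and W :: "(real \<times> 'd \<Rightarrow> real) \<Rightarrow> 'w \<Rightarrow> real" and V :: "real \<Rightarrow> 'd \<Rightarrow> 'w \<Rightarrow> 'b \<Rightarrow> real"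
  assumes noise: "gaussian_noise PW \<gamma> \<Lambda> W"
    and V_meas: "\<And>t x. 0 \<le> t \<Longrightarrow> (\<lambda>z. V t x (fst z) (snd z)) \<in> borel_measurable (PW \<Otimes>\<^sub>M PB)"
    and V_limit: "\<And>t x. 0 \<le> t \<Longrightarrow> (AE \<omega>B in PB.
        ((\<lambda>\<epsilon>. \<integral>\<^sup>+\<omega>W. ennreal ((W (mollified_integrand B t x \<omega>B \<epsilon>) \<omega>W - V t x \<omega>W \<omega>B)\<^sup>2) \<partial>PW) \<longlongrightarrow> 0) (at_right 0))"
begin

lemma PW: "prob_space PW" using noise by (simp add: gaussian_noise_def)

sublocale W: prob_space PW by (rule PW)

sublocale WB: pair_sigma_finite PW PB ..

lemma V_section: "0 \<le> t \<Longrightarrow> \<omega>B \<in> space PB \<Longrightarrow> (\<lambda>\<omega>W. V t x \<omega>W \<omega>B) \<in> borel_measurable PW"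
  using measurable_compose[OF measurable_Pair2' V_meas] by simp

lemma V_section2: "0 \<le> t \<Longrightarrow> \<omega>W \<in> space PW \<Longrightarrow> (\<lambda>\<omega>B. V t x \<omega>W \<omega>B) \<in> borel_measurable PB"
  using measurable_compose[OF measurable_Pair1' V_meas] by simp

lemma V_swap: "0 \<le> t \<Longrightarrow> (\<lambda>(\<omega>B, \<omega>W). V t x \<omega>W \<omega>B) \<in> borel_measurable (PB \<Otimes>\<^sub>M PW)"
  using measurable_compose[OF measurable_Pair[OF measurable_snd measurable_fst] V_meas] by (simp add: case_prod_beta')

lemma W_gaussian:
  assumes "H_admissible \<gamma> \<Lambda> \<phi>"
  shows "W \<phi> \<in> borel_measurable PW"
    and "char (distr PW borel (W \<phi>)) \<theta> = exp (- complex_of_real (H_inner \<gamma> \<Lambda> \<phi> \<phi> * \<theta>\<^sup>2 / 2))"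
  using noise assms by (auto simp: gaussian_noise_def)

text \<open>The second moment over the noise with the Brownian path fixed. It is
  \<open>ennreal\<close>-valued because finiteness is known for almost every path only.\<close>

definition var_V :: "real \<Rightarrow> 'd \<Rightarrow> 'b \<Rightarrow> ennreal" where
  "var_V t x \<omega>B = (\<integral>\<^sup>+\<omega>W. ennreal ((V t x \<omega>W \<omega>B)\<^sup>2) \<partial>PW)"

definition var_incr :: "real \<Rightarrow> 'd \<Rightarrow> real \<Rightarrow> 'd \<Rightarrow> 'b \<Rightarrow> ennreal" where
  "var_incr t x s y \<omega>B = (\<integral>\<^sup>+\<omega>W. ennreal ((V t x \<omega>W \<omega>B - V s y \<omega>W \<omega>B)\<^sup>2) \<partial>PW)"

lemma var_V_measurable: "0 \<le> t \<Longrightarrow> var_V t x \<in> borel_measurable PB"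
proof -
  assume "0 \<le> t"
  from V_swap[OF this, of x] have [measurable]: "(\<lambda>(\<omega>B, \<omega>W). V t x \<omega>W \<omega>B) \<in> borel_measurable (PB \<Otimes>\<^sub>M PW)" .
  show ?thesis unfolding var_V_def[abs_def] by measurable
qed

lemma var_incr_measurable: "0 \<le> t \<Longrightarrow> 0 \<le> s \<Longrightarrow> var_incr t x s y \<in> borel_measurable PB"
proof -
  assume "0 \<le> t" "0 \<le> s"
  from V_swap[OF this(1), of x] V_swap[OF this(2), of y]
  have [measurable]: "(\<lambda>(\<omega>B, \<omega>W). V t x \<omega>W \<omega>B) \<in> borel_measurable (PB \<Otimes>\<^sub>M PW)"
    "(\<lambda>(\<omega>B, \<omega>W). V s y \<omega>W \<omega>B) \<in> borel_measurable (PB \<Otimes>\<^sub>M PW)" .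
  show ?thesis unfolding var_incr_def[abs_def] by measurable
qed

text \<open>All consequences hold on one almost-sure set of paths: the exponent a and the function h
  are quantified inside and may be chosen later.\<close>

lemma V_gaussian_bounds:
  assumes t: "0 \<le> t" "t \<le> T"
  shows "AE \<omega>B in PB. var_V t x \<omega>B < \<infinity> \<and>
    (\<forall>a. (\<integral>\<^sup>+\<omega>W. ennreal (exp (a * V t x \<omega>W \<omega>B)) \<partial>PW) \<le> ennreal (exp (a\<^sup>2 * enn2real (var_V t x \<omega>B)))) \<and>
    (\<forall>h. continuous_on UNIV h \<longrightarrow> mono h \<longrightarrow> ennreal (h (enn2real (var_V t x \<omega>B))) \<le>
       liminf (\<lambda>n. ennreal (h (2 * (\<integral>p. mol_cov (1 / real (Suc n)) t x t x \<omega>B p \<partial>gamma_measure T)))))"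
  using V_limit[OF t(1), of x] AE_space
proof eventually_elim
  fix \<omega>B assume lim: "((\<lambda>\<epsilon>. \<integral>\<^sup>+\<omega>W. ennreal ((W (mollified_integrand B t x \<omega>B \<epsilon>) \<omega>W - V t x \<omega>W \<omega>B)\<^sup>2) \<partial>PW) \<longlongrightarrow> 0) (at_right 0)"
    and \<omega>: "\<omega>B \<in> space PB"
  have T: "0 \<le> T" using t by simp
  have ch: "char (distr PW borel (W (mollified_integrand B t x \<omega>B e))) \<theta> = exp (- complex_of_real ((\<integral>p. mol_cov e t x t x \<omega>B p \<partial>gamma_measure T) * \<theta>\<^sup>2 / 2))" if e: "0 < e" for e \<theta>
    using W_gaussian(2)[OF mollif_admissible[OF \<omega> e, of t x], where \<theta>=\<theta>] cross_integral(2)[OF \<omega> e t(2) t(2) T, where x=x and y=x] by (simp add: mollif_def)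
  have mX: "W (mollified_integrand B t x \<omega>B e) \<in> borel_measurable PW" if e: "0 < e" for e
    using W_gaussian(1)[OF mollif_admissible[OF \<omega> e, of t x]] by (simp add: mollif_def)
  note G = gaussian_L2_limit[OF PW mX V_section[OF t(1) \<omega>] ch lim, folded var_V_def]
  show "var_V t x \<omega>B < \<infinity> \<and>
    (\<forall>a. (\<integral>\<^sup>+\<omega>W. ennreal (exp (a * V t x \<omega>W \<omega>B)) \<partial>PW) \<le> ennreal (exp (a\<^sup>2 * enn2real (var_V t x \<omega>B)))) \<and>
    (\<forall>h. continuous_on UNIV h \<longrightarrow> mono h \<longrightarrow> ennreal (h (enn2real (var_V t x \<omega>B))) \<le>
       liminf (\<lambda>n. ennreal (h (2 * (\<integral>p. mol_cov (1 / real (Suc n)) t x t x \<omega>B p \<partial>gamma_measure T)))))"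
    using G(1) G(3) G(4) by blast
qed

text \<open>The difference is treated as the L2 limit of the Gaussian variables belonging to
  \<open>mollif_diff\<close>, so no joint law of the two limits enters. Almost-sure linearity of W
  connects these variables with the two given limits.\<close>

lemma D_gaussian_bounds:
  assumes t: "0 \<le> t" "t \<le> T" and s: "0 \<le> s" "s \<le> T"
  shows "AE \<omega>B in PB. var_incr t x s y \<omega>B < \<infinity> \<and>
    (\<forall>k. (\<integral>\<^sup>+\<omega>W. ennreal ((V t x \<omega>W \<omega>B - V s y \<omega>W \<omega>B) ^ (2 * k)) \<partial>PW) \<le> ennreal (gauss_moment k * (2 * enn2real (var_incr t x s y \<omega>B)) ^ k)) \<and>
    ennreal (enn2real (var_incr t x s y \<omega>B)) \<le> liminf (\<lambda>n. ennreal (2 * (\<integral>p. mol_incr_cov (1 / real (Suc n)) t x s y \<omega>B p \<partial>gamma_measure T)))"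
  using V_limit[OF t(1), of x] V_limit[OF s(1), of y] AE_space
proof eventually_elim
  fix \<omega>B assume lim: "((\<lambda>\<epsilon>. \<integral>\<^sup>+\<omega>W. ennreal ((W (mollified_integrand B t x \<omega>B \<epsilon>) \<omega>W - V t x \<omega>W \<omega>B)\<^sup>2) \<partial>PW) \<longlongrightarrow> 0) (at_right 0)"
     "((\<lambda>\<epsilon>. \<integral>\<^sup>+\<omega>W. ennreal ((W (mollified_integrand B s y \<omega>B \<epsilon>) \<omega>W - V s y \<omega>W \<omega>B)\<^sup>2) \<partial>PW) \<longlongrightarrow> 0) (at_right 0)"
    and \<omega>: "\<omega>B \<in> space PB"
  have T: "0 \<le> T" using t by simp
  let ?X = "\<lambda>e. W (mollif_diff t x s y \<omega>B e)"
  let ?a = "\<lambda>e. W (mollif t x \<omega>B e)" and ?b = "\<lambda>e. W (mollif s y \<omega>B e)"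
  note V1 = V_section[OF t(1) \<omega>, of x] and V2 = V_section[OF s(1) \<omega>, of y]
  note adm = mollif_diff(1)[OF \<omega> _ t(2) s(2) T]
  have ch: "char (distr PW borel (?X e)) \<theta> = exp (- complex_of_real ((\<integral>p. mol_incr_cov e t x s y \<omega>B p \<partial>gamma_measure T) * \<theta>\<^sup>2 / 2))" if e: "0 < e" for e \<theta>
    using W_gaussian(2)[OF adm[OF e], where \<theta>=\<theta>] mollif_diff(2)[OF \<omega> e t(2) s(2) T] by simp
  have mX: "?X e \<in> borel_measurable PW" if e: "0 < e" for e
    using W_gaussian(1)[OF adm[OF e]] .
  have limX: "((\<lambda>e. \<integral>\<^sup>+\<omega>W. ennreal ((?X e \<omega>W - (V t x \<omega>W \<omega>B - V s y \<omega>W \<omega>B))\<^sup>2) \<partial>PW) \<longlongrightarrow> 0) (at_right 0)"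
  proof -
    let ?U = "\<lambda>e. 2 * (\<integral>\<^sup>+\<omega>W. ennreal ((?a e \<omega>W - V t x \<omega>W \<omega>B)\<^sup>2) \<partial>PW) + 2 * (\<integral>\<^sup>+\<omega>W. ennreal ((?b e \<omega>W - V s y \<omega>W \<omega>B)\<^sup>2) \<partial>PW)"
    have "(?U \<longlongrightarrow> 2 * 0 + 2 * 0) (at_right 0)"
      using lim unfolding mollif_def by (intro tendsto_add ennreal_tendsto_cmult) auto
    then have U: "(?U \<longlongrightarrow> 0) (at_right 0)" by simp
    have "\<forall>\<^sub>F e in at_right 0. (\<integral>\<^sup>+\<omega>W. ennreal ((?X e \<omega>W - (V t x \<omega>W \<omega>B - V s y \<omega>W \<omega>B))\<^sup>2) \<partial>PW) \<le> ?U e"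
      using eventually_at_right_less
    proof eventually_elim
      fix e :: real assume e: "0 < e"
      note [measurable] = W_gaussian(1)[OF mollif_admissible[OF \<omega> e, of t x]] W_gaussian(1)[OF mollif_admissible[OF \<omega> e, of s y]] V1 V2
      have "AE \<omega>W in PW. W (\<lambda>z. 1 * mollif t x \<omega>B e z + (-1) * mollif s y \<omega>B e z) \<omega>W = 1 * ?a e \<omega>W + (-1) * ?b e \<omega>W"
        using noise mollif_admissible[OF \<omega> e, of t x] mollif_admissible[OF \<omega> e, of s y] adm[OF e, of x y]
        unfolding gaussian_noise_def mollif_diff_def by blast
      then have "(\<integral>\<^sup>+\<omega>W. ennreal ((?X e \<omega>W - (V t x \<omega>W \<omega>B - V s y \<omega>W \<omega>B))\<^sup>2) \<partial>PW)
         \<le> (\<integral>\<^sup>+\<omega>W. 2 * ennreal ((?a e \<omega>W - V t x \<omega>W \<omega>B)\<^sup>2) + 2 * ennreal ((?b e \<omega>W - V s y \<omega>W \<omega>B)\<^sup>2) \<partial>PW)"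
      proof (intro nn_integral_mono_AE, eventually_elim)
        fix \<omega>W assume "W (\<lambda>z. 1 * mollif t x \<omega>B e z + (-1) * mollif s y \<omega>B e z) \<omega>W = 1 * ?a e \<omega>W + (-1) * ?b e \<omega>W"
        then have X: "?X e \<omega>W - (V t x \<omega>W \<omega>B - V s y \<omega>W \<omega>B) = (?a e \<omega>W - V t x \<omega>W \<omega>B) - (?b e \<omega>W - V s y \<omega>W \<omega>B)"
          unfolding mollif_diff_def by simp
        have sq: "(c - d)\<^sup>2 \<le> 2 * c\<^sup>2 + 2 * d\<^sup>2" for c d :: real
          using zero_le_power2[of "c + d"] by (simp add: power2_sum power2_diff)
        have "ennreal ((?X e \<omega>W - (V t x \<omega>W \<omega>B - V s y \<omega>W \<omega>B))\<^sup>2) \<le> ennreal (2 * (?a e \<omega>W - V t x \<omega>W \<omega>B)\<^sup>2 + 2 * (?b e \<omega>W - V s y \<omega>W \<omega>B)\<^sup>2)"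
          unfolding X by (intro ennreal_leI sq)
        then show "ennreal ((?X e \<omega>W - (V t x \<omega>W \<omega>B - V s y \<omega>W \<omega>B))\<^sup>2) \<le> 2 * ennreal ((?a e \<omega>W - V t x \<omega>W \<omega>B)\<^sup>2) + 2 * ennreal ((?b e \<omega>W - V s y \<omega>W \<omega>B)\<^sup>2)"
          by (simp add: ennreal_mult)
      qed
      also have "\<dots> = ?U e" by (subst nn_integral_add) (auto simp: nn_integral_cmult)
      finally show "(\<integral>\<^sup>+\<omega>W. ennreal ((?X e \<omega>W - (V t x \<omega>W \<omega>B - V s y \<omega>W \<omega>B))\<^sup>2) \<partial>PW) \<le> ?U e" .
    qed
    then show ?thesis by (rule tendsto_sandwich[OF _ _ tendsto_const U, rotated]) simp
  qed
  have var_V: "(\<lambda>\<omega>W. V t x \<omega>W \<omega>B - V s y \<omega>W \<omega>B) \<in> borel_measurable PW" using V1 V2 by measurable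
  note G = gaussian_L2_limit[OF PW mX var_V ch limX, folded var_incr_def]
  show "var_incr t x s y \<omega>B < \<infinity> \<and>
    (\<forall>k. (\<integral>\<^sup>+\<omega>W. ennreal ((V t x \<omega>W \<omega>B - V s y \<omega>W \<omega>B) ^ (2 * k)) \<partial>PW) \<le> ennreal (gauss_moment k * (2 * enn2real (var_incr t x s y \<omega>B)) ^ k)) \<and>
    ennreal (enn2real (var_incr t x s y \<omega>B)) \<le> liminf (\<lambda>n. ennreal (2 * (\<integral>p. mol_incr_cov (1 / real (Suc n)) t x s y \<omega>B p \<partial>gamma_measure T)))"
    using G(1) G(2) G(4)[of "\<lambda>x. x"] by (auto simp: mono_def)
qed

lemma var_V_exp_moment:
  assumes T: "0 < T" and l: "0 \<le> l"
  shows "\<exists>M\<ge>0. \<forall>t x. 0 \<le> t \<longrightarrow> t \<le> T \<longrightarrow> (\<integral>\<^sup>+\<omega>B. ennreal (exp (l * enn2real (var_V t x \<omega>B))) \<partial>PB) \<le> ennreal M"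
proof -
  \<comment> \<open>The limit lemma bounds the second moment of the limit by twice the mollified
    variance, hence the exponent 2 l.\<close>
  obtain M where M: "\<And>t x \<epsilon>. 0 \<le> t \<Longrightarrow> t \<le> T \<Longrightarrow> 0 < \<epsilon> \<Longrightarrow> (\<integral>\<^sup>+\<omega>. ennreal (exp (2 * l * (\<integral>p. mol_cov \<epsilon> t x t x \<omega> p \<partial>gamma_measure T))) \<partial>PB) \<le> ennreal M"
    using variance_exp_moment[OF T, of "2 * l"] l by auto
  interpret N: finite_measure "gamma_measure T" by (rule finite_gamma_measure) (use T in simp)
  have "(\<integral>\<^sup>+\<omega>B. ennreal (exp (l * enn2real (var_V t x \<omega>B))) \<partial>PB) \<le> ennreal (max M 0)" if t: "0 \<le> t" "t \<le> T" for t x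
  proof -
    have Sm[measurable]: "(\<lambda>\<omega>. \<integral>p. mol_cov \<epsilon> t x t x \<omega> p \<partial>gamma_measure T) \<in> borel_measurable PB" for \<epsilon>
    proof -
      have "(\<lambda>z. mol_cov \<epsilon> t x t x (fst z) (snd z)) \<in> borel_measurable (PB \<Otimes>\<^sub>M gamma_measure T)"
        unfolding mol_cov_def by measurable
      then show ?thesis by (intro N.borel_measurable_lebesgue_integral) (simp add: case_prod_beta)
    qed
    have "(\<integral>\<^sup>+\<omega>B. ennreal (exp (l * enn2real (var_V t x \<omega>B))) \<partial>PB) \<le>
      (\<integral>\<^sup>+\<omega>B. liminf (\<lambda>n. ennreal (exp (l * (2 * (\<integral>p. mol_cov (1 / real (Suc n)) t x t x \<omega>B p \<partial>gamma_measure T))))) \<partial>PB)"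
    proof (rule nn_integral_mono_AE)
      have h: "continuous_on UNIV (\<lambda>y. exp (l * y))" "mono (\<lambda>y. exp (l * y))"
        using l by (auto simp: mono_def mult_left_mono intro!: continuous_intros)
      show "AE \<omega>B in PB. ennreal (exp (l * enn2real (var_V t x \<omega>B))) \<le> liminf (\<lambda>n. ennreal (exp (l * (2 * (\<integral>p. mol_cov (1 / real (Suc n)) t x t x \<omega>B p \<partial>gamma_measure T)))))"
        using V_gaussian_bounds[OF t, of x] by eventually_elim (use h in blast)
    qed
    also have "\<dots> \<le> liminf (\<lambda>n. \<integral>\<^sup>+\<omega>B. ennreal (exp (l * (2 * (\<integral>p. mol_cov (1 / real (Suc n)) t x t x \<omega>B p \<partial>gamma_measure T)))) \<partial>PB)"
      by (rule nn_integral_liminf) measurable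
    also have "\<dots> \<le> liminf (\<lambda>n::nat. ennreal (max M 0))"
    proof (intro Liminf_mono always_eventually allI)
      fix n :: nat
      have "(\<integral>\<^sup>+\<omega>B. ennreal (exp (l * (2 * (\<integral>p. mol_cov (1 / real (Suc n)) t x t x \<omega>B p \<partial>gamma_measure T)))) \<partial>PB) \<le> ennreal M"
        using M[OF t, of "1 / real (Suc n)" x] by (simp add: mult_ac)
      also have "\<dots> \<le> ennreal (max M 0)" by (intro ennreal_leI) simp
      finally show "(\<integral>\<^sup>+\<omega>B. ennreal (exp (l * (2 * (\<integral>p. mol_cov (1 / real (Suc n)) t x t x \<omega>B p \<partial>gamma_measure T)))) \<partial>PB) \<le> ennreal (max M 0)" .
    qed
    also have "\<dots> = ennreal (max M 0)" by (intro Liminf_const) simp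
    finally show ?thesis .
  qed
  then show ?thesis by (intro exI[of _ "max M 0"]) auto
qed

lemma var_incr_le_liminf:
  assumes t: "0 \<le> t" "t \<le> T" and s: "0 \<le> s" "s \<le> T"
    and b: "\<And>\<epsilon>. 0 < \<epsilon> \<Longrightarrow> ennreal (\<integral>\<omega>. (\<integral>p. mol_incr_cov \<epsilon> t x s y \<omega> p \<partial>gamma_measure T) \<partial>PB) \<le> c"
  shows "(\<integral>\<^sup>+\<omega>B. var_incr t x s y \<omega>B \<partial>PB) \<le> 2 * c"
proof -
  have T: "0 \<le> T" using t by simp
  have i: "integrable PB (\<lambda>\<omega>. \<integral>p. mol_incr_cov (1 / real (Suc n)) t x s y \<omega> p \<partial>gamma_measure T)" for n
    by (rule mol_incr_cov_fubini(1)[OF _ T]) simp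
  \<comment> \<open>The integrand has no sign, but its integral is the parameter of a Gaussian
    characteristic function and is therefore nonnegative. This identifies its \<open>ennreal\<close>
    integral over paths with the real one.\<close>
  have n0: "0 \<le> (\<integral>p. mol_incr_cov (1 / real (Suc n)) t x s y \<omega> p \<partial>gamma_measure T)" if \<omega>: "\<omega> \<in> space PB" for \<omega> n
  proof (rule gaussian_char_distr(1)[OF PW])
    have e: "0 < 1 / real (Suc n)" by simp
    show "W (mollif_diff t x s y \<omega> (1 / real (Suc n))) \<in> borel_measurable PW"
      by (rule W_gaussian(1)[OF mollif_diff(1)[OF \<omega> e t(2) s(2) T]])
    show "char (distr PW borel (W (mollif_diff t x s y \<omega> (1 / real (Suc n))))) \<theta> = exp (- complex_of_real ((\<integral>p. mol_incr_cov (1 / real (Suc n)) t x s y \<omega> p \<partial>gamma_measure T) * \<theta>\<^sup>2 / 2))" for \<theta>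
      using W_gaussian(2)[OF mollif_diff(1)[OF \<omega> e t(2) s(2) T]] unfolding mollif_diff(2)[OF \<omega> e t(2) s(2) T] .
  qed
  have "(\<integral>\<^sup>+\<omega>B. var_incr t x s y \<omega>B \<partial>PB) \<le> (\<integral>\<^sup>+\<omega>B. liminf (\<lambda>n. ennreal (2 * (\<integral>p. mol_incr_cov (1 / real (Suc n)) t x s y \<omega>B p \<partial>gamma_measure T))) \<partial>PB)"
    using D_gaussian_bounds[OF t s, of x y]
    by (intro nn_integral_mono_AE, eventually_elim) (auto simp: less_top)
  also have "\<dots> \<le> liminf (\<lambda>n. \<integral>\<^sup>+\<omega>B. ennreal (2 * (\<integral>p. mol_incr_cov (1 / real (Suc n)) t x s y \<omega>B p \<partial>gamma_measure T)) \<partial>PB)"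
    using i by (intro nn_integral_liminf) (auto dest: borel_measurable_integrable)
  also have "\<dots> \<le> liminf (\<lambda>n::nat. 2 * c)"
  proof (intro Liminf_mono always_eventually allI)
    fix n :: nat
    have "(\<integral>\<^sup>+\<omega>B. ennreal (2 * (\<integral>p. mol_incr_cov (1 / real (Suc n)) t x s y \<omega>B p \<partial>gamma_measure T)) \<partial>PB) = ennreal (\<integral>\<omega>B. 2 * (\<integral>p. mol_incr_cov (1 / real (Suc n)) t x s y \<omega>B p \<partial>gamma_measure T) \<partial>PB)"
      using i[of n] n0 by (intro nn_integral_eq_integral) auto
    also have "\<dots> = 2 * ennreal (\<integral>\<omega>B. (\<integral>p. mol_incr_cov (1 / real (Suc n)) t x s y \<omega>B p \<partial>gamma_measure T) \<partial>PB)"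
      using i[of n] by (simp add: ennreal_mult')
    also have "\<dots> \<le> 2 * c" by (intro mult_left_mono b) auto
    finally show "(\<integral>\<^sup>+\<omega>B. ennreal (2 * (\<integral>p. mol_incr_cov (1 / real (Suc n)) t x s y \<omega>B p \<partial>gamma_measure T)) \<partial>PB) \<le> 2 * c" .
  qed
  also have "\<dots> = 2 * c" by (intro Liminf_const) simp
  finally show ?thesis .
qed

text \<open>Increments in time and space are joined at the intermediate point (s, x), at the price
  of a factor 2 on each square.\<close>

lemma increment_variance:
  assumes T: "0 < T"
  shows "\<exists>C>0. \<forall>t s x y. 0 \<le> t \<longrightarrow> t \<le> T \<longrightarrow> 0 \<le> s \<longrightarrow> s \<le> T \<longrightarrow>
     (\<integral>\<^sup>+\<omega>B. var_incr t x s y \<omega>B \<partial>PB) \<le> ennreal ((C * (\<bar>t - s\<bar> powr (\<alpha> / 2) + norm (x - y) powr \<alpha>))\<^sup>2)"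
proof -
  obtain J where J: "gamma_average T frac_cov0 = ennreal J" "0 \<le> J" using gamma_average_frac_cov0_finite[of T] T by (cases "gamma_average T frac_cov0") auto
  have two: "2 * (ennreal a * ennreal J) = ennreal (2 * (a * J))" if "0 \<le> a" for a
    using that J(2) by (simp add: ennreal_mult)
  have two': "2 * ennreal a = ennreal (2 * a)" if "0 \<le> a" for a
    using that by (simp add: ennreal_mult)
  \<comment> \<open>It majorises the coefficients of both squares after the doubling; the 1 makes
    \<open>sqrt D\<close> a positive witness.\<close>
  define D where "D = 1 + 4 * (2 * T + 2 * T powr (1 - \<alpha>)) * J + 16 * T * J"
  have D1: "1 \<le> D" using T J by (simp add: D_def)
  have time: "(\<integral>\<^sup>+\<omega>B. var_incr t x s x \<omega>B \<partial>PB) \<le> ennreal (2 * (2 * T + 2 * T powr (1 - \<alpha>)) * J * \<bar>t - s\<bar> powr \<alpha>)"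
    if ts: "0 \<le> s" "s \<le> t" "t \<le> T" for t s x
  proof -
    \<comment> \<open>The linear term of \<open>time_increment\<close> is absorbed into the power
      \<alpha>, since t - s stays below T.\<close>
    have "(t - s) = (t - s) powr (1 - \<alpha>) * (t - s) powr \<alpha>" using ts by (simp flip: powr_add)
    also have "\<dots> \<le> T powr (1 - \<alpha>) * (t - s) powr \<alpha>"
      using ts alpha_less_1 by (intro mult_right_mono powr_mono2) auto
    finally have le: "t - s \<le> T powr (1 - \<alpha>) * (t - s) powr \<alpha>" .
    have "(\<integral>\<^sup>+\<omega>B. var_incr t x s x \<omega>B \<partial>PB) \<le> 2 * (ennreal (2 * T * (t - s) powr \<alpha> + 2 * (t - s)) * gamma_average T frac_cov0)"
      using ts T by (intro var_incr_le_liminf[where T=T] time_increment) auto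
    also have "\<dots> = ennreal (2 * ((2 * T * (t - s) powr \<alpha> + 2 * (t - s)) * J))"
      unfolding J(1) using ts T by (intro two) simp
    also have "\<dots> \<le> ennreal (2 * (2 * T + 2 * T powr (1 - \<alpha>)) * J * \<bar>t - s\<bar> powr \<alpha>)"
    proof (rule ennreal_leI)
      have "2 * T * (t - s) powr \<alpha> + 2 * (t - s) \<le> (2 * T + 2 * T powr (1 - \<alpha>)) * (t - s) powr \<alpha>" using le by (simp add: algebra_simps)
      then have "(2 * T * (t - s) powr \<alpha> + 2 * (t - s)) * J \<le> (2 * T + 2 * T powr (1 - \<alpha>)) * (t - s) powr \<alpha> * J" using J by (intro mult_right_mono)
      then show "2 * ((2 * T * (t - s) powr \<alpha> + 2 * (t - s)) * J) \<le> 2 * (2 * T + 2 * T powr (1 - \<alpha>)) * J * \<bar>t - s\<bar> powr \<alpha>"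
        using ts by (simp only: abs_of_nonneg diff_ge_0_iff_ge mult.assoc mult.commute[of J])
    qed
    finally show ?thesis .
  qed
  have sym: "var_incr t x s y \<omega>B = var_incr s y t x \<omega>B" for t x s y \<omega>B
    unfolding var_incr_def by (simp add: power2_commute)
  have time': "(\<integral>\<^sup>+\<omega>B. var_incr t x s x \<omega>B \<partial>PB) \<le> ennreal (2 * (2 * T + 2 * T powr (1 - \<alpha>)) * J * \<bar>t - s\<bar> powr \<alpha>)"
    if ts: "0 \<le> s" "s \<le> T" "0 \<le> t" "t \<le> T" for t s x
  proof (cases "s \<le> t")
    case True then show ?thesis using time ts by blast
  next
    case False then show ?thesis using time[of t s x] ts sym[of t x s x] by (simp add: abs_minus_commute)
  qed
  have space: "(\<integral>\<^sup>+\<omega>B. var_incr t x t y \<omega>B \<partial>PB) \<le> ennreal (8 * T * J * norm (x - y) powr (2 * \<alpha>))"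
    if t: "0 \<le> t" "t \<le> T" for t x y
  proof -
    have "(\<integral>\<^sup>+\<omega>B. var_incr t x t y \<omega>B \<partial>PB) \<le> 2 * (ennreal (4 * T * norm (x - y) powr (2 * \<alpha>)) * gamma_average T frac_cov0)"
      using t T by (intro var_incr_le_liminf[where T=T] space_increment) auto
    also have "\<dots> = ennreal (2 * (4 * T * norm (x - y) powr (2 * \<alpha>) * J))"
      unfolding J(1) using T by (intro two) simp
    finally show ?thesis by (simp add: mult_ac)
  qed
  have "(\<integral>\<^sup>+\<omega>B. var_incr t x s y \<omega>B \<partial>PB) \<le> ennreal ((sqrt D * (\<bar>t - s\<bar> powr (\<alpha> / 2) + norm (x - y) powr \<alpha>))\<^sup>2)"
    if t: "0 \<le> t" "t \<le> T" and s: "0 \<le> s" "s \<le> T" for t s x y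
  proof -
    have "var_incr t x s y \<omega>B \<le> 2 * var_incr t x s x \<omega>B + 2 * var_incr s x s y \<omega>B" if \<omega>: "\<omega>B \<in> space PB" for \<omega>B
    proof -
      note [measurable] = V_section[OF t(1) \<omega>] V_section[OF s(1) \<omega>]
      have "var_incr t x s y \<omega>B \<le> (\<integral>\<^sup>+\<omega>W. 2 * ennreal ((V t x \<omega>W \<omega>B - V s x \<omega>W \<omega>B)\<^sup>2) + 2 * ennreal ((V s x \<omega>W \<omega>B - V s y \<omega>W \<omega>B)\<^sup>2) \<partial>PW)"
        unfolding var_incr_def
      proof (rule nn_integral_mono)
        fix \<omega>W
        have sq: "(c + d)\<^sup>2 \<le> 2 * c\<^sup>2 + 2 * d\<^sup>2" for c d :: real
          using zero_le_power2[of "c - d"] by (simp add: power2_sum power2_diff)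
        have "ennreal ((V t x \<omega>W \<omega>B - V s y \<omega>W \<omega>B)\<^sup>2) \<le> ennreal (2 * (V t x \<omega>W \<omega>B - V s x \<omega>W \<omega>B)\<^sup>2 + 2 * (V s x \<omega>W \<omega>B - V s y \<omega>W \<omega>B)\<^sup>2)"
          using sq[of "V t x \<omega>W \<omega>B - V s x \<omega>W \<omega>B" "V s x \<omega>W \<omega>B - V s y \<omega>W \<omega>B"] by (intro ennreal_leI) simp
        then show "ennreal ((V t x \<omega>W \<omega>B - V s y \<omega>W \<omega>B)\<^sup>2) \<le> 2 * ennreal ((V t x \<omega>W \<omega>B - V s x \<omega>W \<omega>B)\<^sup>2) + 2 * ennreal ((V s x \<omega>W \<omega>B - V s y \<omega>W \<omega>B)\<^sup>2)"
          by (simp add: ennreal_mult)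
      qed
      also have "\<dots> = 2 * var_incr t x s x \<omega>B + 2 * var_incr s x s y \<omega>B"
        unfolding var_incr_def by (subst nn_integral_add) (auto simp: nn_integral_cmult)
      finally show ?thesis .
    qed
    then have "(\<integral>\<^sup>+\<omega>B. var_incr t x s y \<omega>B \<partial>PB) \<le> (\<integral>\<^sup>+\<omega>B. 2 * var_incr t x s x \<omega>B + 2 * var_incr s x s y \<omega>B \<partial>PB)"
      by (intro nn_integral_mono) auto
    also have "\<dots> = 2 * (\<integral>\<^sup>+\<omega>B. var_incr t x s x \<omega>B \<partial>PB) + 2 * (\<integral>\<^sup>+\<omega>B. var_incr s x s y \<omega>B \<partial>PB)"
      using var_incr_measurable[OF t(1) s(1)] var_incr_measurable[OF s(1) s(1)] by (simp add: nn_integral_add nn_integral_cmult)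
    also have "\<dots> \<le> 2 * ennreal (2 * (2 * T + 2 * T powr (1 - \<alpha>)) * J * \<bar>t - s\<bar> powr \<alpha>) + 2 * ennreal (8 * T * J * norm (x - y) powr (2 * \<alpha>))"
      by (intro add_mono mult_left_mono time' space t s) auto
    also have "\<dots> = ennreal (4 * (2 * T + 2 * T powr (1 - \<alpha>)) * J * \<bar>t - s\<bar> powr \<alpha> + 16 * T * J * norm (x - y) powr (2 * \<alpha>))"
      using T J(2) two'[of "2 * (2 * T + 2 * T powr (1 - \<alpha>)) * J * \<bar>t - s\<bar> powr \<alpha>"] two'[of "8 * T * J * norm (x - y) powr (2 * \<alpha>)"]
      by (subst ennreal_plus) (simp_all add: mult.assoc)
    also have "\<dots> \<le> ennreal ((sqrt D * (\<bar>t - s\<bar> powr (\<alpha> / 2) + norm (x - y) powr \<alpha>))\<^sup>2)"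
    proof (rule ennreal_leI)
      define a b where "a = \<bar>t - s\<bar> powr (\<alpha> / 2)" and "b = norm (x - y) powr \<alpha>"
      have ab: "0 \<le> a" "0 \<le> b" by (auto simp: a_def b_def)
      have a2: "\<bar>t - s\<bar> powr \<alpha> = a\<^sup>2" unfolding a_def by (simp add: power2_eq_square flip: powr_add)
      have b2: "norm (x - y) powr (2 * \<alpha>) = b\<^sup>2" unfolding b_def by (simp add: power2_eq_square flip: powr_add)
      have "4 * (2 * T + 2 * T powr (1 - \<alpha>)) * J * a\<^sup>2 + 16 * T * J * b\<^sup>2 \<le> D * a\<^sup>2 + D * b\<^sup>2"
        using T J by (intro add_mono mult_right_mono) (auto simp: D_def)
      also have "\<dots> \<le> D * (a + b)\<^sup>2" using D1 ab by (simp add: power2_sum algebra_simps)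
      also have "\<dots> = (sqrt D * (a + b))\<^sup>2" using D1 by (simp add: power_mult_distrib)
      finally show "4 * (2 * T + 2 * T powr (1 - \<alpha>)) * J * \<bar>t - s\<bar> powr \<alpha> + 16 * T * J * norm (x - y) powr (2 * \<alpha>) \<le> (sqrt D * (\<bar>t - s\<bar> powr (\<alpha> / 2) + norm (x - y) powr \<alpha>))\<^sup>2"
        unfolding a2 b2 a_def[symmetric] b_def[symmetric] .
    qed
    finally show ?thesis .
  qed
  then show ?thesis using D1 by (intro exI[of _ "sqrt D"]) auto
qed

end

text \<open>The inequality x y \<le> x^2 / w + w y^2 separates the increment D from the exponentials
  a and b. If the moment of D of order 2n+2 is of order w^(2n+2), the first term has mean of order
  w, one power only. The 4^(n+1) comes from a + b \<le> 2 max a b.\<close>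

lemma product_power_bound:
  fixes D a b w :: real
  assumes w: "0 < w" and ab: "0 \<le> a" "0 \<le> b"
  shows "(\<bar>D\<bar> * (a + b)) ^ Suc n / w ^ n \<le> D ^ (2 * Suc n) / w ^ (2 * n + 1) + w * 4 ^ Suc n * (a ^ (2 * Suc n) + b ^ (2 * Suc n))"
proof -
  define x y where "x = \<bar>D\<bar> ^ Suc n / w ^ n" and "y = (a + b) ^ Suc n"
  have xy0: "0 \<le> x" "0 \<le> y" using w ab by (auto simp: x_def y_def)
  have "0 \<le> (x - w * y)\<^sup>2" by simp
  then have "2 * (w * (x * y)) \<le> x\<^sup>2 + w\<^sup>2 * y\<^sup>2" by (simp add: power2_diff power_mult_distrib mult_ac)
  moreover have "0 \<le> w * (x * y)" using w xy0 by simp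
  ultimately have "w * (x * y) \<le> x\<^sup>2 + w\<^sup>2 * y\<^sup>2" by linarith
  then have xy: "x * y \<le> x\<^sup>2 / w + w * y\<^sup>2" using w by (simp add: field_simps power2_eq_square)
  have "(\<bar>D\<bar> * (a + b)) ^ Suc n / w ^ n = x * y" unfolding x_def y_def power_mult_distrib by simp
  also note xy
  also have "x\<^sup>2 / w = D ^ (2 * Suc n) / w ^ (2 * n + 1)"
  proof -
    have "(\<bar>D\<bar> ^ Suc n)\<^sup>2 = D ^ (2 * Suc n)" by (metis power_even_abs power_mult mult.commute even_mult_iff even_numeral)
    moreover have "(w ^ n)\<^sup>2 * w = w ^ (2 * n + 1)" by (simp flip: power_mult add: mult.commute)
    ultimately show ?thesis unfolding x_def power_divide by (metis divide_divide_eq_left)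
  qed
  also have "y\<^sup>2 \<le> 4 ^ Suc n * (a ^ (2 * Suc n) + b ^ (2 * Suc n))"
  proof -
    have "y\<^sup>2 = (a + b) ^ (2 * Suc n)" unfolding y_def by (metis power_mult mult.commute)
    also have "\<dots> \<le> (2 * max a b) ^ (2 * Suc n)" using ab by (intro power_mono) auto
    also have "\<dots> = 4 ^ Suc n * max a b ^ (2 * Suc n)"
      unfolding power_mult_distrib by (simp add: power_mult)
    also have "\<dots> \<le> 4 ^ Suc n * (a ^ (2 * Suc n) + b ^ (2 * Suc n))" using ab by (intro mult_left_mono) (auto simp: max_def)
    finally show ?thesis .
  qed
  finally show ?thesis using w by (simp add: mult.assoc)
qed

lemma ennreal_abs_diff_le:
  fixes a b :: real
  assumes "0 \<le> a" "0 \<le> b" "ennreal a \<le> ennreal b + I" "ennreal b \<le> ennreal a + I"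
  shows "ennreal \<bar>a - b\<bar> \<le> I"
proof (cases I)
  case (real i)
  then have "a \<le> b + i" "b \<le> a + i" using assms by (auto simp flip: ennreal_plus)
  then show ?thesis using real by (auto intro: ennreal_leI)
qed simp

section \<open>Moments of the increments of the functional\<close>

context feynman_kac begin

definition FK :: "real \<Rightarrow> 'd \<Rightarrow> 'w \<Rightarrow> ennreal" where
  "FK t x \<omega>W = (\<integral>\<^sup>+\<omega>B. ennreal (exp (V t x \<omega>W \<omega>B)) \<partial>PB)"

lemma V_pair: "0 \<le> t \<Longrightarrow> (\<lambda>(\<omega>W, \<omega>B). V t x \<omega>W \<omega>B) \<in> borel_measurable (PW \<Otimes>\<^sub>M PB)"
  using V_meas by (simp add: case_prod_beta')

lemma FK_measurable: "0 \<le> t \<Longrightarrow> FK t x \<in> borel_measurable PW"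
proof -
  assume "0 \<le> t"
  note [measurable] = V_pair[OF this]
  show ?thesis unfolding FK_def[abs_def] by measurable
qed

lemma FK_finite:
  assumes t: "0 \<le> t"
  shows "AE \<omega>W in PW. FK t x \<omega>W \<noteq> \<infinity>"
proof (rule nn_integral_noteq_infinite[OF FK_measurable[OF t]])
  note [measurable] = V_pair[OF t]
  obtain M where M: "(\<integral>\<^sup>+\<omega>B. ennreal (exp (1 * enn2real (var_V t x \<omega>B))) \<partial>PB) \<le> ennreal M"
    using var_V_exp_moment[of "t + 1" 1] t by fastforce
  have "(\<integral>\<^sup>+\<omega>W. FK t x \<omega>W \<partial>PW) = (\<integral>\<^sup>+\<omega>B. \<integral>\<^sup>+\<omega>W. ennreal (exp (V t x \<omega>W \<omega>B)) \<partial>PW \<partial>PB)"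
    unfolding FK_def by (rule WB.Fubini'[symmetric]) measurable
  also have "\<dots> \<le> (\<integral>\<^sup>+\<omega>B. ennreal (exp (1 * enn2real (var_V t x \<omega>B))) \<partial>PB)"
    using V_gaussian_bounds[OF t order_refl, of x]
  proof (intro nn_integral_mono_AE, eventually_elim)
    fix \<omega>B
    assume "var_V t x \<omega>B < \<infinity> \<and> (\<forall>a. (\<integral>\<^sup>+\<omega>W. ennreal (exp (a * V t x \<omega>W \<omega>B)) \<partial>PW) \<le> ennreal (exp (a\<^sup>2 * enn2real (var_V t x \<omega>B)))) \<and>
      (\<forall>h. continuous_on UNIV h \<longrightarrow> mono h \<longrightarrow> ennreal (h (enn2real (var_V t x \<omega>B))) \<le>
       liminf (\<lambda>n. ennreal (h (2 * (\<integral>p. mol_cov (1 / real (Suc n)) t x t x \<omega>B p \<partial>gamma_measure t)))))"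
    then have "\<forall>a. (\<integral>\<^sup>+\<omega>W. ennreal (exp (a * V t x \<omega>W \<omega>B)) \<partial>PW) \<le> ennreal (exp (a\<^sup>2 * enn2real (var_V t x \<omega>B)))" by blast
    from this[rule_format, of 1] show "(\<integral>\<^sup>+\<omega>W. ennreal (exp (V t x \<omega>W \<omega>B)) \<partial>PW) \<le> ennreal (exp (1 * enn2real (var_V t x \<omega>B)))" by simp
  qed
  also note M
  also have "ennreal M < \<infinity>" by simp
  finally show "(\<integral>\<^sup>+\<omega>W. FK t x \<omega>W \<partial>PW) \<noteq> \<infinity>" by simp
qed

definition exp_incr_bound :: "real \<Rightarrow> 'd \<Rightarrow> real \<Rightarrow> 'd \<Rightarrow> 'w \<Rightarrow> 'b \<Rightarrow> real" where
  "exp_incr_bound t x s y \<omega>W \<omega>B = \<bar>V t x \<omega>W \<omega>B - V s y \<omega>W \<omega>B\<bar> * (exp (V t x \<omega>W \<omega>B) + exp (V s y \<omega>W \<omega>B))"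

lemma exp_incr_bound_nonneg: "0 \<le> exp_incr_bound t x s y \<omega>W \<omega>B" by (simp add: exp_incr_bound_def)

lemma FK_le:
  assumes t: "0 \<le> t" and s: "0 \<le> s" and \<omega>: "\<omega>W \<in> space PW"
  shows "FK t x \<omega>W \<le> FK s y \<omega>W + (\<integral>\<^sup>+\<omega>B. ennreal (exp_incr_bound t x s y \<omega>W \<omega>B) \<partial>PB)"
proof -
  note [measurable] = V_section2[OF t \<omega>] V_section2[OF s \<omega>]
  have Ym[measurable]: "exp_incr_bound t x s y \<omega>W \<in> borel_measurable PB" unfolding exp_incr_bound_def[abs_def] by measurable
  have "FK t x \<omega>W \<le> (\<integral>\<^sup>+\<omega>B. ennreal (exp (V s y \<omega>W \<omega>B)) + ennreal (exp_incr_bound t x s y \<omega>W \<omega>B) \<partial>PB)"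
    unfolding FK_def
  proof (rule nn_integral_mono)
    fix \<omega>B
    have "exp (V t x \<omega>W \<omega>B) \<le> exp (V s y \<omega>W \<omega>B) + exp_incr_bound t x s y \<omega>W \<omega>B"
      using exp_diff_le[of "V t x \<omega>W \<omega>B" "V s y \<omega>W \<omega>B"] unfolding exp_incr_bound_def by linarith
    from ennreal_leI[OF this] show "ennreal (exp (V t x \<omega>W \<omega>B)) \<le> ennreal (exp (V s y \<omega>W \<omega>B)) + ennreal (exp_incr_bound t x s y \<omega>W \<omega>B)"
      by (simp add: exp_incr_bound_nonneg)
  qed
  also have "\<dots> = FK s y \<omega>W + (\<integral>\<^sup>+\<omega>B. ennreal (exp_incr_bound t x s y \<omega>W \<omega>B) \<partial>PB)"
    unfolding FK_def by (rule nn_integral_add) measurable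
  finally show ?thesis .
qed

lemma FK_diff_le:
  assumes t: "0 \<le> t" and s: "0 \<le> s"
  shows "AE \<omega>W in PW. ennreal \<bar>enn2real (FK t x \<omega>W) - enn2real (FK s y \<omega>W)\<bar> \<le> (\<integral>\<^sup>+\<omega>B. ennreal (exp_incr_bound t x s y \<omega>W \<omega>B) \<partial>PB)"
  using FK_finite[OF t, of x] FK_finite[OF s, of y] AE_space
proof eventually_elim
  fix \<omega>W assume f: "FK t x \<omega>W \<noteq> \<infinity>" "FK s y \<omega>W \<noteq> \<infinity>" and \<omega>: "\<omega>W \<in> space PW"
  have "exp_incr_bound s y t x \<omega>W \<omega>B = exp_incr_bound t x s y \<omega>W \<omega>B" for \<omega>B by (simp add: exp_incr_bound_def abs_minus_commute add.commute)
  then show "ennreal \<bar>enn2real (FK t x \<omega>W) - enn2real (FK s y \<omega>W)\<bar> \<le> (\<integral>\<^sup>+\<omega>B. ennreal (exp_incr_bound t x s y \<omega>W \<omega>B) \<partial>PB)"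
    using FK_le[OF t s \<omega>, of x y] FK_le[OF s t \<omega>, of y x] f by (intro ennreal_abs_diff_le) (auto simp: less_top)
qed

text \<open>With v for the value of the weight and m for the second moment, m^p \<le> v^(2p) leaves
  a single v in the Gaussian term, and the exponentials give v G. As v \<ge> \<delta>, the bounds v
  \<le> v^2/\<delta> and v G \<le> v^2/\<delta> + \<delta> G^2 together with v^2 \<le> 2 m + 2
  \<delta>^2 reach an expression linear in m, whose mean is available.\<close>

lemma conditional_moment_bound:
  fixes x y :: 'd
  assumes t: "0 \<le> t" and s: "0 \<le> s" and d: "0 < \<delta>"
  defines "w \<equiv> \<lambda>\<omega>B. sqrt (enn2real (var_incr t x s y \<omega>B)) + \<delta>"
  shows "AE \<omega>B in PB. (\<integral>\<^sup>+\<omega>W. ennreal (exp_incr_bound t x s y \<omega>W \<omega>B ^ Suc n / w \<omega>B ^ n) \<partial>PW)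
    \<le> ennreal ((gauss_moment (Suc n) * 2 ^ Suc n + 2 * 4 ^ Suc n) * (2 / \<delta>)) * var_incr t x s y \<omega>B
      + ennreal ((gauss_moment (Suc n) * 2 ^ Suc n + 2 * 4 ^ Suc n) * 2 * \<delta>)
      + ennreal (4 ^ Suc n * \<delta>) * (ennreal (exp (8 * (real (Suc n))\<^sup>2 * enn2real (var_V t x \<omega>B))) + ennreal (exp (8 * (real (Suc n))\<^sup>2 * enn2real (var_V s y \<omega>B))))"
proof -
  define p where "p = Suc n"
  define K where "K = gauss_moment p * 2 ^ p + 2 * 4 ^ p"
  have K: "0 \<le> K" using gauss_moment_pos[of p] by (simp add: K_def add_nonneg_nonneg)
  define T where "T = max t s"
  have T: "t \<le> T" "s \<le> T" by (auto simp: T_def)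
  show ?thesis
    using V_gaussian_bounds[OF t T(1), of x] V_gaussian_bounds[OF s T(2), of y] D_gaussian_bounds[OF t T(1) s T(2), of x y] AE_space
    unfolding p_def[symmetric] K_def[symmetric]
  proof eventually_elim
    case (elim \<omega>B)
    then have \<omega>: "\<omega>B \<in> space PB" by blast
    note [measurable] = V_section[OF t \<omega>] V_section[OF s \<omega>]
    define m where "m = enn2real (var_incr t x s y \<omega>B)"
    \<comment> \<open>The exponential moment of 2 p V has the exponent (2p)^2 = 4 p^2 times the
      second moment; squaring G1 and G2 below turns 4 into 8.\<close>
    define G1 G2 where "G1 = exp (4 * (real p)\<^sup>2 * enn2real (var_V t x \<omega>B))" and "G2 = exp (4 * (real p)\<^sup>2 * enn2real (var_V s y \<omega>B))"
    have m: "var_incr t x s y \<omega>B = ennreal m" "0 \<le> m" using elim by (auto simp: m_def less_top)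
    define v where "v = w \<omega>B"
    have v: "0 < v" "\<delta> \<le> v" "m \<le> v\<^sup>2" "v\<^sup>2 \<le> 2 * m + 2 * \<delta>\<^sup>2"
    proof -
      have v_eq: "v = sqrt m + \<delta>" by (simp add: v_def w_def m_def)
      show "0 < v" "\<delta> \<le> v" using d m by (auto simp: v_eq add_nonneg_pos)
      have "(sqrt m)\<^sup>2 \<le> v\<^sup>2" using d m by (intro power_mono) (auto simp: v_eq)
      then show "m \<le> v\<^sup>2" using m by simp
      have "0 \<le> (sqrt m - \<delta>)\<^sup>2" by simp
      then show "v\<^sup>2 \<le> 2 * m + 2 * \<delta>\<^sup>2" using m unfolding v_eq power2_sum power2_diff by simp
    qed
    have E: "(\<integral>\<^sup>+\<omega>W. ennreal (exp (V t x \<omega>W \<omega>B) ^ (2 * p)) \<partial>PW) \<le> ennreal G1"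
      "(\<integral>\<^sup>+\<omega>W. ennreal (exp (V s y \<omega>W \<omega>B) ^ (2 * p)) \<partial>PW) \<le> ennreal G2"
    proof -
      have "(\<integral>\<^sup>+\<omega>W. ennreal (exp (real (2 * p) * V t x \<omega>W \<omega>B)) \<partial>PW) \<le> ennreal (exp ((real (2 * p))\<^sup>2 * enn2real (var_V t x \<omega>B)))"
        using elim by blast
      moreover have "(\<integral>\<^sup>+\<omega>W. ennreal (exp (real (2 * p) * V s y \<omega>W \<omega>B)) \<partial>PW) \<le> ennreal (exp ((real (2 * p))\<^sup>2 * enn2real (var_V s y \<omega>B)))"
        using elim by blast
      ultimately show "(\<integral>\<^sup>+\<omega>W. ennreal (exp (V t x \<omega>W \<omega>B) ^ (2 * p)) \<partial>PW) \<le> ennreal G1"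
      "(\<integral>\<^sup>+\<omega>W. ennreal (exp (V s y \<omega>W \<omega>B) ^ (2 * p)) \<partial>PW) \<le> ennreal G2"
        unfolding G1_def G2_def exp_of_nat_mult[symmetric] by (simp_all add: power_mult_distrib)
    qed
    have "(\<integral>\<^sup>+\<omega>W. ennreal (exp_incr_bound t x s y \<omega>W \<omega>B ^ p / v ^ n) \<partial>PW)
      \<le> (\<integral>\<^sup>+\<omega>W. ennreal (1 / v ^ (2 * n + 1)) * ennreal ((V t x \<omega>W \<omega>B - V s y \<omega>W \<omega>B) ^ (2 * p))
        + ennreal (v * 4 ^ p) * (ennreal (exp (V t x \<omega>W \<omega>B) ^ (2 * p)) + ennreal (exp (V s y \<omega>W \<omega>B) ^ (2 * p))) \<partial>PW)"
    proof (rule nn_integral_mono)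
      fix \<omega>W
      have "ennreal (exp_incr_bound t x s y \<omega>W \<omega>B ^ p / v ^ n) \<le> ennreal ((V t x \<omega>W \<omega>B - V s y \<omega>W \<omega>B) ^ (2 * p) / v ^ (2 * n + 1) + v * 4 ^ p * (exp (V t x \<omega>W \<omega>B) ^ (2 * p) + exp (V s y \<omega>W \<omega>B) ^ (2 * p)))"
        unfolding exp_incr_bound_def p_def by (intro ennreal_leI product_power_bound v) auto
      also have "\<dots> = ennreal (1 / v ^ (2 * n + 1) * (V t x \<omega>W \<omega>B - V s y \<omega>W \<omega>B) ^ (2 * p)) + ennreal (v * 4 ^ p * (exp (V t x \<omega>W \<omega>B) ^ (2 * p) + exp (V s y \<omega>W \<omega>B) ^ (2 * p)))"
        using v by (subst ennreal_plus) (auto intro!: divide_nonneg_nonneg zero_le_even_power)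
      also have "\<dots> = ennreal (1 / v ^ (2 * n + 1)) * ennreal ((V t x \<omega>W \<omega>B - V s y \<omega>W \<omega>B) ^ (2 * p))
        + ennreal (v * 4 ^ p) * (ennreal (exp (V t x \<omega>W \<omega>B) ^ (2 * p)) + ennreal (exp (V s y \<omega>W \<omega>B) ^ (2 * p)))"
        using v by (subst ennreal_mult, simp, simp add: zero_le_even_power, subst ennreal_mult, simp, simp, subst ennreal_plus[of "exp _ ^ _"]) simp_all
      finally show "ennreal (exp_incr_bound t x s y \<omega>W \<omega>B ^ p / v ^ n) \<le> ennreal (1 / v ^ (2 * n + 1)) * ennreal ((V t x \<omega>W \<omega>B - V s y \<omega>W \<omega>B) ^ (2 * p))
        + ennreal (v * 4 ^ p) * (ennreal (exp (V t x \<omega>W \<omega>B) ^ (2 * p)) + ennreal (exp (V s y \<omega>W \<omega>B) ^ (2 * p)))" .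
    qed
    also have "\<dots> = ennreal (1 / v ^ (2 * n + 1)) * (\<integral>\<^sup>+\<omega>W. ennreal ((V t x \<omega>W \<omega>B - V s y \<omega>W \<omega>B) ^ (2 * p)) \<partial>PW)
        + ennreal (v * 4 ^ p) * ((\<integral>\<^sup>+\<omega>W. ennreal (exp (V t x \<omega>W \<omega>B) ^ (2 * p)) \<partial>PW) + (\<integral>\<^sup>+\<omega>W. ennreal (exp (V s y \<omega>W \<omega>B) ^ (2 * p)) \<partial>PW))"
      by (simp add: nn_integral_add nn_integral_cmult)
    also have "\<dots> \<le> ennreal (1 / v ^ (2 * n + 1)) * ennreal (gauss_moment p * (2 * m) ^ p) + ennreal (v * 4 ^ p) * (ennreal G1 + ennreal G2)"
      using elim unfolding m_def by (intro add_mono mult_left_mono E) auto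
    also have "\<dots> = ennreal (gauss_moment p * (2 * m) ^ p / v ^ (2 * n + 1) + v * 4 ^ p * (G1 + G2))"
      using v m gauss_moment_pos[of p] by (simp add: ennreal_mult[symmetric] G1_def G2_def less_imp_le flip: ennreal_plus)
    also have "\<dots> \<le> ennreal ((K * (2 / \<delta>)) * m + K * 2 * \<delta> + 4 ^ p * \<delta> * (G1\<^sup>2 + G2\<^sup>2))"
    proof (rule ennreal_leI)
      have "(2 * m) ^ p \<le> (2 * v\<^sup>2) ^ p" using m v by (intro power_mono) auto
      also have "\<dots> = 2 ^ p * (v * v ^ (2 * n + 1))" unfolding power_mult_distrib p_def by (simp flip: power_mult) (simp add: power2_eq_square)
      finally have "gauss_moment p * (2 * m) ^ p \<le> gauss_moment p * (2 ^ p * (v * v ^ (2 * n + 1)))"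
        using gauss_moment_pos[of p] by (intro mult_left_mono) auto
      then have 1: "gauss_moment p * (2 * m) ^ p / v ^ (2 * n + 1) \<le> gauss_moment p * 2 ^ p * v"
        using v by (simp add: divide_le_eq mult_ac)
      have vle: "v \<le> v\<^sup>2 / \<delta>" using v d by (simp add: field_simps power2_eq_square)
      have vG: "v * G \<le> v\<^sup>2 / \<delta> + \<delta> * G\<^sup>2" for G
      proof -
        have "0 \<le> (v - \<delta> * G)\<^sup>2" by simp
        then have "2 * (\<delta> * (v * G)) \<le> v\<^sup>2 + \<delta>\<^sup>2 * G\<^sup>2" by (simp add: power2_diff power_mult_distrib mult_ac)
        moreover have "0 \<le> v\<^sup>2 + \<delta>\<^sup>2 * G\<^sup>2" by simp
        ultimately have "\<delta> * (v * G) \<le> v\<^sup>2 + \<delta>\<^sup>2 * G\<^sup>2" by linarith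
        then show ?thesis using d by (simp add: field_simps power2_eq_square)
      qed
      have 2: "gauss_moment p * 2 ^ p * v \<le> gauss_moment p * 2 ^ p * (v\<^sup>2 / \<delta>)" using vle gauss_moment_pos[of p] by (intro mult_left_mono) auto
      have "4 ^ p * (v * G1 + v * G2) \<le> 4 ^ p * ((v\<^sup>2 / \<delta> + \<delta> * G1\<^sup>2) + (v\<^sup>2 / \<delta> + \<delta> * G2\<^sup>2))" by (intro mult_left_mono add_mono vG) auto
      then have 3: "v * 4 ^ p * (G1 + G2) \<le> 2 * 4 ^ p * (v\<^sup>2 / \<delta>) + 4 ^ p * \<delta> * (G1\<^sup>2 + G2\<^sup>2)" by (simp add: algebra_simps)
      have "K * (v\<^sup>2 / \<delta>) \<le> K * ((2 * m + 2 * \<delta>\<^sup>2) / \<delta>)" using v K d by (intro mult_left_mono divide_right_mono) auto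
      also have "\<dots> = (K * (2 / \<delta>)) * m + K * 2 * \<delta>" using d by (simp add: field_simps power2_eq_square)
      finally have 4: "gauss_moment p * 2 ^ p * (v\<^sup>2 / \<delta>) + 2 * 4 ^ p * (v\<^sup>2 / \<delta>) \<le> (K * (2 / \<delta>)) * m + K * 2 * \<delta>"
        unfolding K_def distrib_right .
      show "gauss_moment p * (2 * m) ^ p / v ^ (2 * n + 1) + v * 4 ^ p * (G1 + G2) \<le> (K * (2 / \<delta>)) * m + K * 2 * \<delta> + 4 ^ p * \<delta> * (G1\<^sup>2 + G2\<^sup>2)"
        using 1 2 3 4 by linarith
    qed
    also have "\<dots> = ennreal (K * (2 / \<delta>)) * var_incr t x s y \<omega>B + ennreal (K * 2 * \<delta>) + ennreal (4 ^ p * \<delta>) * (ennreal (G1\<^sup>2) + ennreal (G2\<^sup>2))"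
      using K d m by (simp add: ennreal_mult[symmetric] flip: ennreal_plus)
    also have "G1\<^sup>2 = exp (8 * (real p)\<^sup>2 * enn2real (var_V t x \<omega>B))" unfolding G1_def by (simp flip: exp_double)
    also have "G2\<^sup>2 = exp (8 * (real p)\<^sup>2 * enn2real (var_V s y \<omega>B))" unfolding G2_def by (simp flip: exp_double)
    finally show ?case unfolding v_def .
  qed
qed

text \<open>The weight has mass at most 3 \<delta> and the weighted integral has mean at most L
  \<delta>. The weighted Jensen inequality multiplies them to (3 \<delta>)^(p-1) L \<delta>, so the
  full power \<delta>^p appears for every p.\<close>

lemma FK_moment_bound:
  assumes p: "0 < p"
  shows "\<exists>C\<ge>0. \<forall>s t x y. 0 \<le> s \<longrightarrow> s \<le> real N \<longrightarrow> 0 \<le> t \<longrightarrow> t \<le> real N \<longrightarrow>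
       (\<integral>\<^sup>+\<omega>W. ennreal (\<bar>enn2real (FK t x \<omega>W) - enn2real (FK s y \<omega>W)\<bar> ^ p) \<partial>PW) \<le> ennreal (C * (\<bar>t - s\<bar> powr (\<alpha> / 2) + norm (x - y) powr \<alpha>) ^ p)"
proof -
  obtain n where n: "p = Suc n" using p by (cases p) auto
  \<comment> \<open>One more than N, so that T is positive even for N = 0.\<close>
  define T where "T = real N + 1"
  have T: "0 < T" by (simp add: T_def)
  obtain C0 where C0: "0 < C0" and var_incr: "\<And>t s x y. 0 \<le> t \<Longrightarrow> t \<le> T \<Longrightarrow> 0 \<le> s \<Longrightarrow> s \<le> T \<Longrightarrow>
     (\<integral>\<^sup>+\<omega>B. var_incr t x s y \<omega>B \<partial>PB) \<le> ennreal ((C0 * (\<bar>t - s\<bar> powr (\<alpha> / 2) + norm (x - y) powr \<alpha>))\<^sup>2)"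
    using increment_variance[OF T] by auto
  obtain M where M0: "0 \<le> M" and M: "\<And>t x. 0 \<le> t \<Longrightarrow> t \<le> T \<Longrightarrow> (\<integral>\<^sup>+\<omega>B. ennreal (exp (8 * (real (Suc n))\<^sup>2 * enn2real (var_V t x \<omega>B))) \<partial>PB) \<le> ennreal M"
    using var_V_exp_moment[OF T, of "8 * (real (Suc n))\<^sup>2"] by auto
  define K where "K = gauss_moment (Suc n) * 2 ^ Suc n + 2 * 4 ^ Suc n"
  have K: "0 \<le> K" using gauss_moment_pos[of "Suc n"] by (simp add: K_def add_nonneg_nonneg)
  \<comment> \<open>Collects the three terms of \<open>conditional_moment_bound\<close> after
    integration over the paths.\<close>
  define L where "L = 4 * K + 2 * 4 ^ Suc n * M"
  have L: "0 \<le> L" using K M0 by (simp add: L_def)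
  have main: "(\<integral>\<^sup>+\<omega>W. ennreal (\<bar>enn2real (FK t x \<omega>W) - enn2real (FK s y \<omega>W)\<bar> ^ p) \<partial>PW) \<le> ennreal (3 ^ n * L * C0 ^ p * (\<bar>t - s\<bar> powr (\<alpha> / 2) + norm (x - y) powr \<alpha>) ^ p)"
    if s: "0 \<le> s" "s \<le> real N" and t: "0 \<le> t" "t \<le> real N" for s t x y
  proof (cases "t = s \<and> x = y")
    case True
    then show ?thesis using n by simp
  next
    case False
    \<comment> \<open>Positive because the two points differ; the weight and the bounds divide by
      it.\<close>
    define \<delta> where "\<delta> = C0 * (\<bar>t - s\<bar> powr (\<alpha> / 2) + norm (x - y) powr \<alpha>)"
    have "0 < \<bar>t - s\<bar> powr (\<alpha> / 2) + norm (x - y) powr \<alpha>"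
      using False by (cases "t = s") (auto intro: add_nonneg_pos add_pos_nonneg)
    then have d: "0 < \<delta>" using C0 by (simp add: \<delta>_def)
    have tT: "t \<le> T" "s \<le> T" using t s by (auto simp: T_def)
    note mDd = var_incr[OF t(1) tT(1) s(1) tT(2), of x y, folded \<delta>_def]
    note [measurable] = V_pair[OF t(1)] V_pair[OF s(1)] var_incr_measurable[OF t(1) s(1)] var_V_measurable[OF t(1)] var_V_measurable[OF s(1)] FK_measurable[OF t(1)] FK_measurable[OF s(1)]
    define w where "w \<omega>B = sqrt (enn2real (var_incr t x s y \<omega>B)) + \<delta>" for \<omega>B
    have wm[measurable]: "w \<in> borel_measurable PB" unfolding w_def[abs_def] by measurable
    have w0: "0 < w \<omega>B" for \<omega>B using d by (simp add: w_def add_nonneg_pos)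
    have Ym[measurable]: "(\<lambda>(\<omega>W, \<omega>B). exp_incr_bound t x s y \<omega>W \<omega>B) \<in> borel_measurable (PW \<Otimes>\<^sub>M PB)"
      unfolding exp_incr_bound_def by measurable
    \<comment> \<open>From sqrt m \<le> m/\<delta> + \<delta> the weight is at most m/\<delta> + 2
      \<delta>, and the mean of m is at most \<delta>^2.\<close>
    have wint: "(\<integral>\<^sup>+\<omega>B. ennreal (w \<omega>B) \<partial>PB) \<le> ennreal (3 * \<delta>)"
    proof -
      have "(\<integral>\<^sup>+\<omega>B. ennreal (w \<omega>B) \<partial>PB) \<le> (\<integral>\<^sup>+\<omega>B. ennreal (1 / \<delta>) * var_incr t x s y \<omega>B + ennreal (2 * \<delta>) \<partial>PB)"
      proof (rule nn_integral_mono)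
        fix \<omega>B
        show "ennreal (w \<omega>B) \<le> ennreal (1 / \<delta>) * var_incr t x s y \<omega>B + ennreal (2 * \<delta>)"
        proof (cases "var_incr t x s y \<omega>B")
          case (real m)
          have "0 \<le> (sqrt m - \<delta>)\<^sup>2" by simp
          then have "2 * (\<delta> * sqrt m) \<le> m + \<delta>\<^sup>2" using real by (simp add: power2_diff mult_ac)
          moreover have "0 \<le> \<delta> * sqrt m" using d real by simp
          ultimately have "\<delta> * sqrt m \<le> m + \<delta>\<^sup>2" by linarith
          then have "w \<omega>B \<le> 1 / \<delta> * m + 2 * \<delta>" using d real by (simp add: w_def field_simps power2_eq_square)
          from ennreal_leI[OF this] show ?thesis using real d by (simp add: ennreal_mult flip: ennreal_mult)
        next
          case top
          then show ?thesis using d by (simp add: ennreal_mult_top)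
        qed
      qed
      also have "\<dots> = ennreal (1 / \<delta>) * (\<integral>\<^sup>+\<omega>B. var_incr t x s y \<omega>B \<partial>PB) + ennreal (2 * \<delta>)"
        using d by (simp add: nn_integral_add nn_integral_cmult emeasure_space_1)
      also have "\<dots> \<le> ennreal (1 / \<delta>) * ennreal (\<delta>\<^sup>2) + ennreal (2 * \<delta>)" by (intro add_mono mult_left_mono mDd) auto
      also have "\<dots> = ennreal (1 / \<delta> * \<delta>\<^sup>2 + 2 * \<delta>)" using d by (simp add: ennreal_mult[symmetric] flip: ennreal_plus)
      also have "1 / \<delta> * \<delta>\<^sup>2 + 2 * \<delta> = 3 * \<delta>" using d by (simp add: power2_eq_square)
      finally show ?thesis .
    qed
    have "(\<integral>\<^sup>+\<omega>W. ennreal (\<bar>enn2real (FK t x \<omega>W) - enn2real (FK s y \<omega>W)\<bar> ^ p) \<partial>PW)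
      \<le> (\<integral>\<^sup>+\<omega>W. ennreal ((3 * \<delta>) ^ n) * (\<integral>\<^sup>+\<omega>B. ennreal (exp_incr_bound t x s y \<omega>W \<omega>B ^ Suc n / w \<omega>B ^ n) \<partial>PB) \<partial>PW)"
      using FK_diff_le[OF t(1) s(1), of x y] AE_space
    proof (intro nn_integral_mono_AE, eventually_elim)
      fix \<omega>W
      assume le: "ennreal \<bar>enn2real (FK t x \<omega>W) - enn2real (FK s y \<omega>W)\<bar> \<le> (\<integral>\<^sup>+\<omega>B. ennreal (exp_incr_bound t x s y \<omega>W \<omega>B) \<partial>PB)"
        and \<omega>: "\<omega>W \<in> space PW"
      note [measurable] = V_section2[OF t(1) \<omega>] V_section2[OF s(1) \<omega>]
      have Ym': "exp_incr_bound t x s y \<omega>W \<in> borel_measurable PB" unfolding exp_incr_bound_def[abs_def] by measurable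
      have "ennreal (\<bar>enn2real (FK t x \<omega>W) - enn2real (FK s y \<omega>W)\<bar> ^ p) = ennreal \<bar>enn2real (FK t x \<omega>W) - enn2real (FK s y \<omega>W)\<bar> ^ p"
        by (simp add: ennreal_power)
      also have "\<dots> \<le> (\<integral>\<^sup>+\<omega>B. ennreal (exp_incr_bound t x s y \<omega>W \<omega>B) \<partial>PB) ^ p" by (intro power_mono le) auto
      also have "\<dots> \<le> ennreal ((3 * \<delta>) ^ (p - 1)) * (\<integral>\<^sup>+\<omega>B. ennreal (exp_incr_bound t x s y \<omega>W \<omega>B ^ p / w \<omega>B ^ (p - 1)) \<partial>PB)"
        using d by (intro nn_integral_power_weighted Ym' wm exp_incr_bound_nonneg w0 p wint) simp
      finally show "ennreal (\<bar>enn2real (FK t x \<omega>W) - enn2real (FK s y \<omega>W)\<bar> ^ p) \<le> ennreal ((3 * \<delta>) ^ n) * (\<integral>\<^sup>+\<omega>B. ennreal (exp_incr_bound t x s y \<omega>W \<omega>B ^ Suc n / w \<omega>B ^ n) \<partial>PB)"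
        by (simp add: n)
    qed
    also have "\<dots> = ennreal ((3 * \<delta>) ^ n) * (\<integral>\<^sup>+\<omega>W. (\<integral>\<^sup>+\<omega>B. ennreal (exp_incr_bound t x s y \<omega>W \<omega>B ^ Suc n / w \<omega>B ^ n) \<partial>PB) \<partial>PW)"
      by (rule nn_integral_cmult) measurable
    also have "(\<integral>\<^sup>+\<omega>W. (\<integral>\<^sup>+\<omega>B. ennreal (exp_incr_bound t x s y \<omega>W \<omega>B ^ Suc n / w \<omega>B ^ n) \<partial>PB) \<partial>PW) = (\<integral>\<^sup>+\<omega>B. (\<integral>\<^sup>+\<omega>W. ennreal (exp_incr_bound t x s y \<omega>W \<omega>B ^ Suc n / w \<omega>B ^ n) \<partial>PW) \<partial>PB)"
      by (rule WB.Fubini'[symmetric]) measurable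
    also have "\<dots> \<le> (\<integral>\<^sup>+\<omega>B. ennreal (K * (2 / \<delta>)) * var_incr t x s y \<omega>B + ennreal (K * 2 * \<delta>)
      + ennreal (4 ^ Suc n * \<delta>) * (ennreal (exp (8 * (real (Suc n))\<^sup>2 * enn2real (var_V t x \<omega>B))) + ennreal (exp (8 * (real (Suc n))\<^sup>2 * enn2real (var_V s y \<omega>B)))) \<partial>PB)"
      unfolding w_def K_def by (intro nn_integral_mono_AE conditional_moment_bound t s d)
    also have "\<dots> = ennreal (K * (2 / \<delta>)) * (\<integral>\<^sup>+\<omega>B. var_incr t x s y \<omega>B \<partial>PB) + ennreal (K * 2 * \<delta>)
      + ennreal (4 ^ Suc n * \<delta>) * ((\<integral>\<^sup>+\<omega>B. ennreal (exp (8 * (real (Suc n))\<^sup>2 * enn2real (var_V t x \<omega>B))) \<partial>PB) + (\<integral>\<^sup>+\<omega>B. ennreal (exp (8 * (real (Suc n))\<^sup>2 * enn2real (var_V s y \<omega>B))) \<partial>PB))"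
      by (simp add: nn_integral_add nn_integral_cmult emeasure_space_1 del: of_nat_Suc power_Suc)
    also have "\<dots> \<le> ennreal (K * (2 / \<delta>)) * ennreal (\<delta>\<^sup>2) + ennreal (K * 2 * \<delta>) + ennreal (4 ^ Suc n * \<delta>) * (ennreal M + ennreal M)"
      by (intro add_mono mult_left_mono mDd M t s tT) auto
    also have "\<dots> = ennreal (K * (2 / \<delta>) * \<delta>\<^sup>2 + K * 2 * \<delta> + 4 ^ Suc n * \<delta> * (M + M))"
      using K d M0 by (simp add: ennreal_mult[symmetric] del: power_Suc flip: ennreal_plus)
    also have "K * (2 / \<delta>) * \<delta>\<^sup>2 + K * 2 * \<delta> + 4 ^ Suc n * \<delta> * (M + M) = L * \<delta>"
      using d unfolding L_def by (simp add: power2_eq_square algebra_simps)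
    finally have "(\<integral>\<^sup>+\<omega>W. ennreal (\<bar>enn2real (FK t x \<omega>W) - enn2real (FK s y \<omega>W)\<bar> ^ p) \<partial>PW) \<le> ennreal ((3 * \<delta>) ^ n) * ennreal (L * \<delta>)"
      by (simp add: mult_left_mono)
    also have "\<dots> = ennreal ((3 * \<delta>) ^ n * (L * \<delta>))" using d L by (simp add: ennreal_mult)
    also have "(3 * \<delta>) ^ n * (L * \<delta>) = 3 ^ n * L * C0 ^ p * (\<bar>t - s\<bar> powr (\<alpha> / 2) + norm (x - y) powr \<alpha>) ^ p"
      unfolding n \<delta>_def power_mult_distrib power_Suc by (simp only: mult_ac)
    finally show ?thesis .
  qed
  show ?thesis using main L C0 by (intro exI[of _ "3 ^ n * L * C0 ^ p"]) auto
qed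

lemma FK_hoelder_version:
  "\<exists>U :: real \<Rightarrow> 'd \<Rightarrow> 'w \<Rightarrow> real.
     (\<forall>t x. 0 \<le> t \<longrightarrow> (AE \<omega>W in PW. ennreal (U t x \<omega>W) = FK t x \<omega>W)) \<and>
     (AE \<omega>W in PW. \<forall>T M \<gamma>\<^sub>1 \<gamma>\<^sub>2. 0 < \<gamma>\<^sub>1 \<longrightarrow> \<gamma>\<^sub>1 < \<alpha> / 2 \<longrightarrow> 0 < \<gamma>\<^sub>2 \<longrightarrow> \<gamma>\<^sub>2 < \<alpha> \<longrightarrow>
        (\<exists>C. \<forall>s t x y. s \<in> {0..T} \<longrightarrow> t \<in> {0..T} \<longrightarrow>
           (\<forall>i\<in>Basis. \<bar>x \<bullet> i\<bar> \<le> M) \<longrightarrow> (\<forall>i\<in>Basis. \<bar>y \<bullet> i\<bar> \<le> M) \<longrightarrow>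
           \<bar>U t x \<omega>W - U s y \<omega>W\<bar> \<le> C * (\<bar>t - s\<bar> powr \<gamma>\<^sub>1 + norm (x - y) powr \<gamma>\<^sub>2)))"
proof -
  have m: "(\<lambda>\<omega>W. enn2real (FK t x \<omega>W)) \<in> borel_measurable PW" if "0 \<le> t" for t x
    using FK_measurable[OF that] by measurable
  from kolmogorov_continuity[where u="\<lambda>t x \<omega>W. enn2real (FK t x \<omega>W)" and P=PW and \<alpha>=\<alpha>, OF m alpha(1) FK_moment_bound]
  obtain U where U: "\<And>t x. 0 \<le> t \<Longrightarrow> (AE \<omega>W in PW. U t x \<omega>W = enn2real (FK t x \<omega>W))"
    and H: "AE \<omega>W in PW. \<forall>T M \<gamma>\<^sub>1 \<gamma>\<^sub>2. 0 < \<gamma>\<^sub>1 \<longrightarrow> \<gamma>\<^sub>1 < \<alpha> / 2 \<longrightarrow> 0 < \<gamma>\<^sub>2 \<longrightarrow> \<gamma>\<^sub>2 < \<alpha> \<longrightarrow>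
        (\<exists>C. \<forall>s t x y. s \<in> {0..T} \<longrightarrow> t \<in> {0..T} \<longrightarrow>
           (\<forall>i\<in>Basis. \<bar>x \<bullet> i\<bar> \<le> M) \<longrightarrow> (\<forall>i\<in>Basis. \<bar>y \<bullet> i\<bar> \<le> M) \<longrightarrow>
           \<bar>U t x \<omega>W - U s y \<omega>W\<bar> \<le> C * (\<bar>t - s\<bar> powr \<gamma>\<^sub>1 + norm (x - y) powr \<gamma>\<^sub>2))"
    by blast
  have "AE \<omega>W in PW. ennreal (U t x \<omega>W) = FK t x \<omega>W" if t: "0 \<le> t" for t x
    using U[OF t, of x] FK_finite[OF t, of x] by eventually_elim (simp add: less_top)
  with H show ?thesis by blast
qed

end

theorem mainTheorem9:
  fixes \<gamma> :: "real \<Rightarrow> real"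
    and \<Lambda> :: "'d::euclidean_space \<Rightarrow> real"
    and \<mu> :: "'d measure"
    and PW :: "'w measure" and W :: "(real \<times> 'd \<Rightarrow> real) \<Rightarrow> 'w \<Rightarrow> real"
    and PB :: "'b measure" and B :: "real \<Rightarrow> 'b \<Rightarrow> 'd"
    and V :: "real \<Rightarrow> 'd \<Rightarrow> 'w \<Rightarrow> 'b \<Rightarrow> real"
    and \<beta> C\<^sub>\<beta> \<alpha> :: real
  assumes gamma_meas: "\<gamma> \<in> borel_measurable borel"
    and gamma_nonneg_def: "nonneg_definite \<gamma>"
    and Lambda_meas: "\<Lambda> \<in> borel_measurable borel"
    and Lambda_nonneg: "\<forall>x. 0 \<le> \<Lambda> x"
    and Lambda_nonneg_def: "nonneg_definite \<Lambda>"
    and mu_tempered: "tempered_measure \<mu>"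
    and mu_FLambda: "is_fourier_transform \<mu> \<Lambda>"
    and noise: "gaussian_noise PW \<gamma> \<Lambda> W"
    and BM: "std_brownian_motion PB B"
    and beta: "0 < \<beta>" "\<beta> < 1" and Cbeta: "0 < C\<^sub>\<beta>"
    and gamma_bound: "\<forall>t. 0 \<le> \<gamma> t \<and> (t \<noteq> 0 \<longrightarrow> \<gamma> t \<le> C\<^sub>\<beta> * \<bar>t\<bar> powr (- \<beta>))"
    and alpha: "0 < \<alpha>" "\<alpha> < 1 - \<beta>"
    and mu_integral: "(\<integral>\<^sup>+\<xi>. ennreal (1 / (1 + norm \<xi> powr (2 * (1 - \<beta> - \<alpha>)))) \<partial>\<mu>) < \<infinity>"
    and V_meas: "\<forall>t x. 0 \<le> t \<longrightarrow> (\<lambda>z. V t x (fst z) (snd z)) \<in> borel_measurable (PW \<Otimes>\<^sub>M PB)"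
    and V_limit: "\<forall>t x. 0 \<le> t \<longrightarrow> (AE \<omega>B in PB.
        ((\<lambda>\<epsilon>. \<integral>\<^sup>+\<omega>W. ennreal ((W (mollified_integrand B t x \<omega>B \<epsilon>) \<omega>W - V t x \<omega>W \<omega>B)\<^sup>2) \<partial>PW)
           \<longlongrightarrow> 0) (at_right 0))"
  shows "\<exists>U :: real \<Rightarrow> 'd \<Rightarrow> 'w \<Rightarrow> real.
     (\<forall>t x. 0 \<le> t \<longrightarrow>
        (AE \<omega>W in PW. ennreal (U t x \<omega>W) = (\<integral>\<^sup>+\<omega>B. ennreal (exp (V t x \<omega>W \<omega>B)) \<partial>PB))) \<and>
     (AE \<omega>W in PW. \<forall>T M \<gamma>\<^sub>1 \<gamma>\<^sub>2. 0 < \<gamma>\<^sub>1 \<longrightarrow> \<gamma>\<^sub>1 < \<alpha> / 2 \<longrightarrow> 0 < \<gamma>\<^sub>2 \<longrightarrow> \<gamma>\<^sub>2 < \<alpha> \<longrightarrow>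
        (\<exists>C. \<forall>s t x y. s \<in> {0..T} \<longrightarrow> t \<in> {0..T} \<longrightarrow>
           (\<forall>i\<in>Basis. \<bar>x \<bullet> i\<bar> \<le> M) \<longrightarrow> (\<forall>i\<in>Basis. \<bar>y \<bullet> i\<bar> \<le> M) \<longrightarrow>
           \<bar>U t x \<omega>W - U s y \<omega>W\<bar> \<le> C * (\<bar>t - s\<bar> powr \<gamma>\<^sub>1 + norm (x - y) powr \<gamma>\<^sub>2)))"
proof -
  interpret feynman_kac \<gamma> \<Lambda> \<mu> \<beta> C\<^sub>\<beta> \<alpha> PB B PW W V
    by unfold_locales (use assms in \<open>auto simp: tempered_measure_def\<close>)
  show ?thesis using FK_hoelder_version by (simp add: FK_def)
qed

end
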